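(* Let $\kappa$ be an initial ordinal and let $\tau$ be an infinite order type which is a finite sum of ordinals and reverse ordinals, each of these ordinals being $<\kappa$. Then \[\langle {}^\kappa 2,<_{\mathrm{lex}}\rangle \rightarrow(\tau)^\tau \iff \kappa\rightarrow(\beta(\tau))^{\beta(\tau)},\] where $\beta(\tau)$ is the ordinal defined below.
   Context: Work in ZF (without the Axiom of Choice). For an ordinal $\alpha$, ${}^\alpha 2$ is the set of functions $\alpha\to\{0,1\}$ with the lexicographic order $<_{\mathrm{lex}}$ ($x<_{\mathrm{lex}}y$ iff $x(\delta)<y(\delta)$ for $\delta$ least with $x(\delta)\ne y(\delta)$). Order types are isomorphism classes of linear orders, $\gamma^*$ is the reverse of $\gamma$, $+$ is concatenation. For a linear order $L$ (in particular an ordinal) and order type $\sigma$, $[L]^\sigma$ is the set of subsets of $L$ of induced order type $\sigma$; $L\rightarrow(\sigma)^\tau$ means: for every $F:[L]^\tau\to\{0,1\}$ there is $H\in[L]^\sigma$ with $F$ constant on $[H]^\tau$. Definition of $\beta(\tau)$: write $\tau$ as an alternating sum $\beta_0^{( * )}+\beta_1^{( * )}+\dots+\beta_{n-1}^{( * )}$ of infinite ordinals and reverse ordinals (i.e. either $\tau=\beta_0+\beta_1^*+\beta_2+\cdots$ or $\tau=\beta_0^*+\beta_1+\beta_2^*+\cdots$ with each $\beta_i$ an infinite ordinal). For each $i<n$ let $\beta_i=\omega^{\varepsilon^{(i)}_0}k^{(i)}_0+\dots+\omega^{\varepsilon^{(i)}_{m_i}}k^{(i)}_{m_i}$ be its Cantor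 Normal Form. Then $\beta(\tau)$ is the sum of all the terms $\omega^{\varepsilon^{(i)}_j}k^{(i)}_j$ (over all $i$ and $j$) arranged in weakly decreasing order; equivalently, the largest ordinal expressible as a sum of these terms in some order. *)

theory Defs
  imports Main
begin

text \<open>
  HOL proves the axiom of choice, and choice refutes every partition relation with an infinite
  exponent, so a statement about such relations in ZF cannot be made about HOL's own sets.
  It is made here about an arbitrary first-order model of ZF: a type \<open>'a\<close> with a binary relation
  \<open>mem\<close>. Everything in the locale \<open>membership\<close> below is the interpretation in that
  structure of a notion of set theory. Quantifiers and descriptions range over \<open>'a\<close> only, so
  functions, bijections, colourings and finite sequences are elements of the model, and
  ``finite'' refers to the model's own \<open>\<omega>\<close>.
\<close>

datatype fm = Mem nat nat | Equal nat nat | Neg fm | Conj fm fm | Exists nat fm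

primrec sat :: "('a \<Rightarrow> 'a \<Rightarrow> bool) \<Rightarrow> (nat \<Rightarrow> 'a) \<Rightarrow> fm \<Rightarrow> bool" where
  "sat mem v (Mem i j) \<longleftrightarrow> mem (v i) (v j)"
| "sat mem v (Equal i j) \<longleftrightarrow> v i = v j"
| "sat mem v (Neg p) \<longleftrightarrow> \<not> sat mem v p"
| "sat mem v (Conj p q) \<longleftrightarrow> sat mem v p \<and> sat mem v q"
| "sat mem v (Exists i p) \<longleftrightarrow> (\<exists>x. sat mem (v(i := x)) p)"

locale membership =
  fixes mem :: "'a \<Rightarrow> 'a \<Rightarrow> bool"  (infix "\<^bold>\<in>" 50)
begin

definition subset :: "'a \<Rightarrow> 'a \<Rightarrow> bool"  (infix "\<^bold>\<subseteq>" 50) where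
  "x \<^bold>\<subseteq> y \<longleftrightarrow> (\<forall>z. z \<^bold>\<in> x \<longrightarrow> z \<^bold>\<in> y)"

text \<open>
  The element of the model whose members are exactly the \<open>z\<close> with \<open>P z\<close>. It is used only for
  classes that are sets by the axioms of ZF.
\<close>

definition setof :: "('a \<Rightarrow> bool) \<Rightarrow> 'a" where
  "setof P = (THE x. \<forall>z. z \<^bold>\<in> x \<longleftrightarrow> P z)"

definition zero :: 'a where
  "zero = setof (\<lambda>z. False)"

definition succ :: "'a \<Rightarrow> 'a" where
  "succ x = setof (\<lambda>z. z \<^bold>\<in> x \<or> z = x)"

definition one :: 'a where
  "one = succ zero"

definition two :: 'a where
  "two = succ one"

definition omega :: 'a where
  "omega = setof (\<lambda>n. \<forall>I. zero \<^bold>\<in> I \<and> (\<forall>m. m \<^bold>\<in> I \<longrightarrow> succ m \<^bold>\<in> I) \<longrightarrow> n \<^bold>\<in> I)"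

definition upair :: "'a \<Rightarrow> 'a \<Rightarrow> 'a" where
  "upair x y = setof (\<lambda>z. z = x \<or> z = y)"

definition opair :: "'a \<Rightarrow> 'a \<Rightarrow> 'a" where
  "opair x y = upair (upair x x) (upair x y)"

definition fun_on :: "'a \<Rightarrow> 'a \<Rightarrow> bool" where
  "fun_on f A \<longleftrightarrow> (\<forall>p. p \<^bold>\<in> f \<longrightarrow> (\<exists>x y. x \<^bold>\<in> A \<and> p = opair x y)) \<and>
                 (\<forall>x. x \<^bold>\<in> A \<longrightarrow> (\<exists>!y. opair x y \<^bold>\<in> f))"

definition app :: "'a \<Rightarrow> 'a \<Rightarrow> 'a" where
  "app f x = (THE y. opair x y \<^bold>\<in> f)"

definition maps :: "'a \<Rightarrow> 'a \<Rightarrow> 'a \<Rightarrow> bool" where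
  "maps f A B \<longleftrightarrow> fun_on f A \<and> (\<forall>x. x \<^bold>\<in> A \<longrightarrow> app f x \<^bold>\<in> B)"

definition bijection :: "'a \<Rightarrow> 'a \<Rightarrow> 'a \<Rightarrow> bool" where
  "bijection f A B \<longleftrightarrow> maps f A B \<and> (\<forall>y. y \<^bold>\<in> B \<longrightarrow> (\<exists>!x. x \<^bold>\<in> A \<and> app f x = y))"

definition equipotent :: "'a \<Rightarrow> 'a \<Rightarrow> bool" where
  "equipotent A B \<longleftrightarrow> (\<exists>f. bijection f A B)"

definition infinite_set :: "'a \<Rightarrow> bool" where
  "infinite_set A \<longleftrightarrow> \<not> (\<exists>n. n \<^bold>\<in> omega \<and> equipotent A n)"

text \<open>
  A linear order is given by its carrier \<open>A\<close> and its strict order relation \<open>R\<close>, a set of pairs.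
  Order types are represented by linear orders belonging to them.
\<close>

definition linear_order :: "'a \<Rightarrow> 'a \<Rightarrow> bool" where
  "linear_order A R \<longleftrightarrow>
     (\<forall>p. p \<^bold>\<in> R \<longrightarrow> (\<exists>x y. x \<^bold>\<in> A \<and> y \<^bold>\<in> A \<and> p = opair x y)) \<and>
     (\<forall>x. x \<^bold>\<in> A \<longrightarrow> \<not> opair x x \<^bold>\<in> R) \<and>
     (\<forall>x y z. opair x y \<^bold>\<in> R \<and> opair y z \<^bold>\<in> R \<longrightarrow> opair x z \<^bold>\<in> R) \<and>
     (\<forall>x y. x \<^bold>\<in> A \<and> y \<^bold>\<in> A \<and> x \<noteq> y \<longrightarrow> opair x y \<^bold>\<in> R \<or> opair y x \<^bold>\<in> R)"

text \<open>
  Only pairs with both components in the carrier matter for isomorphism, so \<open>isomorphic H R B S\<close>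
  for a subset \<open>H\<close> of the carrier of \<open>R\<close> refers to the order induced on \<open>H\<close>.
\<close>

definition isomorphic :: "'a \<Rightarrow> 'a \<Rightarrow> 'a \<Rightarrow> 'a \<Rightarrow> bool" where
  "isomorphic A R B S \<longleftrightarrow>
     (\<exists>f. bijection f A B \<and>
          (\<forall>x y. x \<^bold>\<in> A \<and> y \<^bold>\<in> A \<longrightarrow>
             (opair x y \<^bold>\<in> R \<longleftrightarrow> opair (app f x) (app f y) \<^bold>\<in> S)))"

definition subsets_of_type :: "'a \<Rightarrow> 'a \<Rightarrow> 'a \<Rightarrow> 'a \<Rightarrow> 'a" where
  "subsets_of_type A R T S = setof (\<lambda>H. H \<^bold>\<subseteq> A \<and> isomorphic H R T S)"

text \<open>
  \<open>arrow A R P Q T S\<close> is the partition relation \<open>\<langle>A,R\<rangle> \<rightarrow> (\<sigma>)\<^sup>\<tau>\<close> with two colours, where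
  \<open>\<sigma>\<close> and \<open>\<tau>\<close> are the types of \<open>\<langle>P,Q\<rangle>\<close> and \<open>\<langle>T,S\<rangle>\<close>.
\<close>

definition arrow :: "'a \<Rightarrow> 'a \<Rightarrow> 'a \<Rightarrow> 'a \<Rightarrow> 'a \<Rightarrow> 'a \<Rightarrow> bool" where
  "arrow A R P Q T S \<longleftrightarrow>
     (\<forall>F. maps F (subsets_of_type A R T S) two \<longrightarrow>
       (\<exists>H. H \<^bold>\<in> subsets_of_type A R P Q \<and>
         (\<forall>X Y. X \<^bold>\<in> subsets_of_type H R T S \<and> Y \<^bold>\<in> subsets_of_type H R T S \<longrightarrow>
            app F X = app F Y)))"

definition transitive_set :: "'a \<Rightarrow> bool" where
  "transitive_set x \<longleftrightarrow> (\<forall>y. y \<^bold>\<in> x \<longrightarrow> y \<^bold>\<subseteq> x)"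

definition ordinal :: "'a \<Rightarrow> bool" where
  "ordinal a \<longleftrightarrow> transitive_set a \<and> (\<forall>x. x \<^bold>\<in> a \<longrightarrow> transitive_set x)"

definition initial_ordinal :: "'a \<Rightarrow> bool" where
  "initial_ordinal k \<longleftrightarrow> ordinal k \<and> (\<forall>a. a \<^bold>\<in> k \<longrightarrow> \<not> equipotent a k)"

definition memrel :: "'a \<Rightarrow> 'a" where
  "memrel a = setof (\<lambda>p. \<exists>x y. x \<^bold>\<in> a \<and> y \<^bold>\<in> a \<and> x \<^bold>\<in> y \<and> p = opair x y)"

definition otype :: "'a \<Rightarrow> 'a \<Rightarrow> 'a" where
  "otype A R = (THE a. ordinal a \<and> isomorphic A R a (memrel a))"

definition binary_seqs :: "'a \<Rightarrow> 'a" where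
  "binary_seqs a = setof (\<lambda>x. maps x a two)"

definition lex :: "'a \<Rightarrow> 'a" where
  "lex a = setof (\<lambda>p. \<exists>x y. x \<^bold>\<in> binary_seqs a \<and> y \<^bold>\<in> binary_seqs a \<and> p = opair x y \<and>
     (\<exists>d. d \<^bold>\<in> a \<and> app x d \<^bold>\<in> app y d \<and> (\<forall>e. e \<^bold>\<in> d \<longrightarrow> app x e = app y e)))"

text \<open>
  The sum over \<open>i\<close> in the ordinal \<open>I\<close> of the ordinals \<open>b(i)\<close>, with summand \<open>i\<close> reversed iff
  \<open>d(i) = 1\<close>; its points are the pairs \<open>\<langle>i,x\<rangle>\<close> with \<open>x\<close> in \<open>b(i)\<close>.
\<close>

definition sum_set :: "'a \<Rightarrow> 'a \<Rightarrow> 'a" where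
  "sum_set I b = setof (\<lambda>p. \<exists>i x. i \<^bold>\<in> I \<and> x \<^bold>\<in> app b i \<and> p = opair i x)"

definition sum_rel :: "'a \<Rightarrow> 'a \<Rightarrow> 'a \<Rightarrow> 'a" where
  "sum_rel I b d = setof (\<lambda>p. \<exists>i x j y.
     i \<^bold>\<in> I \<and> x \<^bold>\<in> app b i \<and> j \<^bold>\<in> I \<and> y \<^bold>\<in> app b j \<and> p = opair (opair i x) (opair j y) \<and>
     (i \<^bold>\<in> j \<or> i = j \<and> (app d i = zero \<and> x \<^bold>\<in> y \<or> app d i = one \<and> y \<^bold>\<in> x)))"

definition finite_sum_below :: "'a \<Rightarrow> 'a \<Rightarrow> 'a \<Rightarrow> bool" where
  "finite_sum_below k T S \<longleftrightarrow>
     (\<exists>n b d. n \<^bold>\<in> omega \<and> maps b n k \<and> maps d n two \<and>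
        isomorphic T S (sum_set n b) (sum_rel n b d))"

definition const :: "'a \<Rightarrow> 'a \<Rightarrow> 'a" where
  "const I c = setof (\<lambda>p. \<exists>i. i \<^bold>\<in> I \<and> p = opair i c)"

definition osum :: "'a \<Rightarrow> 'a \<Rightarrow> 'a" where
  "osum I b = otype (sum_set I b) (sum_rel I b (const I zero))"

definition omult :: "'a \<Rightarrow> 'a \<Rightarrow> 'a" where
  "omult a c = osum c (const c a)"

text \<open>Ordinal exponentiation with base \<open>\<omega>\<close>, by transfinite recursion.\<close>

definition omega_power :: "'a \<Rightarrow> 'a" where
  "omega_power e = (THE p. \<exists>f. fun_on f (succ e) \<and> p = app f e \<and>
     app f zero = one \<and>
     (\<forall>x. x \<^bold>\<in> e \<longrightarrow> app f (succ x) = omult (app f x) omega) \<and>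
     (\<forall>x. x \<^bold>\<in> succ e \<and> x \<noteq> zero \<and> \<not> (\<exists>y. x = succ y) \<longrightarrow>
        app f x = setof (\<lambda>z. \<exists>y. y \<^bold>\<in> x \<and> z \<^bold>\<in> app f y)))"

text \<open>
  \<open>t\<close> is the sequence, of length \<open>m\<close>, of the terms \<open>\<omega>\<^bsup>e(j)\<^esup> c(j)\<close> of the Cantor normal form
  of \<open>x\<close>.
\<close>

definition is_cnf :: "'a \<Rightarrow> 'a \<Rightarrow> 'a \<Rightarrow> bool" where
  "is_cnf x m t \<longleftrightarrow> m \<^bold>\<in> omega \<and> fun_on t m \<and>
     (\<exists>e c. fun_on e m \<and> maps c m omega \<and>
        (\<forall>j. j \<^bold>\<in> m \<longrightarrow> ordinal (app e j) \<and> app c j \<noteq> zero \<and>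
           app t j = omult (omega_power (app e j)) (app c j)) \<and>
        (\<forall>i j. i \<^bold>\<in> j \<and> j \<^bold>\<in> m \<longrightarrow> app e j \<^bold>\<in> app e i)) \<and>
     x = osum m t"

definition alternating_sum :: "'a \<Rightarrow> 'a \<Rightarrow> 'a \<Rightarrow> 'a \<Rightarrow> bool" where
  "alternating_sum T S n b \<longleftrightarrow> n \<^bold>\<in> omega \<and> fun_on b n \<and>
     (\<forall>i. i \<^bold>\<in> n \<longrightarrow> ordinal (app b i) \<and> infinite_set (app b i)) \<and>
     (\<exists>d. maps d n two \<and> (\<forall>i. succ i \<^bold>\<in> n \<longrightarrow> app d (succ i) \<noteq> app d i) \<and>
        isomorphic T S (sum_set n b) (sum_rel n b d))"

text \<open>
  Summand \<open>b(i)\<close> has the Cantor normal form terms \<open>t(i)(j)\<close> for \<open>j < m(i)\<close>. The terms are indexed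
  by the pairs \<open>\<langle>i,j\<rangle>\<close>, which make up \<open>sum_set n m\<close>; \<open>g\<close> lists these pairs, each once, so that
  the corresponding sequence \<open>s\<close> of terms is weakly decreasing.
\<close>

definition is_beta :: "'a \<Rightarrow> 'a \<Rightarrow> 'a \<Rightarrow> bool" where
  "is_beta T S c \<longleftrightarrow>
     (\<exists>n b m t N g s. alternating_sum T S n b \<and> fun_on m n \<and> fun_on t n \<and>
        (\<forall>i. i \<^bold>\<in> n \<longrightarrow> is_cnf (app b i) (app m i) (app t i)) \<and>
        N \<^bold>\<in> omega \<and> bijection g N (sum_set n m) \<and> fun_on s N \<and>
        (\<forall>l i j. l \<^bold>\<in> N \<and> app g l = opair i j \<longrightarrow> app s l = app (app t i) j) \<and>
        (\<forall>l l'. l \<^bold>\<in> l' \<and> l' \<^bold>\<in> N \<longrightarrow> app s l' \<^bold>\<in> app s l \<or> app s l' = app s l) \<and>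
        c = osum N s)"

definition beta :: "'a \<Rightarrow> 'a \<Rightarrow> 'a" where
  "beta T S = (THE c. is_beta T S c)"

end

text \<open>
  In the two schemes \<open>p\<close> is an arbitrary formula whose variables 0 and 1 are the displayed ones;
  the valuation \<open>v\<close> supplies the parameters.
\<close>

locale zf_model = membership mem
  for mem :: "'a \<Rightarrow> 'a \<Rightarrow> bool"  (infix "\<^bold>\<in>" 50) +
  assumes extensionality: "\<forall>x y. (\<forall>z. z \<^bold>\<in> x \<longleftrightarrow> z \<^bold>\<in> y) \<longrightarrow> x = y"
    and foundation: "\<forall>x. (\<exists>y. y \<^bold>\<in> x) \<longrightarrow> (\<exists>y. y \<^bold>\<in> x \<and> \<not> (\<exists>z. z \<^bold>\<in> x \<and> z \<^bold>\<in> y))"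
    and pairing: "\<forall>x y. \<exists>u. \<forall>z. z \<^bold>\<in> u \<longleftrightarrow> z = x \<or> z = y"
    and union: "\<forall>x. \<exists>u. \<forall>z. z \<^bold>\<in> u \<longleftrightarrow> (\<exists>y. y \<^bold>\<in> x \<and> z \<^bold>\<in> y)"
    and power_set: "\<forall>x. \<exists>u. \<forall>z. z \<^bold>\<in> u \<longleftrightarrow> z \<^bold>\<subseteq> x"
    and infinity: "\<exists>u. (\<exists>e. e \<^bold>\<in> u \<and> \<not> (\<exists>z. z \<^bold>\<in> e)) \<and>
      (\<forall>x. x \<^bold>\<in> u \<longrightarrow> (\<exists>y. y \<^bold>\<in> u \<and> (\<forall>z. z \<^bold>\<in> y \<longleftrightarrow> z \<^bold>\<in> x \<or> z = x)))"
    and separation: "\<forall>p v a. \<exists>u. \<forall>x. x \<^bold>\<in> u \<longleftrightarrow> x \<^bold>\<in> a \<and> sat (\<^bold>\<in>) (v(0 := x)) p"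
    and replacement: "\<forall>p v a. (\<forall>x. x \<^bold>\<in> a \<longrightarrow> (\<exists>!y. sat (\<^bold>\<in>) (v(0 := x, 1 := y)) p)) \<longrightarrow>
      (\<exists>u. \<forall>y. y \<^bold>\<in> u \<longleftrightarrow> (\<exists>x. x \<^bold>\<in> a \<and> sat (\<^bold>\<in>) (v(0 := x, 1 := y)) p))"

end

theory Submission
  imports Defs
begin

text \<open>
  Cut \<open>\<tau>\<close> into finitely many convex pieces of indecomposable type \<open>\<omega>\<^bsup>e\<^esup>\<close>, or the reverse of such a
  type, according to the Cantor normal forms of its summands. Arranging the pieces by decreasing
  size and turning the reversed ones around gives a second order \<open>W\<close> on the same set \<open>T\<close>, of type
  \<open>\<beta>(\<tau>)\<close>. An embedding of \<open>T\<close> into itself sends a tail of each piece into a single piece; comparing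
  sizes shows that the subsets of \<open>T\<close> of type \<open>\<tau>\<close> in the given order and those of type \<open>\<beta>(\<tau>)\<close> in \<open>W\<close>
  are the same, namely the sets that meet every piece in a set of full type. This also makes
  \<open>\<beta>(\<tau>)\<close> independent of the decomposition.

  If \<open>\<kappa> \<rightarrow> (\<beta>)\<^sup>\<beta>\<close>, code the ordinal \<open>x\<close> at a point of the \<open>q\<close>-th piece by the sequence that names
  \<open>q\<close> and continues with the characteristic function of \<open>x\<close>, or its complement if the piece is
  reversed: a copy of \<open>W\<close> in \<open>\<kappa>\<close> becomes a copy of \<open>\<tau>\<close> among the sequences.
  Conversely, let \<open>f\<close> embed \<open>T\<close> into the sequences. The least position where \<open>f t\<close> splits from a later
  element of its piece is weakly increasing along the piece. If these positions (moved below \<open>\<kappa>\<close> by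
  a cofinal map where they are unbounded) are injective on the pieces, they yield a copy of \<open>W\<close> in
  \<open>\<kappa>\<close>, whose colour is used; otherwise the colour tells whether some piece starts with a repeated
  value, and no copy of \<open>\<tau>\<close> is homogeneous for that.
\<close>

subsection \<open>Definability\<close>

text \<open>The obstacle is the absence of choice. A colouring of subsets is pulled back along a
  coding of sets by sets, and the coding must be definable from the set alone. Between isomorphic
  well-orders the isomorphism is unique and given by ranks. A set of type \<open>\<tau>\<close>,
  however, can have many isomorphisms with \<open>T\<close>: where a reversed piece is directly
  followed by an unreversed one, as in the integers, points can be shifted across the junction.
  Embeddings are therefore first thinned until the first difference across each such junction is
  constant; those with this property are determined by their range.

  The second obstacle is room. Finitely many blocks of one length below \<open>\<kappa>\<close> fit
  below \<open>\<kappa>\<close> because \<open>\<kappa>\<close> is initial, but then the values on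
  every piece have to be bounded. An unbounded piece makes \<open>\<kappa>\<close> singular, and one
  cofinal map, fixed once as a parameter, folds all such pieces.

  Every set must come from Separation or Replacement for a formula with parameters, so definability
  is tracked throughout, even for values on meaningless arguments.\<close>

inductive first_order :: "('a \<Rightarrow> 'a \<Rightarrow> bool) \<Rightarrow> ((nat \<Rightarrow> 'a) \<Rightarrow> bool) \<Rightarrow> bool" for mem where
  fo_Mem: "first_order mem (\<lambda>v. mem (v i) (v j))"
| fo_Equal: "first_order mem (\<lambda>v. v i = v j)"
| fo_Neg: "first_order mem P \<Longrightarrow> first_order mem (\<lambda>v. \<not> P v)"
| fo_Conj: "first_order mem P \<Longrightarrow> first_order mem Q \<Longrightarrow> first_order mem (\<lambda>v. P v \<and> Q v)"
| fo_Exists: "first_order mem P \<Longrightarrow> first_order mem (\<lambda>v. \<exists>x. P (case_nat x v))"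

lemma first_order_reindex: "first_order mem P \<Longrightarrow> first_order mem (\<lambda>v. P (\<lambda>i. v (r i)))"
proof (induction arbitrary: r rule: first_order.induct)
  case (fo_Exists P)
  have eq: "(\<lambda>i. case_nat x v (case_nat 0 (\<lambda>n. Suc (r n)) i)) = case_nat x (\<lambda>i. v (r i))" for x v
    by (auto split: nat.splits)
  show ?case
    using first_order.fo_Exists[OF fo_Exists.IH[of "case_nat 0 (\<lambda>n. Suc (r n))"]] by (simp add: eq)
qed (auto intro: first_order.intros)

lemma first_order_formula:
  "first_order mem P \<Longrightarrow> infinite (- range r) \<Longrightarrow> \<exists>p. \<forall>v. sat mem v p \<longleftrightarrow> P (\<lambda>i. v (r i))"
proof (induction arbitrary: r rule: first_order.induct)
  case (fo_Mem i j)
  show ?case by (rule exI[of _ "Mem (r i) (r j)"]) simp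
next
  case (fo_Equal i j)
  show ?case by (rule exI[of _ "Equal (r i) (r j)"]) simp
next
  case (fo_Neg P)
  then obtain p where "\<forall>v. sat mem v p \<longleftrightarrow> P (\<lambda>i. v (r i))" by blast
  thus ?case by (intro exI[of _ "Neg p"]) simp
next
  case (fo_Conj P Q)
  then obtain p q where "\<forall>v. sat mem v p \<longleftrightarrow> P (\<lambda>i. v (r i))" "\<forall>v. sat mem v q \<longleftrightarrow> Q (\<lambda>i. v (r i))"
    by blast
  thus ?case by (intro exI[of _ "Conj p q"]) simp
next
  case (fo_Exists P)
  obtain k where k: "k \<notin> range r"
    using fo_Exists.prems infinite_imp_nonempty by blast
  have "range (case_nat k r) = insert k (range r)"
  proof safe
    fix i assume "case_nat k r i \<notin> range r" thus "case_nat k r i = k" by (cases i) auto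
  next
    show "k \<in> range (case_nat k r)" by (rule range_eqI[of _ _ 0]) simp
  next
    fix i show "r i \<in> range (case_nat k r)" by (rule range_eqI[of _ _ "Suc i"]) simp
  qed
  hence "infinite (- range (case_nat k r))"
    using fo_Exists.prems by (simp add: Compl_insert)
  then obtain p where p: "\<forall>v. sat mem v p \<longleftrightarrow> P (\<lambda>i. v (case_nat k r i))"
    using fo_Exists.IH by blast
  have eq: "(\<lambda>i. (v(k := x)) (case_nat k r i)) = case_nat x (\<lambda>i. v (r i))" for v x
    using k by (auto simp: fun_eq_iff split: nat.splits)
  show ?case by (rule exI[of _ "Exists k p"]) (simp only: sat.simps p[rule_format] eq simp_thms)
qed

text \<open>From here on the symbols \<open>\<in>\<close> and \<open>\<subseteq>\<close> denote membership and inclusion in the model.\<close>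

no_notation Set.member (\<open>'(\<in>')\<close>) and Set.member (\<open>(\<open>notation=\<open>infix \<in>\<close>\<close>_/ \<in> _)\<close> [51, 51] 50)
  and subset_eq (\<open>'(\<subseteq>')\<close>) and subset_eq (\<open>(\<open>notation=\<open>infix \<subseteq>\<close>\<close>_/ \<subseteq> _)\<close> [51, 51] 50)

context membership
begin

notation mem (infix "\<in>" 50) and subset (infix "\<subseteq>" 50)

abbreviation lt :: "'a \<Rightarrow> 'a \<Rightarrow> 'a \<Rightarrow> bool" where
  "lt R x y \<equiv> opair x y \<in> R"

text \<open>Even positions carry the environment, odd positions an infinite supply of parameters, so
  a definable predicate can use arbitrarily many parameters without reserving environment indices
  for them.\<close>

definition interleave :: "(nat \<Rightarrow> 'a) \<Rightarrow> (nat \<Rightarrow> 'a) \<Rightarrow> nat \<Rightarrow> 'a" where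
  "interleave v w i = (if even i then v (i div 2) else w (i div 2))"

text \<open>
  First-order definability with parameters. Environments are de Bruijn style: a quantifier
  pushes its value in front of the environment, so definability goals are closed by blind
  application of the rules \<open>dfn\<close>.
\<close>

definition dfnp :: "((nat \<Rightarrow> 'a) \<Rightarrow> bool) \<Rightarrow> bool" where
  "dfnp P \<longleftrightarrow> (\<exists>Q w. first_order (\<in>) Q \<and> (\<forall>v. P v \<longleftrightarrow> Q (interleave v w)))"

text \<open>A term is definable when its graph is; position 0 of the environment is set aside for
  the value.\<close>

definition dfnt :: "((nat \<Rightarrow> 'a) \<Rightarrow> 'a) \<Rightarrow> bool" where
  "dfnt f \<longleftrightarrow> dfnp (\<lambda>v. v 0 = f (\<lambda>i. v (Suc i)))"

abbreviation dfn1 :: "('a \<Rightarrow> 'a) \<Rightarrow> bool" where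
  "dfn1 F \<equiv> dfnt (\<lambda>v. F (v 0))"

named_theorems dfn

lemma dfnpI: "first_order (\<in>) Q \<Longrightarrow> (\<And>v. P v \<longleftrightarrow> Q (interleave v w)) \<Longrightarrow> dfnp P"
  unfolding dfnp_def by blast

lemma dfnp_neg [dfn]: "dfnp P \<Longrightarrow> dfnp (\<lambda>v. \<not> P v)"
  unfolding dfnp_def by (blast intro: first_order.fo_Neg)

lemma dfnp_conj [dfn]:
  assumes "dfnp P" "dfnp P'"
  shows "dfnp (\<lambda>v. P v \<and> P' v)"
proof -
  obtain Q w Q' w' where Q: "first_order (\<in>) Q" "\<And>v. P v \<longleftrightarrow> Q (interleave v w)"
    and Q': "first_order (\<in>) Q'" "\<And>v. P' v \<longleftrightarrow> Q' (interleave v w')"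
    using assms unfolding dfnp_def by blast
  \<comment> \<open>The two parameter supplies are merged by a second interleaving;
    \<open>?r\<close> and \<open>?r'\<close> recover the first and the second from it.\<close>
  let ?r = "\<lambda>i. if even i then i else 2 * (2 * (i div 2)) + 1"
  let ?r' = "\<lambda>i. if even i then i else 2 * (2 * (i div 2) + 1) + 1"
  have eq: "(\<lambda>i. interleave v (interleave w w') (?r i)) = interleave v w"
    "(\<lambda>i. interleave v (interleave w w') (?r' i)) = interleave v w'" for v
    by (auto simp: interleave_def fun_eq_iff elim!: oddE)
  have "first_order (\<in>) (\<lambda>v. Q (\<lambda>i. v (?r i)) \<and> Q' (\<lambda>i. v (?r' i)))"
    by (rule first_order.fo_Conj[OF first_order_reindex[OF Q(1), of ?r] first_order_reindex[OF Q'(1), of ?r']])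
  thus ?thesis
    by (rule dfnpI[where w = "interleave w w'"]) (simp only: eq Q(2) Q'(2))
qed

lemma dfnp_ex [dfn]:
  assumes "dfnp (\<lambda>v. P (v 0) (\<lambda>i. v (Suc i)))"
  shows "dfnp (\<lambda>v. \<exists>x. P x v)"
proof -
  obtain Q w where Q: "first_order (\<in>) Q"
      "\<And>v. P (v 0) (\<lambda>i. v (Suc i)) \<longleftrightarrow> Q (interleave v w)"
    using assms unfolding dfnp_def by blast
  \<comment> \<open>A pushed value moves every environment entry one place up but leaves the
    parameters where they are. \<open>?r\<close> translates from this layout to the one in which the
    value precedes the whole interleaved sequence.\<close>
  let ?r = "\<lambda>i. case i of 0 \<Rightarrow> 0 | Suc j \<Rightarrow> if even i then j else Suc i"
  have eq: "(\<lambda>i. case_nat x (interleave v w) (?r i)) = interleave (case_nat x v) w" for x v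
  proof
    fix i show "case_nat x (interleave v w) (?r i) = interleave (case_nat x v) w i"
    proof (cases "even i")
      case True
      then obtain k where "i = 2 * k" by (auto elim: evenE)
      thus ?thesis by (cases k) (auto simp: interleave_def)
    next
      case False
      then obtain k where "i = 2 * k + 1" by (auto elim: oddE)
      thus ?thesis by (auto simp: interleave_def)
    qed
  qed
  have "first_order (\<in>) (\<lambda>v. \<exists>x. Q (\<lambda>i. case_nat x v (?r i)))"
    by (rule first_order.fo_Exists[OF first_order_reindex[OF Q(1), of ?r]])
  moreover have "P x v \<longleftrightarrow> Q (interleave (case_nat x v) w)" for x v
    using Q(2)[of "case_nat x v"] by simp
  ultimately show ?thesis
    by (intro dfnpI[where w = w]) (assumption, simp only: eq)
qed

lemma dfnp_iff_cong: "dfnp P \<Longrightarrow> (\<And>v. P v \<longleftrightarrow> Q v) \<Longrightarrow> dfnp Q"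
  by (subgoal_tac "P = Q") auto

lemma dfnp_const [dfn]: "dfnp (\<lambda>v. b)"
proof -
  have T: "dfnp (\<lambda>v. True)"
    unfolding dfnp_def using first_order.fo_Equal[of "(\<in>)" 0 0] by auto
  show ?thesis using T dfnp_neg[OF T] by (cases b) auto
qed

lemma dfnp_disj [dfn]: "dfnp P \<Longrightarrow> dfnp Q \<Longrightarrow> dfnp (\<lambda>v. P v \<or> Q v)"
  by (rule dfnp_iff_cong[OF dfnp_neg[OF dfnp_conj[OF dfnp_neg dfnp_neg]]]) auto

lemma dfnp_imp [dfn]: "dfnp P \<Longrightarrow> dfnp Q \<Longrightarrow> dfnp (\<lambda>v. P v \<longrightarrow> Q v)"
  by (rule dfnp_iff_cong[OF dfnp_neg[OF dfnp_conj[OF _ dfnp_neg]]]) auto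

lemma dfnp_iff [dfn]: "dfnp P \<Longrightarrow> dfnp Q \<Longrightarrow> dfnp (\<lambda>v. P v \<longleftrightarrow> Q v)"
  by (rule dfnp_iff_cong[OF dfnp_conj[OF dfnp_imp[of P Q] dfnp_imp[of Q P]]]) auto

lemma dfnp_all [dfn]:
  assumes "dfnp (\<lambda>v. P (v 0) (\<lambda>i. v (Suc i)))"
  shows "dfnp (\<lambda>v. \<forall>x. P x v)"
  by (rule dfnp_iff_cong[OF dfnp_neg[OF dfnp_ex[OF dfnp_neg[OF assms]]]]) auto

lemma dfnp_var_eq: "dfnp (\<lambda>v. v i = v j)"
  unfolding dfnp_def
  by (rule exI[of _ "\<lambda>v. v (2*i) = v (2*j)"])
     (auto intro: first_order.fo_Equal simp: interleave_def)

lemma dfnp_var_mem: "dfnp (\<lambda>v. v i \<in> v j)"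
  unfolding dfnp_def
  by (rule exI[of _ "\<lambda>v. v (2*i) \<in> v (2*j)"])
     (auto intro: first_order.fo_Mem simp: interleave_def)

lemma dfnt_var [dfn]: "dfnt (\<lambda>v. v i)"
  unfolding dfnt_def by (rule dfnp_var_eq)

lemma dfnt_const [dfn]: "dfnt (\<lambda>v. c)"
  unfolding dfnt_def dfnp_def
  by (intro exI[of _ "\<lambda>v. v 0 = v 1"] exI[of _ "\<lambda>i. c"])
     (use first_order.fo_Equal[of "(\<in>)" 0 1] in \<open>auto simp: interleave_def\<close>)

lemma dfnp_reindex:
  assumes "dfnp P" shows "dfnp (\<lambda>v. P (\<lambda>i. v (r i)))"
proof -
  obtain Q w where Q: "first_order (\<in>) Q" "\<And>v. P v \<longleftrightarrow> Q (interleave v w)"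
    using assms unfolding dfnp_def by blast
  let ?r = "\<lambda>i. if even i then 2 * r (i div 2) else i"
  have eq: "(\<lambda>i. interleave v w (?r i)) = interleave (\<lambda>i. v (r i)) w" for v
    by (auto simp: interleave_def fun_eq_iff)
  have "first_order (\<in>) (\<lambda>v. Q (\<lambda>i. v (?r i)))" by (rule first_order_reindex[OF Q(1)])
  thus ?thesis by (rule dfnpI[where w = w]) (simp only: eq Q(2))
qed

lemma dfnt_shift: "dfnt f \<Longrightarrow> dfnt (\<lambda>v. f (\<lambda>i. v (r i)))"
  unfolding dfnt_def
  by (drule dfnp_reindex[of _ "case_nat 0 (\<lambda>i. Suc (r i))"]) simp

text \<open>\<open>P (f v) v\<close> amounts to the existence of some \<open>x = f v\<close> with
  \<open>P x v\<close>, so definability of the graph of \<open>f\<close> suffices.\<close>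

lemma dfnp_subst:
  assumes f: "dfnt f" and P: "dfnp (\<lambda>v. P (v 0) (\<lambda>i. v (Suc i)))"
  shows "dfnp (\<lambda>v. P (f v) v)"
proof -
  have "dfnp (\<lambda>v. \<exists>x. x = f v \<and> P x v)"
    by (intro dfn) (use f P in \<open>auto simp: dfnt_def\<close>)
  thus ?thesis by (rule dfnp_iff_cong) auto
qed

lemma dfnt_subst:
  assumes f: "dfnt f" and g: "dfnt (\<lambda>v. g (v 0) (\<lambda>i. v (Suc i)))"
  shows "dfnt (\<lambda>v. g (f v) v)"
  unfolding dfnt_def
proof (rule dfnp_subst[of "\<lambda>v. f (\<lambda>i. v (Suc i))" "\<lambda>x v. v 0 = g x (\<lambda>i. v (Suc i))"])
  show "dfnt (\<lambda>v. f (\<lambda>i. v (Suc i)))" by (rule dfnt_shift[OF f])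
  show "dfnp (\<lambda>v. v (Suc 0) = g (v 0) (\<lambda>i. v (Suc (Suc i))))"
    using dfnp_reindex[OF g[unfolded dfnt_def], of "\<lambda>i. case i of 0 \<Rightarrow> 1 | Suc 0 \<Rightarrow> 0 | Suc (Suc j) \<Rightarrow> Suc (Suc j)"]
    by simp
qed

lemma dfnp_app1: "dfnp (\<lambda>v. P (v 0)) \<Longrightarrow> dfnt f \<Longrightarrow> dfnp (\<lambda>v. P (f v))"
  by (rule dfnp_subst[of f "\<lambda>x v. P x"])

lemma dfnp_app5:
  assumes P: "dfnp (\<lambda>v. P (v 0) (v 1) (v 2) (v 3) (v 4))"
    and f: "dfnt f0" "dfnt f1" "dfnt f2" "dfnt f3" "dfnt f4"
  shows "dfnp (\<lambda>v. P (f0 v) (f1 v) (f2 v) (f3 v) (f4 v))"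
  by (rule dfnp_subst[OF f(5), of "\<lambda>z w. P (f0 w) (f1 w) (f2 w) (f3 w) z"],
      rule dfnp_subst[OF dfnt_shift[OF f(4), of "\<lambda>i. Suc i"], of "\<lambda>z w. P (f0 (\<lambda>i. w (Suc i))) (f1 (\<lambda>i. w (Suc i))) (f2 (\<lambda>i. w (Suc i))) z (w 0)"],
      rule dfnp_subst[OF dfnt_shift[OF f(3), of "\<lambda>i. Suc (Suc i)"], of "\<lambda>z w. P (f0 (\<lambda>i. w (Suc (Suc i)))) (f1 (\<lambda>i. w (Suc (Suc i)))) z (w 0) (w (Suc 0))"],
      rule dfnp_subst[OF dfnt_shift[OF f(2), of "\<lambda>i. Suc (Suc (Suc i))"], of "\<lambda>z w. P (f0 (\<lambda>i. w (Suc (Suc (Suc i))))) z (w 0) (w (Suc 0)) (w (Suc (Suc 0)))"],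
      rule dfnp_subst[OF dfnt_shift[OF f(1), of "\<lambda>i. Suc (Suc (Suc (Suc i)))"], of "\<lambda>z w. P z (w 0) (w (Suc 0)) (w (Suc (Suc 0))) (w (Suc (Suc (Suc 0))))"])
     (use P in \<open>simp add: numeral_eq_Suc\<close>)

lemma dfnp_app4:
  "dfnp (\<lambda>v. P (v 0) (v 1) (v 2) (v 3)) \<Longrightarrow> dfnt f \<Longrightarrow> dfnt g \<Longrightarrow> dfnt h \<Longrightarrow> dfnt k \<Longrightarrow>
    dfnp (\<lambda>v. P (f v) (g v) (h v) (k v))"
  by (rule dfnp_app5[of "\<lambda>a b c d _. P a b c d" f g h k f])

lemma dfnp_app3:
  "dfnp (\<lambda>v. P (v 0) (v 1) (v 2)) \<Longrightarrow> dfnt f \<Longrightarrow> dfnt g \<Longrightarrow> dfnt h \<Longrightarrow> dfnp (\<lambda>v. P (f v) (g v) (h v))"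
  by (rule dfnp_app4[of "\<lambda>a b c _. P a b c" f g h f])

lemma dfnp_app2: "dfnp (\<lambda>v. P (v 0) (v 1)) \<Longrightarrow> dfnt f \<Longrightarrow> dfnt g \<Longrightarrow> dfnp (\<lambda>v. P (f v) (g v))"
  by (rule dfnp_app3[of "\<lambda>a b _. P a b" f g f])

lemma dfnt_app4:
  assumes "dfnt (\<lambda>v. F (v 0) (v 1) (v 2) (v 3))" "dfnt f" "dfnt g" "dfnt h" "dfnt k"
  shows "dfnt (\<lambda>v. F (f v) (g v) (h v) (k v))"
  unfolding dfnt_def
  by (rule dfnp_app5[of "\<lambda>x a b c d. x = F a b c d" "\<lambda>v. v 0", OF _ dfnt_var])
    (use assms dfnt_shift[of _ Suc] in \<open>simp_all add: dfnt_def numeral_eq_Suc\<close>)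

lemma dfnt_app3:
  "dfnt (\<lambda>v. F (v 0) (v 1) (v 2)) \<Longrightarrow> dfnt f \<Longrightarrow> dfnt g \<Longrightarrow> dfnt h \<Longrightarrow> dfnt (\<lambda>v. F (f v) (g v) (h v))"
  by (rule dfnt_app4[of "\<lambda>a b c _. F a b c" f g h f])

lemma dfnt_app2: "dfnt (\<lambda>v. F (v 0) (v 1)) \<Longrightarrow> dfnt f \<Longrightarrow> dfnt g \<Longrightarrow> dfnt (\<lambda>v. F (f v) (g v))"
  by (rule dfnt_app3[of "\<lambda>a b _. F a b" f g f])

lemma dfnt_app1: "dfn1 F \<Longrightarrow> dfnt f \<Longrightarrow> dfnt (\<lambda>v. F (f v))"
  by (rule dfnt_app2[of "\<lambda>a _. F a" f f])

lemma dfnp_mem [dfn]: "dfnt f \<Longrightarrow> dfnt g \<Longrightarrow> dfnp (\<lambda>v. f v \<in> g v)"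
  by (rule dfnp_app2[of "(\<in>)", OF dfnp_var_mem])

lemma dfnp_eq [dfn]: "dfnt f \<Longrightarrow> dfnt g \<Longrightarrow> dfnp (\<lambda>v. f v = g v)"
  by (rule dfnp_app2[of "(=)", OF dfnp_var_eq])

lemma dfnt_if [dfn]:
  assumes P: "dfnp P" and f: "dfnt f" and g: "dfnt g"
  shows "dfnt (\<lambda>v. if P v then f v else g v)"
proof -
  have "dfnp (\<lambda>v. (P (\<lambda>i. v (Suc i)) \<and> v 0 = f (\<lambda>i. v (Suc i))) \<or>
        (\<not> P (\<lambda>i. v (Suc i)) \<and> v 0 = g (\<lambda>i. v (Suc i))))"
    by (intro dfnp_disj dfnp_conj dfnp_neg dfnp_reindex[OF P, of Suc] f[unfolded dfnt_def] g[unfolded dfnt_def])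
  thus ?thesis unfolding dfnt_def by (rule dfnp_iff_cong) auto
qed

lemma dfnp_subset [dfn]: "dfnt f \<Longrightarrow> dfnt g \<Longrightarrow> dfnp (\<lambda>v. f v \<subseteq> g v)"
  by (rule dfnp_app2[of "(\<subseteq>)"]) (unfold subset_def, intro dfn)

end

context zf_model
begin

text \<open>Position i of the interleaved environment gets the variable name 2i, which leaves the
  odd names for bound variables. The valuation \<open>V\<close> supplies the parameters, and
  variable 0 is the one displayed in the scheme.\<close>

lemma dfn_separation:
  assumes "dfnp (\<lambda>v. P (v 0))"
  shows "\<exists>u. \<forall>x. x \<in> u \<longleftrightarrow> x \<in> a \<and> P x"
proof -
  obtain Q w where Q: "first_order (\<in>) Q" "\<And>v. P (v 0) \<longleftrightarrow> Q (interleave v w)"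
    using assms unfolding dfnp_def by blast
  let ?r = "\<lambda>i::nat. 2 * i"
  have "infinite (- range ?r)"
  proof
    assume "finite (- range ?r)"
    moreover have "range (\<lambda>i::nat. 2 * i + 1) \<le> - range ?r"
    proof safe
      fix x y :: nat assume "2 * x + 1 = 2 * y" thus False by presburger
    qed
    ultimately have "finite (range (\<lambda>i::nat. 2 * i + 1))" by (rule rev_finite_subset)
    thus False by (auto dest!: finite_imageD intro: injI)
  qed
  then obtain p where p: "\<And>v. sat (\<in>) v p \<longleftrightarrow> Q (\<lambda>i. v (?r i))"
    using first_order_formula[OF Q(1)] by metis
  define V where "V = (\<lambda>i. interleave (\<lambda>_. undefined) w (i div 2))"
  have "(\<lambda>i. (V(0 := x)) (?r i)) = interleave ((\<lambda>_. undefined)(0 := x)) w" for x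
    by (auto simp: V_def interleave_def fun_eq_iff)
  hence "sat (\<in>) (V(0 := x)) p \<longleftrightarrow> P x" for x
    using p[of "V(0 := x)"] Q(2)[of "(\<lambda>_. undefined)(0 := x)"] by simp
  thus ?thesis using separation[rule_format, of a V p] by simp
qed

lemma dfn_replacement:
  assumes "dfnp (\<lambda>v. P (v 0) (v 1))" and "\<And>x. x \<in> a \<Longrightarrow> \<exists>!y. P x y"
  shows "\<exists>u. \<forall>y. y \<in> u \<longleftrightarrow> (\<exists>x. x \<in> a \<and> P x y)"
proof -
  obtain Q w where Q: "first_order (\<in>) Q" "\<And>v. P (v 0) (v 1) \<longleftrightarrow> Q (interleave v w)"
    using assms(1) unfolding dfnp_def by blast
  \<comment> \<open>The second argument is entry 1 of the environment, hence position 2 of the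
    interleaving, and must receive the name 1, the output variable of the scheme.\<close>
  let ?r = "\<lambda>i::nat. if i = 2 then 1 else 2 * i"
  have "infinite (- range ?r)"
  proof
    assume "finite (- range ?r)"
    moreover have "range (\<lambda>i::nat. 2 * i + 3) \<le> - range ?r"
    proof safe
      fix x y :: nat assume "2 * x + 3 = (if y = 2 then 1 else 2 * y)"
      thus False by (cases "y = 2"; simp; presburger)
    qed
    ultimately have "finite (range (\<lambda>i::nat. 2 * i + 3))" by (rule rev_finite_subset)
    thus False by (auto dest!: finite_imageD intro: injI)
  qed
  then obtain p where p: "\<And>v. sat (\<in>) v p \<longleftrightarrow> Q (\<lambda>i. v (?r i))"
    using first_order_formula[OF Q(1)] by metis
  define V where "V = (\<lambda>i. interleave (\<lambda>_. undefined) w (i div 2))"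
  have "(\<lambda>i. (V(0 := x, 1 := y)) (?r i)) = interleave ((\<lambda>_. undefined)(0 := x, 1 := y)) w" for x y
  proof
    fix i show "(V(0 := x, 1 := y)) (?r i) = interleave ((\<lambda>_. undefined)(0 := x, 1 := y)) w i"
      by (cases "even i") (auto simp: V_def interleave_def)
  qed
  hence "sat (\<in>) (V(0 := x, 1 := y)) p \<longleftrightarrow> P x y" for x y
    using p[of "V(0 := x, 1 := y)"] Q(2)[of "(\<lambda>_. undefined)(0 := x, 1 := y)"] by simp
  thus ?thesis using replacement[rule_format, of a V p] assms(2) by simp
qed

end

subsection \<open>Sets and functions\<close>

context membership
begin

declare dfn [simp]

lemma dfnp_ex1 [dfn, simp]:
  assumes "dfnp (\<lambda>v. P (v 0) (\<lambda>i. v (Suc i)))"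
  shows "dfnp (\<lambda>v. \<exists>!x. P x v)"
proof -
  have "dfnp (\<lambda>v. P (v 0) (\<lambda>i. v (Suc (Suc i))))"
    using dfnp_reindex[OF assms, of "case_nat 0 (\<lambda>i. Suc (Suc i))"] by simp
  thus ?thesis unfolding Ex1_def using assms by simp
qed

definition el :: "'a \<Rightarrow> 'a set" where
  "el A = {x. x \<in> A}"

lemma in_el [simp]: "Set.member x (el A) \<longleftrightarrow> x \<in> A"
  by (simp add: el_def)

definition sep :: "'a \<Rightarrow> ('a \<Rightarrow> bool) \<Rightarrow> 'a" where
  "sep A P = setof (\<lambda>z. z \<in> A \<and> P z)"

definition img :: "('a \<Rightarrow> 'a) \<Rightarrow> 'a \<Rightarrow> 'a" where
  "img F A = setof (\<lambda>y. \<exists>x. x \<in> A \<and> y = F x)"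

definition lam :: "'a \<Rightarrow> ('a \<Rightarrow> 'a) \<Rightarrow> 'a" where
  "lam A F = setof (\<lambda>p. \<exists>x. x \<in> A \<and> p = opair x (F x))"

text \<open>Agrees with \<open>app\<close> on functions and, unlike \<open>app\<close>, is definable even on junk arguments.\<close>

definition ap :: "'a \<Rightarrow> 'a \<Rightarrow> 'a" where
  "ap f x = setof (\<lambda>z. \<exists>y. opair x y \<in> f \<and> z \<in> y)"

definition times :: "'a \<Rightarrow> 'a \<Rightarrow> 'a" where
  "times A B = setof (\<lambda>p. \<exists>x y. x \<in> A \<and> y \<in> B \<and> p = opair x y)"

definition unite :: "'a \<Rightarrow> 'a" where
  "unite A = setof (\<lambda>z. \<exists>y. y \<in> A \<and> z \<in> y)"

definition pow :: "'a \<Rightarrow> 'a" where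
  "pow A = setof (\<lambda>z. z \<subseteq> A)"

definition un :: "'a \<Rightarrow> 'a \<Rightarrow> 'a" where
  "un A B = setof (\<lambda>z. z \<in> A \<or> z \<in> B)"

end

context zf_model
begin

lemma ext_iff: "x = y \<longleftrightarrow> (\<forall>z. z \<in> x \<longleftrightarrow> z \<in> y)"
  using extensionality by blast

lemma mext: "(\<And>z. z \<in> x \<longleftrightarrow> z \<in> y) \<Longrightarrow> x = y"
  using extensionality by blast

lemma mem_setof:
  assumes "\<exists>u. \<forall>z. z \<in> u \<longleftrightarrow> P z"
  shows "z \<in> setof P \<longleftrightarrow> P z"
proof -
  have "\<exists>!u. \<forall>z. z \<in> u \<longleftrightarrow> P z" using assms extensionality by blast
  from theI'[OF this] show ?thesis by (simp add: setof_def)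
qed

text \<open>If no set with these members exists, the description still denotes one fixed element,
  \<open>THE x. False\<close>, which can serve as a parameter. Hence operations built with
  \<open>setof\<close> are definable without side conditions on their arguments.\<close>

lemma dfnt_setof [dfn, simp]:
  assumes P: "dfnp (\<lambda>v. P (v 0) (\<lambda>i. v (Suc i)))"
  shows "dfnt (\<lambda>v. setof (\<lambda>z. P z v))"
proof -
  let ?S = "\<lambda>x v. \<forall>z. z \<in> x \<longleftrightarrow> P z v"
  have P2: "dfnp (\<lambda>v. P (v 0) (\<lambda>i. v (Suc (Suc i))))" "dfnp (\<lambda>v. P (v 0) (\<lambda>i. v (Suc (Suc (Suc i)))))"
    using dfnp_reindex[OF P, of "case_nat 0 (\<lambda>i. Suc (Suc i))"]
      dfnp_reindex[OF P, of "case_nat 0 (\<lambda>i. Suc (Suc (Suc i)))"] by simp_all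
  have "dfnp (\<lambda>v. ?S (v 0) (\<lambda>i. v (Suc i)) \<or>
      \<not> (\<exists>x. ?S x (\<lambda>i. v (Suc i))) \<and> v 0 = (THE x. False))"
    using P2 by simp
  moreover have "(?S x v \<or> \<not> (\<exists>x. ?S x v) \<and> x = (THE x. False)) \<longleftrightarrow> x = setof (\<lambda>z. P z v)" for x v
  proof (cases "\<exists>u. ?S u v")
    case True
    thus ?thesis using mem_setof[of "\<lambda>z. P z v"] by (auto simp: ext_iff)
  next
    case False
    hence "?S x v \<longleftrightarrow> False" for x by blast
    hence "(\<lambda>x. ?S x v) = (\<lambda>x. False)" by (rule ext)
    hence "setof (\<lambda>z. P z v) = (THE x. False)" unfolding setof_def by simp
    thus ?thesis using False by auto
  qed
  ultimately show ?thesis unfolding dfnt_def by (rule dfnp_iff_cong)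
qed

lemma dfnt_sep [dfn, simp]:
  "dfnt A \<Longrightarrow> dfnp (\<lambda>v. P (v 0) (\<lambda>i. v (Suc i))) \<Longrightarrow> dfnt (\<lambda>v. sep (A v) (\<lambda>z. P z v))"
  unfolding sep_def by (intro dfnt_setof dfn dfnt_shift[of A Suc])

lemma dfnt_succ [dfn, simp]: "dfnt f \<Longrightarrow> dfnt (\<lambda>v. succ (f v))"
  by (rule dfnt_app1[of succ]) (unfold succ_def, intro dfn)

lemma dfnt_upair [dfn, simp]: "dfnt f \<Longrightarrow> dfnt g \<Longrightarrow> dfnt (\<lambda>v. upair (f v) (g v))"
  by (rule dfnt_app2[of upair]) (unfold upair_def, intro dfn)

lemma dfnt_opair [dfn, simp]: "dfnt f \<Longrightarrow> dfnt g \<Longrightarrow> dfnt (\<lambda>v. opair (f v) (g v))"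
  unfolding opair_def by (intro dfn)

lemma dfnt_ap [dfn, simp]: "dfnt f \<Longrightarrow> dfnt g \<Longrightarrow> dfnt (\<lambda>v. ap (f v) (g v))"
  by (rule dfnt_app2[of ap]) (unfold ap_def, intro dfn)

lemma dfnt_times [dfn, simp]: "dfnt f \<Longrightarrow> dfnt g \<Longrightarrow> dfnt (\<lambda>v. times (f v) (g v))"
  by (rule dfnt_app2[of times]) (unfold times_def, intro dfn)

lemma dfnt_un [dfn, simp]: "dfnt f \<Longrightarrow> dfnt g \<Longrightarrow> dfnt (\<lambda>v. un (f v) (g v))"
  by (rule dfnt_app2[of un]) (unfold un_def, intro dfn)

lemma dfnt_unite [dfn, simp]: "dfnt f \<Longrightarrow> dfnt (\<lambda>v. unite (f v))"
  by (rule dfnt_app1[of unite]) (unfold unite_def, intro dfn)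

lemma dfnt_img [dfn, simp]:
  assumes F: "dfnt (\<lambda>v. F (v 0) (\<lambda>i. v (Suc i)))" and A: "dfnt A"
  shows "dfnt (\<lambda>v. img (\<lambda>x. F x v) (A v))"
proof -
  have "dfnt (\<lambda>v. F (v 0) (\<lambda>i. v (Suc (Suc i))))"
    using dfnt_shift[OF F, of "case_nat 0 (\<lambda>i. Suc (Suc i))"] by simp
  thus ?thesis unfolding img_def by (intro dfn dfnt_shift[OF A, of "\<lambda>i. Suc (Suc i)"])
qed

lemma dfnt_lam [dfn, simp]:
  assumes F: "dfnt (\<lambda>v. F (v 0) (\<lambda>i. v (Suc i)))" and A: "dfnt A"
  shows "dfnt (\<lambda>v. lam (A v) (\<lambda>x. F x v))"
proof -
  have "dfnt (\<lambda>v. F (v 0) (\<lambda>i. v (Suc (Suc i))))"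
    using dfnt_shift[OF F, of "case_nat 0 (\<lambda>i. Suc (Suc i))"] by simp
  thus ?thesis unfolding lam_def by (intro dfn dfnt_shift[OF A, of "\<lambda>i. Suc (Suc i)"])
qed

lemma mem_sep [simp]: "dfnp (\<lambda>v. P (v 0)) \<Longrightarrow> z \<in> sep A P \<longleftrightarrow> z \<in> A \<and> P z"
  unfolding sep_def by (rule mem_setof) (rule dfn_separation)

lemma mem_img [simp]:
  assumes "dfn1 F"
  shows "y \<in> img F A \<longleftrightarrow> (\<exists>x. x \<in> A \<and> y = F x)"
  unfolding img_def
proof (rule mem_setof, rule dfn_replacement)
  show "dfnp (\<lambda>v. v 1 = F (v 0))" using dfnt_shift[OF assms, of "\<lambda>i. i"] by simp
qed simp

lemma not_mem_zero [simp]: "\<not> x \<in> zero"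
proof -
  have "\<exists>u. \<forall>z. z \<in> u \<longleftrightarrow> z \<in> undefined \<and> False" by (rule dfn_separation) simp
  thus ?thesis unfolding zero_def by (subst mem_setof) auto
qed

lemma mem_upair [simp]: "z \<in> upair x y \<longleftrightarrow> z = x \<or> z = y"
  unfolding upair_def by (rule mem_setof) (use pairing in auto)

lemma mem_unite [simp]: "z \<in> unite A \<longleftrightarrow> (\<exists>y. y \<in> A \<and> z \<in> y)"
  unfolding unite_def by (rule mem_setof) (use union in auto)

lemma mem_pow [simp]: "z \<in> pow A \<longleftrightarrow> z \<subseteq> A"
  unfolding pow_def by (rule mem_setof) (use power_set in auto)

lemma mem_un [simp]: "z \<in> un A B \<longleftrightarrow> z \<in> A \<or> z \<in> B"
  unfolding un_def by (rule mem_setof, rule exI[of _ "unite (upair A B)"]) auto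

lemma mem_succ [simp]: "z \<in> succ x \<longleftrightarrow> z \<in> x \<or> z = x"
  unfolding succ_def by (rule mem_setof, rule exI[of _ "un x (upair x x)"]) auto

lemma opair_eq [simp]: "opair a b = opair c d \<longleftrightarrow> a = c \<and> b = d"
proof
  assume eq: "opair a b = opair c d"
  have U: "upair x y = upair z w \<longleftrightarrow> (x = z \<and> y = w) \<or> (x = w \<and> y = z)" for x y z w
    using ext_iff[of "upair x y" "upair z w"] by (metis mem_upair)
  show "a = c \<and> b = d" using eq unfolding opair_def U by auto
qed simp

lemma mem_times [simp]: "p \<in> times A B \<longleftrightarrow> (\<exists>x y. x \<in> A \<and> y \<in> B \<and> p = opair x y)"
  unfolding times_def
proof (rule mem_setof, rule exI[of _ "unite (img (\<lambda>x. img (\<lambda>y. opair x y) B) A)"], rule allI)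
  fix z
  have "y \<in> img (opair x) B \<longleftrightarrow> (\<exists>w. w \<in> B \<and> y = opair x w)" for x y
    by (rule mem_img) (intro dfn)
  moreover have "y \<in> img (\<lambda>x. img (opair x) B) A \<longleftrightarrow> (\<exists>w. w \<in> A \<and> y = img (opair w) B)" for y
    by (rule mem_img) (intro dfn)
  ultimately show "(z \<in> unite (img (\<lambda>x. img (opair x) B) A)) = (\<exists>x y. x \<in> A \<and> y \<in> B \<and> z = opair x y)"
    by auto
qed

lemma mem_lam [simp]:
  assumes "dfn1 F"
  shows "p \<in> lam A F \<longleftrightarrow> (\<exists>x. x \<in> A \<and> p = opair x (F x))"
proof -
  have "dfnt (\<lambda>v. opair (v 0) (F (v 0)))" using assms by (intro dfn)
  thus ?thesis using mem_img[of "\<lambda>x. opair x (F x)"] unfolding lam_def img_def by simp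
qed

lemma fun_on_ap:
  assumes "fun_on f A" "x \<in> A"
  shows "opair x y \<in> f \<longleftrightarrow> y = ap f x" and "app f x = ap f x"
proof -
  obtain w where w: "opair x w \<in> f" "\<And>y. opair x y \<in> f \<Longrightarrow> y = w"
    using assms unfolding fun_on_def by metis
  have iff: "(\<exists>y. opair x y \<in> f \<and> z \<in> y) \<longleftrightarrow> z \<in> w" for z using w by blast
  have "z \<in> ap f x \<longleftrightarrow> z \<in> w" for z
    unfolding ap_def by (subst mem_setof) (use iff in blast)+
  hence "ap f x = w" by (rule mext)
  moreover have "app f x = w" unfolding app_def using w by (rule the_equality)
  ultimately show "opair x y \<in> f \<longleftrightarrow> y = ap f x" "app f x = ap f x" using w by blast+
qed

lemma ap_eqI: "fun_on f A \<Longrightarrow> opair x y \<in> f \<Longrightarrow> ap f x = y"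
  by (metis fun_on_ap(1) fun_on_def opair_eq)

lemma mem_fun_on:
  assumes "fun_on f A" shows "p \<in> f \<longleftrightarrow> (\<exists>x. x \<in> A \<and> p = opair x (ap f x))"
  using assms fun_on_ap(1)[OF assms] unfolding fun_on_def by metis

lemma fun_on_ext:
  assumes "fun_on f A" "fun_on g A" "\<And>x. x \<in> A \<Longrightarrow> ap f x = ap g x"
  shows "f = g"
  by (rule mext) (use assms(3) in \<open>auto simp: mem_fun_on[OF assms(1)] mem_fun_on[OF assms(2)]\<close>)

lemma fun_on_lam [simp]: "dfn1 F \<Longrightarrow> fun_on (lam A F) A"
  unfolding fun_on_def by auto

lemma ap_lam [simp]: "dfn1 F \<Longrightarrow> x \<in> A \<Longrightarrow> ap (lam A F) x = F x"
  by (rule ap_eqI[OF fun_on_lam]) auto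

lemma maps_iff: "maps f A B \<longleftrightarrow> fun_on f A \<and> (\<forall>x. x \<in> A \<longrightarrow> ap f x \<in> B)"
  unfolding maps_def using fun_on_ap(2) by metis

lemma bij_el_iff: "bij_betw F (el A) (el B) \<longleftrightarrow>
  (\<forall>x. x \<in> A \<longrightarrow> F x \<in> B) \<and> (\<forall>y. y \<in> B \<longrightarrow> (\<exists>!x. x \<in> A \<and> F x = y))"
    (is "_ \<longleftrightarrow> ?M \<and> ?U")
proof
  assume b: "bij_betw F (el A) (el B)"
  have ?M using bij_betwE[OF b] by simp
  moreover have "\<exists>!x. x \<in> A \<and> F x = y" if y: "y \<in> B" for y
  proof -
    obtain x where x: "x \<in> A" "F x = y" using b y unfolding bij_betw_def by (metis imageE in_el)
    show ?thesis
    proof (rule ex1I[of _ x])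
      show "x \<in> A \<and> F x = y" using x by simp
      show "x' = x" if "x' \<in> A \<and> F x' = y" for x'
        using b x that unfolding bij_betw_def inj_on_def by (metis in_el)
    qed
  qed
  ultimately show "?M \<and> ?U" by blast
next
  assume h: "?M \<and> ?U"
  show "bij_betw F (el A) (el B)"
  proof (rule bij_betwI')
    show "(F x = F y) = (x = y)" if "Set.member x (el A)" "Set.member y (el A)" for x y
      using h that by (metis in_el)
    show "\<exists>x\<in>el A. y = F x" if "Set.member y (el B)" for y
      using h that by (metis in_el)
  qed (use h in simp)
qed

lemma bijection_iff: "bijection f A B \<longleftrightarrow> fun_on f A \<and> bij_betw (ap f) (el A) (el B)"
proof (cases "fun_on f A")
  case True
  have "(x \<in> A \<and> app f x = y) \<longleftrightarrow> (x \<in> A \<and> ap f x = y)" for x y using fun_on_ap(2)[OF True] by auto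
  thus ?thesis
    unfolding bijection_def maps_iff bij_el_iff by auto
qed (simp add: bijection_def maps_iff)

definition isoby :: "'a \<Rightarrow> 'a \<Rightarrow> 'a \<Rightarrow> 'a \<Rightarrow> 'a \<Rightarrow> bool" where
  "isoby f A R B S \<longleftrightarrow> fun_on f A \<and> bij_betw (ap f) (el A) (el B) \<and>
     (\<forall>x y. x \<in> A \<and> y \<in> A \<longrightarrow> (lt R x y \<longleftrightarrow> lt S (ap f x) (ap f y)))"

lemma isomorphic_iff: "isomorphic A R B S \<longleftrightarrow> (\<exists>f. isoby f A R B S)"
  unfolding isomorphic_def isoby_def bijection_iff using fun_on_ap(2) by (metis (no_types, lifting))

lemma isomorphicI:
  assumes F: "dfn1 F" and b: "bij_betw F (el A) (el B)"
    and o: "\<And>x y. x \<in> A \<Longrightarrow> y \<in> A \<Longrightarrow> lt R x y \<longleftrightarrow> lt S (F x) (F y)"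
  shows "isomorphic A R B S"
proof -
  have "bij_betw (ap (lam A F)) (el A) (el B)"
    using b by (rule bij_betw_cong[THEN iffD1, rotated]) (simp add: F)
  thus ?thesis
    unfolding isomorphic_iff isoby_def by (intro exI[of _ "lam A F"]) (simp add: F o)
qed

lemma equipotent_iff: "equipotent A B \<longleftrightarrow> (\<exists>f. fun_on f A \<and> bij_betw (ap f) (el A) (el B))"
  unfolding equipotent_def bijection_iff ..

lemma equipotentI:
  assumes F: "dfn1 F" and b: "bij_betw F (el A) (el B)"
  shows "equipotent A B"
proof -
  have "bij_betw (ap (lam A F)) (el A) (el B)"
    using b by (rule bij_betw_cong[THEN iffD1, rotated]) (simp add: F)
  thus ?thesis unfolding equipotent_iff by (intro exI[of _ "lam A F"]) (simp add: F)
qed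

text \<open>The inverse is obtained by description, hence definable whenever the function is.\<close>

definition invf :: "'a \<Rightarrow> ('a \<Rightarrow> 'a) \<Rightarrow> 'a \<Rightarrow> 'a" where
  "invf A F y = setof (\<lambda>z. \<exists>x. x \<in> A \<and> F x = y \<and> z \<in> x)"

lemma dfnt_invf [dfn, simp]:
  assumes F: "dfnt (\<lambda>v. F (v 0) (\<lambda>i. v (Suc i)))" and A: "dfnt A" and y: "dfnt y"
  shows "dfnt (\<lambda>v. invf (A v) (\<lambda>x. F x v) (y v))"
proof -
  have "dfnt (\<lambda>v. F (v 0) (\<lambda>i. v (Suc (Suc i))))"
    using dfnt_shift[OF F, of "case_nat 0 (\<lambda>i. Suc (Suc i))"] by simp
  thus ?thesis unfolding invf_def
    by (intro dfn dfnt_shift[OF A, of "\<lambda>i. Suc (Suc i)"] dfnt_shift[OF y, of "\<lambda>i. Suc (Suc i)"])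
qed

lemma invf_eq:
  assumes "inj_on F (el A)" "x \<in> A"
  shows "invf A F (F x) = x"
proof -
  have "\<exists>u. \<forall>z. z \<in> u \<longleftrightarrow> (\<exists>x'. x' \<in> A \<and> F x' = F x \<and> z \<in> x')"
    using assms by (intro exI[of _ x]) (auto dest: inj_onD)
  hence "z \<in> invf A F (F x) \<longleftrightarrow> (\<exists>x'. x' \<in> A \<and> F x' = F x \<and> z \<in> x')" for z
    unfolding invf_def by (rule mem_setof)
  thus ?thesis using assms by (intro mext) (auto dest: inj_onD)
qed

lemma bij_betw_invf:
  assumes "bij_betw F (el A) (el B)"
  shows "bij_betw (invf A F) (el B) (el A)" and "\<And>y. y \<in> B \<Longrightarrow> F (invf A F y) = y"
    and "\<And>x. x \<in> A \<Longrightarrow> invf A F (F x) = x"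
proof -
  have inj: "inj_on F (el A)" and im: "F ` el A = el B" using assms by (auto simp: bij_betw_def)
  show 3: "\<And>x. x \<in> A \<Longrightarrow> invf A F (F x) = x" using invf_eq[OF inj] .
  show "\<And>y. y \<in> B \<Longrightarrow> F (invf A F y) = y"
  proof -
    fix y assume "y \<in> B"
    then obtain x where "x \<in> A" "y = F x" using im by (metis imageE in_el)
    thus "F (invf A F y) = y" using 3 by simp
  qed
  show "bij_betw (invf A F) (el B) (el A)"
    by (rule bij_betw_byWitness[of _ F]) (use im 3 in \<open>auto simp flip: im\<close>)
qed

lemma isomorphic_refl: "isomorphic A R A R"
  by (rule isomorphicI[of "\<lambda>x. x"]) (auto simp: bij_betw_def)

lemma isomorphic_sym:
  assumes "isomorphic A R B S" shows "isomorphic B S A R"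
proof -
  obtain f where f: "isoby f A R B S" using assms isomorphic_iff by blast
  hence b: "bij_betw (ap f) (el A) (el B)" by (simp add: isoby_def)
  note inv = bij_betw_invf[OF b]
  have "invf A (ap f) y \<in> A" if "y \<in> B" for y using inv(1) that bij_betwE by fastforce
  thus ?thesis
    using f inv by (intro isomorphicI[of "invf A (ap f)"]) (auto simp: isoby_def)
qed

lemma isomorphic_trans:
  assumes "isomorphic A R B S" "isomorphic B S C Q" shows "isomorphic A R C Q"
proof -
  obtain f g where f: "isoby f A R B S" and g: "isoby g B S C Q" using assms isomorphic_iff by metis
  have B: "\<And>x. x \<in> A \<Longrightarrow> ap f x \<in> B" using f bij_betwE unfolding isoby_def by fastforce
  show ?thesis
  proof (rule isomorphicI[of "\<lambda>x. ap g (ap f x)"])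
    show "bij_betw (\<lambda>x. ap g (ap f x)) (el A) (el C)"
      using f g bij_betw_trans[of "ap f" "el A" "el B" "ap g" "el C"] by (simp add: isoby_def comp_def)
  qed (use f g B in \<open>auto simp: isoby_def\<close>)
qed

lemma dfnp_fun_on [dfn, simp]: "dfnt f \<Longrightarrow> dfnt g \<Longrightarrow> dfnp (\<lambda>v. fun_on (f v) (g v))"
  by (rule dfnp_app2[of fun_on]) (unfold fun_on_def, intro dfn)

lemma dfnp_maps [dfn, simp]: "dfnt f \<Longrightarrow> dfnt g \<Longrightarrow> dfnt h \<Longrightarrow> dfnp (\<lambda>v. maps (f v) (g v) (h v))"
  by (rule dfnp_app3[of maps]) (unfold maps_iff, intro dfn)

lemma dfnp_isoby [dfn, simp]:
  "dfnt f \<Longrightarrow> dfnt A \<Longrightarrow> dfnt R \<Longrightarrow> dfnt B \<Longrightarrow> dfnt S \<Longrightarrow>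
    dfnp (\<lambda>v. isoby (f v) (A v) (R v) (B v) (S v))"
  by (rule dfnp_app5[of isoby]) (unfold isoby_def bij_el_iff, intro dfn)

lemma dfnp_isomorphic [dfn, simp]:
  "dfnt A \<Longrightarrow> dfnt R \<Longrightarrow> dfnt B \<Longrightarrow> dfnt S \<Longrightarrow> dfnp (\<lambda>v. isomorphic (A v) (R v) (B v) (S v))"
  by (rule dfnp_app4[of isomorphic]) (unfold isomorphic_iff, intro dfn)

lemma dfnp_equipotent [dfn, simp]: "dfnt A \<Longrightarrow> dfnt B \<Longrightarrow> dfnp (\<lambda>v. equipotent (A v) (B v))"
  by (rule dfnp_app2[of equipotent]) (unfold equipotent_iff bij_el_iff, intro dfn)

lemma mem_subsets_of_type [simp]:
  "H \<in> subsets_of_type A R T S \<longleftrightarrow> H \<subseteq> A \<and> isomorphic H R T S"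
proof -
  have "H \<in> sep (pow A) (\<lambda>H. isomorphic H R T S) \<longleftrightarrow> H \<subseteq> A \<and> isomorphic H R T S" for H by simp
  thus ?thesis unfolding subsets_of_type_def by (intro mem_setof) blast
qed

lemma arrow_iff:
  "arrow A R P Q T S \<longleftrightarrow>
     (\<forall>F. maps F (subsets_of_type A R T S) two \<longrightarrow>
       (\<exists>H. H \<subseteq> A \<and> isomorphic H R P Q \<and>
         (\<forall>X Y. X \<subseteq> H \<and> isomorphic X R T S \<and> Y \<subseteq> H \<and> isomorphic Y R T S \<longrightarrow> ap F X = ap F Y)))"
proof -
  have "app F X = ap F X" if "maps F (subsets_of_type A R T S) two" "H \<subseteq> A" "X \<subseteq> H" "isomorphic X R T S"
    for F H X
    using that by (intro fun_on_ap(2)[of F "subsets_of_type A R T S"]) (auto simp: maps_iff subset_def)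
  thus ?thesis unfolding arrow_def mem_subsets_of_type by (metis (no_types, lifting))
qed

lemma arrow_cong:
  assumes "isomorphic P Q P' Q'"
  shows "arrow A R P Q P Q \<longleftrightarrow> arrow A R P' Q' P' Q'"
proof -
  have "isomorphic X R P Q \<longleftrightarrow> isomorphic X R P' Q'" for X
    using assms isomorphic_sym isomorphic_trans by blast
  moreover hence "subsets_of_type A R P Q = subsets_of_type A R P' Q'" by (intro mext) simp
  ultimately show ?thesis unfolding arrow_iff by simp
qed

lemma subsetD: "x \<subseteq> y \<Longrightarrow> z \<in> x \<Longrightarrow> z \<in> y"
  by (simp add: subset_def)

lemma subset_refl [simp]: "x \<subseteq> x"
  by (simp add: subset_def)

lemma subset_trans: "x \<subseteq> y \<Longrightarrow> y \<subseteq> z \<Longrightarrow> x \<subseteq> z"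
  by (simp add: subset_def)

lemma subset_antisym: "x \<subseteq> y \<Longrightarrow> y \<subseteq> x \<Longrightarrow> x = y"
  by (rule mext) (auto simp: subset_def)

lemma mem_irrefl [simp]: "\<not> x \<in> x"
  using foundation[rule_format, of "upair x x"] by auto

lemma mem_asym: "x \<in> y \<Longrightarrow> \<not> y \<in> x"
  using foundation[rule_format, of "upair x y"] by auto

subsection \<open>Ordinals\<close>

lemma dfnp_transitive_set [dfn, simp]: "dfnt f \<Longrightarrow> dfnp (\<lambda>v. transitive_set (f v))"
  by (rule dfnp_app1[of transitive_set]) (unfold transitive_set_def, intro dfn)

lemma dfnp_ordinal [dfn, simp]: "dfnt f \<Longrightarrow> dfnp (\<lambda>v. ordinal (f v))"
  by (rule dfnp_app1[of ordinal]) (unfold ordinal_def, intro dfn)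

lemma ord_trans: "ordinal a \<Longrightarrow> x \<in> y \<Longrightarrow> y \<in> a \<Longrightarrow> x \<in> a"
  unfolding ordinal_def transitive_set_def subset_def by blast

lemma ord_mem: "ordinal a \<Longrightarrow> x \<in> a \<Longrightarrow> ordinal x"
  unfolding ordinal_def transitive_set_def subset_def by blast

lemma ord_memI: "(\<And>x y. y \<in> a \<Longrightarrow> x \<in> y \<Longrightarrow> x \<in> a) \<Longrightarrow> (\<And>x. x \<in> a \<Longrightarrow> ordinal x) \<Longrightarrow> ordinal a"
  unfolding ordinal_def transitive_set_def subset_def by blast

lemma ord_mem_subset: "ordinal a \<Longrightarrow> x \<in> a \<Longrightarrow> x \<subseteq> a"
  by (auto simp: ordinal_def transitive_set_def)

lemma ord_zero [simp]: "ordinal zero"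
  by (rule ord_memI) auto

lemma ord_succ [simp]: "ordinal a \<Longrightarrow> ordinal (succ a)"
  by (rule ord_memI) (auto intro: ord_trans ord_mem)

text \<open>Foundation is applied to the set of counterexamples in \<open>succ a\<close>. That set
  exists by Separation, which is why the predicate has to be definable.\<close>

lemma ord_induct [consumes 1, case_names defn step]:
  assumes "ordinal a" and P: "dfnp (\<lambda>v. P (v 0))"
    and step: "\<And>a. ordinal a \<Longrightarrow> (\<And>b. b \<in> a \<Longrightarrow> P b) \<Longrightarrow> P a"
  shows "P a"
proof (rule ccontr)
  assume "\<not> P a"
  define X where "X = sep (succ a) (\<lambda>x. \<not> P x)"
  have X: "z \<in> X \<longleftrightarrow> z \<in> succ a \<and> \<not> P z" for z unfolding X_def using P by (intro mem_sep) simp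
  have "\<exists>y. y \<in> X" using X[of a] \<open>\<not> P a\<close> by auto
  then obtain y where y: "y \<in> X" "\<not> (\<exists>z. z \<in> X \<and> z \<in> y)" using foundation by blast
  have oa: "ordinal (succ a)" using assms(1) by simp
  have ya: "y \<in> succ a" using y X by blast
  have "P z" if "z \<in> y" for z using y(2) X that ord_trans[OF oa that ya] by blast
  hence "P y" using step ord_mem[OF oa ya] by blast
  thus False using y X by blast
qed

lemma ord_least:
  assumes "ordinal a" "P a" and P: "dfnp (\<lambda>v. P (v 0))"
  obtains b where "ordinal b" "P b" "\<And>c. c \<in> b \<Longrightarrow> \<not> P c"
proof -
  have "\<exists>b. ordinal b \<and> P b \<and> (\<forall>c. c \<in> b \<longrightarrow> \<not> P c)"
  proof (rule ccontr)
    assume n: "\<not> ?thesis"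
    have "dfnp (\<lambda>v. \<not> P (v 0))" using P by simp
    with assms(1) have "\<not> P a" by (rule ord_induct) (use n in blast)
    thus False using assms by blast
  qed
  thus ?thesis using that by blast
qed

lemma ord_linear: "ordinal a \<Longrightarrow> ordinal b \<Longrightarrow> a \<in> b \<or> a = b \<or> b \<in> a"
proof -
  assume "ordinal a" "ordinal b"
  from \<open>ordinal a\<close> have "\<forall>b. ordinal b \<longrightarrow> a \<in> b \<or> a = b \<or> b \<in> a"
  proof (induction rule: ord_induct)
    case (step a)
    show ?case
    proof (intro allI impI)
      fix b assume "ordinal b"
      thus "a \<in> b \<or> a = b \<or> b \<in> a"
      proof (induction rule: ord_induct)
        case (step b)
        show ?case
        proof (cases "a \<subseteq> b")
          case False
          then obtain x where x: "x \<in> a" "\<not> x \<in> b" by (auto simp: subset_def)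
          hence "x = b \<or> b \<in> x" using \<open>\<And>c. c \<in> a \<Longrightarrow> _\<close> step(1) by blast
          thus ?thesis using x ord_trans[OF \<open>ordinal a\<close>] by blast
        next
          case True
          show ?thesis
          proof (cases "b \<subseteq> a")
            case True
            thus ?thesis using \<open>a \<subseteq> b\<close> subset_antisym by blast
          next
            case False
            then obtain x where x: "x \<in> b" "\<not> x \<in> a" by (auto simp: subset_def)
            hence "a \<in> x \<or> a = x" using step(2) by blast
            thus ?thesis using x ord_trans[OF step(1)] by blast
          qed
        qed
      qed simp
    qed
  qed simp
  thus ?thesis using \<open>ordinal b\<close> by blast
qed

lemma ord_subset_iff: "ordinal a \<Longrightarrow> ordinal b \<Longrightarrow> a \<subseteq> b \<longleftrightarrow> a \<in> b \<or> a = b"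
  using ord_linear ord_mem_subset mem_irrefl subsetD subset_refl by metis

lemma ord_not_mem: "ordinal a \<Longrightarrow> ordinal b \<Longrightarrow> \<not> a \<in> b \<longleftrightarrow> b \<subseteq> a"
  using ord_linear ord_subset_iff mem_asym mem_irrefl by metis

lemma ord_le_lt: "ordinal a \<Longrightarrow> ordinal b \<Longrightarrow> ordinal c \<Longrightarrow> a \<subseteq> b \<Longrightarrow> b \<in> c \<Longrightarrow> a \<in> c"
  using ord_subset_iff ord_trans by metis

lemma ord_unite: "(\<And>x. x \<in> A \<Longrightarrow> ordinal x) \<Longrightarrow> ordinal (unite A)"
  by (rule ord_memI; simp; blast intro: ord_trans ord_mem)

text \<open>Burali-Forti: a set containing all ordinals would yield the set of all ordinals, itself
  an ordinal.\<close>

lemma no_set_of_ordinals: "\<exists>a. ordinal a \<and> \<not> a \<in> A"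
proof (rule ccontr)
  assume n: "\<not> (\<exists>a. ordinal a \<and> \<not> a \<in> A)"
  define X where "X = sep A ordinal"
  have X: "x \<in> X \<longleftrightarrow> ordinal x" for x using n by (auto simp: X_def)
  have "ordinal X" by (rule ord_memI) (auto simp: X intro: ord_mem)
  thus False using X mem_irrefl by blast
qed

text \<open>Each \<open>z \<in> x\<close> satisfies \<open>z \<subseteq> F z\<close> by induction
  and \<open>F z \<in> F x\<close> by monotonicity, hence \<open>z \<in> F x\<close>.\<close>

lemma incr_ge:
  assumes "ordinal a" "x \<in> a" and F: "dfn1 F"
    and inc: "\<And>x y. y \<in> a \<Longrightarrow> x \<in> y \<Longrightarrow> F x \<in> F y" and ord: "\<And>x. x \<in> a \<Longrightarrow> ordinal (F x)"
  shows "x \<subseteq> F x"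
proof -
  have "ordinal x" using assms ord_mem by blast
  hence "x \<in> a \<longrightarrow> x \<subseteq> F x"
  proof (induction rule: ord_induct)
    case defn show ?case using F by simp
  next
    case (step x)
    show ?case
    proof (intro impI)
      assume xa: "x \<in> a"
      have "z \<in> F x" if z: "z \<in> x" for z
      proof -
        have za: "z \<in> a" using ord_trans[OF assms(1) z xa] .
        thus ?thesis
          using ord_le_lt[OF ord_mem[OF step(1) z] ord[OF za] ord[OF xa]] step(2)[OF z] inc[OF xa z] by blast
      qed
      thus "x \<subseteq> F x" by (simp add: subset_def)
    qed
  qed
  thus ?thesis using assms by blast
qed

lemma mem_memrel [simp]: "lt (memrel a) x y \<longleftrightarrow> x \<in> a \<and> y \<in> a \<and> x \<in> y"
proof -
  have "p \<in> sep (times a a) (\<lambda>p. \<exists>x y. x \<in> a \<and> y \<in> a \<and> x \<in> y \<and> p = opair x y) \<longleftrightarrow>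
    (\<exists>x y. x \<in> a \<and> y \<in> a \<and> x \<in> y \<and> p = opair x y)" for p by auto
  thus ?thesis unfolding memrel_def by (subst mem_setof) (blast, auto)
qed

lemma dfnt_memrel [dfn, simp]: "dfnt f \<Longrightarrow> dfnt (\<lambda>v. memrel (f v))"
  by (rule dfnt_app1[of memrel]) (unfold memrel_def, intro dfn)

subsection \<open>Natural numbers\<close>

lemma mem_omega: "n \<in> omega \<longleftrightarrow> (\<forall>I. zero \<in> I \<and> (\<forall>m. m \<in> I \<longrightarrow> succ m \<in> I) \<longrightarrow> n \<in> I)"
proof -
  obtain u where u: "\<exists>e. e \<in> u \<and> \<not> (\<exists>z. z \<in> e)"
    "\<forall>x. x \<in> u \<longrightarrow> (\<exists>y. y \<in> u \<and> (\<forall>z. z \<in> y \<longleftrightarrow> z \<in> x \<or> z = x))" using infinity by blast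
  have 0: "zero \<in> u"
  proof -
    obtain e where "e \<in> u" "\<not> (\<exists>z. z \<in> e)" using u(1) by blast
    moreover hence "e = zero" by (intro mext) auto
    ultimately show ?thesis by simp
  qed
  have S: "succ x \<in> u" if xu: "x \<in> u" for x
  proof -
    obtain y where "y \<in> u" "\<forall>z. z \<in> y \<longleftrightarrow> z \<in> x \<or> z = x" using u(2) xu by blast
    moreover hence "y = succ x" by (intro mext) auto
    ultimately show ?thesis by simp
  qed
  let ?P = "\<lambda>n. \<forall>I. zero \<in> I \<and> (\<forall>m. m \<in> I \<longrightarrow> succ m \<in> I) \<longrightarrow> n \<in> I"
  have "x \<in> sep u ?P \<longleftrightarrow> ?P x" for x
    using 0 S by (subst mem_sep) (simp, blast)
  thus ?thesis unfolding omega_def by (intro mem_setof) blast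
qed

lemma zero_omega [simp]: "zero \<in> omega"
  unfolding mem_omega by blast

lemma succ_omega [simp]: "n \<in> omega \<Longrightarrow> succ n \<in> omega"
  unfolding mem_omega by blast

lemma omega_induct [consumes 1, case_names defn zero succ]:
  assumes "n \<in> omega" and P: "dfnp (\<lambda>v. P (v 0))" and "P zero"
    and "\<And>n. n \<in> omega \<Longrightarrow> P n \<Longrightarrow> P (succ n)"
  shows "P n"
proof -
  have m: "x \<in> sep omega P \<longleftrightarrow> x \<in> omega \<and> P x" for x using P by (rule mem_sep)
  have "zero \<in> sep omega P" "\<forall>m. m \<in> sep omega P \<longrightarrow> succ m \<in> sep omega P"
    unfolding m using assms by auto
  hence "n \<in> sep omega P" using assms(1)[unfolded mem_omega] by blast
  thus ?thesis using m by blast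
qed

lemma ord_omega_mem: "n \<in> omega \<Longrightarrow> ordinal n"
  by (induction rule: omega_induct) auto

lemma omega_mem_mem: "n \<in> omega \<Longrightarrow> m \<in> n \<Longrightarrow> m \<in> omega"
proof -
  assume n: "n \<in> omega" and m: "m \<in> n"
  from n have "\<forall>m. m \<in> n \<longrightarrow> m \<in> omega" by (induction rule: omega_induct) auto
  thus ?thesis using m by blast
qed

lemma ord_omega [simp]: "ordinal omega"
  by (rule ord_memI) (auto intro: omega_mem_mem ord_omega_mem)

lemma omega_cases: "n \<in> omega \<Longrightarrow> n = zero \<or> (\<exists>m. m \<in> omega \<and> n = succ m)"
  by (induction rule: omega_induct) auto

lemma succ_eq [simp]: "succ a = succ b \<longleftrightarrow> a = b"
  using mem_succ mem_asym by metis

lemma succ_not_zero [simp]: "succ a \<noteq> zero" "zero \<noteq> succ a"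
  using mem_succ not_mem_zero by metis+

lemma succ_subset_iff: "ordinal a \<Longrightarrow> ordinal b \<Longrightarrow> succ a \<subseteq> b \<longleftrightarrow> a \<in> b"
  by (auto simp: subset_def intro: ord_trans)

lemma succ_mem_succ: "ordinal a \<Longrightarrow> ordinal b \<Longrightarrow> succ a \<in> succ b \<longleftrightarrow> a \<in> b"
  using succ_subset_iff[of a b] ord_subset_iff[of "succ a" b] by auto

lemma zero_subset [simp]: "zero \<subseteq> x"
  by (simp add: subset_def)

lemma ord_zero_mem: "ordinal a \<Longrightarrow> a \<noteq> zero \<Longrightarrow> zero \<in> a"
  using ord_subset_iff[of zero a] by auto

lemma mem_two [simp]: "x \<in> two \<longleftrightarrow> x = zero \<or> x = one"
  by (simp add: two_def one_def)

lemma mem_one [simp]: "x \<in> one \<longleftrightarrow> x = zero"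
  by (simp add: one_def)

lemma one_zero [simp]: "one \<noteq> zero" "zero \<noteq> one"
  by (simp_all add: one_def)

lemma omega_greatest:
  assumes "n \<in> omega" "X \<subseteq> n" "x \<in> X"
  obtains m where "m \<in> X" "\<And>y. y \<in> X \<Longrightarrow> y \<in> m \<or> y = m"
proof -
  from assms(1) have "\<forall>X x. X \<subseteq> n \<and> x \<in> X \<longrightarrow> (\<exists>m. m \<in> X \<and> (\<forall>y. y \<in> X \<longrightarrow> y \<in> m \<or> y = m))"
  proof (induction rule: omega_induct)
    case (succ n)
    show ?case
    proof (intro allI impI)
      fix X x assume X: "X \<subseteq> succ n \<and> x \<in> X"
      show "\<exists>m. m \<in> X \<and> (\<forall>y. y \<in> X \<longrightarrow> y \<in> m \<or> y = m)"
      proof (cases "n \<in> X")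
        case True
        thus ?thesis using X by (auto simp: subset_def)
      next
        case False
        hence "X \<subseteq> n" using X by (auto simp: subset_def)
        thus ?thesis using succ X by blast
      qed
    qed
  qed (auto simp: subset_def)
  thus ?thesis using that assms by blast
qed

subsection \<open>Recursion on the ordinals\<close>

definition approx :: "('a \<Rightarrow> 'a) \<Rightarrow> 'a \<Rightarrow> 'a \<Rightarrow> bool" where
  "approx G f a \<longleftrightarrow> fun_on f a \<and> (\<forall>b. b \<in> a \<longrightarrow> ap f b = G (lam b (ap f)))"

text \<open>All approximations agree at \<open>a\<close>, so the value can be described through its
  members; the form with \<open>setof\<close> makes definability automatic.\<close>

definition recur :: "('a \<Rightarrow> 'a) \<Rightarrow> 'a \<Rightarrow> 'a" where
  "recur G a = setof (\<lambda>z. \<exists>f. approx G f (succ a) \<and> z \<in> ap f a)"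

lemma dfnt_recur [dfn, simp]:
  assumes G: "dfnt (\<lambda>v. G (v 0) (\<lambda>i. v (Suc i)))" and a: "dfnt a"
  shows "dfnt (\<lambda>v. recur (\<lambda>f. G f v) (a v))"
proof -
  have 1: "dfnt (\<lambda>v. G (lam (v 0) (ap (v (Suc 0)))) (\<lambda>i. v (Suc (Suc (Suc i)))))"
    by (rule dfnt_subst[of "\<lambda>v. lam (v 0) (ap (v (Suc 0)))" "\<lambda>z v. G z (\<lambda>i. v (Suc (Suc (Suc i))))"])
      (use dfnt_shift[OF G, of "case_nat 0 (\<lambda>i. Suc (Suc (Suc (Suc i))))"] in \<open>simp_all\<close>)
  show ?thesis unfolding recur_def approx_def
    by (intro dfn 1 dfnt_shift[OF a, of "\<lambda>i. Suc (Suc i)"] dfnt_shift[OF a, of "\<lambda>i. Suc (Suc (Suc i))"])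
qed

lemma lam_cong: "(\<And>x. x \<in> A \<Longrightarrow> F x = G x) \<Longrightarrow> lam A F = lam A G"
  unfolding lam_def by (rule arg_cong[of _ _ setof]) (auto simp: fun_eq_iff)

lemma recur:
  assumes G: "dfn1 G" and "ordinal a"
  shows "recur G a = G (lam a (recur G))"
proof -
  have unique: "ap f b = ap g b" if f: "approx G f a" and g: "approx G g a'" and a: "ordinal a" "ordinal a'"
    and b: "b \<in> a" "b \<in> a'" for f g a a' b
  proof -
    have "ordinal b" using a b ord_mem by blast
    hence "b \<in> a \<and> b \<in> a' \<longrightarrow> ap f b = ap g b"
    proof (induction rule: ord_induct)
      case (step b)
      have "lam b (ap f) = lam b (ap g)" if "b \<in> a" "b \<in> a'"
        by (rule lam_cong) (use step that a ord_trans in blast)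
      thus ?case using f g unfolding approx_def by metis
    qed simp
    thus ?thesis using b by blast
  qed
  have eq: "recur G a = ap f a" if "approx G f (succ a)" "ordinal a" for f a
  proof -
    have "(\<exists>f. approx G f (succ a) \<and> z \<in> ap f a) \<longleftrightarrow> z \<in> ap f a" for z
      using that unique[OF that(1), of _ "succ a" a] by (metis mem_succ ord_succ)
    hence "z \<in> recur G a \<longleftrightarrow> z \<in> ap f a" for z unfolding recur_def by (subst mem_setof) blast+
    thus ?thesis by (rule mext)
  qed
  have R: "dfnt (\<lambda>v. recur G (v 0))" by (intro dfnt_recur[of "\<lambda>f v. G f"] G dfn)
  have rec: "recur G b = G (lam b (recur G))"
    if ob: "ordinal b" and ex: "\<And>c. c \<in> succ b \<Longrightarrow> \<exists>f. approx G f (succ c)" for b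
  proof -
    obtain f where f: "approx G f (succ b)" using ex[of b] by auto
    have "recur G b = ap f b" using eq[OF f ob] .
    also have "\<dots> = G (lam b (ap f))" using f unfolding approx_def by simp
    also have "lam b (ap f) = lam b (recur G)"
    proof (rule lam_cong)
      fix c assume c: "c \<in> b"
      then obtain g where g: "approx G g (succ c)" using ex[of c] by auto
      have oc: "ordinal c" using ob c ord_mem by blast
      show "ap f c = recur G c" unfolding eq[OF g oc]
        by (rule unique[OF f g]) (use ob oc c in auto)
    qed
    finally show ?thesis .
  qed
  have ex: "\<exists>f. approx G f (succ a)" if "ordinal a" for a
    using that
  proof (induction rule: ord_induct)
    case defn
    have "dfnp (\<lambda>v. \<exists>f. fun_on f (succ (v 0)) \<and> (\<forall>b. b \<in> succ (v 0) \<longrightarrow> ap f b = G (lam b (ap f))))"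
      by (intro dfn dfnt_app1[OF G])
    thus ?case unfolding approx_def .
  next
    case (step a)
    \<comment> \<open>The approximation consists of the values of \<open>recur G\<close> below
      \<open>a\<close>, justified by the induction hypothesis, with one application of
      \<open>G\<close> on top.\<close>
    define h where "h = lam (succ a) (\<lambda>b. if b \<in> a then recur G b else G (lam a (recur G)))"
    have D: "dfnt (\<lambda>v. if v 0 \<in> a then recur G (v 0) else G (lam a (recur G)))" using R by simp
    have hb: "ap h b = recur G b" if "b \<in> a" for b
      unfolding h_def using that by (subst ap_lam[OF D]) auto
    have ha: "ap h a = G (lam a (recur G))" unfolding h_def by (subst ap_lam[OF D]) auto
    have "ap h b = G (lam b (ap h))" if "b \<in> succ a" for b
    proof (cases "b = a")
      case True
      have "lam a (ap h) = lam a (recur G)" by (rule lam_cong) (rule hb)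
      thus ?thesis using True ha by simp
    next
      case False
      hence b: "b \<in> a" using that by simp
      have "lam b (ap h) = lam b (recur G)" by (rule lam_cong) (use hb b step(1) ord_trans in blast)
      moreover have "recur G b = G (lam b (recur G))"
      proof (rule rec)
        show "ordinal b" using step(1) b ord_mem by blast
        show "\<exists>f. approx G f (succ c)" if "c \<in> succ b" for c
          using step(2)[of c] that b ord_trans[OF step(1), of c b] by auto
      qed
      ultimately show ?thesis using hb[OF b] by simp
    qed
    moreover have "fun_on h (succ a)" unfolding h_def by (rule fun_on_lam[OF D])
    ultimately show ?case unfolding approx_def by blast
  qed
  show ?thesis by (rule rec[OF assms(2)]) (rule ex, erule ord_mem[OF ord_succ[OF assms(2)]])
qed

subsection \<open>Well-orders and their types\<close>

text \<open>Unlike \<open>linear_order\<close>, this does not confine the relation to the carrier,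
  so one relation can be used on all subsets of a carrier.\<close>

definition lin :: "'a \<Rightarrow> 'a \<Rightarrow> bool" where
  "lin A R \<longleftrightarrow> (\<forall>x. x \<in> A \<longrightarrow> \<not> lt R x x) \<and>
     (\<forall>x y z. x \<in> A \<and> y \<in> A \<and> z \<in> A \<and> lt R x y \<and> lt R y z \<longrightarrow> lt R x z) \<and>
     (\<forall>x y. x \<in> A \<and> y \<in> A \<and> x \<noteq> y \<longrightarrow> lt R x y \<or> lt R y x)"

definition wo :: "'a \<Rightarrow> 'a \<Rightarrow> bool" where
  "wo A R \<longleftrightarrow> lin A R \<and> (\<forall>X. X \<subseteq> A \<and> (\<exists>x. x \<in> X) \<longrightarrow>
     (\<exists>x. x \<in> X \<and> (\<forall>y. y \<in> X \<longrightarrow> y = x \<or> lt R x y)))"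

lemma linD:
  assumes "lin A R"
  shows lin_irrefl: "x \<in> A \<Longrightarrow> \<not> lt R x x"
    and lin_trans: "x \<in> A \<Longrightarrow> y \<in> A \<Longrightarrow> z \<in> A \<Longrightarrow> lt R x y \<Longrightarrow> lt R y z \<Longrightarrow> lt R x z"
    and lin_total: "x \<in> A \<Longrightarrow> y \<in> A \<Longrightarrow> x \<noteq> y \<Longrightarrow> lt R x y \<or> lt R y x"
  using assms unfolding lin_def by blast+

lemma lin_asym: "lin A R \<Longrightarrow> x \<in> A \<Longrightarrow> y \<in> A \<Longrightarrow> lt R x y \<Longrightarrow> \<not> lt R y x"
  using linD by metis

lemma wo_lin: "wo A R \<Longrightarrow> lin A R"
  by (simp add: wo_def)

lemma lin_subset: "lin A R \<Longrightarrow> B \<subseteq> A \<Longrightarrow> lin B R"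
  unfolding lin_def subset_def by meson

lemma wo_subset: "wo A R \<Longrightarrow> B \<subseteq> A \<Longrightarrow> wo B R"
  unfolding wo_def using lin_subset subset_trans by meson

lemma wo_least:
  assumes "wo A R" "x \<in> A" "P x" and P: "dfnp (\<lambda>v. P (v 0))"
  obtains m where "m \<in> A" "P m" "\<And>y. y \<in> A \<Longrightarrow> P y \<Longrightarrow> y = m \<or> lt R m y"
proof -
  have m: "z \<in> sep A P \<longleftrightarrow> z \<in> A \<and> P z" for z using P by (rule mem_sep)
  hence "sep A P \<subseteq> A" "x \<in> sep A P" using assms by (auto simp: subset_def)
  then obtain y where "y \<in> sep A P" "\<forall>z. z \<in> sep A P \<longrightarrow> z = y \<or> lt R y z"
    using assms(1) unfolding wo_def by blast
  thus ?thesis using that m by blast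
qed

lemma dfnp_lin [dfn, simp]: "dfnt A \<Longrightarrow> dfnt R \<Longrightarrow> dfnp (\<lambda>v. lin (A v) (R v))"
  by (rule dfnp_app2[of lin]) (unfold lin_def, intro dfn)

lemma dfnp_wo [dfn, simp]: "dfnt A \<Longrightarrow> dfnt R \<Longrightarrow> dfnp (\<lambda>v. wo (A v) (R v))"
  by (rule dfnp_app2[of wo]) (unfold wo_def, intro dfn)

lemma wo_memrel: "ordinal a \<Longrightarrow> wo a (memrel a)"
proof -
  assume a: "ordinal a"
  have "\<exists>x. x \<in> X \<and> (\<forall>y. y \<in> X \<longrightarrow> y = x \<or> lt (memrel a) x y)" if X: "X \<subseteq> a" "\<exists>x. x \<in> X" for X
  proof -
    obtain x where x: "x \<in> X" "\<not> (\<exists>z. z \<in> X \<and> z \<in> x)" using foundation X(2) by blast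
    have "y = x \<or> x \<in> y" if "y \<in> X" for y
      using ord_linear[of x y] ord_mem[OF a] X(1) x that by (metis subsetD)
    thus ?thesis using x X(1) subsetD mem_memrel by metis
  qed
  moreover have "lin a (memrel a)"
    unfolding lin_def using ord_linear ord_mem[OF a] ord_trans by (metis mem_irrefl mem_memrel)
  ultimately show ?thesis unfolding wo_def by blast
qed

lemma isoby_memD: "isoby f A R B S \<Longrightarrow> x \<in> A \<Longrightarrow> ap f x \<in> B"
  unfolding isoby_def bij_el_iff by blast

lemma wo_iso:
  assumes "isomorphic A R B S" "wo B S"
  shows "wo A R"
proof -
  obtain f where f: "isoby f A R B S" using assms isomorphic_iff by blast
  note fB = isoby_memD[OF f]
  have R: "lt R x y \<longleftrightarrow> lt S (ap f x) (ap f y)" if "x \<in> A" "y \<in> A" for x y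
    using f that by (simp add: isoby_def)
  have inj: "ap f x = ap f y \<Longrightarrow> x = y" if "x \<in> A" "y \<in> A" for x y
    using f that unfolding isoby_def bij_el_iff by metis
  have lB: "lin B S" using assms wo_lin by blast
  have "lin A R" unfolding lin_def
  proof (intro conjI allI impI)
    fix x assume "x \<in> A" thus "\<not> lt R x x" using R lin_irrefl[OF lB] fB by blast
  next
    fix x y z assume "x \<in> A \<and> y \<in> A \<and> z \<in> A \<and> lt R x y \<and> lt R y z"
    thus "lt R x z" using R lin_trans[OF lB] fB by blast
  next
    fix x y assume "x \<in> A \<and> y \<in> A \<and> x \<noteq> y"
    thus "lt R x y \<or> lt R y x" using R lin_total[OF lB] fB inj by blast
  qed
  moreover have "\<exists>x. x \<in> X \<and> (\<forall>y. y \<in> X \<longrightarrow> y = x \<or> lt R x y)"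
    if X: "X \<subseteq> A" "\<exists>x. x \<in> X" for X
  proof -
    obtain x where x: "x \<in> X" using X by blast
    obtain m where m: "m \<in> B" "\<exists>x. x \<in> X \<and> m = ap f x"
      "\<And>y. y \<in> B \<Longrightarrow> \<exists>x. x \<in> X \<and> y = ap f x \<Longrightarrow> y = m \<or> lt S m y"
      by (rule wo_least[OF assms(2), of "ap f x" "\<lambda>b. \<exists>x. x \<in> X \<and> b = ap f x"])
        (use x X fB in \<open>auto simp: subset_def\<close>)
    then obtain x0 where "x0 \<in> X" "m = ap f x0" by blast
    thus ?thesis using m(3) R inj fB X(1) by (metis subsetD)
  qed
  ultimately show ?thesis unfolding wo_def by blast
qed

text \<open>The value \<open>A\<close> signals that the range of \<open>f\<close> exhausts \<open>A\<close>.\<close>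

definition next_elt :: "'a \<Rightarrow> 'a \<Rightarrow> 'a \<Rightarrow> 'a" where
  "next_elt A R f = (if \<exists>x. x \<in> A \<and> \<not> (\<exists>b. opair b x \<in> f)
     then setof (\<lambda>z. \<exists>x. x \<in> A \<and> \<not> (\<exists>b. opair b x \<in> f) \<and>
       (\<forall>y. y \<in> A \<and> \<not> (\<exists>b. opair b y \<in> f) \<longrightarrow> y = x \<or> lt R x y) \<and> z \<in> x)
     else A)"

lemma next_elt:
  assumes "wo A R" "x \<in> A" "\<not> (\<exists>b. opair b x \<in> f)"
  shows "next_elt A R f \<in> A" "\<not> (\<exists>b. opair b (next_elt A R f) \<in> f)"
    "next_elt A R f = x \<or> lt R (next_elt A R f) x"
proof -
  let ?P = "\<lambda>x. \<not> (\<exists>b. opair b x \<in> f)"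
  obtain m where m: "m \<in> A" "?P m" "\<And>y. y \<in> A \<Longrightarrow> ?P y \<Longrightarrow> y = m \<or> lt R m y"
    by (rule wo_least[OF assms(1,2), of ?P]) (use assms in auto)
  have u: "x = m" if "x \<in> A" "?P x" "\<forall>y. y \<in> A \<and> ?P y \<longrightarrow> y = x \<or> lt R x y" for x
    using m that lin_asym[OF wo_lin[OF assms(1)]] by blast
  have "z \<in> next_elt A R f \<longleftrightarrow> z \<in> m" for z
  proof -
    have iff: "(\<exists>x. x \<in> A \<and> ?P x \<and> (\<forall>y. y \<in> A \<and> ?P y \<longrightarrow> y = x \<or> lt R x y) \<and> z \<in> x) \<longleftrightarrow> z \<in> m" for z
      using m u by blast
    have "\<exists>x. x \<in> A \<and> ?P x" using m by blast
    thus ?thesis unfolding next_elt_def by (simp only: if_True) (subst mem_setof, use iff in blast, rule iff)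
  qed
  hence "next_elt A R f = m" by (rule mext)
  thus "next_elt A R f \<in> A" "\<not> (\<exists>b. opair b (next_elt A R f) \<in> f)"
    "next_elt A R f = x \<or> lt R (next_elt A R f) x" using m assms by blast+
qed

text \<open>Transfinite enumeration: \<open>e a\<close> is the least element not yet enumerated. The
  enumeration must stop, since otherwise its inverse would send the set \<open>A\<close> onto all
  ordinals.\<close>

lemma wo_iso_ordinal:
  assumes wo: "wo A R"
  obtains a where "ordinal a" "isomorphic A R a (memrel a)"
proof -
  define e where "e = recur (next_elt A R)"
  have G: "dfnt (\<lambda>v. next_elt A R (v 0))" unfolding next_elt_def by (intro dfn)
  have De: "dfn1 e" unfolding e_def by (intro dfnt_recur[of "\<lambda>f v. next_elt A R f"] G dfn)
  have e: "e a = next_elt A R (lam a e)" if "ordinal a" for a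
    unfolding e_def by (rule recur[OF G that])
  have ran: "(\<exists>b. opair b x \<in> lam a e) \<longleftrightarrow> (\<exists>b. b \<in> a \<and> e b = x)" for a x
    by (subst mem_lam[OF De]) auto
  have ea: "e a \<in> A" "\<not> (\<exists>b. b \<in> a \<and> e b = e a)" "\<And>x. x \<in> A \<Longrightarrow> \<not> (\<exists>b. b \<in> a \<and> e b = x) \<Longrightarrow> e a = x \<or> lt R (e a) x"
    if a: "ordinal a" "x \<in> A" "\<not> (\<exists>b. b \<in> a \<and> e b = x)" for a x
    using next_elt[OF wo, of _ "lam a e", unfolded ran] that e[OF that(1)] by metis+
  have fin: "\<not> e a \<in> A" if "ordinal a" "\<not> (\<exists>x. x \<in> A \<and> \<not> (\<exists>b. b \<in> a \<and> e b = x))" for a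
  proof -
    have "e a = A" unfolding e[OF that(1)] next_elt_def ran using that(2) by argo
    thus ?thesis by simp
  qed
  have new: "\<not> (\<exists>b. b \<in> a \<and> e b = e a)" if a: "ordinal a" "e a \<in> A" for a
  proof -
    obtain x where x: "x \<in> A" "\<not> (\<exists>b. b \<in> a \<and> e b = x)" using fin[OF a(1)] a(2) by metis
    show ?thesis by (rule ea(2)[OF a(1) x])
  qed
  have stop: "\<exists>a. ordinal a \<and> \<not> e a \<in> A"
  proof (rule ccontr)
    assume "\<not> ?thesis"
    hence all: "e a \<in> A" if "ordinal a" for a using that by blast
    have inj: "e a \<noteq> e b" if "ordinal a" "b \<in> a" for a b
      using new[OF that(1) all[OF that(1)]] that(2) by metis
    \<comment> \<open>The image of \<open>A\<close> under the inverse of \<open>e\<close>. It is a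
      set by Replacement, yet it would contain every ordinal.\<close>
    define B where "B = img (\<lambda>x. setof (\<lambda>z. \<exists>a. ordinal a \<and> e a = x \<and> z \<in> a)) A"
    have D: "dfnt (\<lambda>v. setof (\<lambda>z. \<exists>a. ordinal a \<and> e a = v 0 \<and> z \<in> a))"
      by (intro dfn dfnt_app1[OF De])
    obtain a where a: "ordinal a" "\<not> a \<in> B" using no_set_of_ordinals by blast
    have "(\<exists>a'. ordinal a' \<and> e a' = e a \<and> z \<in> a') \<longleftrightarrow> z \<in> a" for z
      using inj ord_linear[OF a(1)] a(1) by metis
    hence "z \<in> setof (\<lambda>z. \<exists>a'. ordinal a' \<and> e a' = e a \<and> z \<in> a') \<longleftrightarrow> z \<in> a" for z
      by (subst mem_setof) blast+
    hence "setof (\<lambda>z. \<exists>a'. ordinal a' \<and> e a' = e a \<and> z \<in> a') = a" by (rule mext)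
    hence "a \<in> B" unfolding B_def using all[OF a(1)] by (subst mem_img[OF D]) auto
    thus False using a by blast
  qed
  have "dfnp (\<lambda>v. \<not> e (v 0) \<in> A)" using De by simp
  with stop obtain a where a: "ordinal a" "\<not> e a \<in> A" "\<And>c. c \<in> a \<Longrightarrow> e c \<in> A"
    using ord_least[of _ "\<lambda>a. \<not> e a \<in> A"] by metis
  have inc: "lt R (e b) (e c)" if "c \<in> a" "b \<in> c" for b c
  proof -
    have oc: "ordinal c" "ordinal b" using that a(1) ord_mem ord_trans by blast+
    have c: "e c \<in> A" using a that by blast
    have n: "\<not> (\<exists>d. d \<in> c \<and> e d = e c)" by (rule new[OF oc(1) c])
    hence nb: "\<not> (\<exists>d. d \<in> b \<and> e d = e c)" using that(2) ord_trans[OF oc(1)] by blast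
    have "e b = e c \<or> lt R (e b) (e c)" by (rule ea(3)[OF oc(2) c nb c nb])
    thus ?thesis using n that(2) by metis
  qed
  have surj: "\<exists>b. b \<in> a \<and> e b = x" if "x \<in> A" for x
  proof (rule ccontr)
    assume "\<not> ?thesis"
    from ea(1)[OF a(1) that this] show False using a(2) by blast
  qed
  have lA: "lin A R" using wo wo_lin by blast
  have iff: "lt R (e b) (e c) \<longleftrightarrow> b \<in> c" if "b \<in> a" "c \<in> a" for b c
    using inc that ord_linear[of b c] ord_mem[OF a(1)] lin_asym[OF lA] lin_irrefl[OF lA] a(3) by metis
  have bij: "bij_betw e (el a) (el A)" unfolding bij_el_iff
  proof (intro conjI allI impI)
    fix x assume x: "x \<in> A"
    obtain b where "b \<in> a" "e b = x" using surj[OF x] by blast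
    moreover have "c = b" if "c \<in> a" "e c = x" for c
      using that calculation iff ord_linear[of b c] ord_mem[OF a(1)] lin_irrefl[OF lA x] by metis
    ultimately show "\<exists>!b. b \<in> a \<and> e b = x" by blast
  qed (use a in blast)
  have "isomorphic a (memrel a) A R"
    by (rule isomorphicI[OF De bij]) (use iff in simp)
  thus ?thesis using that a isomorphic_sym by blast
qed

text \<open>Agrees with \<open>otype\<close> on well-orders and is definable everywhere.\<close>

definition otp :: "'a \<Rightarrow> 'a \<Rightarrow> 'a" where
  "otp A R = setof (\<lambda>z. \<exists>a. ordinal a \<and> isomorphic A R a (memrel a) \<and> z \<in> a)"

lemma dfnt_otp [dfn, simp]: "dfnt A \<Longrightarrow> dfnt R \<Longrightarrow> dfnt (\<lambda>v. otp (A v) (R v))"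
  by (rule dfnt_app2[of otp]) (unfold otp_def, intro dfn)

lemma ord_iso_le:
  assumes "ordinal a" "ordinal b" "isomorphic a (memrel a) b (memrel b)"
  shows "a \<subseteq> b"
proof -
  obtain f where f: "isoby f a (memrel a) b (memrel b)" using assms isomorphic_iff by blast
  have fb: "ap f x \<in> b" if "x \<in> a" for x using isoby_memD[OF f that] .
  have inc: "ap f x \<in> ap f y" if "y \<in> a" "x \<in> y" for x y
    using f that ord_trans[OF assms(1)] unfolding isoby_def by (metis mem_memrel)
  have "x \<in> b" if x: "x \<in> a" for x
  proof -
    have "x \<subseteq> ap f x"
      by (rule incr_ge[OF assms(1) x]) (use inc fb ord_mem[OF assms(2)] in auto)
    thus ?thesis
      using ord_le_lt[OF ord_mem[OF assms(1) x] ord_mem[OF assms(2) fb[OF x]] assms(2) _ fb[OF x]] by blast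
  qed
  thus ?thesis by (simp add: subset_def)
qed

lemma ord_iso_eq: "ordinal a \<Longrightarrow> ordinal b \<Longrightarrow> isomorphic a (memrel a) b (memrel b) \<Longrightarrow> a = b"
  using ord_iso_le isomorphic_sym subset_antisym by metis

lemma otp_eq:
  assumes "ordinal a" "isomorphic A R a (memrel a)"
  shows "otp A R = a" and "otype A R = a"
proof -
  have u: "b = a" if "ordinal b" "isomorphic A R b (memrel b)" for b
    using that assms ord_iso_eq isomorphic_sym isomorphic_trans by metis
  have "(\<exists>b. ordinal b \<and> isomorphic A R b (memrel b) \<and> z \<in> b) \<longleftrightarrow> z \<in> a" for z using u assms by blast
  hence "z \<in> otp A R \<longleftrightarrow> z \<in> a" for z unfolding otp_def by (subst mem_setof) blast+
  thus "otp A R = a" by (rule mext)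
  show "otype A R = a" unfolding otype_def using assms u by (intro the_equality conjI) blast+
qed

lemma otp:
  assumes "wo A R"
  shows "ordinal (otp A R)" "isomorphic A R (otp A R) (memrel (otp A R))" "otype A R = otp A R"
  using wo_iso_ordinal[OF assms] otp_eq by metis+

lemma otp_iso_iff:
  assumes "wo A R" "wo B S"
  shows "isomorphic A R B S \<longleftrightarrow> otp A R = otp B S"
  using otp[OF assms(1)] otp[OF assms(2)] otp_eq(1) isomorphic_sym isomorphic_trans by metis

definition pred :: "'a \<Rightarrow> 'a \<Rightarrow> 'a \<Rightarrow> 'a" where
  "pred A R x = sep A (\<lambda>y. lt R y x)"

lemma mem_pred [simp]: "y \<in> pred A R x \<longleftrightarrow> y \<in> A \<and> lt R y x"
  unfolding pred_def by simp

lemma dfnt_pred [dfn, simp]: "dfnt A \<Longrightarrow> dfnt R \<Longrightarrow> dfnt x \<Longrightarrow> dfnt (\<lambda>v. pred (A v) (R v) (x v))"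
  by (rule dfnt_app3[of pred]) (unfold pred_def, intro dfn)

definition rk :: "'a \<Rightarrow> 'a \<Rightarrow> 'a \<Rightarrow> 'a" where
  "rk A R x = otp (pred A R x) R"

lemma dfnt_rk [dfn, simp]: "dfnt A \<Longrightarrow> dfnt R \<Longrightarrow> dfnt x \<Longrightarrow> dfnt (\<lambda>v. rk (A v) (R v) (x v))"
  by (rule dfnt_app3[of rk]) (unfold rk_def, intro dfn)

text \<open>An isomorphism onto an ordinal carries the predecessors of \<open>x\<close> onto the
  members of its value at \<open>x\<close>. So ranks give the only such isomorphism, definable from
  the order; later they stand in wherever an isomorphism between well-orders would have to be
  chosen.\<close>

lemma rk_eq_iso:
  assumes "wo A R" and f: "isoby f A R a (memrel a)" and a: "ordinal a" and x: "x \<in> A"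
  shows "rk A R x = ap f x"
proof -
  have R: "lt R y z \<longleftrightarrow> ap f y \<in> ap f z" if "y \<in> A" "z \<in> A" for y z
    using f that isoby_memD[OF f] unfolding isoby_def by auto
  have fx: "ap f x \<in> a" using isoby_memD[OF f x] .
  have "bij_betw (ap f) (el (pred A R x)) (el (ap f x))"
    unfolding bij_el_iff
  proof (intro conjI allI impI)
    fix y assume "y \<in> pred A R x" thus "ap f y \<in> ap f x" using R x by auto
  next
    fix z assume z: "z \<in> ap f x"
    hence "z \<in> a" using ord_trans[OF a _ fx] by blast
    then obtain y where y: "y \<in> A" "ap f y = z" "\<And>y'. y' \<in> A \<Longrightarrow> ap f y' = z \<Longrightarrow> y' = y"
      using f unfolding isoby_def bij_el_iff by metis
    hence "lt R y x" using R x z by blast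
    thus "\<exists>!y. y \<in> pred A R x \<and> ap f y = z" unfolding mem_pred using y by blast
  qed
  moreover have "lt R y z \<longleftrightarrow> opair (ap f y) (ap f z) \<in> memrel (ap f x)"
    if "y \<in> pred A R x" "z \<in> pred A R x" for y z using R that x by auto
  ultimately have "isomorphic (pred A R x) R (ap f x) (memrel (ap f x))"
    by (intro isomorphicI[of "ap f"]) auto
  thus ?thesis unfolding rk_def using otp_eq(1) ord_mem[OF a fx] by blast
qed

lemma rk:
  assumes "wo A R"
  shows rk_bij: "bij_betw (rk A R) (el A) (el (otp A R))"
    and rk_iff: "\<And>x y. x \<in> A \<Longrightarrow> y \<in> A \<Longrightarrow> lt R x y \<longleftrightarrow> rk A R x \<in> rk A R y"
    and rk_mem: "\<And>x. x \<in> A \<Longrightarrow> rk A R x \<in> otp A R"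
    and rk_inj: "\<And>x y. x \<in> A \<Longrightarrow> y \<in> A \<Longrightarrow> rk A R x = rk A R y \<Longrightarrow> x = y"
    and rk_surj: "\<And>z. z \<in> otp A R \<Longrightarrow> \<exists>x. x \<in> A \<and> rk A R x = z"
    and rk_ord: "\<And>x. x \<in> A \<Longrightarrow> ordinal (rk A R x)"
proof -
  obtain f where f: "isoby f A R (otp A R) (memrel (otp A R))"
    using otp(2)[OF assms] isomorphic_iff by blast
  note eq = rk_eq_iso[OF assms f otp(1)[OF assms]]
  have b: "bij_betw (ap f) (el A) (el (otp A R))" using f unfolding isoby_def by blast
  show 1: "bij_betw (rk A R) (el A) (el (otp A R))"
    using b by (rule bij_betw_cong[THEN iffD1, rotated]) (simp add: eq)
  show "\<And>x y. x \<in> A \<Longrightarrow> y \<in> A \<Longrightarrow> lt R x y \<longleftrightarrow> rk A R x \<in> rk A R y"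
    using f isoby_memD[OF f] unfolding isoby_def by (simp add: eq)
  show 3: "\<And>x. x \<in> A \<Longrightarrow> rk A R x \<in> otp A R" using 1 unfolding bij_el_iff by blast
  show "\<And>x y. x \<in> A \<Longrightarrow> y \<in> A \<Longrightarrow> rk A R x = rk A R y \<Longrightarrow> x = y"
    using 1 3 unfolding bij_el_iff by metis
  show "\<And>z. z \<in> otp A R \<Longrightarrow> \<exists>x. x \<in> A \<and> rk A R x = z" using 1 unfolding bij_el_iff by blast
  show "\<And>x. x \<in> A \<Longrightarrow> ordinal (rk A R x)" using 3 otp(1)[OF assms] ord_mem by blast
qed

lemma rk_le:
  assumes A: "wo A R" and B: "wo B S" and F: "dfn1 F"
    and FB: "\<And>x. x \<in> A \<Longrightarrow> F x \<in> B"
    and inc: "\<And>x y. x \<in> A \<Longrightarrow> y \<in> A \<Longrightarrow> lt R x y \<Longrightarrow> lt S (F x) (F y)"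
    and x: "x \<in> A"
  shows "rk A R x \<subseteq> rk B S (F x)"
proof -
  \<comment> \<open>\<open>F\<close> read through the ranks on both sides: a strictly increasing map
    on an ordinal, to which \<open>incr_ge\<close> applies.\<close>
  define G where "G z = rk B S (F (invf A (rk A R) z))" for z
  have DG: "dfn1 G" unfolding G_def
    by (intro dfnt_rk dfnt_const dfnt_app1[OF F] dfnt_invf dfnt_var)
  have inv: "invf A (rk A R) (rk A R y) = y" if "y \<in> A" for y
    using bij_betw_invf(3)[OF rk_bij[OF A] that] .
  have Grk: "G (rk A R y) = rk B S (F y)" if "y \<in> A" for y unfolding G_def inv[OF that] ..
  have "rk A R x \<subseteq> G (rk A R x)"
  proof (rule incr_ge[OF otp(1)[OF A] rk_mem[OF A x] DG])
    fix z w assume w: "w \<in> otp A R" and z: "z \<in> w"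
    obtain y where y: "y \<in> A" "rk A R y = w" using rk_surj[OF A w] by blast
    obtain y' where y': "y' \<in> A" "rk A R y' = z"
      using rk_surj[OF A] ord_trans[OF otp(1)[OF A] z w] by blast
    have "lt R y' y" using rk_iff[OF A y'(1) y(1)] y y' z by simp
    hence "rk B S (F y') \<in> rk B S (F y)"
      using rk_iff[OF B FB[OF y'(1)] FB[OF y(1)]] inc y y' by blast
    thus "G z \<in> G w" using Grk y y' by metis
  next
    fix w assume "w \<in> otp A R"
    thus "ordinal (G w)" using rk_surj[OF A] Grk rk_ord[OF B] FB by metis
  qed
  thus ?thesis using Grk[OF x] by simp
qed

lemma otp_le:
  assumes A: "wo A R" and B: "wo B S" and F: "dfn1 F"
    and FB: "\<And>x. x \<in> A \<Longrightarrow> F x \<in> B"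
    and inc: "\<And>x y. x \<in> A \<Longrightarrow> y \<in> A \<Longrightarrow> lt R x y \<Longrightarrow> lt S (F x) (F y)"
  shows "otp A R \<subseteq> otp B S"
  unfolding subset_def
proof (intro allI impI)
  fix z assume z: "z \<in> otp A R"
  obtain x where x: "x \<in> A" "rk A R x = z" using rk_surj[OF A z] by blast
  have "z \<subseteq> rk B S (F x)" using rk_le[OF assms x(1)] x by simp
  thus "z \<in> otp B S"
    using ord_le_lt[OF _ rk_ord[OF B FB] otp(1)[OF B]] rk_mem[OF B FB] x(1) rk_ord[OF A x(1)] x(2) by metis
qed

lemma otp_lt:
  assumes A: "wo A R" and B: "wo B S" and F: "dfn1 F"
    and FB: "\<And>x. x \<in> A \<Longrightarrow> F x \<in> B"
    and inc: "\<And>x y. x \<in> A \<Longrightarrow> y \<in> A \<Longrightarrow> lt R x y \<Longrightarrow> lt S (F x) (F y)"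
    and b: "b \<in> B" "\<And>x. x \<in> A \<Longrightarrow> lt S (F x) b"
  shows "otp A R \<in> otp B S"
proof -
  have "otp A R \<subseteq> rk B S b"
    unfolding subset_def
  proof (intro allI impI)
    fix z assume z: "z \<in> otp A R"
    obtain x where x: "x \<in> A" "rk A R x = z" using rk_surj[OF A z] by blast
    have 1: "z \<subseteq> rk B S (F x)" using rk_le[OF A B F FB inc x(1)] x by simp
    have 2: "rk B S (F x) \<in> rk B S b" using rk_iff[OF B FB[OF x(1)] b(1)] b(2)[OF x(1)] by blast
    show "z \<in> rk B S b"
      using ord_le_lt[OF _ rk_ord[OF B FB[OF x(1)]] rk_ord[OF B b(1)] 1 2] rk_ord[OF A x(1)] x(2) by simp
  qed
  thus ?thesis using ord_le_lt[OF otp(1)[OF A] rk_ord[OF B b(1)] otp(1)[OF B]] rk_mem[OF B b(1)] by blast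
qed

lemma otp_mono: "wo B R \<Longrightarrow> A \<subseteq> B \<Longrightarrow> otp A R \<subseteq> otp B R"
  by (rule otp_le[of _ _ _ _ "\<lambda>x. x"]) (auto intro: wo_subset subsetD)

lemma otp_ordinal: "ordinal a \<Longrightarrow> otp a (memrel a) = a"
  by (rule otp_eq(1)) (auto intro: isomorphic_refl)

lemma otp_subset_ordinal: "ordinal a \<Longrightarrow> B \<subseteq> a \<Longrightarrow> otp B (memrel a) \<subseteq> a"
  using otp_mono[OF wo_memrel] otp_ordinal by metis

subsection \<open>Finite sets\<close>

definition fin :: "'a \<Rightarrow> bool" where
  "fin A \<longleftrightarrow> (\<exists>n. n \<in> omega \<and> equipotent A n)"

definition ins :: "'a \<Rightarrow> 'a \<Rightarrow> 'a" where
  "ins x A = un A (upair x x)"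

lemma mem_ins [simp]: "y \<in> ins x A \<longleftrightarrow> y = x \<or> y \<in> A"
  by (auto simp: ins_def)

lemma infinite_set_iff: "infinite_set A \<longleftrightarrow> \<not> fin A"
  by (simp add: infinite_set_def fin_def)

lemma dfnp_fin [dfn, simp]: "dfnt A \<Longrightarrow> dfnp (\<lambda>v. fin (A v))"
  by (rule dfnp_app1[of fin]) (unfold fin_def, intro dfn)

lemma equipotent_sym: "equipotent A B \<Longrightarrow> equipotent B A"
  unfolding equipotent_iff[of A B] using bij_betw_invf(1) equipotentI[of "invf A (ap _)"] by fastforce

lemma equipotent_refl: "equipotent A A"
  by (rule equipotentI[of "\<lambda>x. x"]) (auto simp: bij_betw_def)

lemma equipotent_trans: "equipotent A B \<Longrightarrow> equipotent B C \<Longrightarrow> equipotent A C"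
  unfolding equipotent_iff[of A B] equipotent_iff[of B C]
proof (elim exE conjE)
  fix f g assume "bij_betw (ap f) (el A) (el B)" "bij_betw (ap g) (el B) (el C)"
  hence "bij_betw (\<lambda>x. ap g (ap f x)) (el A) (el C)" using bij_betw_trans by (fastforce simp: comp_def)
  thus ?thesis by (rule equipotentI[rotated]) simp
qed

lemma fin_cong: "equipotent A B \<Longrightarrow> fin A \<longleftrightarrow> fin B"
  unfolding fin_def using equipotent_sym equipotent_trans by blast

lemma fin_omega_mem: "n \<in> omega \<Longrightarrow> fin n"
  unfolding fin_def using equipotent_refl by blast

lemma fin_zero [simp]: "fin zero"
  by (simp add: fin_omega_mem)

lemma fin_ins [simp]:
  assumes "fin A" shows "fin (ins x A)"
proof (cases "x \<in> A")
  case True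
  hence "ins x A = A" by (intro mext) auto
  thus ?thesis using assms by simp
next
  case False
  obtain n f where n: "n \<in> omega" and f: "bij_betw (ap f) (el A) (el n)"
    using assms unfolding fin_def equipotent_iff by blast
  have "bij_betw (\<lambda>y. if y = x then n else ap f y) (el (ins x A)) (el (succ n))"
    unfolding bij_el_iff
  proof (intro conjI allI impI)
    fix y assume "y \<in> ins x A"
    thus "(if y = x then n else ap f y) \<in> succ n" using f unfolding bij_el_iff by auto
  next
    fix z assume z: "z \<in> succ n"
    show "\<exists>!y. y \<in> ins x A \<and> (if y = x then n else ap f y) = z"
    proof (cases "z = n")
      case True
      have "ap f y \<noteq> n" if "y \<in> A" for y using f that mem_irrefl unfolding bij_el_iff by metis
      thus ?thesis using True by (intro ex1I[of _ x]) (simp, metis mem_ins)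
    next
      case nz: False
      hence "z \<in> n" using z by simp
      then obtain y where y: "y \<in> A" "ap f y = z" "\<And>y'. y' \<in> A \<Longrightarrow> ap f y' = z \<Longrightarrow> y' = y"
        using f unfolding bij_el_iff by metis
      show ?thesis
      proof (rule ex1I[of _ y])
        show "y \<in> ins x A \<and> (if y = x then n else ap f y) = z" using y(1,2) False by auto
        show "y' = y" if "y' \<in> ins x A \<and> (if y' = x then n else ap f y') = z" for y'
          using that y(3) nz by (metis mem_ins)
      qed
    qed
  qed
  hence "equipotent (ins x A) (succ n)" by (rule equipotentI[rotated]) simp
  thus ?thesis unfolding fin_def using n succ_omega by blast
qed

lemma fin_induct [consumes 1, case_names defn empty ins]:
  assumes "fin A" and P: "dfnp (\<lambda>v. P (v 0))" and 0: "P zero"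
    and s: "\<And>A x. fin A \<Longrightarrow> P A \<Longrightarrow> \<not> x \<in> A \<Longrightarrow> P (ins x A)"
  shows "P A"
proof -
  have P': "dfnp (\<lambda>v. P (v i))" for i using dfnp_app1[OF P, of "\<lambda>v. v i"] by simp
  have "\<forall>A. equipotent A n \<longrightarrow> P A" if "n \<in> omega" for n
    using that
  proof (induction rule: omega_induct)
    case defn show ?case using P' by simp
  next
    case zero
    have "A = zero" if "equipotent A zero" for A
      using that unfolding equipotent_iff bij_el_iff by (intro mext) auto
    thus ?case using 0 by blast
  next
    case (succ n)
    show ?case
    proof (intro allI impI)
      fix A assume "equipotent A (succ n)"
      then obtain f where f: "bij_betw (ap f) (el A) (el (succ n))" unfolding equipotent_iff by blast
      obtain x where x: "x \<in> A" "ap f x = n" using f unfolding bij_el_iff by (metis mem_succ)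
      define B where "B = sep A (\<lambda>y. y \<noteq> x)"
      have B: "y \<in> B \<longleftrightarrow> y \<in> A \<and> y \<noteq> x" for y unfolding B_def by simp
      have AB: "A = ins x B" by (rule mext) (auto simp: B x)
      have "bij_betw (ap f) (el B) (el n)"
        unfolding bij_el_iff
      proof (intro conjI allI impI)
        fix y assume "y \<in> B" thus "ap f y \<in> n"
          using f x B unfolding bij_el_iff by (metis mem_succ)
      next
        fix z assume z: "z \<in> n"
        hence "z \<noteq> n" by auto
        thus "\<exists>!y. y \<in> B \<and> ap f y = z"
          using f x B z unfolding bij_el_iff by (metis mem_succ)
      qed
      hence "equipotent B n" by (rule equipotentI[rotated]) simp
      thus "P A" unfolding AB using s succ B unfolding fin_def by blast
    qed
  qed
  thus ?thesis using assms(1) unfolding fin_def by blast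
qed

lemma fin_subset: "fin A \<Longrightarrow> B \<subseteq> A \<Longrightarrow> fin B"
proof -
  assume A: "fin A" and B: "B \<subseteq> A"
  from A have "\<forall>B. B \<subseteq> A \<longrightarrow> fin B"
  proof (induction rule: fin_induct)
    case empty
    have "B = zero" if "B \<subseteq> zero" for B by (rule mext) (use that in \<open>auto simp: subset_def\<close>)
    thus ?case using fin_zero by metis
  next
    case (ins A x)
    show ?case
    proof (intro allI impI)
      fix B assume B: "B \<subseteq> ins x A"
      define C where "C = sep B (\<lambda>y. y \<noteq> x)"
      have C: "y \<in> C \<longleftrightarrow> y \<in> B \<and> y \<noteq> x" for y unfolding C_def by simp
      have "C \<subseteq> A" using B by (auto simp: subset_def C)
      hence fC: "fin C" using ins by blast
      have "B = C \<or> B = ins x C" by (metis C mem_ins mext)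
      thus "fin B" using fC by auto
    qed
  qed simp
  thus ?thesis using B by blast
qed

lemma fin_un: "fin A \<Longrightarrow> fin B \<Longrightarrow> fin (un A B)"
proof (induction rule: fin_induct)
  case empty
  have "un zero B = B" by (rule mext) auto
  thus ?case using empty by simp
next
  case (ins A x)
  have "un (ins x A) B = ins x (un A B)" by (rule mext) auto
  thus ?case using ins by simp
qed simp

lemma fin_img:
  assumes "fin A" and F: "dfn1 F"
  shows "fin (img F A)"
  using assms(1)
proof (induction rule: fin_induct)
  case defn
  show ?case by (intro dfn dfnt_app1[OF F])
next
  case empty
  have "img F zero = zero" using F by (intro mext) auto
  thus ?case by simp
next
  case (ins A x)
  have "img F (ins x A) = ins (F x) (img F A)" using F by (intro mext) auto
  thus ?case using ins by simp
qed

lemma fin_unite: "fin A \<Longrightarrow> (\<And>x. x \<in> A \<Longrightarrow> fin x) \<Longrightarrow> fin (unite A)"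
proof -
  assume A: "fin A" and h: "\<And>x. x \<in> A \<Longrightarrow> fin x"
  from A have "(\<forall>x. x \<in> A \<longrightarrow> fin x) \<longrightarrow> fin (unite A)"
  proof (induction rule: fin_induct)
    case empty
    have "unite zero = zero" by (rule mext) auto
    thus ?case by simp
  next
    case (ins A x)
    have "unite (ins x A) = un x (unite A)" by (rule mext) auto
    thus ?case using ins fin_un by simp
  qed simp
  thus ?thesis using h by blast
qed

lemma fin_inj_surj:
  assumes "fin A" and F: "dfn1 F" and FA: "\<And>x. x \<in> A \<Longrightarrow> F x \<in> A"
    and inj: "\<And>x y. x \<in> A \<Longrightarrow> y \<in> A \<Longrightarrow> F x = F y \<Longrightarrow> x = y" and y: "y \<in> A"
  shows "\<exists>x. x \<in> A \<and> F x = y"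
proof -
  let ?I = "\<lambda>A f. (\<forall>x. x \<in> A \<longrightarrow> ap f x \<in> A) \<and> (\<forall>x y. x \<in> A \<and> y \<in> A \<and> ap f x = ap f y \<longrightarrow> x = y)"
  from \<open>fin A\<close> have "\<forall>f y. ?I A f \<and> y \<in> A \<longrightarrow> (\<exists>x. x \<in> A \<and> ap f x = y)"
  proof (induction rule: fin_induct)
    case (ins A a)
    show ?case
    proof (intro allI impI)
      fix f y assume f: "?I (ins a A) f \<and> y \<in> ins a A"
      have im: "ap f x \<in> A \<or> ap f x = a" if "x \<in> A \<or> x = a" for x
        using f that unfolding mem_ins by blast
      have inj: "x = y" if "x \<in> A \<or> x = a" "y \<in> A \<or> y = a" "ap f x = ap f y" for x y
        using f that unfolding mem_ins by blast
      \<comment> \<open>Deletes \<open>a\<close> from the domain and from the range: a point of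
        \<open>A\<close> that \<open>f\<close> sent to \<open>a\<close> is redirected to the value
        of \<open>f\<close> at \<open>a\<close>.\<close>
      define g where "g = lam A (\<lambda>x. if ap f x = a then ap f a else ap f x)"
      have g: "ap g x = (if ap f x = a then ap f a else ap f x)" if "x \<in> A" for x
        unfolding g_def using that by simp
      have "?I A g"
      proof (intro conjI allI impI)
        fix x assume "x \<in> A"
        thus "ap g x \<in> A" using g im inj ins.hyps by metis
      next
        fix x y assume "x \<in> A \<and> y \<in> A \<and> ap g x = ap g y"
        thus "x = y" using g inj ins.hyps by (metis (full_types))
      qed
      hence s: "\<exists>x. x \<in> A \<and> ap g x = z" if "z \<in> A" for z using ins.IH that by blast
      show "\<exists>x. x \<in> ins a A \<and> ap f x = y"
      proof (cases "y = a")
        case False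
        hence "y \<in> A" using f unfolding mem_ins by blast
        then obtain x where "x \<in> A" "ap g x = y" using s by blast
        thus ?thesis using g by (metis mem_ins)
      next
        case True
        show ?thesis
        proof (cases "ap f a = a")
          case False
          hence "ap f a \<in> A" using im by blast
          then obtain x where x: "x \<in> A" "ap g x = ap f a" using s by blast
          hence "ap f x = a" using g inj ins.hyps by metis
          thus ?thesis using x True by auto
        qed (use True in auto)
      qed
    qed
  qed auto
  moreover have eq: "ap (lam A F) x = F x" if "x \<in> A" for x using F that by (rule ap_lam)
  have "?I A (lam A F)" using FA inj eq by metis
  ultimately have "\<exists>x. x \<in> A \<and> ap (lam A F) x = y" using y by blast
  thus ?thesis using eq by metis
qed

lemma not_fin_omega: "\<not> fin omega"
proof
  assume "fin omega"
  from fin_inj_surj[OF this, of succ zero] show False by simp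
qed

lemma fin_ordinal: "ordinal a \<Longrightarrow> fin a \<longleftrightarrow> a \<in> omega"
  using fin_omega_mem not_fin_omega fin_subset ord_not_mem[of a omega] by auto

lemma fin_lin_wo:
  assumes "fin A" "lin A R"
  shows "wo A R"
proof -
  have "\<exists>x. x \<in> X \<and> (\<forall>y. y \<in> X \<longrightarrow> y = x \<or> lt R x y)" if X: "X \<subseteq> A" "\<exists>x. x \<in> X" for X
  proof -
    have "fin X" using fin_subset assms X by blast
    hence "X \<subseteq> A \<and> (\<exists>x. x \<in> X) \<longrightarrow> (\<exists>x. x \<in> X \<and> (\<forall>y. y \<in> X \<longrightarrow> y = x \<or> lt R x y))"
    proof (induction rule: fin_induct)
      case (ins X x)
      show ?case
      proof (intro impI)
        assume h: "ins x X \<subseteq> A \<and> (\<exists>y. y \<in> ins x X)"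
        hence XA: "X \<subseteq> A" "x \<in> A" by (auto simp: subset_def)
        show "\<exists>z. z \<in> ins x X \<and> (\<forall>y. y \<in> ins x X \<longrightarrow> y = z \<or> lt R z y)"
        proof (cases "\<exists>z. z \<in> X")
          case True
          then obtain m where m: "m \<in> X" "\<forall>y. y \<in> X \<longrightarrow> y = m \<or> lt R m y" using ins XA by blast
          have mA: "m \<in> A" using m XA subsetD by blast
          show ?thesis
          proof (cases "lt R x m")
            case True
            have "lt R x y" if "y \<in> X" for y
              using m that True lin_trans[OF assms(2) XA(2) mA] XA(1) subsetD by metis
            thus ?thesis by (intro exI[of _ x]) auto
          next
            case False
            hence "x = m \<or> lt R m x" using lin_total[OF assms(2) XA(2) mA] by blast
            thus ?thesis using m by (intro exI[of _ m]) auto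
          qed
        qed (auto intro!: exI[of _ x])
      qed
    qed auto
    thus ?thesis using X by blast
  qed
  thus ?thesis using assms unfolding wo_def by blast
qed

lemma fin_otp:
  assumes "fin A" "wo A R" shows "otp A R \<in> omega"
proof -
  have "equipotent A (otp A R)" by (rule equipotentI[OF _ rk_bij[OF assms(2)]]) simp
  thus ?thesis using fin_cong assms fin_ordinal otp(1)[OF assms(2)] by blast
qed

subsection \<open>Decompositions into pieces\<close>

definition piece :: "'a \<Rightarrow> 'a \<Rightarrow> 'a \<Rightarrow> 'a" where
  "piece T pc t = sep T (\<lambda>s. ap pc s = ap pc t)"

definition tail :: "'a \<Rightarrow> 'a \<Rightarrow> 'a \<Rightarrow> 'a \<Rightarrow> 'a" where
  "tail T W pc t = sep T (\<lambda>s. ap pc s = ap pc t \<and> (s = t \<or> lt W t s))"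

lemma mem_piece [simp]: "s \<in> piece T pc t \<longleftrightarrow> s \<in> T \<and> ap pc s = ap pc t"
  unfolding piece_def by simp

lemma mem_tail [simp]:
  "s \<in> tail T W pc t \<longleftrightarrow> s \<in> T \<and> ap pc s = ap pc t \<and> (s = t \<or> lt W t s)"
  unfolding tail_def by simp

lemma dfnt_piece [dfn, simp]: "dfnt T \<Longrightarrow> dfnt pc \<Longrightarrow> dfnt t \<Longrightarrow> dfnt (\<lambda>v. piece (T v) (pc v) (t v))"
  by (rule dfnt_app3[of piece]) (unfold piece_def, intro dfn)

lemma dfnt_tail [dfn, simp]:
  "dfnt T \<Longrightarrow> dfnt W \<Longrightarrow> dfnt pc \<Longrightarrow> dfnt t \<Longrightarrow> dfnt (\<lambda>v. tail (T v) (W v) (pc v) (t v))"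
  by (rule dfnt_app4[of tail]) (unfold tail_def, intro dfn)

lemma fin_max:
  assumes "fin X" and g: "dfn1 g" and o: "\<And>x. x \<in> X \<Longrightarrow> ordinal (g x)" and "x \<in> X"
  obtains m where "m \<in> X" "\<And>y. y \<in> X \<Longrightarrow> g y \<subseteq> g m"
proof -
  have g': "dfnt (\<lambda>v. g (v i))" for i using dfnt_app1[OF g, of "\<lambda>v. v i"] by simp
  from \<open>fin X\<close> have "(\<forall>x. x \<in> X \<longrightarrow> ordinal (g x)) \<and> (\<exists>x. x \<in> X) \<longrightarrow>
      (\<exists>m. m \<in> X \<and> (\<forall>y. y \<in> X \<longrightarrow> g y \<subseteq> g m))"
  proof (induction rule: fin_induct)
    case defn show ?case by (intro dfn g')
  next
    case (ins X a)
    show ?case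
    proof (intro impI)
      assume h: "(\<forall>x. x \<in> ins a X \<longrightarrow> ordinal (g x)) \<and> (\<exists>x. x \<in> ins a X)"
      show "\<exists>m. m \<in> ins a X \<and> (\<forall>y. y \<in> ins a X \<longrightarrow> g y \<subseteq> g m)"
      proof (cases "\<exists>x. x \<in> X")
        case True
        then obtain m where m: "m \<in> X" "\<And>y. y \<in> X \<Longrightarrow> g y \<subseteq> g m" using ins h by auto
        have "g a \<subseteq> g m \<or> g m \<subseteq> g a"
          using h m ord_linear[of "g a" "g m"] ord_mem_subset by (metis mem_ins subset_refl)
        thus ?thesis
        proof
          assume "g a \<subseteq> g m" thus ?thesis using m by (intro exI[of _ m]) auto
        next
          assume "g m \<subseteq> g a" thus ?thesis using m subset_trans by (intro exI[of _ a]) auto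
        qed
      next
        case False
        thus ?thesis by (intro exI[of _ a]) auto
      qed
    qed
  qed auto
  thus ?thesis using that assms by blast
qed

text \<open>
  On the highest level reached by a violation, \<open>k\<close> restricts to an injection of a finite set into
  itself.
\<close>

lemma level_preserved:
  assumes X: "fin X" and k: "dfn1 k" and P: "dfn1 P"
    and kX: "\<And>q. q \<in> X \<Longrightarrow> k q \<in> X" and oP: "\<And>q. q \<in> X \<Longrightarrow> ordinal (P q)"
    and le: "\<And>q. q \<in> X \<Longrightarrow> P q \<subseteq> P (k q)"
    and fib: "\<And>q r. q \<in> X \<Longrightarrow> r \<in> X \<Longrightarrow> P q = P (k q) \<Longrightarrow> k r = k q \<Longrightarrow> r = q"
    and q: "q \<in> X"
  shows "P (k q) = P q"
proof (rule ccontr)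
  assume ne: "P (k q) \<noteq> P q"
  have Pk: "dfnt (\<lambda>v. P (k (v 0)))" by (rule dfnt_app1[OF P k])
  define Y where "Y = sep X (\<lambda>q. P (k q) \<noteq> P q)"
  have "dfnp (\<lambda>v. P (k (v 0)) \<noteq> P (v 0))" using Pk P by simp
  hence Y: "z \<in> Y \<longleftrightarrow> z \<in> X \<and> P (k z) \<noteq> P z" for z unfolding Y_def by (rule mem_sep)
  have "fin Y" by (rule fin_subset[OF X]) (simp add: subset_def Y)
  then obtain m where m: "m \<in> Y" "\<And>y. y \<in> Y \<Longrightarrow> P (k y) \<subseteq> P (k m)"
    by (rule fin_max[OF _ Pk]) (use Y oP kX q ne in auto)
  have mX: "m \<in> X" "P (k m) \<noteq> P m" using m Y by auto
  define Z where "Z = sep X (\<lambda>s. P s = P (k m))"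
  have Z: "s \<in> Z \<longleftrightarrow> s \<in> X \<and> P s = P (k m)" for s unfolding Z_def using P by simp
  have keep: "P (k s) = P s" if s: "s \<in> Z" for s
  proof (rule ccontr)
    assume n: "P (k s) \<noteq> P s"
    hence "P (k s) \<subseteq> P (k m)" using m(2) Y Z s by blast
    hence "P (k s) \<subseteq> P s" using Z s by metis
    thus False using le[of s] n Z s subset_antisym by metis
  qed
  have "\<exists>s. s \<in> Z \<and> k s = k m"
  proof (rule fin_inj_surj[OF _ k])
    show "fin Z" by (rule fin_subset[OF X]) (simp add: subset_def Z)
    show "k s \<in> Z" if "s \<in> Z" for s using keep[OF that] that Z kX by metis
    show "s = s'" if "s \<in> Z" "s' \<in> Z" "k s = k s'" for s s'
      using fib[of s' s] keep[OF that(2)] that Z by metis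
    show "k m \<in> Z" using Z kX mX by metis
  qed
  then obtain s where s: "s \<in> Z" "k s = k m" by blast
  hence "m = s" using fib[of s m] keep[of s] Z mX by metis
  thus False using s Z mX by metis
qed

end

text \<open>
  \<open>pc\<close> numbers convex pieces of \<open>R\<close>. The relation \<open>W\<close> matters only inside the pieces, where \<open>d\<close> tells
  whether it is \<open>R\<close> or the converse of \<open>R\<close>.
\<close>

locale wpieces = zf_model +
  fixes T R W pc N d :: 'a
  assumes lin_R: "lin T R" and N_omega: "N \<in> omega"
    and pc_mem: "t \<in> T \<Longrightarrow> ap pc t \<in> N"
    and pc_less: "\<lbrakk>s \<in> T; t \<in> T; ap pc s \<in> ap pc t\<rbrakk> \<Longrightarrow> lt R s t"
    and wo_piece: "t \<in> T \<Longrightarrow> wo (piece T pc t) W"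
    and dir: "\<lbrakk>s \<in> T; t \<in> T; ap pc s = ap pc t\<rbrakk> \<Longrightarrow>
      lt R s t \<longleftrightarrow> (if ap d (ap pc t) = zero then lt W s t else lt W t s)"
begin

abbreviation ty :: "'a \<Rightarrow> 'a" where "ty t \<equiv> otp (piece T pc t) W"

text \<open>In the intended decompositions the pieces have the type of a power of omega. A piece
  with more than one point is then infinite and has no last point, see
  \<open>big_next\<close>.\<close>

definition big :: "'a \<Rightarrow> bool" where
  "big t \<longleftrightarrow> (\<exists>s. s \<in> T \<and> ap pc s = ap pc t \<and> s \<noteq> t)"

lemma pc_ord: "t \<in> T \<Longrightarrow> ordinal (ap pc t)"
  using pc_mem N_omega omega_mem_mem ord_omega_mem by blast

lemma pc_cases: "s \<in> T \<Longrightarrow> t \<in> T \<Longrightarrow> ap pc s \<in> ap pc t \<or> ap pc s = ap pc t \<or> ap pc t \<in> ap pc s"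
  using ord_linear pc_ord by blast

lemma pc_le: "s \<in> T \<Longrightarrow> t \<in> T \<Longrightarrow> lt R s t \<Longrightarrow> ap pc s \<in> ap pc t \<or> ap pc s = ap pc t"
  using pc_cases pc_less lin_asym[OF lin_R] by blast

lemma piece_cong: "ap pc s = ap pc t \<Longrightarrow> piece T pc s = piece T pc t"
  unfolding piece_def by simp

lemma tail_sub: "tail T W pc t \<subseteq> piece T pc t"
  by (simp add: subset_def)

lemma W_lin:
  assumes "t \<in> T"
  shows W_irrefl: "\<not> lt W t t"
    and W_total: "\<And>s. s \<in> T \<Longrightarrow> ap pc s = ap pc t \<Longrightarrow> s \<noteq> t \<Longrightarrow> lt W s t \<or> lt W t s"
    and W_asym: "\<And>s. s \<in> T \<Longrightarrow> ap pc s = ap pc t \<Longrightarrow> lt W s t \<Longrightarrow> \<not> lt W t s"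
    and W_trans: "\<And>r s. r \<in> T \<Longrightarrow> s \<in> T \<Longrightarrow> ap pc r = ap pc t \<Longrightarrow> ap pc s = ap pc t \<Longrightarrow>
      lt W r s \<Longrightarrow> lt W s t \<Longrightarrow> lt W r t"
proof -
  have l: "lin (piece T pc t) W" using wo_piece[OF assms] wo_lin by blast
  show "\<not> lt W t t" using lin_irrefl[OF l, of t] assms by simp
  show "\<And>s. s \<in> T \<Longrightarrow> ap pc s = ap pc t \<Longrightarrow> s \<noteq> t \<Longrightarrow> lt W s t \<or> lt W t s"
    using lin_total[OF l, of _ t] assms by simp
  show "\<And>s. s \<in> T \<Longrightarrow> ap pc s = ap pc t \<Longrightarrow> lt W s t \<Longrightarrow> \<not> lt W t s"
    using lin_asym[OF l, of _ t] assms by simp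
  show "\<And>r s. r \<in> T \<Longrightarrow> s \<in> T \<Longrightarrow> ap pc r = ap pc t \<Longrightarrow> ap pc s = ap pc t \<Longrightarrow>
      lt W r s \<Longrightarrow> lt W s t \<Longrightarrow> lt W r t"
    using lin_trans[OF l, of _ _ t] assms by simp
qed

lemma ty_ord: "t \<in> T \<Longrightarrow> ordinal (ty t)"
  using otp(1) wo_piece by blast

lemma wo_tail: "t \<in> T \<Longrightarrow> wo (tail T W pc t) W"
  using wo_subset[OF wo_piece tail_sub] .

lemma tail_trans: "t \<in> T \<Longrightarrow> s \<in> tail T W pc t \<Longrightarrow> r \<in> tail T W pc s \<Longrightarrow> r \<in> tail T W pc t"
  using W_trans[of r t s] unfolding mem_tail by metis

lemma tail_or: "s \<in> T \<Longrightarrow> t \<in> T \<Longrightarrow> ap pc s = ap pc t \<Longrightarrow> s \<in> tail T W pc t \<or> t \<in> tail T W pc s"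
  using W_total[of t s] unfolding mem_tail by metis

definition pset :: 'a where
  "pset = img (piece T pc) T"

lemma mem_pset: "Z \<in> pset \<longleftrightarrow> (\<exists>t. t \<in> T \<and> Z = piece T pc t)"
  unfolding pset_def by (rule mem_img) simp

lemma fin_pset: "fin pset"
proof -
  define g where "g q = sep T (\<lambda>s. ap pc s = q)" for q
  have D: "dfn1 g" unfolding g_def by (intro dfn)
  have "fin (img g N)" by (rule fin_img[OF fin_omega_mem[OF N_omega] D])
  moreover have "pset \<subseteq> img g N"
    unfolding subset_def mem_pset mem_img[OF D] using pc_mem by (auto simp: g_def piece_def)
  ultimately show ?thesis by (rule fin_subset)
qed

end

text \<open>
  The piece of \<open>t\<close> is no larger than the pieces it can absorb: those before it, or after it if it is
  reversed, up to the nearest infinite piece of the opposite direction.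
\<close>

locale pieces = wpieces +
  assumes indec: "t \<in> T \<Longrightarrow> otp (tail T W pc t) W = otp (piece T pc t) W"
    and sorted0: "\<lbrakk>s \<in> T; t \<in> T; ap pc s \<in> ap pc t; ap d (ap pc t) = zero; big t;
      \<And>r. r \<in> T \<Longrightarrow> big r \<Longrightarrow> ap pc s \<in> ap pc r \<or> ap pc s = ap pc r \<Longrightarrow> ap pc r \<in> ap pc t \<Longrightarrow>
        ap d (ap pc r) = zero\<rbrakk> \<Longrightarrow> otp (piece T pc t) W \<subseteq> otp (piece T pc s) W"
    and sorted1: "\<lbrakk>s \<in> T; t \<in> T; ap pc t \<in> ap pc s; ap d (ap pc t) \<noteq> zero; big t;
      \<And>r. r \<in> T \<Longrightarrow> big r \<Longrightarrow> ap pc r \<in> ap pc s \<or> ap pc s = ap pc r \<Longrightarrow> ap pc t \<in> ap pc r \<Longrightarrow>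
        ap d (ap pc r) \<noteq> zero\<rbrakk> \<Longrightarrow> otp (piece T pc t) W \<subseteq> otp (piece T pc s) W"
begin

text \<open>If \<open>t\<close> were last in its piece, the tail of \<open>t\<close> would be a
  single point, while the piece has a point before \<open>t\<close> and hence a larger type; this
  contradicts indecomposability.\<close>

lemma big_next:
  assumes t: "t \<in> T" "big t"
  obtains s where "s \<in> T" "ap pc s = ap pc t" "lt W t s"
proof -
  have "\<exists>s. s \<in> T \<and> ap pc s = ap pc t \<and> lt W t s"
  proof (rule ccontr)
    assume n: "\<not> ?thesis"
    obtain s where s: "s \<in> T" "ap pc s = ap pc t" "s \<noteq> t" using t unfolding big_def by blast
    hence st: "lt W s t" using W_total t n by blast
    have u: "x = t" if "x \<in> tail T W pc t" for x using that n by auto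
    have "otp (tail T W pc t) W \<in> otp (piece T pc t) W"
    proof (rule otp_lt[OF wo_tail[OF t(1)] wo_piece[OF t(1)], of "\<lambda>x. s" t])
      show "lt W s s" if "x \<in> tail T W pc t" "y \<in> tail T W pc t" "lt W x y" for x y
        using u[OF that(1)] u[OF that(2)] that(3) W_irrefl t by blast
    qed (use s t st in auto)
    thus False using indec[OF t(1)] by simp
  qed
  thus ?thesis using that by blast
qed

lemma big_cong: "t \<in> T \<Longrightarrow> s \<in> T \<Longrightarrow> ap pc s = ap pc t \<Longrightarrow> big s \<longleftrightarrow> big t"
  unfolding big_def by metis

lemma not_big_ty: "t \<in> T \<Longrightarrow> \<not> big t \<Longrightarrow> s \<in> piece T pc t \<Longrightarrow> s = t"
  unfolding big_def by auto

end

text \<open>Only the source is assumed indecomposable and sorted. The target may be any convex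
  decomposition into pieces well-ordered in one of the two directions; this allows a comparison with
  the finite sum that is given for \<open>T\<close>.\<close>

locale piece_embedding = zf_model mem + src: pieces mem T R W pc N d + tgt: wpieces mem T' R' W' pc' N' d'
  for mem :: "'a \<Rightarrow> 'a \<Rightarrow> bool"  (infix "\<in>" 50) and T R W pc N d T' R' W' pc' N' d' +
  fixes F :: "'a \<Rightarrow> 'a"
  assumes F_dfn: "dfn1 F"
    and F_mem: "t \<in> T \<Longrightarrow> F t \<in> T'"
    and F_inc: "s \<in> T \<Longrightarrow> t \<in> T \<Longrightarrow> lt R s t \<Longrightarrow> lt R' (F s) (F t)"
begin

definition stable :: "'a \<Rightarrow> bool" where
  "stable t \<longleftrightarrow> t \<in> T \<and> (\<forall>s. s \<in> tail T W pc t \<longrightarrow> ap pc' (F s) = ap pc' (F t))"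

lemma stableD: "stable t \<Longrightarrow> s \<in> tail T W pc t \<Longrightarrow> ap pc' (F s) = ap pc' (F t)"
  unfolding stable_def by blast

lemma dfnp_stable: "dfnt f \<Longrightarrow> dfnp (\<lambda>v. stable (f v))"
  by (rule dfnp_app1[of stable]) (unfold stable_def, intro dfn dfnt_app1[OF F_dfn])

lemma F_inj: "s \<in> T \<Longrightarrow> t \<in> T \<Longrightarrow> F s = F t \<Longrightarrow> s = t"
  using lin_total[OF src.lin_R] F_inc F_mem lin_irrefl[OF tgt.lin_R] by metis

text \<open>Along the \<open>W\<close>-order of a piece the index of the target piece changes
  monotonically, upwards if the piece is not reversed and downwards if it is. There are finitely
  many indices, so a point attaining the extreme one has a tail mapped into a single target
  piece.\<close>

lemma stable_ex:
  assumes t: "t \<in> T"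
  obtains t0 where "stable t0" "ap pc t0 = ap pc t"
proof -
  have Fpc: "dfnt (\<lambda>v. ap pc' (F (v 0)))" using F_dfn by simp
  show ?thesis
  proof (cases "ap d (ap pc t) = zero")
    case True
    define X where "X = img (\<lambda>s. ap pc' (F s)) (piece T pc t)"
    have X: "x \<in> X \<longleftrightarrow> (\<exists>s. s \<in> piece T pc t \<and> x = ap pc' (F s))" for x
      unfolding X_def by (rule mem_img[OF Fpc])
    have "X \<subseteq> N'" unfolding subset_def X using tgt.pc_mem F_mem by auto
    moreover have "ap pc' (F t) \<in> X" unfolding X using t by auto
    ultimately obtain m where m: "m \<in> X" "\<And>y. y \<in> X \<Longrightarrow> y \<in> m \<or> y = m"
      using omega_greatest[OF tgt.N_omega] by metis
    obtain t0 where t0: "t0 \<in> T" "ap pc t0 = ap pc t" "m = ap pc' (F t0)" using m X by auto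
    have "ap pc' (F s) = ap pc' (F t0)" if s: "s \<in> tail T W pc t0" "s \<noteq> t0" for s
    proof -
      have s': "s \<in> T" "ap pc s = ap pc t0" "lt W t0 s" using s by auto
      have "lt R t0 s" using src.dir[OF t0(1) s'(1)] s' True t0 by simp
      hence "ap pc' (F t0) \<in> ap pc' (F s) \<or> ap pc' (F t0) = ap pc' (F s)"
        using F_inc tgt.pc_le F_mem t0 s' by blast
      moreover have "ap pc' (F s) \<in> X" unfolding X using s' t0 by auto
      ultimately show ?thesis using m(2) t0(3) mem_asym by metis
    qed
    thus ?thesis using that[of t0] t0 unfolding stable_def by metis
  next
    case False
    obtain m where m: "m \<in> N'" "\<exists>s. s \<in> piece T pc t \<and> m = ap pc' (F s)"
      "\<And>y. y \<in> N' \<Longrightarrow> \<exists>s. s \<in> piece T pc t \<and> y = ap pc' (F s) \<Longrightarrow> y = m \<or> opair m y \<in> memrel N'"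
    proof (rule wo_least[OF wo_memrel[OF ord_omega_mem[OF tgt.N_omega]]])
      show "ap pc' (F t) \<in> N'" using tgt.pc_mem F_mem t by blast
      show "\<exists>s. s \<in> piece T pc t \<and> ap pc' (F t) = ap pc' (F s)" using t by auto
      show "dfnp (\<lambda>v. \<exists>s. s \<in> piece T pc t \<and> v 0 = ap pc' (F s))" by (intro dfn dfnt_app1[OF F_dfn])
    qed blast
    obtain t0 where t0: "t0 \<in> T" "ap pc t0 = ap pc t" "m = ap pc' (F t0)" using m(2) by auto
    have "ap pc' (F s) = ap pc' (F t0)" if s: "s \<in> tail T W pc t0" "s \<noteq> t0" for s
    proof -
      have s': "s \<in> T" "ap pc s = ap pc t0" "lt W t0 s" using s by auto
      have "lt R s t0" using src.dir[OF s'(1) t0(1)] s' False t0 by simp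
      hence "ap pc' (F s) \<in> ap pc' (F t0) \<or> ap pc' (F t0) = ap pc' (F s)"
        using F_inc tgt.pc_le F_mem t0 s' by metis
      moreover have "ap pc' (F s) = m \<or> opair m (ap pc' (F s)) \<in> memrel N'"
        by (rule m(3)) (use s' t0 tgt.pc_mem F_mem in auto)
      ultimately show ?thesis using t0(3) mem_asym mem_memrel by metis
    qed
    thus ?thesis using that[of t0] t0 unfolding stable_def by metis
  qed
qed

text \<open>With opposite directions a stable tail would be mapped into a well-order with the order
  reversed. The contradiction comes from the point with the \<open>W'\<close>-least image: the tail
  has no last point, and a next point would be mapped below it.\<close>

lemma stable_dir:
  assumes t: "stable t" "src.big t"
  shows "ap d (ap pc t) = zero \<longleftrightarrow> ap d' (ap pc' (F t)) = zero"
proof (rule ccontr)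
  assume n: "\<not> ?thesis"
  have tT: "t \<in> T" using t stable_def by blast
  have same: "ap pc' (F s) = ap pc' (F t)" if "s \<in> tail T W pc t" for s using stableD[OF t(1) that] .
  have "\<exists>m. m \<in> piece T' pc' (F t) \<and> (\<exists>s. s \<in> tail T W pc t \<and> m = F s) \<and>
    (\<forall>y. y \<in> piece T' pc' (F t) \<longrightarrow> (\<exists>s. s \<in> tail T W pc t \<and> y = F s) \<longrightarrow> y = m \<or> lt W' m y)"
    by (rule wo_least[OF tgt.wo_piece[OF F_mem[OF tT]], of "F t" "\<lambda>x. \<exists>s. s \<in> tail T W pc t \<and> x = F s"])
      (use tT F_mem in \<open>auto intro!: dfn dfnt_app1[OF F_dfn]\<close>)
  then obtain s where s: "s \<in> tail T W pc t"
    "\<And>y. y \<in> piece T' pc' (F t) \<Longrightarrow> \<exists>s. s \<in> tail T W pc t \<and> y = F s \<Longrightarrow> y = F s \<or> lt W' (F s) y" by blast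
  have sT: "s \<in> T" "ap pc s = ap pc t" using s by auto
  have "src.big s" using t(2) src.big_cong[OF tT sT] by blast
  then obtain r where r: "r \<in> T" "ap pc r = ap pc s" "lt W s r" using src.big_next[OF sT(1)] by blast
  have rt: "r \<in> tail T W pc t" using src.tail_trans[OF tT s(1)] r by auto
  have eq: "ap pc' (F r) = ap pc' (F t)" "ap pc' (F s) = ap pc' (F t)" using same rt s(1) by blast+
  have "F r = F s \<or> lt W' (F s) (F r)" by (rule s(2)) (use rt r F_mem eq in auto)
  moreover have "r \<noteq> s" using r src.W_irrefl by metis
  ultimately have 1: "lt W' (F s) (F r)" using F_inj r sT by blast
  hence n1: "\<not> lt W' (F r) (F s)" using tgt.W_asym[OF F_mem[OF r(1)] F_mem[OF sT(1)]] eq by metis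
  have D: "lt R s r \<longleftrightarrow> ap d (ap pc t) = zero" "lt R r s \<longleftrightarrow> ap d (ap pc t) \<noteq> zero"
    using src.dir[OF sT(1) r(1)] src.dir[OF r(1) sT(1)] r sT src.W_asym[OF r(1) sT(1)] by auto
  have D': "lt R' (F s) (F r) \<longleftrightarrow> ap d' (ap pc' (F t)) = zero" "lt R' (F r) (F s) \<longleftrightarrow> ap d' (ap pc' (F t)) \<noteq> zero"
    using tgt.dir[OF F_mem[OF sT(1)] F_mem[OF r(1)]] tgt.dir[OF F_mem[OF r(1)] F_mem[OF sT(1)]] eq 1 n1 by auto
  show False using n D D' F_inc sT r by metis
qed

lemma stable_inc:
  assumes t: "stable t" and s: "s \<in> tail T W pc t" and r: "r \<in> tail T W pc t" and W: "lt W s r"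
  shows "lt W' (F s) (F r)"
proof -
  have tT: "t \<in> T" using t stable_def by blast
  have sT: "s \<in> T" "ap pc s = ap pc t" "r \<in> T" "ap pc r = ap pc t" using s r by auto
  have eq: "ap pc' (F r) = ap pc' (F t)" "ap pc' (F s) = ap pc' (F t)" using stableD[OF t] s r by blast+
  have "src.big s" unfolding src.big_def using sT W src.W_irrefl by metis
  hence "src.big t" using src.big_cong[OF tT sT(1,2)] by blast
  note d = stable_dir[OF t this]
  show ?thesis
  proof (cases "ap d (ap pc t) = zero")
    case True
    hence "lt R s r" using src.dir[OF sT(1,3)] sT W by simp
    hence "lt R' (F s) (F r)" using F_inc sT by blast
    thus ?thesis using tgt.dir[OF F_mem[OF sT(1)] F_mem[OF sT(3)]] eq d True by simp
  next
    case False
    hence "lt R r s" using src.dir[OF sT(3,1)] sT W by simp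
    hence "lt R' (F r) (F s)" using F_inc sT by blast
    thus ?thesis using tgt.dir[OF F_mem[OF sT(3)] F_mem[OF sT(1)]] eq d False by simp
  qed
qed

lemma stable_mem: "stable t \<Longrightarrow> s \<in> tail T W pc t \<Longrightarrow> F s \<in> piece T' pc' (F t)"
  using F_mem stableD by auto

lemma stable_ty:
  assumes t: "stable t" shows "otp (piece T pc t) W \<subseteq> otp (piece T' pc' (F t)) W'"
proof -
  have tT: "t \<in> T" using t stable_def by blast
  have "otp (tail T W pc t) W \<subseteq> otp (piece T' pc' (F t)) W'"
    by (rule otp_le[OF src.wo_tail[OF tT] tgt.wo_piece[OF F_mem[OF tT]] F_dfn])
      (use stable_mem[OF t] stable_inc[OF t] in blast)+
  thus ?thesis using src.indec[OF tT] by simp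
qed

lemma stable_bounded:
  assumes t: "stable t" and x: "x \<in> piece T' pc' (F t)"
    and b: "\<And>s. s \<in> tail T W pc t \<Longrightarrow> lt W' (F s) x"
  shows "otp (piece T pc t) W \<in> otp (piece T' pc' (F t)) W'"
proof -
  have tT: "t \<in> T" using t stable_def by blast
  have "otp (tail T W pc t) W \<in> otp (piece T' pc' (F t)) W'"
    by (rule otp_lt[OF src.wo_tail[OF tT] tgt.wo_piece[OF F_mem[OF tT]] F_dfn _ _ x])
      (use stable_mem[OF t] stable_inc[OF t] b in blast)+
  thus ?thesis using src.indec[OF tT] by simp
qed

lemma stable_cofinal:
  assumes t: "stable t" and e: "otp (piece T pc t) W = otp (piece T' pc' (F t)) W'"
    and x: "x \<in> piece T' pc' (F t)"
  obtains s where "s \<in> tail T W pc t" "\<not> lt W' (F s) x"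
  using stable_bounded[OF t x] e mem_irrefl by metis

lemma between:
  assumes "s \<in> T" "r \<in> T" "t \<in> T" "ap pc s \<in> ap pc r" "ap pc r \<in> ap pc t"
    and "ap pc' (F s) = ap pc' (F t)"
  shows "ap pc' (F r) = ap pc' (F t)"
proof -
  have "lt R' (F s) (F r)" "lt R' (F r) (F t)" using F_inc src.pc_less assms by blast+
  thus ?thesis using tgt.pc_le F_mem assms mem_asym by metis
qed

text \<open>When the piece of \<open>t\<close> and its target have equal type, the image of the tail
  is cofinal in the target. A second piece landing stably there lies on one side of the first. On
  the side of larger \<open>W'\<close> it would exceed the cofinal image. On the other side its
  image is bounded by \<open>F t\<close>, so its type is strictly smaller than that of the piece of
  \<open>t\<close>, contrary to the sorting condition.\<close>

lemma stable_fibre: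
  assumes t: "stable t" and s: "stable s" and e: "otp (piece T pc t) W = otp (piece T' pc' (F t)) W'"
    and same: "ap pc' (F s) = ap pc' (F t)"
  shows "ap pc s = ap pc t"
proof (rule ccontr)
  assume ne: "ap pc s \<noteq> ap pc t"
  have tT: "t \<in> T" and sT: "s \<in> T" using t s stable_def by blast+
  have pe: "piece T' pc' (F s) = piece T' pc' (F t)" using tgt.piece_cong same by blast
  have stl: "s \<in> tail T W pc s" "t \<in> tail T W pc t" using sT tT by auto
  have small: False if W: "\<And>x. x \<in> tail T W pc s \<Longrightarrow> lt W' (F x) (F t)" and le: "otp (piece T pc t) W \<subseteq> otp (piece T pc s) W"
  proof -
    have "otp (piece T pc s) W \<in> otp (piece T' pc' (F s)) W'"
      by (rule stable_bounded[OF s, of "F t"]) (use W F_mem[OF tT] same in auto)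
    hence "otp (piece T pc s) W \<in> otp (piece T pc s) W" using e pe le subsetD by metis
    thus False by simp
  qed
  \<comment> \<open>For a one-point piece the target would have the type of a single point but
    contain both \<open>F s\<close> and \<open>F t\<close>.\<close>
  have bg: "src.big t"
  proof (rule ccontr)
    assume nb: "\<not> src.big t"
    have u: "x = t" if "x \<in> tail T W pc t" for x using nb that unfolding src.big_def mem_tail by blast
    have "F s \<in> piece T' pc' (F t)" using F_mem sT same by simp
    then obtain x where "x \<in> tail T W pc t" "\<not> lt W' (F x) (F s)" using stable_cofinal[OF t e] by blast
    hence 1: "\<not> lt W' (F t) (F s)" using u by blast
    have "F s \<noteq> F t" using F_inj sT tT ne by blast
    hence 2: "lt W' (F s) (F t)" using tgt.W_total[OF F_mem[OF tT] F_mem[OF sT]] same 1 by blast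
    have "otp (tail T W pc t) W \<in> otp (piece T' pc' (F t)) W'"
    proof (rule otp_lt[OF src.wo_tail[OF tT] tgt.wo_piece[OF F_mem[OF tT]], of "\<lambda>x. F s" "F t"])
      show "lt W' (F s) (F s)" if "x \<in> tail T W pc t" "y \<in> tail T W pc t" "lt W x y" for x y
        using u[OF that(1)] u[OF that(2)] that(3) src.W_irrefl tT by blast
    qed (use 2 F_mem sT tT same in auto)
    thus False using src.indec[OF tT] e by simp
  qed
  note dt = stable_dir[OF t bg]
  have "F s \<in> piece T' pc' (F t)" using F_mem sT same by simp
  then obtain x where x: "x \<in> tail T W pc t" "\<not> lt W' (F x) (F s)" using stable_cofinal[OF t e] by blast
  have xT: "x \<in> T" "ap pc x = ap pc t" "ap pc' (F x) = ap pc' (F t)" using x(1) stableD[OF t x(1)] by auto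
  have sx: "y \<in> T" "ap pc y = ap pc s" "ap pc' (F y) = ap pc' (F t)" if "y \<in> tail T W pc s" for y
    using that stableD[OF s that] same by auto
  \<comment> \<open>Pieces between those of \<open>s\<close> and \<open>t\<close> are mapped into
    the same target piece by convexity, so the infinite ones have its direction. This is what the
    sorting conditions require before they compare \<open>s\<close> with \<open>t\<close>.\<close>
  have mid: "ap d (ap pc r) = zero \<longleftrightarrow> ap d (ap pc t) = zero" if r: "r \<in> T" "src.big r"
    and b: "ap pc s = ap pc r \<or> ap pc s \<in> ap pc r \<and> ap pc r \<in> ap pc t \<or> ap pc t \<in> ap pc r \<and> ap pc r \<in> ap pc s" for r
  proof (cases "ap pc s = ap pc r")
    case eq: True
    have "src.big s" using r(2) src.big_cong[OF r(1) sT eq] by blast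
    thus ?thesis using stable_dir[OF s] same dt eq by simp
  next
    case False
    hence b': "ap pc s \<in> ap pc r \<and> ap pc r \<in> ap pc t \<or> ap pc t \<in> ap pc r \<and> ap pc r \<in> ap pc s" using b by blast
    have *: "ap pc' (F y) = ap pc' (F t)" if y: "y \<in> T" "ap pc y = ap pc r" for y
      using b' between[OF sT y(1) tT _ _ same] between[OF tT y(1) sT _ _ same[symmetric]] unfolding y(2) same by blast
    hence "stable r" unfolding stable_def mem_tail using r(1) by metis
    thus ?thesis using stable_dir[of r] r * dt by simp
  qed
  show False
  proof (cases "ap d (ap pc t) = zero")
    case True
    show False
    proof (cases "ap pc t \<in> ap pc s")
      case lt: True
      have "lt R' (F x) (F s)" using F_inc src.pc_less xT sT lt by metis
      thus False using tgt.dir[OF F_mem[OF xT(1)] F_mem[OF sT]] xT same dt True x by simp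
    next
      case False
      hence lt: "ap pc s \<in> ap pc t" using src.pc_cases[OF sT tT] ne by blast
      show False
      proof (rule small)
        show "lt W' (F y) (F t)" if y: "y \<in> tail T W pc s" for y
        proof -
          have "lt R' (F y) (F t)" using F_inc src.pc_less sx[OF y] tT lt by metis
          thus ?thesis using tgt.dir[OF F_mem[OF sx(1)[OF y]] F_mem[OF tT]] sx[OF y] dt True by simp
        qed
        show "otp (piece T pc t) W \<subseteq> otp (piece T pc s) W"
          
        proof (rule src.sorted0[OF sT tT lt True bg])
          fix r assume "r \<in> T" "src.big r" "ap pc s \<in> ap pc r \<or> ap pc s = ap pc r" "ap pc r \<in> ap pc t"
          thus "ap d (ap pc r) = zero" using mid[of r] True by blast
        qed
      qed
    qed
  next
    case False
    show False
    proof (cases "ap pc s \<in> ap pc t")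
      case lt: True
      have "lt R' (F s) (F x)" using F_inc src.pc_less xT sT lt by metis
      thus False using tgt.dir[OF F_mem[OF sT] F_mem[OF xT(1)]] xT same dt False x by simp
    next
      case nlt: False
      hence lt: "ap pc t \<in> ap pc s" using src.pc_cases[OF sT tT] ne by blast
      show False
      proof (rule small)
        show "lt W' (F y) (F t)" if y: "y \<in> tail T W pc s" for y
        proof -
          have "lt R' (F t) (F y)" using F_inc src.pc_less sx[OF y] tT lt by metis
          thus ?thesis using tgt.dir[OF F_mem[OF tT] F_mem[OF sx(1)[OF y]]] sx[OF y] dt False by simp
        qed
        show "otp (piece T pc t) W \<subseteq> otp (piece T pc s) W"
          
        proof (rule src.sorted1[OF sT tT lt False bg])
          fix r assume "r \<in> T" "src.big r" "ap pc r \<in> ap pc s \<or> ap pc s = ap pc r" "ap pc t \<in> ap pc r"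
          thus "ap d (ap pc r) \<noteq> zero" using mid[of r] False by blast
        qed
      qed
    qed
  qed
qed

end

context wpieces
begin

lemma piecewise_mono:
  assumes G: "\<And>t. t \<in> T \<Longrightarrow> G t \<in> T" "\<And>t. t \<in> T \<Longrightarrow> ap pc (G t) = ap pc t"
    and inc: "\<And>s t. s \<in> T \<Longrightarrow> t \<in> T \<Longrightarrow> ap pc s = ap pc t \<Longrightarrow> lt W s t \<Longrightarrow> lt W (G s) (G t)"
    and st: "s \<in> T" "t \<in> T"
  shows "lt R s t \<longleftrightarrow> lt R (G s) (G t)"
proof -
  have 1: "lt R (G s) (G t)" if "s \<in> T" "t \<in> T" "lt R s t" for s t
  proof (cases "ap pc s = ap pc t")
    case True
    thus ?thesis
      using that dir[OF that(1,2) True] dir[of "G s" "G t"] G inc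
      by (cases "ap d (ap pc t) = zero") auto
  next
    case False
    hence "ap pc s \<in> ap pc t" using pc_le that by blast
    thus ?thesis using pc_less G that by metis
  qed
  show ?thesis
  proof
    assume "lt R (G s) (G t)"
    thus "lt R s t"
      using 1[OF st(2,1)] lin_total[OF lin_R st] lin_asym[OF lin_R G(1)[OF st(1)] G(1)[OF st(2)]]
        lin_irrefl[OF lin_R G(1)[OF st(1)]] by metis
  qed (rule 1[OF st])
qed

end

context piece_embedding
begin

text \<open>The induced map on pieces. Of two tails in one piece, one contains the other's starting
  point, so all stable points of \<open>Z\<close> agree on the target; taking the union over them
  avoids choosing one.\<close>

definition H :: "'a \<Rightarrow> 'a" where
  "H Z = setof (\<lambda>z. \<exists>t. stable t \<and> t \<in> Z \<and> z \<in> piece T' pc' (F t))"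

lemma dfnt_H: "dfnt f \<Longrightarrow> dfnt (\<lambda>v. H (f v))"
  by (rule dfnt_app1[of H]) (unfold H_def, intro dfn dfnp_stable dfnt_app1[OF F_dfn])

lemma H_eq:
  assumes t: "stable t"
  shows "H (piece T pc t) = piece T' pc' (F t)"
proof -
  have tT: "t \<in> T" using t stable_def by blast
  have same: "ap pc' (F s) = ap pc' (F t)" if "stable s" "s \<in> piece T pc t" for s
  proof -
    have "s \<in> T" "ap pc s = ap pc t" using that by auto
    hence "s \<in> tail T W pc t \<or> t \<in> tail T W pc s" using src.tail_or tT by blast
    thus ?thesis using stableD t that(1) by metis
  qed
  have tp: "t \<in> piece T pc t" using tT by simp
  have iff: "(\<exists>s. stable s \<and> s \<in> piece T pc t \<and> z \<in> piece T' pc' (F s)) \<longleftrightarrow> z \<in> piece T' pc' (F t)" for z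
    using same tgt.piece_cong t tp by metis
  have "z \<in> H (piece T pc t) \<longleftrightarrow> z \<in> piece T' pc' (F t)" for z
    unfolding H_def by (subst mem_setof) (use iff in blast)+
  thus ?thesis by (rule mext)
qed

lemma pset_stable:
  assumes "Z \<in> src.pset"
  obtains t where "stable t" "Z = piece T pc t" "H Z = piece T' pc' (F t)"
proof -
  obtain t where t: "t \<in> T" "Z = piece T pc t" using assms src.mem_pset by blast
  obtain t0 where t0: "stable t0" "ap pc t0 = ap pc t" using stable_ex[OF t(1)] by blast
  have "Z = piece T pc t0" using src.piece_cong[OF t0(2)] t by simp
  thus ?thesis using that t0 H_eq by blast
qed

lemma H_mem: "Z \<in> src.pset \<Longrightarrow> H Z \<in> tgt.pset"
  using pset_stable F_mem tgt.mem_pset stable_def by metis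

lemma H_le: "Z \<in> src.pset \<Longrightarrow> otp Z W \<subseteq> otp (H Z) W'"
  using pset_stable stable_ty by metis

lemma H_fibre:
  assumes Z: "Z \<in> src.pset" and Y: "Y \<in> src.pset" and e: "otp Z W = otp (H Z) W'" and h: "H Y = H Z"
  shows "Y = Z"
proof -
  obtain t where t: "stable t" "Z = piece T pc t" "H Z = piece T' pc' (F t)" using pset_stable[OF Z] .
  obtain s where s: "stable s" "Y = piece T pc s" "H Y = piece T' pc' (F s)" using pset_stable[OF Y] .
  have "F s \<in> piece T' pc' (F t)" using h s t F_mem[of s] unfolding stable_def
    by (metis mem_piece)
  hence "ap pc' (F s) = ap pc' (F t)" by simp
  hence "ap pc s = ap pc t" using stable_fibre[OF t(1) s(1)] e t by simp
  thus ?thesis using src.piece_cong s t by metis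
qed

end

section \<open>Self-embeddings fill every piece\<close>

context pieces
begin

lemma pset_ord: "Z \<in> pset \<Longrightarrow> ordinal (otp Z W)"
  using mem_pset ty_ord by metis

text \<open>By \<open>level_preserved\<close> the induced map on the finitely many pieces preserves
  types; then \<open>H_fibre\<close> makes it injective, hence surjective. So the piece of
  \<open>t\<close> receives a tail of some piece of the same type, and this image lies in
  \<open>U\<close>.\<close>

lemma tight:
  assumes F: "dfn1 F" "\<And>t. t \<in> T \<Longrightarrow> F t \<in> T"
    and inc: "\<And>s t. s \<in> T \<Longrightarrow> t \<in> T \<Longrightarrow> lt R s t \<Longrightarrow> lt R (F s) (F t)"
    and U: "\<And>t. t \<in> T \<Longrightarrow> F t \<in> U" "U \<subseteq> T" and t: "t \<in> T"
  shows "otp (sep U (\<lambda>u. ap pc u = ap pc t)) W = otp (piece T pc t) W"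
proof -
  interpret e: piece_embedding mem T R W pc N d T R W pc N d F
    by unfold_locales (use F inc in auto)
  have H: "dfn1 (e.H)" by (intro e.dfnt_H dfn)
  have lev: "otp (e.H Z) W = otp Z W" if "Z \<in> pset" for Z
    by (rule level_preserved[OF fin_pset H, of "\<lambda>Z. otp Z W"])
      (use that e.H_mem pset_ord e.H_le e.H_fibre in \<open>simp_all\<close>)
  have Zt: "piece T pc t \<in> pset" using mem_pset t by blast
  have "\<exists>Z. Z \<in> pset \<and> e.H Z = piece T pc t"
    by (rule fin_inj_surj[OF fin_pset H e.H_mem _ Zt], assumption)
       (rule e.H_fibre; simp add: lev)
  then obtain Z where Z: "Z \<in> pset" "e.H Z = piece T pc t" by blast
  obtain s where s: "e.stable s" "Z = piece T pc s" "e.H Z = piece T pc (F s)" using e.pset_stable[OF Z(1)] .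
  have sT: "s \<in> T" using s e.stable_def by blast
  have pF: "piece T pc (F s) = piece T pc t" using s Z by simp
  let ?U = "sep U (\<lambda>u. ap pc u = ap pc t)"
  have Usub: "?U \<subseteq> piece T pc t" using U(2) by (auto simp: subset_def)
  have woU: "wo ?U W" using wo_subset[OF wo_piece[OF t] Usub] .
  have "otp (tail T W pc s) W \<subseteq> otp ?U W"
  proof (rule otp_le[OF wo_tail[OF sT] woU F(1)])
    fix x assume x: "x \<in> tail T W pc s"
    hence "F x \<in> piece T pc t" using e.stable_mem[OF s(1)] pF by metis
    thus "F x \<in> ?U" using U(1)[of x] x by simp
  qed (use e.stable_inc[OF s(1)] in blast)
  hence "otp Z W \<subseteq> otp ?U W" using indec[OF sT] s by simp
  hence "otp (piece T pc t) W \<subseteq> otp ?U W" using lev[OF Z(1)] Z by simp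
  thus ?thesis using otp_mono[OF wo_piece[OF t] Usub] subset_antisym by blast
qed

end

text \<open>One partition of \<open>T\<close> with two numberings: \<open>pc\<close> follows
  \<open>S\<close>, and \<open>wp\<close> follows \<open>W\<close>, for which no piece is reversed.
  Both orders thus satisfy \<open>pieces\<close>, and the results on self-embeddings apply to
  each.\<close>

locale beta_structure = zf_model mem + s: pieces mem T S W pc N d + w: pieces mem T W W wp M e
  for mem :: "'a \<Rightarrow> 'a \<Rightarrow> bool"  (infix "\<in>" 50) and T S W pc N d wp M e +
  assumes pc_wp: "s \<in> T \<Longrightarrow> t \<in> T \<Longrightarrow> ap pc s = ap pc t \<longleftrightarrow> ap wp s = ap wp t"
    and e_zero: "t \<in> T \<Longrightarrow> ap e (ap wp t) = zero"
    and wo_W: "wo T W"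
begin

lemma piece_eq: "t \<in> T \<Longrightarrow> piece T wp t = piece T pc t"
  by (rule mext) (use pc_wp in auto)

lemma pset_eq: "w.pset = s.pset"
  by (rule mext) (auto simp: w.mem_pset s.mem_pset piece_eq)

definition part :: "'a \<Rightarrow> 'a \<Rightarrow> 'a" where
  "part U t = sep U (\<lambda>u. ap pc u = ap pc t)"

lemma mem_part [simp]: "u \<in> part U t \<longleftrightarrow> u \<in> U \<and> ap pc u = ap pc t"
  unfolding part_def by simp

lemma dfnt_part [simp]: "dfnt f \<Longrightarrow> dfnt g \<Longrightarrow> dfnt (\<lambda>v. part (f v) (g v))"
  by (rule dfnt_app2[of part]) (unfold part_def, intro dfn)

definition full :: "'a \<Rightarrow> bool" where
  "full U \<longleftrightarrow> U \<subseteq> T \<and> (\<forall>t. t \<in> T \<longrightarrow> otp (part U t) W = otp (piece T pc t) W)"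

text \<open>Rank matching inside each piece: the canonical map onto \<open>U\<close>, determined by
  \<open>U\<close> alone, so that no isomorphism has to be chosen.\<close>

definition glue :: "'a \<Rightarrow> 'a \<Rightarrow> 'a" where
  "glue U t = invf (part U t) (rk (part U t) W) (rk (piece T pc t) W t)"

lemma dfnt_glue [simp]: "dfnt f \<Longrightarrow> dfnt (\<lambda>v. glue U (f v))"
  by (rule dfnt_app1[of "glue U"]) (unfold glue_def, intro dfn dfnt_part)

text \<open>Both \<open>S\<close> and \<open>W\<close> are determined by the order of the pieces and
  by \<open>W\<close> inside them, and rank matching preserves these data; hence one map is an
  isomorphism for both orders. It moves points only upwards in \<open>W\<close>, because ranks in a
  subset are no larger than in the whole piece.\<close>

lemma glue:
  assumes U: "full U"
  shows glue_mem: "\<And>t. t \<in> T \<Longrightarrow> glue U t \<in> U"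
    and glue_pc: "\<And>t. t \<in> T \<Longrightarrow> ap pc (glue U t) = ap pc t"
    and glue_T: "\<And>t. t \<in> T \<Longrightarrow> glue U t \<in> T"
    and glue_W: "\<And>s t. s \<in> T \<Longrightarrow> t \<in> T \<Longrightarrow> lt W s t \<longleftrightarrow> lt W (glue U s) (glue U t)"
    and glue_S: "\<And>s t. s \<in> T \<Longrightarrow> t \<in> T \<Longrightarrow> lt S s t \<longleftrightarrow> lt S (glue U s) (glue U t)"
    and glue_bij: "bij_betw (glue U) (el T) (el U)"
    and glue_ge: "\<And>t. t \<in> T \<Longrightarrow> glue U t = t \<or> lt W t (glue U t)"
proof -
  have UT: "U \<subseteq> T" using U full_def by blast
  have psub: "part U t \<subseteq> piece T pc t" for t using UT by (auto simp: subset_def)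
  have wop: "wo (part U t) W" if "t \<in> T" for t using wo_subset[OF s.wo_piece[OF that] psub] .
  have rkb: "bij_betw (rk (part U t) W) (el (part U t)) (el (otp (part U t) W))" if "t \<in> T" for t
    using rk_bij[OF wop[OF that]] .
  have tp: "t \<in> piece T pc t" if "t \<in> T" for t using that by simp
  have rm: "rk (piece T pc t) W t \<in> otp (part U t) W" if "t \<in> T" for t
    using rk_mem[OF s.wo_piece[OF that] tp[OF that]] U that unfolding full_def by simp
  have gp: "glue U t \<in> part U t" if "t \<in> T" for t
    unfolding glue_def using bij_betw_invf(1)[OF rkb[OF that]] rm[OF that] unfolding bij_el_iff by blast
  have gr: "rk (part U t) W (glue U t) = rk (piece T pc t) W t" if "t \<in> T" for t
    unfolding glue_def using bij_betw_invf(2)[OF rkb[OF that] rm[OF that]] .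
  show m: "\<And>t. t \<in> T \<Longrightarrow> glue U t \<in> U" using gp by simp
  show p: "\<And>t. t \<in> T \<Longrightarrow> ap pc (glue U t) = ap pc t" using gp by simp
  show gT: "\<And>t. t \<in> T \<Longrightarrow> glue U t \<in> T" using m UT subsetD by blast
  have part_cong: "part U s = part U t" "piece T pc s = piece T pc t" if "ap pc s = ap pc t" for s t
    unfolding part_def piece_def using that by simp_all
  have inc: "lt W s t \<longleftrightarrow> lt W (glue U s) (glue U t)"
    if st: "s \<in> T" "t \<in> T" "ap pc s = ap pc t" for s t
  proof -
    have "lt W s t \<longleftrightarrow> rk (piece T pc t) W s \<in> rk (piece T pc t) W t"
      by (rule rk_iff[OF s.wo_piece[OF st(2)]]) (use st in auto)
    also have "\<dots> \<longleftrightarrow> rk (part U t) W (glue U s) \<in> rk (part U t) W (glue U t)"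
      using gr[OF st(1)] gr[OF st(2)] part_cong[OF st(3)] by simp
    also have "\<dots> \<longleftrightarrow> lt W (glue U s) (glue U t)"
      using rk_iff[OF wop[OF st(2)]] gp[OF st(1)] gp[OF st(2)] part_cong[OF st(3)] by metis
    finally show ?thesis .
  qed
  have pw: "ap wp (glue U t) = ap wp t" if "t \<in> T" for t using p[OF that] pc_wp gT that by blast
  show "\<And>s t. s \<in> T \<Longrightarrow> t \<in> T \<Longrightarrow> lt W s t \<longleftrightarrow> lt W (glue U s) (glue U t)"
    by (rule w.piecewise_mono[of "glue U"]) (use gT pw inc pc_wp in blast)+
  thus "\<And>s t. s \<in> T \<Longrightarrow> t \<in> T \<Longrightarrow> lt S s t \<longleftrightarrow> lt S (glue U s) (glue U t)"
    by (intro s.piecewise_mono[of "glue U"]) (use gT p inc in blast)+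
  show "bij_betw (glue U) (el T) (el U)" unfolding bij_el_iff
  proof (intro conjI allI impI)
    fix u assume u: "u \<in> U"
    hence uT: "u \<in> T" using UT subsetD by blast
    have up: "u \<in> part U u" using u by simp
    have "rk (part U u) W u \<in> otp (piece T pc u) W"
      using rk_mem[OF wop[OF uT] up] U uT unfolding full_def by simp
    then obtain t where t: "t \<in> piece T pc u" "rk (piece T pc u) W t = rk (part U u) W u"
      using rk_surj[OF s.wo_piece[OF uT]] by metis
    have tT: "t \<in> T" "ap pc t = ap pc u" using t by auto
    have "glue U t = u"
      using rk_inj[OF wop[OF uT]] gr[OF tT(1)] gp[OF tT(1)] part_cong[OF tT(2)] t(2) up by metis
    moreover have "t' = t" if "t' \<in> T" "glue U t' = u" for t'
    proof -
      have e: "ap pc t' = ap pc u" using p[OF that(1)] that by simp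
      hence "rk (piece T pc u) W t' = rk (piece T pc u) W t"
        using gr[OF that(1)] that(2) t(2) part_cong[OF e] by metis
      moreover have "t' \<in> piece T pc u" using e that by simp
      ultimately show ?thesis using rk_inj[OF s.wo_piece[OF uT]] t(1) by blast
    qed
    ultimately show "\<exists>!t. t \<in> T \<and> glue U t = u" using tT by blast
  qed (rule m)
  show "\<And>t. t \<in> T \<Longrightarrow> glue U t = t \<or> lt W t (glue U t)"
  proof -
    fix t assume t: "t \<in> T"
    have g': "glue U t \<in> piece T pc t" using gp[OF t] psub subsetD by blast
    have "rk (part U t) W (glue U t) \<subseteq> rk (piece T pc t) W (glue U t)"
      by (rule rk_le[OF wop[OF t] s.wo_piece[OF t], of "\<lambda>x. x"]) (use subsetD[OF UT] gp[OF t] in auto)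
    hence "rk (piece T pc t) W t \<subseteq> rk (piece T pc t) W (glue U t)" using gr[OF t] by simp
    hence "\<not> lt W (glue U t) t"
      using rk_iff[OF s.wo_piece[OF t] g' tp[OF t]] mem_irrefl subsetD by blast
    thus "glue U t = t \<or> lt W t (glue U t)" using s.W_total[OF t gT[OF t] p[OF t]] by blast
  qed
qed

lemma full_iso_S: "full U \<Longrightarrow> isomorphic U S T S"
  using isomorphic_sym[OF isomorphicI[of "glue U" T U S S]] glue_bij glue_S by simp

text \<open>An isomorphism of \<open>T\<close> onto \<open>U\<close> is a self-embedding of
  \<open>T\<close>, so \<open>tight\<close> applies, here with the numbering of \<open>W\<close>.
  Together with \<open>glue\<close> and \<open>iso_S_full\<close> this identifies the
  \<open>W\<close>-copies and the \<open>S\<close>-copies of \<open>T\<close> inside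
  \<open>T\<close>.\<close>

lemma iso_W_full:
  assumes UT: "U \<subseteq> T" and i: "isomorphic U W T W"
  shows "full U"
proof -
  obtain f where f: "isoby f T W U W" using isomorphic_sym[OF i] isomorphic_iff by blast
  have fU: "\<And>t. t \<in> T \<Longrightarrow> ap f t \<in> U" using isoby_memD[OF f] .
  have "otp (sep U (\<lambda>u. ap wp u = ap wp t)) W = otp (piece T wp t) W" if t: "t \<in> T" for t
    by (rule w.tight[of "ap f", OF _ _ _ fU UT t]) (use f fU UT subsetD t in \<open>auto simp: isoby_def\<close>)
  moreover have "sep U (\<lambda>u. ap wp u = ap wp t) = part U t" if t: "t \<in> T" for t
    by (rule mext) (use pc_wp[OF _ t] UT subsetD in auto)
  ultimately show ?thesis unfolding full_def using UT piece_eq by metis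
qed

lemma iso_S_full:
  assumes UT: "U \<subseteq> T" and i: "isomorphic U S T S"
  shows "full U"
proof -
  obtain f where f: "isoby f T S U S" using isomorphic_sym[OF i] isomorphic_iff by blast
  have fU: "\<And>t. t \<in> T \<Longrightarrow> ap f t \<in> U" using isoby_memD[OF f] .
  have "otp (sep U (\<lambda>u. ap pc u = ap pc t)) W = otp (piece T pc t) W" if t: "t \<in> T" for t
    by (rule s.tight[of "ap f", OF _ _ _ fU UT t]) (use f fU UT subsetD t in \<open>auto simp: isoby_def\<close>)
  thus ?thesis unfolding full_def part_def using UT by blast
qed

end

section \<open>Independence of the type of \<open>W\<close> from the decomposition\<close>

context zf_model
begin

text \<open>If the type of \<open>W1\<close> were smaller, matching ranks would embed
  \<open>W1\<close> onto a proper initial segment of \<open>W2\<close>. Three maps on pieces are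
  combined: \<open>a\<close> and \<open>b\<close> from the identity of \<open>T\<close> between the
  two decompositions, and \<open>c\<close> from this embedding. Comparing types shows that
  \<open>b\<close> is injective and type-preserving, and that \<open>b\<close> after
  \<open>c\<close> is a type-preserving permutation of the pieces of the first structure. So the
  piece containing the bound \<open>u\<close> is the target under \<open>c\<close> of a piece of
  equal type, whose image is cofinal there; this is impossible below \<open>u\<close>.\<close>

lemma beta_structure_not_less:
  assumes b1: "beta_structure mem T S W1 pc1 N1 d1 wp1 M1 e1"
    and b2: "beta_structure mem T S W2 pc2 N2 d2 wp2 M2 e2"
  shows "\<not> otp T W1 \<in> otp T W2"
proof
  assume lt: "otp T W1 \<in> otp T W2"
  interpret b1: beta_structure mem T S W1 pc1 N1 d1 wp1 M1 e1 by (rule b1)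
  interpret b2: beta_structure mem T S W2 pc2 N2 d2 wp2 M2 e2 by (rule b2)
  interpret a: piece_embedding mem T S W1 pc1 N1 d1 T S W2 pc2 N2 d2 "\<lambda>x. x" by unfold_locales auto
  interpret b: piece_embedding mem T S W2 pc2 N2 d2 T S W1 pc1 N1 d1 "\<lambda>x. x" by unfold_locales auto
  have aH: "dfn1 (a.H)" and bH: "dfn1 (b.H)" by (intro a.dfnt_H b.dfnt_H dfn)+
  have ab: "dfnt (\<lambda>v. a.H (b.H (v 0)))" by (intro a.dfnt_H bH)
  have lev: "otp (a.H (b.H Y)) W2 = otp Y W2" if "Y \<in> b2.s.pset" for Y
  proof (rule level_preserved[OF b2.s.fin_pset ab, of "\<lambda>Z. otp Z W2"])
    fix Z assume Z: "Z \<in> b2.s.pset"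
    show "a.H (b.H Z) \<in> b2.s.pset" using Z a.H_mem b.H_mem by blast
    show "ordinal (otp Z W2)" using b2.s.pset_ord[OF Z] .
    show "otp Z W2 \<subseteq> otp (a.H (b.H Z)) W2" using b.H_le[OF Z] a.H_le[OF b.H_mem[OF Z]] subset_trans by blast
    fix Y assume Y: "Y \<in> b2.s.pset" and e: "otp Z W2 = otp (a.H (b.H Z)) W2" "a.H (b.H Y) = a.H (b.H Z)"
    have e1: "otp Z W2 = otp (b.H Z) W1" "otp (b.H Z) W1 = otp (a.H (b.H Z)) W2"
      using b.H_le[OF Z] a.H_le[OF b.H_mem[OF Z]] e(1) subset_antisym by metis+
    have "b.H Y = b.H Z" by (rule a.H_fibre[OF b.H_mem[OF Z] b.H_mem[OF Y] e1(2) e(2)])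
    thus "Y = Z" using b.H_fibre[OF Z Y e1(1)] by blast
  qed (use that in simp_all)
  have bty: "otp (b.H Y) W1 = otp Y W2" if "Y \<in> b2.s.pset" for Y
    using b.H_le[OF that] a.H_le[OF b.H_mem[OF that]] lev[OF that] subset_antisym by metis
  have binj: "Y = Z" if "Y \<in> b2.s.pset" "Z \<in> b2.s.pset" "b.H Y = b.H Z" for Y Z
    using b.H_fibre[OF that(2,1)] bty[OF that(2)] that(3) by simp
  define p where "p t = invf T (rk T W2) (rk T W1 t)" for t
  have pD: "dfn1 p" unfolding p_def by (intro dfn)
  note r1 = rk[OF b1.wo_W] and r2 = rk[OF b2.wo_W]
  have rin: "rk T W1 t \<in> otp T W2" if "t \<in> T" for t
    using ord_trans[OF otp(1)[OF b2.wo_W] r1(3)[OF that] lt] .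
  have prk: "rk T W2 (p t) = rk T W1 t" if "t \<in> T" for t
    unfolding p_def using bij_betw_invf(2)[OF r2(1) rin[OF that]] .
  have pT: "p t \<in> T" if "t \<in> T" for t
    unfolding p_def using bij_betw_invf(1)[OF r2(1)] rin[OF that] unfolding bij_el_iff by blast
  have pinc: "lt W2 (p s) (p t)" if "s \<in> T" "t \<in> T" "lt W1 s t" for s t
    using r2(2)[OF pT[OF that(1)] pT[OF that(2)]] r1(2)[OF that(1,2)] that prk by simp
  interpret c: piece_embedding mem T W1 W1 wp1 M1 e1 T W2 W2 wp2 M2 e2 p
    by unfold_locales (use pD pT pinc in auto)
  note ps1 = b1.pset_eq and ps2 = b2.pset_eq
  have cm: "c.H Z \<in> b2.s.pset" if "Z \<in> b1.s.pset" for Z using c.H_mem that ps1 ps2 by simp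
  have bc: "dfnt (\<lambda>v. b.H (c.H (v 0)))" by (intro b.dfnt_H c.dfnt_H dfn)
  have km: "b.H (c.H Z) \<in> b1.s.pset" if "Z \<in> b1.s.pset" for Z using b.H_mem cm that by blast
  have cle: "otp Z W1 \<subseteq> otp (c.H Z) W2" if "Z \<in> b1.s.pset" for Z using c.H_le that ps1 by simp
  have fib: "Y = Z" if "Z \<in> b1.s.pset" "Y \<in> b1.s.pset" "otp Z W1 = otp (b.H (c.H Z)) W1"
    "b.H (c.H Y) = b.H (c.H Z)" for Y Z
    using c.H_fibre[of Z Y] binj[OF cm[OF that(2)] cm[OF that(1)] that(4)] bty[OF cm[OF that(1)]] that ps1 by simp
  have lev1: "otp (b.H (c.H Z)) W1 = otp Z W1" if "Z \<in> b1.s.pset" for Z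
  proof (rule level_preserved[OF b1.s.fin_pset bc, of "\<lambda>Z. otp Z W1"])
    fix Z assume Z: "Z \<in> b1.s.pset"
    show "b.H (c.H Z) \<in> b1.s.pset" by (rule km[OF Z])
    show "ordinal (otp Z W1)" using b1.s.pset_ord[OF Z] .
    show "otp Z W1 \<subseteq> otp (b.H (c.H Z)) W1" using cle[OF Z] bty[OF cm[OF Z]] by simp
    show "Y = Z" if "Y \<in> b1.s.pset" "otp Z W1 = otp (b.H (c.H Z)) W1" "b.H (c.H Y) = b.H (c.H Z)" for Y
      by (rule fib[OF Z that])
  qed (use that in simp_all)
  obtain u where u: "u \<in> T" "rk T W2 u = otp T W1" using r2(5)[OF lt] by blast
  have below: "lt W2 (p t) u" if "t \<in> T" for t
    using r2(2)[OF pT[OF that] u(1)] u(2) prk[OF that] r1(3)[OF that] by simp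
  define Y where "Y = piece T pc2 u"
  have Y: "Y \<in> b2.s.pset" unfolding Y_def using b2.s.mem_pset u by blast
  have "\<exists>Z. Z \<in> b1.s.pset \<and> b.H (c.H Z) = b.H Y"
  proof (rule fin_inj_surj[OF b1.s.fin_pset bc km _ b.H_mem[OF Y]])
    show "Y = Z" if "Y \<in> b1.s.pset" "Z \<in> b1.s.pset" "b.H (c.H Y) = b.H (c.H Z)" for Y Z
      by (rule fib[OF that(2,1) lev1[OF that(2), symmetric] that(3)])
  qed
  then obtain Z where Z: "Z \<in> b1.s.pset" "c.H Z = Y" using binj cm Y by metis
  have Zw: "Z \<in> b1.w.pset" using Z ps1 by simp
  obtain t where t: "c.stable t" "Z = piece T wp1 t" "c.H Z = piece T wp2 (p t)" using c.pset_stable[OF Zw] .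
  have eq: "otp (piece T wp1 t) W1 = otp (piece T wp2 (p t)) W2"
    using lev1[OF Z(1)] bty[OF cm[OF Z(1)]] t by simp
  have "u \<in> piece T pc2 u" using u(1) by simp
  hence "u \<in> piece T wp2 (p t)" using t(3) Z(2) Y_def by metis
  then obtain s where "s \<in> tail T W1 wp1 t" "\<not> lt W2 (p s) u" using c.stable_cofinal[OF t(1) eq] by blast
  thus False using below by simp
qed

lemma beta_structure_unique:
  assumes "beta_structure mem T S W1 pc1 N1 d1 wp1 M1 e1" "beta_structure mem T S W2 pc2 N2 d2 wp2 M2 e2"
  shows "otp T W1 = otp T W2"
  using beta_structure_not_less[OF assms] beta_structure_not_less[OF assms(2,1)]
    ord_linear[OF otp(1) otp(1)] assms[THEN beta_structure.wo_W] by blast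

lemma rk_iso:
  assumes A: "wo A R" and G: "dfn1 G" and b: "bij_betw G (el A) (el B)"
    and o: "\<And>x y. x \<in> A \<Longrightarrow> y \<in> A \<Longrightarrow> lt R x y \<longleftrightarrow> lt S (G x) (G y)" and x: "x \<in> A"
  shows "rk B S (G x) = rk A R x"
proof -
  have woB: "wo B S" by (rule wo_iso[OF isomorphic_sym[OF isomorphicI[OF G b o]] A])
  have "isomorphic (pred A R x) R (pred B S (G x)) S"
  proof (rule isomorphicI[OF G])
    show "bij_betw G (el (pred A R x)) (el (pred B S (G x)))"
      using b o x unfolding bij_el_iff mem_pred by metis
    show "lt R y z \<longleftrightarrow> lt S (G y) (G z)" if "y \<in> pred A R x" "z \<in> pred A R x" for y z
      using o that by simp
  qed
  moreover have "wo (pred A R x) R" "wo (pred B S (G x)) S"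
    by (rule wo_subset[OF A], simp add: subset_def, rule wo_subset[OF woB], simp add: subset_def)
  ultimately show ?thesis unfolding rk_def using otp_iso_iff by metis
qed

lemma inc_iff:
  assumes "lin A R" "lin B S" "\<And>x. x \<in> A \<Longrightarrow> G x \<in> B"
    and inc: "\<And>x y. x \<in> A \<Longrightarrow> y \<in> A \<Longrightarrow> lt R x y \<Longrightarrow> lt S (G x) (G y)"
    and "x \<in> A" "y \<in> A"
  shows "lt R x y \<longleftrightarrow> lt S (G x) (G y)" and "G x = G y \<Longrightarrow> x = y"
proof -
  note t = lin_total[OF assms(1,5,6)]
  have n: "\<not> lt S (G x) (G x)" "lt S (G y) (G x) \<Longrightarrow> \<not> lt S (G x) (G y)"
    using lin_irrefl[OF assms(2)] lin_asym[OF assms(2)] assms by blast+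
  show "lt R x y \<longleftrightarrow> lt S (G x) (G y)" using t n inc assms(5,6) by metis
  show "G x = G y \<Longrightarrow> x = y" using t n inc assms(5,6) by metis
qed

lemma bij_img:
  assumes "dfn1 G" "\<And>x y. x \<in> A \<Longrightarrow> y \<in> A \<Longrightarrow> G x = G y \<Longrightarrow> x = y"
  shows "bij_betw G (el A) (el (img G A))"
  unfolding bij_el_iff mem_img[OF assms(1)] using assms(2) by metis

lemma inc_iso:
  assumes "lin A R" "lin B S" "dfn1 G" "\<And>x. x \<in> A \<Longrightarrow> G x \<in> B"
    and "\<And>x y. x \<in> A \<Longrightarrow> y \<in> A \<Longrightarrow> lt R x y \<Longrightarrow> lt S (G x) (G y)"
  shows "isomorphic A R (img G A) S"
proof (rule isomorphicI[OF assms(3)])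
  show "bij_betw G (el A) (el (img G A))"
    by (rule bij_img[OF assms(3)]) (rule inc_iff(2)[OF assms(1,2,4,5)])
  show "\<And>x y. x \<in> A \<Longrightarrow> y \<in> A \<Longrightarrow> lt R x y \<longleftrightarrow> lt S (G x) (G y)"
    by (rule inc_iff(1)[OF assms(1,2,4,5)])
qed

subsection \<open>The lexicographic order\<close>

lemma mem_binary_seqs [simp]: "x \<in> binary_seqs a \<longleftrightarrow> maps x a two"
proof -
  have "x \<in> sep (pow (times a two)) (\<lambda>x. maps x a two) \<longleftrightarrow> maps x a two" for x
  proof -
    have "x \<subseteq> times a two" if "maps x a two"
      using that mem_fun_on[of x a] unfolding maps_iff subset_def mem_times by metis
    thus ?thesis by (subst mem_sep) (simp, auto)
  qed
  thus ?thesis unfolding binary_seqs_def by (intro mem_setof) blast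
qed

definition dl :: "'a \<Rightarrow> 'a \<Rightarrow> 'a \<Rightarrow> 'a" where
  "dl a x y = setof (\<lambda>z. \<exists>c. c \<in> a \<and> ap x c \<noteq> ap y c \<and> (\<forall>b. b \<in> c \<longrightarrow> ap x b = ap y b) \<and> z \<in> c)"

lemma dfnt_dl [dfn, simp]: "dfnt a \<Longrightarrow> dfnt x \<Longrightarrow> dfnt y \<Longrightarrow> dfnt (\<lambda>v. dl (a v) (x v) (y v))"
  by (rule dfnt_app3[of dl]) (unfold dl_def, intro dfn)

lemma dl_eqI:
  assumes a: "ordinal a" and c: "c \<in> a" "ap x c \<noteq> ap y c" "\<And>b. b \<in> c \<Longrightarrow> ap x b = ap y b"
  shows "dl a x y = c"
proof -
  have u: "c' = c" if "c' \<in> a" "ap x c' \<noteq> ap y c'" "\<forall>b. b \<in> c' \<longrightarrow> ap x b = ap y b" for c'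
    using ord_linear[OF ord_mem[OF a c(1)] ord_mem[OF a that(1)]] that c by blast
  have "(\<exists>c. c \<in> a \<and> ap x c \<noteq> ap y c \<and> (\<forall>b. b \<in> c \<longrightarrow> ap x b = ap y b) \<and> z \<in> c) \<longleftrightarrow> z \<in> c" for z
    using u c by blast
  hence "z \<in> dl a x y \<longleftrightarrow> z \<in> c" for z unfolding dl_def by (subst mem_setof) blast+
  thus ?thesis by (rule mext)
qed

lemma dl:
  assumes a: "ordinal a" and x: "maps x a two" and y: "maps y a two" and ne: "x \<noteq> y"
  shows "dl a x y \<in> a" "ap x (dl a x y) \<noteq> ap y (dl a x y)" "\<And>b. b \<in> dl a x y \<Longrightarrow> ap x b = ap y b"
proof -
  obtain c where c: "c \<in> a" "ap x c \<noteq> ap y c"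
    using fun_on_ext[of x a y] x y ne unfolding maps_iff by blast
  have "dfnp (\<lambda>v. v 0 \<in> a \<and> ap x (v 0) \<noteq> ap y (v 0))" by simp
  then obtain m where "m \<in> a \<and> ap x m \<noteq> ap y m" "\<And>b. b \<in> m \<Longrightarrow> \<not> (b \<in> a \<and> ap x b \<noteq> ap y b)"
    using ord_least[OF ord_mem[OF a c(1)], of "\<lambda>c. c \<in> a \<and> ap x c \<noteq> ap y c"] c by blast
  hence m: "m \<in> a" "ap x m \<noteq> ap y m" "\<And>b. b \<in> m \<Longrightarrow> \<not> (b \<in> a \<and> ap x b \<noteq> ap y b)" by blast+
  have m3: "ap x b = ap y b" if "b \<in> m" for b using m(3)[OF that] ord_trans[OF a that m(1)] by blast
  have "dl a x y = m" by (rule dl_eqI[OF a m(1,2) m3])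
  thus "dl a x y \<in> a" "ap x (dl a x y) \<noteq> ap y (dl a x y)" "\<And>b. b \<in> dl a x y \<Longrightarrow> ap x b = ap y b"
    using m m3 by simp_all
qed

lemma mem_lex:
  assumes a: "ordinal a"
  shows "lt (lex a) x y \<longleftrightarrow> maps x a two \<and> maps y a two \<and>
    (\<exists>c. c \<in> a \<and> ap x c = zero \<and> ap y c = one \<and> (\<forall>b. b \<in> c \<longrightarrow> ap x b = ap y b))"
proof -
  let ?L = "\<lambda>x y. \<exists>d. d \<in> a \<and> app x d \<in> app y d \<and> (\<forall>e. e \<in> d \<longrightarrow> app x e = app y e)"
  let ?L' = "\<lambda>x y. \<exists>d. d \<in> a \<and> ap x d \<in> ap y d \<and> (\<forall>e. e \<in> d \<longrightarrow> ap x e = ap y e)"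
  have L: "?L x y \<longleftrightarrow> ?L' x y" if "maps x a two" "maps y a two" for x y
  proof -
    have *: "app x d = ap x d" "app y d = ap y d" if "d \<in> a" for d
      using \<open>maps x a two\<close> \<open>maps y a two\<close> fun_on_ap(2) that unfolding maps_def by blast+
    show ?thesis using * ord_trans[OF a] by metis
  qed
  have B: "x \<in> binary_seqs a \<and> y \<in> binary_seqs a \<and> p = opair x y \<and> ?L x y \<longleftrightarrow>
     x \<in> binary_seqs a \<and> y \<in> binary_seqs a \<and> p = opair x y \<and> ?L' x y" for p x y using L by auto
  have "p \<in> sep (times (binary_seqs a) (binary_seqs a)) (\<lambda>p. \<exists>x y. x \<in> binary_seqs a \<and> y \<in> binary_seqs a \<and> p = opair x y \<and> ?L' x y) \<longleftrightarrow>
    (\<exists>x y. x \<in> binary_seqs a \<and> y \<in> binary_seqs a \<and> p = opair x y \<and> ?L' x y)" for p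
    by (subst mem_sep) (intro dfn, auto)
  hence "lt (lex a) x y \<longleftrightarrow> (\<exists>x' y'. x' \<in> binary_seqs a \<and> y' \<in> binary_seqs a \<and> opair x y = opair x' y' \<and> ?L' x' y')"
    unfolding lex_def B by (intro mem_setof) blast
  hence 1: "lt (lex a) x y \<longleftrightarrow> maps x a two \<and> maps y a two \<and> ?L' x y" by auto
  have "ap x d \<in> ap y d \<longleftrightarrow> ap x d = zero \<and> ap y d = one" if "maps x a two" "maps y a two" "d \<in> a" for d
  proof -
    have "ap x d \<in> two" "ap y d \<in> two" using that unfolding maps_iff by blast+
    thus ?thesis by auto
  qed
  thus ?thesis unfolding 1 by metis
qed

lemma lex_iff:
  assumes a: "ordinal a" and x: "maps x a two" and y: "maps y a two"
  shows "lt (lex a) x y \<longleftrightarrow> x \<noteq> y \<and> ap x (dl a x y) = zero \<and> ap y (dl a x y) = one"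
proof
  assume "lt (lex a) x y"
  then obtain c where c: "c \<in> a" "ap x c = zero" "ap y c = one" "\<forall>b. b \<in> c \<longrightarrow> ap x b = ap y b"
    unfolding mem_lex[OF a] by blast
  have ne: "ap x c \<noteq> ap y c" using c by simp
  have "dl a x y = c" by (rule dl_eqI[OF a c(1) ne]) (use c in blast)
  thus "x \<noteq> y \<and> ap x (dl a x y) = zero \<and> ap y (dl a x y) = one" using c ne by auto
next
  assume h: "x \<noteq> y \<and> ap x (dl a x y) = zero \<and> ap y (dl a x y) = one"
  thus "lt (lex a) x y" unfolding mem_lex[OF a] using dl[OF a x y] x y by blast
qed

text \<open>In \<open>x < y < z\<close> the two first differences are distinct positions, since
  \<open>y\<close> carries a 1 at the first and a 0 at the second. The first difference of
  \<open>x\<close> and \<open>z\<close> is the smaller of the two.\<close>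

lemma lex_trans:
  assumes a: "ordinal a" and xy: "lt (lex a) x y" and yz: "lt (lex a) y z"
  shows "lt (lex a) x z"
    and "dl a x y \<in> dl a y z \<Longrightarrow> dl a x z = dl a x y"
    and "\<not> dl a x y \<in> dl a y z \<Longrightarrow> dl a x z = dl a y z \<and> dl a y z \<in> dl a x y"
proof -
  have m: "maps x a two" "maps y a two" "maps z a two" using xy yz mem_lex[OF a] by blast+
  note x = lex_iff[OF a m(1,2), THEN iffD1, OF xy] and y = lex_iff[OF a m(2,3), THEN iffD1, OF yz]
  have ne: "x \<noteq> y" "y \<noteq> z" using x y by blast+
  note D = dl[OF a m(1,2) ne(1)] and E = dl[OF a m(2,3) ne(2)]
  have oD: "ordinal (dl a x y)" "ordinal (dl a y z)" using D(1) E(1) ord_mem[OF a] by blast+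
  have neq: "dl a x y \<noteq> dl a y z" using x y one_zero by metis
  have 1: "dl a x z = dl a x y \<and> lt (lex a) x z" if lt: "dl a x y \<in> dl a y z"
  proof -
    have z: "ap z (dl a x y) = one" using E(3)[OF lt] x by simp
    have b: "ap x b = ap z b" if "b \<in> dl a x y" for b using D(3)[OF that] E(3) ord_trans[OF oD(2) that lt] by metis
    have "dl a x z = dl a x y" by (rule dl_eqI[OF a D(1) _ b]) (use z x in simp_all)
    moreover have "lt (lex a) x z" unfolding mem_lex[OF a] using m z x D(1) b by blast
    ultimately show ?thesis by blast
  qed
  have 2: "dl a x z = dl a y z \<and> lt (lex a) x z" if lt: "dl a y z \<in> dl a x y"
  proof -
    have z: "ap x (dl a y z) = zero" using D(3)[OF lt] y by simp
    have b: "ap x b = ap z b" if "b \<in> dl a y z" for b using E(3)[OF that] D(3) ord_trans[OF oD(1) that lt] by metis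
    have "dl a x z = dl a y z" by (rule dl_eqI[OF a E(1) _ b]) (use z y in simp_all)
    moreover have "lt (lex a) x z" unfolding mem_lex[OF a] using m z y E(1) b by blast
    ultimately show ?thesis by blast
  qed
  show "dl a x y \<in> dl a y z \<Longrightarrow> dl a x z = dl a x y" using 1 by blast
  have or: "dl a x y \<in> dl a y z \<or> dl a y z \<in> dl a x y" using ord_linear[OF oD] neq by blast
  show "\<not> dl a x y \<in> dl a y z \<Longrightarrow> dl a x z = dl a y z \<and> dl a y z \<in> dl a x y" using 2 or by blast
  show "lt (lex a) x z" using 1 2 or by blast
qed

lemma lin_lex: "ordinal a \<Longrightarrow> lin (binary_seqs a) (lex a)"
proof -
  assume a: "ordinal a"
  have "lt (lex a) x y \<or> lt (lex a) y x" if m: "maps x a two" "maps y a two" "x \<noteq> y" for x y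
  proof -
    note D = dl[OF a m]
    have "ap x (dl a x y) \<in> two" "ap y (dl a x y) \<in> two" using D(1) m unfolding maps_iff by blast+
    hence "(ap x (dl a x y) = zero \<and> ap y (dl a x y) = one) \<or> (ap y (dl a x y) = zero \<and> ap x (dl a x y) = one)"
      using D(2) unfolding mem_two by metis
    thus ?thesis unfolding mem_lex[OF a] using D m by metis
  qed
  thus ?thesis unfolding lin_def mem_binary_seqs using lex_trans(1)[OF a] lex_iff[OF a] by blast
qed

lemma dl_commute: "dl a x y = dl a y x"
proof -
  have "(ap x c \<noteq> ap y c \<and> (\<forall>b. b \<in> c \<longrightarrow> ap x b = ap y b)) \<longleftrightarrow> (ap y c \<noteq> ap x c \<and> (\<forall>b. b \<in> c \<longrightarrow> ap y b = ap x b))" for c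
    by metis
  thus ?thesis unfolding dl_def by metis
qed

end

section \<open>Tails and infinite pieces\<close>

context beta_structure
begin

text \<open>A tail already has the type of its piece, by indecomposability.\<close>

lemma full_tails:
  assumes UT: "U \<subseteq> T" and h: "\<And>t. t \<in> T \<Longrightarrow> \<exists>s. s \<in> T \<and> ap pc s = ap pc t \<and> tail T W pc s \<subseteq> U"
  shows "full U"
  unfolding full_def
proof (intro conjI allI impI)
  fix t assume t: "t \<in> T"
  obtain s where s: "s \<in> T" "ap pc s = ap pc t" "tail T W pc s \<subseteq> U" using h[OF t] by blast
  have sub: "part U t \<subseteq> piece T pc t" using UT by (auto simp: subset_def)
  have "tail T W pc s \<subseteq> part U t" using s by (auto simp: subset_def)
  hence "otp (tail T W pc s) W \<subseteq> otp (part U t) W"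
    using otp_mono wo_subset[OF s.wo_piece[OF t] sub] by blast
  hence "otp (piece T pc t) W \<subseteq> otp (part U t) W" using s.indec[OF s(1)] s.piece_cong[OF s(2)] by simp
  thus "otp (part U t) W = otp (piece T pc t) W"
    using otp_mono[OF s.wo_piece[OF t] sub] subset_antisym by blast
qed (rule UT)

lemma big_eq: "t \<in> T \<Longrightarrow> w.big t \<longleftrightarrow> s.big t"
  unfolding s.big_def w.big_def using pc_wp by metis

text \<open>The first piece of \<open>W\<close> is infinite because it is the largest one.\<close>

lemma first_big:
  assumes inf: "\<not> fin T" and t1: "t1 \<in> T" "\<And>t. t \<in> T \<Longrightarrow> t = t1 \<or> lt W t1 t"
  shows "s.big t1"
proof (rule ccontr)
  assume nb: "\<not> s.big t1"
  have single: "x = t1" if "x \<in> piece T wp t1" for x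
    using that nb piece_eq[OF t1(1)] s.not_big_ty[OF t1(1) nb] by metis
  have "\<not> s.big t" if t: "t \<in> T" for t
  proof
    assume b: "s.big t"
    have ne: "ap wp t1 \<noteq> ap wp t" using b nb s.big_cong t1(1) t pc_wp by metis
    hence "t \<noteq> t1" by auto
    hence "lt W t1 t" using t1(2)[OF t] by blast
    hence lt: "ap wp t1 \<in> ap wp t" using w.pc_le[OF t1(1) t] ne by blast
    have le: "otp (piece T wp t) W \<subseteq> otp (piece T wp t1) W"
      by (rule w.sorted0[OF t1(1) t lt e_zero[OF t]]) (use b big_eq t e_zero in blast)+
    obtain r where r: "r \<in> T" "ap wp r = ap wp t" "r \<noteq> t" using b big_eq[OF t] unfolding w.big_def by blast
    have mem: "t \<in> piece T wp t" "r \<in> piece T wp t" using r t by auto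
    have "rk (piece T wp t) W t \<in> otp (piece T wp t1) W" "rk (piece T wp t) W r \<in> otp (piece T wp t1) W"
      using rk_mem[OF w.wo_piece[OF t]] mem le subsetD by blast+
    hence "rk (piece T wp t) W t = rk (piece T wp t) W r"
      using rk_surj[OF w.wo_piece[OF t1(1)]] single by metis
    thus False using rk_inj[OF w.wo_piece[OF t] mem] r by blast
  qed
  hence pe: "piece T pc t = upair t t" if "t \<in> T" for t
    by (intro mext) (use s.not_big_ty[OF that] that in auto)
  have "fin (upair t t)" for t
  proof -
    have "upair t t = ins t zero" by (rule mext) auto
    thus ?thesis by simp
  qed
  hence "fin (unite s.pset)" by (intro fin_unite s.fin_pset) (use pe s.mem_pset in metis)
  moreover have "unite s.pset = T" by (rule mext) (auto simp: s.mem_pset)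
  ultimately show False using inf by simp
qed

text \<open>Values inside a natural number would include a greatest one, but an infinite piece has
  no last point and \<open>f\<close> is increasing.\<close>

lemma big_not_in_nat:
  assumes t: "t \<in> T" "s.big t" and n: "n \<in> omega" and f: "dfn1 f"
    and inc: "\<And>s t. s \<in> T \<Longrightarrow> t \<in> T \<Longrightarrow> lt W s t \<Longrightarrow> f s \<in> f t"
  shows "\<exists>s. s \<in> T \<and> ap pc s = ap pc t \<and> \<not> f s \<in> n"
proof (rule ccontr)
  assume no: "\<not> ?thesis"
  have "img f (piece T pc t) \<subseteq> n" using no by (auto simp: subset_def f)
  moreover have "f t \<in> img f (piece T pc t)" using t by (auto simp: f)
  ultimately obtain m where m: "m \<in> img f (piece T pc t)" "\<And>y. y \<in> img f (piece T pc t) \<Longrightarrow> y \<in> m \<or> y = m"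
    using omega_greatest[OF n] by metis
  obtain s where s: "s \<in> T" "ap pc s = ap pc t" "m = f s" using m(1) by (auto simp: f)
  have "s.big s" using s.big_cong t s by blast
  then obtain r where r: "r \<in> T" "ap pc r = ap pc s" "lt W s r" using s.big_next[OF s(1)] by blast
  have "f r \<in> img f (piece T pc t)" using r s by (auto simp: f)
  hence "f r \<in> f s \<or> f r = f s" using m(2) s(3) by blast
  moreover have "f s \<in> f r" using inc s r by blast
  ultimately show False using mem_asym mem_irrefl by metis
qed

end

subsection \<open>From ordinals to sequences\<close>

context beta_structure
begin

text \<open>The prefix of \<open>q\<close> ones and a zero orders the sequences by piece. Positions
  up to \<open>q\<close> are thereby lost for \<open>x\<close>, which is the source of the condition
  \<open>q \<in> x\<close> in \<open>code_less\<close>.\<close>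

definition code :: "'a \<Rightarrow> 'a \<Rightarrow> 'a \<Rightarrow> 'a" where
  "code k q x = lam k (\<lambda>p. if p \<in> q then one else if p = q then zero
     else if (ap d q = zero) = (p \<in> x) then one else zero)"

lemma dfnt_code [simp]: "dfnt f \<Longrightarrow> dfnt g \<Longrightarrow> dfnt (\<lambda>v. code k (f v) (g v))"
  by (rule dfnt_app2[of "code k"]) (unfold code_def, intro dfn)

lemma code_maps: "maps (code k q x) k two"
  unfolding maps_iff code_def by auto

lemma code_ap: "p \<in> k \<Longrightarrow> ap (code k q x) p = (if p \<in> q then one else if p = q then zero
     else if (ap d q = zero) = (p \<in> x) then one else zero)"
  unfolding code_def by (subst ap_lam) (simp_all)

lemma code_less_piece:
  assumes k: "ordinal k" and q: "q \<in> q'" "q \<in> k" "ordinal q'"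
  shows "lt (lex k) (code k q x) (code k q' x')"
  unfolding mem_lex[OF k]
proof (intro conjI exI[of _ q] code_maps allI impI)
  show "ap (code k q x) q = zero" "ap (code k q' x') q = one" using q by (simp_all add: code_ap)
  fix b assume b: "b \<in> q"
  hence "b \<in> k" "b \<in> q'" using q ord_trans[OF k] ord_trans[OF q(3)] by blast+
  thus "ap (code k q x) b = ap (code k q' x') b" using b by (simp add: code_ap)
qed (rule q(2))

text \<open>For \<open>x \<in> x'\<close> the characteristic functions first differ at position
  \<open>x\<close> itself, and complementing them reverses the comparison. The condition
  \<open>q \<in> x\<close> puts this position behind the prefix.\<close>

lemma code_less:
  assumes k: "ordinal k" and x: "x \<in> x'" "x' \<in> k" "q \<in> x"
  shows "if ap d q = zero then lt (lex k) (code k q x) (code k q x') else lt (lex k) (code k q x') (code k q x)"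
proof -
  have xk: "x \<in> k" using ord_trans[OF k x(1,2)] .
  have ox: "ordinal x" "ordinal x'" using ord_mem[OF k] xk x by blast+
  have qx: "\<not> x \<in> q" "x \<noteq> q" using x(3) mem_asym mem_irrefl by blast+
  have below: "ap (code k q x) b = ap (code k q x') b" if b: "b \<in> x" for b
  proof -
    have "b \<in> x'" "b \<in> k" using ord_trans[OF ox(2) b x(1)] ord_trans[OF k b xk] by blast+
    thus ?thesis using b by (simp add: code_ap)
  qed
  have 1: "ap (code k q x) x = (if ap d q = zero then zero else one)"
    "ap (code k q x') x = (if ap d q = zero then one else zero)" using xk qx x(1) by (simp_all add: code_ap)
  show ?thesis unfolding mem_lex[OF k] using code_maps 1 below xk by (auto intro!: exI[of _ x])
qed

theorem arrow_ordinal_imp_arrow_lex: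
  assumes k: "ordinal k" and inf: "\<not> fin T" and om: "omega \<subseteq> k"
    and arr: "arrow k (memrel k) T W T W"
  shows "arrow (binary_seqs k) (lex k) T S T S"
  unfolding arrow_iff
proof (intro allI impI)
  fix F assume F: "maps F (subsets_of_type (binary_seqs k) (lex k) T S) two"
  \<comment> \<open>The isomorphism of \<open>T\<close>, ordered by \<open>W\<close>, onto a copy
    \<open>X\<close> in \<open>k\<close>, written with ranks so that it is definable from
    \<open>X\<close>.\<close>
  define ph where "ph X t = invf X (rk X (memrel k)) (rk T W t)" for X t
  have phD: "dfnt (\<lambda>v. ph (f v) (g v))" if "dfnt f" "dfnt g" for f g
    by (rule dfnt_app2[of ph, OF _ that]) (unfold ph_def, intro dfn)
  \<comment> \<open>The set of sequences coding \<open>X\<close>. The new colour of \<open>X\<close>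
    is the old colour of \<open>E X\<close>, with zero as the default when \<open>E X\<close> has
    the wrong type.\<close>
  define E where "E X = img (\<lambda>t. code k (ap pc t) (ph X t)) T" for X
  have ED: "dfn1 E" unfolding E_def by (intro dfnt_img dfnt_code phD dfn)
  define G where "G = lam (subsets_of_type k (memrel k) T W)
    (\<lambda>X. if E X \<in> subsets_of_type (binary_seqs k) (lex k) T S then ap F (E X) else zero)"
  have GD: "dfnt (\<lambda>v. if E (v 0) \<in> subsets_of_type (binary_seqs k) (lex k) T S then ap F (E (v 0)) else zero)"
    using ED by (intro dfn)
  have G: "ap G X = (if E X \<in> subsets_of_type (binary_seqs k) (lex k) T S then ap F (E X) else zero)"
    if "X \<subseteq> k" "isomorphic X (memrel k) T W" for X unfolding G_def by (rule ap_lam[OF GD]) (use that in simp)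
  have "maps G (subsets_of_type k (memrel k) T W) two"
    unfolding maps_iff
  proof (intro conjI allI impI)
    show "fun_on G (subsets_of_type k (memrel k) T W)" unfolding G_def by (rule fun_on_lam[OF GD])
    fix X assume "X \<in> subsets_of_type k (memrel k) T W"
    thus "ap G X \<in> two" using G[of X] F unfolding maps_iff by (simp del: mem_two) simp
  qed
  then obtain H where H: "H \<subseteq> k" "isomorphic H (memrel k) T W"
    and hom: "\<And>X Y. X \<subseteq> H \<Longrightarrow> isomorphic X (memrel k) T W \<Longrightarrow> Y \<subseteq> H \<Longrightarrow> isomorphic Y (memrel k) T W \<Longrightarrow> ap G X = ap G Y"
    using arr unfolding arrow_iff by (metis (no_types, lifting))
  obtain f where f: "isoby f T W H (memrel k)" using isomorphic_sym[OF H(2)] isomorphic_iff by blast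
  have fH: "\<And>t. t \<in> T \<Longrightarrow> ap f t \<in> H" using isoby_memD[OF f] .
  have fk: "\<And>t. t \<in> T \<Longrightarrow> ap f t \<in> k" using fH H subsetD by blast
  have finc: "lt W s t \<longleftrightarrow> ap f s \<in> ap f t" if "s \<in> T" "t \<in> T" for s t
    using f that fk unfolding isoby_def by auto
  \<comment> \<open>Ordinals below \<open>N\<close> may collide with the prefixes of the codes, so
    these points are dropped. The rest is still full: an infinite piece keeps a tail, and a
    one-point piece comes after the first piece of \<open>W\<close>, which is infinite and already
    leaves \<open>N\<close>.\<close>
  define U where "U = sep T (\<lambda>t. \<not> ap f t \<in> N)"
  have U: "t \<in> U \<longleftrightarrow> t \<in> T \<and> \<not> ap f t \<in> N" for t unfolding U_def by simp
  have oN: "ordinal N" using ord_omega_mem[OF s.N_omega] .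
  have fo: "ordinal (ap f t)" if "t \<in> T" for t using fk[OF that] ord_mem[OF k] by blast
  have fullU: "full U"
  proof (rule full_tails)
    show "U \<subseteq> T" by (simp add: subset_def U)
    fix t assume t: "t \<in> T"
    have "\<exists>s. s \<in> T \<and> ap pc s = ap pc t \<and> \<not> ap f s \<in> N"
    proof (cases "s.big t")
      case True
      show ?thesis by (rule big_not_in_nat[OF t True s.N_omega, of "ap f"]) (use finc in auto)
    next
      case False
      have "\<not> ap f t \<in> N"
      proof
        assume ftN: "ap f t \<in> N"
        obtain t1 where t1: "t1 \<in> T" "\<And>y. y \<in> T \<Longrightarrow> y = t1 \<or> lt W t1 y"
          by (rule wo_least[OF wo_W t, of "\<lambda>x. True"]) auto
        have b1: "s.big t1" by (rule first_big[OF inf t1])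
        obtain r where r: "r \<in> T" "ap pc r = ap pc t1" "\<not> ap f r \<in> N"
          using big_not_in_nat[OF t1(1) b1 s.N_omega, of "ap f"] finc by auto
        have ne: "ap pc t \<noteq> ap pc t1" using False b1 s.big_cong t t1(1) by metis
        hence "t \<noteq> t1" by auto
        hence "lt W t1 t" using t1(2)[OF t] by blast
        hence "ap wp t1 \<in> ap wp t" using w.pc_le[OF t1(1) t] ne pc_wp[OF t1(1) t] by metis
        hence "ap wp r \<in> ap wp t" using r pc_wp[OF r(1) t1(1)] by simp
        hence "lt W r t" using w.pc_less r t by blast
        hence "ap f r \<in> ap f t" using finc r t by blast
        thus False using r ord_trans[OF oN _ ftN] by blast
      qed
      thus ?thesis using t by blast
    qed
    then obtain s where s: "s \<in> T" "ap pc s = ap pc t" "\<not> ap f s \<in> N" by blast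
    have "tail T W pc s \<subseteq> U"
      unfolding subset_def U mem_tail using s finc ord_trans[OF oN] by blast
    thus "\<exists>s. s \<in> T \<and> ap pc s = ap pc t \<and> tail T W pc s \<subseteq> U" using s by blast
  qed
  have UT: "U \<subseteq> T" using fullU full_def by blast
  define c where "c t = code k (ap pc t) (ap f t)" for t
  have cD: "dfn1 c" unfolding c_def by (intro dfnt_code dfn)
  have cB: "c t \<in> binary_seqs k" for t unfolding c_def using code_maps by simp
  have qk: "ap pc t \<in> k" if "t \<in> T" for t using s.pc_mem[OF that] s.N_omega omega_mem_mem om subsetD by blast
  have cinc: "lt (lex k) (c s) (c t)" if st: "s \<in> U" "t \<in> U" "lt S s t" for s t
  proof -
    have sT: "s \<in> T" "t \<in> T" using st U by blast+
    show ?thesis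
    proof (cases "ap pc s = ap pc t")
      case False
      hence "ap pc s \<in> ap pc t" using s.pc_le[OF sT st(3)] by blast
      thus ?thesis unfolding c_def using code_less_piece[OF k] qk[OF sT(1)] s.pc_ord[OF sT(2)] by blast
    next
      case True
      have N: "N \<subseteq> ap f x" if "x \<in> U" for x using that U ord_not_mem[OF fo oN] by blast
      have q: "ap pc t \<in> ap f x" if "x \<in> U" for x using N[OF that] s.pc_mem[OF sT(2)] subsetD by blast
      show ?thesis
      proof (cases "ap d (ap pc t) = zero")
        case d: True
        hence "ap f s \<in> ap f t" using s.dir[OF sT True] st finc sT by simp
        thus ?thesis unfolding c_def using code_less[OF k _ fk[OF sT(2)] q[OF st(1)]] d True by simp
      next
        case d: False
        hence "ap f t \<in> ap f s" using s.dir[OF sT True] st finc sT by simp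
        thus ?thesis unfolding c_def using code_less[OF k _ fk[OF sT(1)] q[OF st(2)]] d True by simp
      qed
    qed
  qed
  have linU: "lin U S" using lin_subset[OF s.lin_R UT] .
  define K where "K = img c U"
  have KB: "K \<subseteq> binary_seqs k" unfolding K_def subset_def mem_img[OF cD] using cB by blast
  have cinj: "x = y" if "x \<in> U" "y \<in> U" "c x = c y" for x y
    using inc_iff(2)[OF linU lin_lex[OF k] cB cinc that(1,2,3)] .
  have ciff: "lt S x y \<longleftrightarrow> lt (lex k) (c x) (c y)" if "x \<in> U" "y \<in> U" for x y
    using inc_iff(1)[OF linU lin_lex[OF k] cB cinc that] .
  have "isomorphic U S K (lex k)" unfolding K_def by (rule inc_iso[OF linU lin_lex[OF k] cD cB cinc])
  hence Kiso: "isomorphic K (lex k) T S"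
    using full_iso_S[OF fullU] isomorphic_sym isomorphic_trans by blast
  \<comment> \<open>Every copy of \<open>T\<close> inside \<open>K\<close> is the code of a copy of
    \<open>W\<close> inside \<open>H\<close>: its preimage \<open>V\<close> in \<open>U\<close> is
    full, and the ranks used by \<open>E\<close> recover exactly the points of
    \<open>V\<close>.\<close>
  have key: "\<exists>X. X \<subseteq> H \<and> isomorphic X (memrel k) T W \<and> E X = Y"
    if Y: "Y \<subseteq> K" "isomorphic Y (lex k) T S" for Y
  proof -
    define V where "V = sep U (\<lambda>u. c u \<in> Y)"
    have V: "u \<in> V \<longleftrightarrow> u \<in> U \<and> c u \<in> Y" for u unfolding V_def using cD by simp
    have VT: "V \<subseteq> T" using UT by (auto simp: subset_def V)
    have cV: "bij_betw c (el V) (el Y)"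
      unfolding bij_el_iff V
    proof (intro conjI allI impI)
      fix y assume y: "y \<in> Y"
      then obtain u where u: "u \<in> U" "y = c u" using Y(1) unfolding K_def subset_def mem_img[OF cD] by blast
      show "\<exists>!u. (u \<in> U \<and> c u \<in> Y) \<and> c u = y" using u y cinj by blast
    qed blast
    have "isomorphic V S Y (lex k)" by (rule isomorphicI[OF cD cV]) (use ciff V in blast)
    hence "isomorphic V S T S" using Y(2) isomorphic_trans by blast
    hence fV: "full V" using iso_S_full[OF VT] by blast
    note g = glue[OF fV]
    define X where "X = img (ap f) V"
    have X: "x \<in> X \<longleftrightarrow> (\<exists>u. u \<in> V \<and> x = ap f u)" for x unfolding X_def by (rule mem_img) simp
    have XH: "X \<subseteq> H" unfolding subset_def X using fH VT subsetD by blast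
    have finj: "x = y" if "x \<in> T" "y \<in> T" "ap f x = ap f y" for x y
      using f that fH unfolding isoby_def bij_el_iff by metis
    define h where "h t = ap f (glue V t)" for t
    have hD: "dfn1 h" unfolding h_def by simp
    have hb: "bij_betw h (el T) (el X)" unfolding bij_el_iff
    proof (intro conjI allI impI)
      fix t assume "t \<in> T" thus "h t \<in> X" unfolding X h_def using g(1) by blast
    next
      fix x assume "x \<in> X"
      then obtain u where u: "u \<in> V" "x = ap f u" using X by blast
      then obtain t where t: "t \<in> T" "glue V t = u" "\<And>t'. t' \<in> T \<Longrightarrow> glue V t' = u \<Longrightarrow> t' = t"
        using g(6) unfolding bij_el_iff by metis
      have "t' = t" if "t' \<in> T" "h t' = x" for t'
        using t(3)[OF that(1)] finj[OF g(3)[OF that(1)]] u VT subsetD that(2) unfolding h_def by metis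
      thus "\<exists>!t. t \<in> T \<and> h t = x" using t u h_def by blast
    qed
    have hinc: "lt W s t \<longleftrightarrow> lt (memrel k) (h s) (h t)" if "s \<in> T" "t \<in> T" for s t
      unfolding h_def using g(4)[OF that] finc[OF g(3)[OF that(1)] g(3)[OF that(2)]] fk g(3) that by simp
    have Xiso: "isomorphic X (memrel k) T W" by (rule isomorphic_sym[OF isomorphicI[OF hD hb hinc]])
    have woX: "wo X (memrel k)" using wo_iso[OF Xiso wo_W] .
    have phX: "ph X t = h t" if t: "t \<in> T" for t
    proof -
      have "rk X (memrel k) (h t) = rk T W t" by (rule rk_iso[OF wo_W hD hb hinc t])
      moreover have "h t \<in> X" using hb t unfolding bij_el_iff by blast
      ultimately show ?thesis unfolding ph_def using bij_betw_invf(3)[OF rk_bij[OF woX]] by metis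
    qed
    have D1: "dfnt (\<lambda>v. code k (ap pc (v 0)) (ph X (v 0)))" by (intro dfnt_code phD dfn)
    have "code k (ap pc t) (ph X t) = c (glue V t)" if "t \<in> T" for t
      unfolding c_def phX[OF that] g(2)[OF that] h_def ..
    hence e1: "y \<in> E X \<longleftrightarrow> (\<exists>t. t \<in> T \<and> y = c (glue V t))" for y
      unfolding E_def mem_img[OF D1] by metis
    have e2: "(\<exists>t. t \<in> T \<and> y = c (glue V t)) \<longleftrightarrow> (\<exists>u. u \<in> V \<and> y = c u)" for y
      using g(1) g(6) unfolding bij_el_iff by metis
    have e3: "(\<exists>u. u \<in> V \<and> y = c u) \<longleftrightarrow> y \<in> Y" for y using cV unfolding bij_el_iff by metis
    have "E X = Y" by (rule mext) (simp only: e1 e2 e3)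
    thus ?thesis using XH Xiso by blast
  qed
  show "\<exists>H. H \<subseteq> binary_seqs k \<and> isomorphic H (lex k) T S \<and> (\<forall>X Y. X \<subseteq> H \<and> isomorphic X (lex k) T S \<and>
      Y \<subseteq> H \<and> isomorphic Y (lex k) T S \<longrightarrow> ap F X = ap F Y)"
  proof (intro exI[of _ K] conjI KB Kiso allI impI)
    fix Y Y' assume h: "Y \<subseteq> K \<and> isomorphic Y (lex k) T S \<and> Y' \<subseteq> K \<and> isomorphic Y' (lex k) T S"
    obtain X where X: "X \<subseteq> H" "isomorphic X (memrel k) T W" "E X = Y" using key h by blast
    obtain X' where X': "X' \<subseteq> H" "isomorphic X' (memrel k) T W" "E X' = Y'" using key h by blast
    have "ap G X = ap F Y" using G[OF subset_trans[OF X(1) H(1)] X(2)] X(3) h KB subset_trans by auto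
    moreover have "ap G X' = ap F Y'" using G[OF subset_trans[OF X'(1) H(1)] X'(2)] X'(3) h KB subset_trans by auto
    ultimately show "ap F Y = ap F Y'" using hom[OF X(1,2) X'(1,2)] by simp
  qed
qed

end

section \<open>Pairs and lexicographic products\<close>

context zf_model
begin

definition fstp :: "'a \<Rightarrow> 'a" where
  "fstp p = setof (\<lambda>z. \<exists>x y. p = opair x y \<and> z \<in> x)"

definition sndp :: "'a \<Rightarrow> 'a" where
  "sndp p = setof (\<lambda>z. \<exists>x y. p = opair x y \<and> z \<in> y)"

lemma fstp [simp]: "fstp (opair x y) = x"
  by (rule mext) (unfold fstp_def, subst mem_setof, auto)

lemma sndp [simp]: "sndp (opair x y) = y"
  by (rule mext) (unfold sndp_def, subst mem_setof, auto)

lemma dfnt_fstp [dfn, simp]: "dfnt f \<Longrightarrow> dfnt (\<lambda>v. fstp (f v))"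
  by (rule dfnt_app1[of fstp]) (unfold fstp_def, intro dfn)

lemma dfnt_sndp [dfn, simp]: "dfnt f \<Longrightarrow> dfnt (\<lambda>v. sndp (f v))"
  by (rule dfnt_app1[of sndp]) (unfold sndp_def, intro dfn)

definition lxr :: "'a \<Rightarrow> 'a \<Rightarrow> 'a" where
  "lxr A B = sep (times (times A B) (times A B)) (\<lambda>p. \<exists>q x q' x'. p = opair (opair q x) (opair q' x') \<and> (q \<in> q' \<or> q = q' \<and> x \<in> x'))"

lemma dfnt_lxr [dfn, simp]: "dfnt A \<Longrightarrow> dfnt B \<Longrightarrow> dfnt (\<lambda>v. lxr (A v) (B v))"
  by (rule dfnt_app2[of lxr]) (unfold lxr_def, intro dfn)

lemma mem_lxr: "lt (lxr A B) (opair q x) (opair q' x') \<longleftrightarrow>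
  q \<in> A \<and> x \<in> B \<and> q' \<in> A \<and> x' \<in> B \<and> (q \<in> q' \<or> q = q' \<and> x \<in> x')"
  unfolding lxr_def by (subst mem_sep) (intro dfn, auto)

lemma wo_lxr:
  assumes A: "ordinal A" and B: "ordinal B"
  shows "wo (times A B) (lxr A B)"
proof -
  have "lin (times A B) (lxr A B)" unfolding lin_def
  proof (intro conjI allI impI)
    fix p assume "p \<in> times A B" thus "\<not> lt (lxr A B) p p" by (auto simp: mem_lxr)
  next
    fix p p' p'' assume h: "p \<in> times A B \<and> p' \<in> times A B \<and> p'' \<in> times A B \<and> lt (lxr A B) p p' \<and> lt (lxr A B) p' p''"
    then obtain q x q' x' q'' x'' where p: "p = opair q x" "p' = opair q' x'" "p'' = opair q'' x''" by auto
    hence "q'' \<in> A" "x'' \<in> B" using h by auto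
    hence "ordinal q''" "ordinal x''" using A B ord_mem by blast+
    thus "lt (lxr A B) p p''" using h ord_trans unfolding p mem_lxr by blast
  next
    fix p p' assume h: "p \<in> times A B \<and> p' \<in> times A B \<and> p \<noteq> p'"
    then obtain q x q' x' where p: "p = opair q x" "p' = opair q' x'" "q \<in> A" "x \<in> B" "q' \<in> A" "x' \<in> B" by auto
    have "q \<in> q' \<or> q = q' \<or> q' \<in> q" "x \<in> x' \<or> x = x' \<or> x' \<in> x"
      using ord_linear ord_mem A B p by blast+
    thus "lt (lxr A B) p p' \<or> lt (lxr A B) p' p" unfolding p(1,2) mem_lxr using p h by blast
  qed
  moreover have "\<exists>m. m \<in> X \<and> (\<forall>y. y \<in> X \<longrightarrow> y = m \<or> lt (lxr A B) m y)"
    if X: "X \<subseteq> times A B" "\<exists>x. x \<in> X" for X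
  proof -
    have X': "q \<in> A \<and> x \<in> B" if "opair q x \<in> X" for q x using X(1) that unfolding subset_def by auto
    obtain q x where qx: "opair q x \<in> X" using X unfolding subset_def mem_times by metis
    have D1: "dfnp (\<lambda>v. \<exists>x. opair (v 0) x \<in> X)" by simp
    have ex: "\<exists>x. opair q x \<in> X" using qx by blast
    obtain q0 where q0: "\<exists>x. opair q0 x \<in> X" "\<And>q. q \<in> q0 \<Longrightarrow> \<not> (\<exists>x. opair q x \<in> X)"
      using ord_least[OF ord_mem[OF A conjunct1[OF X'[OF qx]]], of "\<lambda>q. \<exists>x. opair q x \<in> X"] D1 ex by blast
    obtain x1 where x1: "opair q0 x1 \<in> X" using q0 by blast
    have D2: "dfnp (\<lambda>v. opair q0 (v 0) \<in> X)" by simp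
    obtain x0 where x0: "opair q0 x0 \<in> X" "\<And>x. x \<in> x0 \<Longrightarrow> \<not> opair q0 x \<in> X"
      using ord_least[OF ord_mem[OF B conjunct2[OF X'[OF x1]]], of "\<lambda>x. opair q0 x \<in> X"] D2 x1 by blast
    have "y = opair q0 x0 \<or> lt (lxr A B) (opair q0 x0) y" if y: "y \<in> X" for y
    proof -
      obtain q' x' where y': "y = opair q' x'" using y X(1) unfolding subset_def mem_times by blast
      have m: "q' \<in> A" "x' \<in> B" "q0 \<in> A" "x0 \<in> B" using X' y x0(1) y' by blast+
      have "q0 = q' \<or> q0 \<in> q'" using ord_linear[OF ord_mem[OF A m(1)] ord_mem[OF A m(3)]] q0(2) y y' by blast
      moreover have "x0 = x' \<or> x0 \<in> x'" if "q0 = q'"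
        using ord_linear[OF ord_mem[OF B m(2)] ord_mem[OF B m(4)]] x0(2) y y' that by blast
      ultimately show ?thesis unfolding y' mem_lxr using m by auto
    qed
    thus ?thesis using x0(1) by blast
  qed
  ultimately show ?thesis unfolding wo_def by blast
qed

subsection \<open>Initial ordinals\<close>

text \<open>Cardinality below \<open>k\<close>, expressed by an injection into some member of
  \<open>k\<close>, so that no cardinal of \<open>A\<close> has to exist.\<close>

definition sm :: "'a \<Rightarrow> 'a \<Rightarrow> bool" where
  "sm k A \<longleftrightarrow> (\<exists>l f. l \<in> k \<and> (\<forall>x. x \<in> A \<longrightarrow> ap f x \<in> l) \<and> (\<forall>x y. x \<in> A \<and> y \<in> A \<and> ap f x = ap f y \<longrightarrow> x = y))"

lemma dfnp_sm [dfn, simp]: "dfnt k \<Longrightarrow> dfnt A \<Longrightarrow> dfnp (\<lambda>v. sm (k v) (A v))"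
  by (rule dfnp_app2[of sm]) (unfold sm_def, intro dfn)

lemma smI:
  assumes "l \<in> k" "dfn1 F" "\<And>x. x \<in> A \<Longrightarrow> F x \<in> l" "\<And>x y. x \<in> A \<Longrightarrow> y \<in> A \<Longrightarrow> F x = F y \<Longrightarrow> x = y"
  shows "sm k A"
proof -
  have eq: "ap (lam A F) x = F x" if "x \<in> A" for x using ap_lam[OF assms(2) that] .
  have "ap (lam A F) x \<in> l" if "x \<in> A" for x using eq[OF that] assms(3)[OF that] by simp
  moreover have "x = y" if "x \<in> A" "y \<in> A" "ap (lam A F) x = ap (lam A F) y" for x y
    using assms(4)[OF that(1,2)] that(3) eq[OF that(1)] eq[OF that(2)] by simp
  ultimately show ?thesis unfolding sm_def using assms(1) by blast
qed

lemma sm_inj: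
  assumes "sm k A" "dfn1 G" "\<And>x. x \<in> B \<Longrightarrow> G x \<in> A" "\<And>x y. x \<in> B \<Longrightarrow> y \<in> B \<Longrightarrow> G x = G y \<Longrightarrow> x = y"
  shows "sm k B"
proof -
  obtain l f where lf: "l \<in> k" "\<And>x. x \<in> A \<Longrightarrow> ap f x \<in> l" "\<And>x y. x \<in> A \<Longrightarrow> y \<in> A \<Longrightarrow> ap f x = ap f y \<Longrightarrow> x = y"
    using assms(1) unfolding sm_def by blast
  show ?thesis
  proof (rule smI[OF lf(1), of "\<lambda>x. ap f (G x)"])
    show "dfnt (\<lambda>v. ap f (G (v 0)))" using assms(2) by simp
    show "\<And>x. x \<in> B \<Longrightarrow> ap f (G x) \<in> l" using lf(2) assms(3) by blast
    show "\<And>x y. x \<in> B \<Longrightarrow> y \<in> B \<Longrightarrow> ap f (G x) = ap f (G y) \<Longrightarrow> x = y" using lf(3) assms(3,4) by blast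
  qed
qed

lemma initial_not_sm:
  assumes k: "initial_ordinal k" shows "\<not> sm k k"
proof
  assume "sm k k"
  then obtain l f where lf: "l \<in> k" "\<And>x. x \<in> k \<Longrightarrow> ap f x \<in> l" "\<And>x y. x \<in> k \<Longrightarrow> y \<in> k \<Longrightarrow> ap f x = ap f y \<Longrightarrow> x = y"
    unfolding sm_def by blast
  have ok: "ordinal k" and ol: "ordinal l" using k lf(1) ord_mem unfolding initial_ordinal_def by blast+
  define B where "B = img (ap f) k"
  have B: "B \<subseteq> l" unfolding B_def subset_def using lf(2) by auto
  have wB: "wo B (memrel l)" using wo_subset[OF wo_memrel[OF ol] B] .
  have "otp B (memrel l) \<subseteq> l" using otp_subset_ordinal[OF ol B] .
  hence b: "otp B (memrel l) \<in> k" using ord_le_lt[OF otp(1)[OF wB] ol ok _ lf(1)] by blast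
  have "bij_betw (ap f) (el k) (el B)" unfolding B_def by (rule bij_img) (use lf(3) in auto)
  hence "equipotent k B" by (rule equipotentI[rotated]) simp
  moreover have "equipotent B (otp B (memrel l))" by (rule equipotentI[OF _ rk_bij[OF wB]]) simp
  ultimately have "equipotent (otp B (memrel l)) k" using equipotent_sym equipotent_trans by blast
  thus False using k b unfolding initial_ordinal_def by blast
qed

text \<open>An order type outside \<open>k\<close> would include \<open>k\<close>, and inverting
  ranks would inject \<open>k\<close> into one of its own members.\<close>

lemma sm_otp:
  assumes k: "initial_ordinal k" and A: "wo A R" and s: "sm k A"
  shows "otp A R \<in> k"
proof (rule ccontr)
  assume n: "\<not> otp A R \<in> k"
  have ok: "ordinal k" using k unfolding initial_ordinal_def by blast
  have sub: "k \<subseteq> otp A R" using n ord_not_mem[OF otp(1)[OF A] ok] by blast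
  note inv = bij_betw_invf[OF rk_bij[OF A]]
  have "sm k k"
  proof (rule sm_inj[OF s, of "invf A (rk A R)"])
    show "invf A (rk A R) x \<in> A" if "x \<in> k" for x
      using inv(1) subsetD[OF sub that] unfolding bij_el_iff by blast
    show "x = y" if "x \<in> k" "y \<in> k" "invf A (rk A R) x = invf A (rk A R) y" for x y
      using inv(2)[OF subsetD[OF sub that(1)]] inv(2)[OF subsetD[OF sub that(2)]] that(3) by metis
  qed simp
  thus False using initial_not_sm[OF k] by blast
qed

lemma sm_fin:
  assumes "omega \<subseteq> k" "fin A" shows "sm k A"
proof -
  obtain n f where n: "n \<in> omega" "bij_betw (ap f) (el A) (el n)" using assms unfolding fin_def equipotent_iff by blast
  show ?thesis
  proof (rule smI[of n k "ap f"])
    show "n \<in> k" using n assms subsetD by blast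
    show "\<And>x. x \<in> A \<Longrightarrow> ap f x \<in> n" using n(2) unfolding bij_el_iff by blast
    show "\<And>x y. x \<in> A \<Longrightarrow> y \<in> A \<Longrightarrow> ap f x = ap f y \<Longrightarrow> x = y" using n(2) unfolding bij_el_iff by metis
  qed simp
qed

lemma initial_equipotent:
  assumes "ordinal x"
  obtains l where "initial_ordinal l" "l \<subseteq> x" "equipotent x l"
proof -
  have D: "dfnp (\<lambda>v. equipotent x (v 0))" by simp
  obtain l where l: "ordinal l" "equipotent x l" "\<And>c. c \<in> l \<Longrightarrow> \<not> equipotent x c"
    using ord_least[OF assms, of "equipotent x"] D equipotent_refl by blast
  have "\<not> equipotent c l" if "c \<in> l" for c using l(3)[OF that] l(2) equipotent_sym equipotent_trans by blast
  hence "initial_ordinal l" unfolding initial_ordinal_def using l(1) by blast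
  moreover have "l \<subseteq> x" using ord_not_mem[OF assms l(1)] l(3) equipotent_refl by blast
  ultimately show ?thesis using that l(2) by blast
qed

lemma fin_times: "fin A \<Longrightarrow> fin B \<Longrightarrow> fin (times A B)"
proof -
  assume A: "fin A" and B: "fin B"
  have D: "dfnt (\<lambda>v. img (opair (v 0)) B)" by (intro dfn)
  have D': "dfnt (\<lambda>v. opair a (v 0))" for a by (intro dfn)
  have "fin (unite (img (\<lambda>a. img (opair a) B) A))"
  proof (rule fin_unite[OF fin_img[OF A D]])
    fix x assume "x \<in> img (\<lambda>a. img (opair a) B) A"
    thus "fin x" unfolding mem_img[OF D] using fin_img[OF B D'] by blast
  qed
  moreover have "unite (img (\<lambda>a. img (opair a) B) A) = times A B"
    by (rule mext) (auto simp: mem_img[OF D] mem_img[OF D'])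
  ultimately show ?thesis by simp
qed

text \<open>The new top element is sent to zero and the natural numbers are shifted by one.\<close>

lemma succ_equipotent:
  assumes x: "ordinal x" "omega \<subseteq> x"
  shows "equipotent (succ x) x"
proof (rule equipotentI[of "\<lambda>z. if z = x then zero else if z \<in> omega then succ z else z"])
  have xo: "\<not> x \<in> omega" using x ord_not_mem[OF x(1) ord_omega] by blast
  show "bij_betw (\<lambda>z. if z = x then zero else if z \<in> omega then succ z else z) (el (succ x)) (el x)"
    unfolding bij_el_iff
  proof (intro conjI allI impI)
    fix z assume "z \<in> succ x"
    thus "(if z = x then zero else if z \<in> omega then succ z else z) \<in> x"
      using subsetD[OF x(2)] by auto
  next
    fix y assume y: "y \<in> x"
    consider "y = zero" | m where "m \<in> omega" "y = succ m" | "\<not> y \<in> omega" using omega_cases by blast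
    thus "\<exists>!z. z \<in> succ x \<and> (if z = x then zero else if z \<in> omega then succ z else z) = y"
    proof cases
      case 1
      show ?thesis
      proof (rule ex1I[of _ x])
        fix z assume "z \<in> succ x \<and> (if z = x then zero else if z \<in> omega then succ z else z) = y"
        thus "z = x" using 1 by (metis succ_not_zero(1) zero_omega)
      qed (use 1 in simp)
    next
      case 2
      have mx: "m \<in> x" "m \<noteq> x" using 2 x xo subsetD by blast+
      show ?thesis
      proof (rule ex1I[of _ m])
        fix z assume "z \<in> succ x \<and> (if z = x then zero else if z \<in> omega then succ z else z) = y"
        thus "z = m" using 2 by (metis succ_not_zero(2) succ_eq succ_omega)
      qed (use 2 mx in simp)
    next
      case 3
      have yx: "y \<noteq> x" using y by auto
      show ?thesis
      proof (rule ex1I[of _ y])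
        fix z assume "z \<in> succ x \<and> (if z = x then zero else if z \<in> omega then succ z else z) = y"
        thus "z = y" using 3 by (metis zero_omega succ_omega)
      qed (use 3 y yx in simp)
    qed
  qed
qed simp

text \<open>Induction on \<open>k\<close>. Let \<open>l\<close> be the initial ordinal equipotent
  with an infinite \<open>x \<in> k\<close>. A proper initial segment of \<open>l\<close> times
  \<open>M\<close> lies in \<open>succ y\<close> times \<open>M\<close> for some
  \<open>y \<in> l\<close>, so by the induction hypothesis its type is below \<open>l\<close>. Hence
  ranks inject \<open>l\<close> times \<open>M\<close> into \<open>l\<close>.\<close>

lemma initial_times:
  assumes "initial_ordinal k" "omega \<subseteq> k" and M: "M \<in> omega" and "x \<in> k"
  shows "sm k (times (succ x) M)"
proof -
  have "ordinal k" using assms(1) unfolding initial_ordinal_def by blast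
  hence "initial_ordinal k \<and> omega \<subseteq> k \<longrightarrow> (\<forall>x. x \<in> k \<longrightarrow> sm k (times (succ x) M))"
  proof (induction rule: ord_induct)
    case defn
    show ?case unfolding initial_ordinal_def by (intro dfn)
  next
    case (step k)
    show ?case
    proof (intro impI allI)
      fix x assume k: "initial_ordinal k \<and> omega \<subseteq> k" and x: "x \<in> k"
      have ox: "ordinal x" using step(1) x ord_mem by blast
      show "sm k (times (succ x) M)"
      proof (cases "x \<in> omega")
        case True
        thus ?thesis using sm_fin fin_times fin_omega_mem succ_omega M k by blast
      next
        case False
        hence ix: "omega \<subseteq> x" using ord_not_mem[OF ox ord_omega] by blast
        obtain l where l: "initial_ordinal l" "l \<subseteq> x" "equipotent x l" using initial_equipotent[OF ox] .
        have ol: "ordinal l" using l(1) unfolding initial_ordinal_def by blast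
        have lk: "l \<in> k" using ord_le_lt[OF ol ox step(1) l(2) x] .
        have "\<not> fin l" using fin_cong[OF l(3)] not_fin_omega fin_subset[OF _ ix] by blast
        hence il: "omega \<subseteq> l" using fin_ordinal[OF ol] ord_not_mem[OF ol ord_omega] by blast
        have IH: "sm l (times (succ y) M)" if "y \<in> l" for y using step(2)[OF lk] l(1) il that by blast
        have w: "wo (times l M) (lxr l M)" by (rule wo_lxr[OF ol ord_omega_mem[OF M]])
        have rl: "rk (times l M) (lxr l M) p \<in> l" if p: "p \<in> times l M" for p
        proof -
          obtain y i where yi: "p = opair y i" "y \<in> l" "i \<in> M" using p by auto
          have sub: "pred (times l M) (lxr l M) p \<subseteq> times (succ y) M"
            unfolding subset_def mem_pred yi(1) by (auto simp: mem_lxr)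
          have "sm l (pred (times l M) (lxr l M) p)"
            by (rule sm_inj[OF IH[OF yi(2)] dfnt_var subsetD[OF sub]])
          moreover have "wo (pred (times l M) (lxr l M) p) (lxr l M)"
            by (rule wo_subset[OF w]) (simp add: subset_def)
          ultimately show ?thesis unfolding rk_def using sm_otp[OF l(1)] by blast
        qed
        have "equipotent (succ x) l" using succ_equipotent[OF ox ix] l(3) equipotent_trans by blast
        then obtain f where f: "bij_betw (ap f) (el (succ x)) (el l)" unfolding equipotent_iff by blast
        have fl: "ap f y \<in> l" if "y \<in> succ x" for y using f that unfolding bij_el_iff by blast
        have fi: "y = z" if "y \<in> succ x" "z \<in> succ x" "ap f y = ap f z" for y z
          using f that unfolding bij_el_iff by metis
        let ?r = "rk (times l M) (lxr l M)" and ?F = "\<lambda>p. opair (ap f (fstp p)) (sndp p)"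
        have FM: "?F p \<in> times l M" if "p \<in> times (succ x) M" for p
          using that fl unfolding mem_times by (auto simp del: mem_succ)
        show ?thesis
        proof (rule smI[OF lk, of "\<lambda>p. ?r (?F p)"])
          show "dfnt (\<lambda>v. ?r (?F (v 0)))" by (intro dfn)
          show "?r (?F p) \<in> l" if "p \<in> times (succ x) M" for p using rl[OF FM[OF that]] .
          show "p = p'" if h: "p \<in> times (succ x) M" "p' \<in> times (succ x) M" "?r (?F p) = ?r (?F p')" for p p'
          proof -
            have "?F p = ?F p'" using rk_inj[OF w FM FM] h by blast
            thus ?thesis using h(1,2) fi unfolding mem_times by (auto simp del: mem_succ)
          qed
        qed
      qed
    qed
  qed
  thus ?thesis using assms by blast
qed

text \<open>The position of \<open>(q,x)\<close> in the lexicographic order of \<open>m \<times> s\<close>, that is, \<open>s \<cdot> q + x\<close>.\<close>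

definition lexpos :: "'a \<Rightarrow> 'a \<Rightarrow> 'a \<Rightarrow> 'a \<Rightarrow> 'a" where
  "lexpos m s q x = rk (times m s) (lxr m s) (opair q x)"

lemma dfnt_lexpos [dfn, simp]:
  "dfnt m \<Longrightarrow> dfnt s \<Longrightarrow> dfnt q \<Longrightarrow> dfnt x \<Longrightarrow> dfnt (\<lambda>v. lexpos (m v) (s v) (q v) (x v))"
  by (rule dfnt_app4[of lexpos]) (unfold lexpos_def, intro dfn)

lemma lexpos:
  assumes k: "initial_ordinal k" "omega \<subseteq> k" and m: "m \<in> omega" and s: "s \<in> k" and q: "q \<in> m" "x \<in> s"
  shows "lexpos m s q x \<in> k"
    and "q' \<in> m \<Longrightarrow> x' \<in> s \<Longrightarrow> lexpos m s q x \<in> lexpos m s q' x' \<longleftrightarrow> q \<in> q' \<or> q = q' \<and> x \<in> x'"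
proof -
  have ok: "ordinal k" using k unfolding initial_ordinal_def by blast
  have w: "wo (times m s) (lxr m s)" by (rule wo_lxr[OF ord_omega_mem[OF m] ord_mem[OF ok s]])
  \<comment> \<open>Exchanges the components, since \<open>initial_times\<close> has the finite
    factor on the right.\<close>
  define F where "F p = setof (\<lambda>z. \<exists>y i. p = opair y i \<and> z \<in> opair i y)" for p
  have D: "dfn1 F" unfolding F_def by (intro dfn)
  have F: "F (opair y i) = opair i y" for y i
    unfolding F_def by (rule mext, subst mem_setof) (auto intro: exI[of _ "opair i y"])
  have "sm k (times m s)"
  proof (rule sm_inj[OF initial_times[OF k m s] D])
    show "F p \<in> times (succ s) m" if "p \<in> times m s" for p using that F by (auto simp: F)
    show "p = p'" if "p \<in> times m s" "p' \<in> times m s" "F p = F p'" for p p' using that by (auto simp: F)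
  qed
  hence o: "otp (times m s) (lxr m s) \<in> k" by (rule sm_otp[OF k(1) w])
  have p: "opair q x \<in> times m s" using q by auto
  show "lexpos m s q x \<in> k" unfolding lexpos_def using ord_trans[OF ok rk_mem[OF w p] o] .
  assume q': "q' \<in> m" "x' \<in> s"
  hence p': "opair q' x' \<in> times m s" by auto
  show "lexpos m s q x \<in> lexpos m s q' x' \<longleftrightarrow> q \<in> q' \<or> q = q' \<and> x \<in> x'"
    unfolding lexpos_def using rk_iff[OF w p p'] q q' by (simp add: mem_lxr)
qed

end

subsection \<open>From sequences to ordinals\<close>

context pieces
begin

text \<open>As in \<open>tight\<close>, the map on pieces is a permutation. It also respects the
  order of the pieces, and an increasing permutation of a finite linear order is the
  identity.\<close>

lemma automorphism_stable:
  assumes F: "dfn1 F" "\<And>t. t \<in> T \<Longrightarrow> F t \<in> T"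
    and inc: "\<And>s t. s \<in> T \<Longrightarrow> t \<in> T \<Longrightarrow> lt R s t \<Longrightarrow> lt R (F s) (F t)"
    and t: "t \<in> T"
  obtains t0 where "t0 \<in> T" "ap pc t0 = ap pc t" "\<And>s. s \<in> tail T W pc t0 \<Longrightarrow> ap pc (F s) = ap pc t"
proof -
  interpret e: piece_embedding mem T R W pc N d T R W pc N d F
    by unfold_locales (use F inc in auto)
  have H: "dfn1 (e.H)" by (intro e.dfnt_H dfn)
  have lev: "otp (e.H Z) W = otp Z W" if "Z \<in> pset" for Z
    by (rule level_preserved[OF fin_pset H, of "\<lambda>Z. otp Z W"])
      (use that e.H_mem pset_ord e.H_le e.H_fibre in \<open>simp_all\<close>)
  have inj: "Y = Z" if "Z \<in> pset" "Y \<in> pset" "e.H Y = e.H Z" for Y Z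
    by (rule e.H_fibre[OF that(1,2) _ that(3)]) (simp add: lev[OF that(1)])
  have surj: "\<exists>Z. Z \<in> pset \<and> e.H Z = Y" if "Y \<in> pset" for Y
    by (rule fin_inj_surj[OF fin_pset H e.H_mem _ that]) (use inj in blast)+
  have st: "e.stable s \<Longrightarrow> s \<in> T" for s using e.stable_def by blast
  have fib: "ap pc s = ap pc r" if "e.stable s" "e.stable r" "ap pc (F s) = ap pc (F r)" for s r
  proof -
    have "piece T pc s = piece T pc r"
      using inj[of "piece T pc r" "piece T pc s"] e.H_eq that piece_cong mem_pset st by metis
    hence "s \<in> piece T pc r" using st that by (metis mem_piece)
    thus ?thesis by simp
  qed
  have mono: "ap pc (F s) \<in> ap pc (F r)" if "e.stable s" "e.stable r" "ap pc s \<in> ap pc r" for s r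
  proof -
    have "lt R (F s) (F r)" using inc pc_less st that by blast
    hence "ap pc (F s) \<in> ap pc (F r) \<or> ap pc (F s) = ap pc (F r)" using pc_le F(2) st that by blast
    moreover have "ap pc (F s) \<noteq> ap pc (F r)" using fib that mem_irrefl by metis
    ultimately show ?thesis by blast
  qed
  have pre: "\<exists>r. e.stable r \<and> ap pc (F r) = ap pc s" if s: "s \<in> T" for s
  proof -
    have "piece T pc s \<in> pset" using s mem_pset by blast
    then obtain Z where Z: "Z \<in> pset" "e.H Z = piece T pc s" using surj by blast
    obtain r where r: "e.stable r" "e.H Z = piece T pc (F r)" using e.pset_stable[OF Z(1)] by metis
    have "s \<in> piece T pc (F r)" using r Z s by (metis mem_piece)
    thus ?thesis using r by auto
  qed
  \<comment> \<open>The least moved piece cannot go down, since the images there are taken by fixed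
    pieces. If it went up, its place would be the image of a later piece, which contradicts
    monotonicity.\<close>
  have fixd: "ap pc (F s) = ap pc s" if s: "e.stable s" for s
  proof (rule ccontr)
    assume n: "ap pc (F s) \<noteq> ap pc s"
    have D: "dfnp (\<lambda>v. \<exists>s. e.stable s \<and> ap pc (F s) \<noteq> ap pc s \<and> v 0 = ap pc s)"
      by (intro dfn e.dfnp_stable dfnt_app1[OF F(1)])
    have ex: "\<exists>r. e.stable r \<and> ap pc (F r) \<noteq> ap pc r \<and> ap pc s = ap pc r" using s n by blast
    obtain q where "ordinal q" and q: "\<exists>s. e.stable s \<and> ap pc (F s) \<noteq> ap pc s \<and> q = ap pc s"
      "\<And>c. c \<in> q \<Longrightarrow> \<not> (\<exists>s. e.stable s \<and> ap pc (F s) \<noteq> ap pc s \<and> c = ap pc s)"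
      by (rule ord_least[OF pc_ord[OF st[OF s]], of "\<lambda>q. \<exists>s. e.stable s \<and> ap pc (F s) \<noteq> ap pc s \<and> q = ap pc s", OF ex D], rule that)
    obtain s1 where s1: "e.stable s1" "ap pc (F s1) \<noteq> ap pc s1" "q = ap pc s1" using q(1) by blast
    have s1T: "s1 \<in> T" using st s1 by blast
    have ok: "ap pc (F r) = ap pc r" if "e.stable r" "ap pc r \<in> ap pc s1" for r using q(2) that s1(3) by blast
    show False
    proof (cases "ap pc (F s1) \<in> ap pc s1")
      case True
      obtain r where r: "e.stable r" "ap pc r = ap pc (F s1)" using e.stable_ex[OF F(2)[OF s1T]] by metis
      hence "ap pc (F r) = ap pc (F s1)" using ok True by metis
      hence "ap pc r = ap pc s1" using fib r s1 by blast
      thus False using r s1 by metis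
    next
      case False
      hence up: "ap pc s1 \<in> ap pc (F s1)" using pc_cases[OF s1T F(2)[OF s1T]] s1(2) by metis
      obtain r where r: "e.stable r" "ap pc (F r) = ap pc s1" using pre[OF s1T] by blast
      have rT: "r \<in> T" using st r by blast
      have "\<not> ap pc r \<in> ap pc s1" using ok r mem_irrefl by metis
      moreover have "ap pc r \<noteq> ap pc s1"
      proof
        assume "ap pc r = ap pc s1"
        from piece_cong[OF this] have "e.H (piece T pc r) = e.H (piece T pc s1)" by simp
        hence "piece T pc (F r) = piece T pc (F s1)" using e.H_eq r s1 by metis
        hence "F r \<in> piece T pc (F s1)" using F(2)[OF rT] by (metis mem_piece)
        thus False using r s1 by simp
      qed
      ultimately have "ap pc s1 \<in> ap pc r" using pc_cases[OF rT s1T] by blast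
      hence "ap pc (F s1) \<in> ap pc s1" using mono[OF s1(1) r(1)] r(2) by simp
      thus False using False by blast
    qed
  qed
  obtain t0 where t0: "e.stable t0" "ap pc t0 = ap pc t" using e.stable_ex[OF t] .
  have "ap pc (F s) = ap pc t" if "s \<in> tail T W pc t0" for s
    using e.stableD[OF t0(1) that] fixd[OF t0(1)] t0(2) by simp
  thus ?thesis using that st t0 by blast
qed

end

text \<open>
  If \<open>k\<close> is singular then \<open>c\<close> maps some \<open>\<rho> < k\<close> cofinally into \<open>k\<close>; otherwise \<open>\<rho>\<close> and \<open>c\<close> are arbitrary.
\<close>

locale reduction = beta_structure mem T S W pc N d wp M e
  for mem :: "'a \<Rightarrow> 'a \<Rightarrow> bool"  (infix "\<in>" 50) and T S W pc N d wp M e +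
  fixes k \<rho> c :: 'a
  assumes init: "initial_ordinal k" and om: "omega \<subseteq> k"
    and small: "t \<in> T \<Longrightarrow> otp (piece T pc t) W \<in> k"
    and singular: "\<lbrakk>r \<in> k; \<And>x. x \<in> r \<Longrightarrow> ap c' x \<in> k; \<And>x. x \<in> k \<Longrightarrow> \<exists>y. y \<in> r \<and> x \<subseteq> ap c' y\<rbrakk> \<Longrightarrow>
      \<rho> \<in> k \<and> (\<forall>x. x \<in> \<rho> \<longrightarrow> ap c x \<in> k) \<and> (\<forall>x. x \<in> k \<longrightarrow> (\<exists>y. y \<in> \<rho> \<and> x \<subseteq> ap c y))"
begin

lemma ok: "ordinal k"
  using init unfolding initial_ordinal_def by blast

definition after :: "'a \<Rightarrow> 'a \<Rightarrow> bool" where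
  "after t s \<longleftrightarrow> s \<in> T \<and> ap pc s = ap pc t \<and> lt W t s"

lemma dfnp_after [simp]: "dfnt f \<Longrightarrow> dfnt g \<Longrightarrow> dfnp (\<lambda>v. after (f v) (g v))"
  by (rule dfnp_app2[of after]) (unfold after_def, intro dfn)

definition emb :: "'a \<Rightarrow> 'a \<Rightarrow> bool" where
  "emb f Y \<longleftrightarrow> isoby f T S Y (lex k) \<and> Y \<subseteq> binary_seqs k"

lemma embD:
  assumes "emb f Y"
  shows emb_mem: "\<And>t. t \<in> T \<Longrightarrow> ap f t \<in> Y" and emb_maps: "\<And>t. t \<in> T \<Longrightarrow> maps (ap f t) k two"
    and emb_iff: "\<And>s t. s \<in> T \<Longrightarrow> t \<in> T \<Longrightarrow> lt S s t \<longleftrightarrow> lt (lex k) (ap f s) (ap f t)"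
    and emb_inj: "\<And>s t. s \<in> T \<Longrightarrow> t \<in> T \<Longrightarrow> ap f s = ap f t \<Longrightarrow> s = t"
    and emb_surj: "\<And>y. y \<in> Y \<Longrightarrow> \<exists>t. t \<in> T \<and> ap f t = y"
    and emb_fun: "fun_on f T"
proof -
  have i: "isoby f T S Y (lex k)" and Y: "Y \<subseteq> binary_seqs k" using assms emb_def by blast+
  show m: "\<And>t. t \<in> T \<Longrightarrow> ap f t \<in> Y" using isoby_memD[OF i] .
  show "\<And>t. t \<in> T \<Longrightarrow> maps (ap f t) k two" using m subsetD[OF Y] mem_binary_seqs by blast
  show "\<And>s t. s \<in> T \<Longrightarrow> t \<in> T \<Longrightarrow> lt S s t \<longleftrightarrow> lt (lex k) (ap f s) (ap f t)"
    using i unfolding isoby_def by blast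
  show "\<And>s t. s \<in> T \<Longrightarrow> t \<in> T \<Longrightarrow> ap f s = ap f t \<Longrightarrow> s = t"
    using i m unfolding isoby_def bij_el_iff by metis
  show "\<And>y. y \<in> Y \<Longrightarrow> \<exists>t. t \<in> T \<and> ap f t = y" using i unfolding isoby_def bij_el_iff by blast
  show "fun_on f T" using i unfolding isoby_def by blast
qed

abbreviation D :: "'a \<Rightarrow> 'a \<Rightarrow> 'a \<Rightarrow> 'a" where
  "D f s t \<equiv> dl k (ap f s) (ap f t)"

lemma D_ord:
  assumes "emb f Y" "s \<in> T" "t \<in> T" "s \<noteq> t"
  shows "D f s t \<in> k" "ordinal (D f s t)"
proof -
  show 1: "D f s t \<in> k"
    by (rule dl(1)[OF ok emb_maps[OF assms(1,2)] emb_maps[OF assms(1,3)]]) (use emb_inj[OF assms(1-3)] assms(4) in blast)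
  thus "ordinal (D f s t)" using ord_mem[OF ok] by blast
qed

lemma D_bits:
  assumes f: "emb f Y" and st: "s \<in> T" "t \<in> T" "lt S s t"
  shows "ap (ap f s) (D f s t) = zero" "ap (ap f t) (D f s t) = one"
  using lex_iff[OF ok emb_maps[OF f st(1)] emb_maps[OF f st(2)]] emb_iff[OF f st(1,2)] st(3) by blast+

text \<open>By \<open>lex_trans\<close> the first difference of the outer pair is the smaller of the
  two inner ones.\<close>

lemma D_outer:
  assumes f: "emb f Y" and st: "r \<in> T" "s \<in> T" "t \<in> T" "lt S r s" "lt S s t"
  shows "D f r t \<subseteq> D f r s" "D f r t \<subseteq> D f s t"
proof -
  have l: "lt (lex k) (ap f r) (ap f s)" "lt (lex k) (ap f s) (ap f t)" using emb_iff[OF f] st by blast+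
  note tr = lex_trans[OF ok l]
  have ne: "r \<noteq> s" "s \<noteq> t" using st lin_irrefl[OF s.lin_R] by blast+
  have o: "ordinal (D f r s)" "ordinal (D f s t)" using D_ord[OF f] st ne by blast+
  show "D f r t \<subseteq> D f r s" "D f r t \<subseteq> D f s t"
    using tr(2,3) ord_mem_subset[OF o(1)] ord_mem_subset[OF o(2)] subset_refl by metis+
qed

lemma D_commute: "D f s t = D f t s"
  by (rule dl_commute)

lemma D_after:
  assumes f: "emb f Y" and t: "t \<in> T" and s: "after t s" and r: "after s r"
  shows "D f t r \<subseteq> D f t s" "D f t r \<subseteq> D f s r"
proof -
  have T: "s \<in> T" "r \<in> T" "ap pc s = ap pc t" "ap pc r = ap pc s" "lt W t s" "lt W s r"
    using s r unfolding after_def by auto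
  show "D f t r \<subseteq> D f t s" "D f t r \<subseteq> D f s r"
  proof (atomize (full), cases "ap d (ap pc t) = zero")
    case True
    have "lt S t s" "lt S s r" using s.dir[OF t T(1)] s.dir[OF T(1,2)] T True by simp_all
    thus "D f t r \<subseteq> D f t s \<and> D f t r \<subseteq> D f s r" using D_outer[OF f t T(1,2)] by blast
  next
    case False
    have "lt S s t" "lt S r s" using s.dir[OF T(1) t] s.dir[OF T(2,1)] T False by simp_all
    thus "D f t r \<subseteq> D f t s \<and> D f t r \<subseteq> D f s r"
      using D_outer[OF f T(2,1) t] D_commute[of f] by metis
  qed
qed

lemma after_trans: "t \<in> T \<Longrightarrow> after t s \<Longrightarrow> after s r \<Longrightarrow> after t r"
  unfolding after_def using s.W_trans[of r t s] by metis

lemma after_ne: "t \<in> T \<Longrightarrow> after t s \<Longrightarrow> s \<noteq> t"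
  unfolding after_def using s.W_irrefl by blast

lemma after_total: "t \<in> T \<Longrightarrow> s \<in> T \<Longrightarrow> ap pc s = ap pc t \<Longrightarrow> s \<noteq> t \<Longrightarrow> after t s \<or> after s t"
  unfolding after_def using s.W_total[of t s] by metis

text \<open>The minimum of \<open>D f t s\<close> over all later \<open>s\<close>, written as an
  intersection of ordinals. The existential conjunct makes the value zero at a point with nothing
  after it, which happens only in one-point pieces.\<close>

definition mm :: "'a \<Rightarrow> 'a \<Rightarrow> 'a" where
  "mm f t = sep k (\<lambda>z. (\<exists>s. after t s) \<and> (\<forall>s. after t s \<longrightarrow> z \<in> D f t s))"

lemma dfnt_mm [simp]: "dfnt f \<Longrightarrow> dfnt g \<Longrightarrow> dfnt (\<lambda>v. mm (f v) (g v))"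
  by (rule dfnt_app2[of mm]) (unfold mm_def, intro dfn dfnp_after)

lemma mm_attained:
  assumes f: "emb f Y" and t: "t \<in> T" and s: "after t s"
  obtains r where "after t r" "mm f t = D f t r"
proof -
  have mem: "z \<in> mm f t \<longleftrightarrow> z \<in> k \<and> (\<exists>s. after t s) \<and> (\<forall>s. after t s \<longrightarrow> z \<in> D f t s)" for z
    unfolding mm_def by simp
  have o: "D f t r \<in> k" "ordinal (D f t r)" if "after t r" for r
    using D_ord[OF f t, of r] after_ne[OF t that] that unfolding after_def by metis+
  have Dm: "dfnp (\<lambda>v. \<exists>r. after t r \<and> v 0 = D f t r)" by simp
  have ex: "\<exists>r. after t r \<and> D f t s = D f t r" using s by blast
  obtain q where "ordinal q" and q: "\<exists>r. after t r \<and> q = D f t r" "\<And>c. c \<in> q \<Longrightarrow> \<not> (\<exists>r. after t r \<and> c = D f t r)"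
    by (rule ord_least[OF o(2)[OF s], of "\<lambda>q. \<exists>r. after t r \<and> q = D f t r", OF ex Dm], rule that)
  obtain r where r: "after t r" "q = D f t r" using q(1) by blast
  have "D f t r \<subseteq> D f t s'" if "after t s'" for s'
    using ord_not_mem[OF o(2)[OF that] o(2)[OF r(1)]] q(2) r(2) that by blast
  hence "mm f t = D f t r" by (intro mext) (use mem r(1) subsetD o(1)[OF r(1)] ord_trans[OF ok] in blast)
  thus ?thesis using that r by blast
qed

lemma mm_le: "emb f Y \<Longrightarrow> t \<in> T \<Longrightarrow> after t s \<Longrightarrow> mm f t \<subseteq> D f t s"
  unfolding mm_def subset_def by simp

lemma mm_last: "\<not> (\<exists>s. after t s) \<Longrightarrow> mm f t = zero"
  unfolding mm_def by (rule mext) simp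

lemma mm_k:
  assumes "emb f Y" "t \<in> T"
  shows "mm f t \<in> k" "ordinal (mm f t)"
proof -
  show 1: "mm f t \<in> k"
  proof (cases "\<exists>s. after t s")
    case True
    then obtain r where r: "after t r" "mm f t = D f t r" using mm_attained[OF assms] by blast
    thus ?thesis using D_ord(1)[OF assms, of r] after_ne[OF assms(2) r(1)] unfolding after_def by metis
  next
    case False
    thus ?thesis using mm_last[OF False] subsetD[OF om zero_omega] by simp
  qed
  thus "ordinal (mm f t)" using ord_mem[OF ok] by blast
qed

lemma after_next: "t \<in> T \<Longrightarrow> after t s \<Longrightarrow> \<exists>r. after s r"
  using s.big_next[of s] s.W_irrefl unfolding after_def s.big_def by metis

lemma mm_mono:
  assumes f: "emb f Y" and t: "t \<in> T" and s: "after t s"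
  shows "mm f t \<subseteq> mm f s"
proof -
  have sT: "s \<in> T" using s after_def by blast
  obtain r where r: "after s r" "mm f s = D f s r" using after_next[OF t s] mm_attained[OF f sT] by metis
  have "mm f t \<subseteq> D f t r" using mm_le[OF f t after_trans[OF t s r(1)]] .
  also have "D f t r \<subseteq> D f s r" using D_after[OF f t s r(1)] by blast
  finally (subset_trans) show ?thesis using r by simp
qed

text \<open>If \<open>s\<close> attains the minimum for \<open>t\<close>, and \<open>r\<close> the
  one for \<open>s\<close>, equality of the two would give the sequence of \<open>s\<close> two
  different bits at one position, because \<open>s\<close> is the right end of one of the pairs and
  the left end of the other.\<close>

lemma mm_incr:
  assumes f: "emb f Y" and t: "t \<in> T" and ex: "\<exists>s. after t s"
  obtains s where "after t s" "mm f t \<in> mm f s"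
proof -
  obtain s where s: "after t s" "mm f t = D f t s" using mm_attained[OF f t] ex by metis
  have sT: "s \<in> T" "ap pc s = ap pc t" "lt W t s" using s after_def by auto
  obtain r where r: "after s r" "mm f s = D f s r" using after_next[OF t s(1)] mm_attained[OF f sT(1)] by metis
  have rT: "r \<in> T" "ap pc r = ap pc s" "lt W s r" using r after_def by auto
  have "mm f t \<noteq> mm f s"
  proof
    assume e: "mm f t = mm f s"
    show False
    proof (cases "ap d (ap pc t) = zero")
      case True
      have "lt S t s" "lt S s r" using s.dir[OF t sT(1)] s.dir[OF sT(1) rT(1)] sT rT True by simp_all
      hence "ap (ap f s) (D f t s) = one" "ap (ap f s) (D f s r) = zero"
        using D_bits[OF f t sT(1)] D_bits[OF f sT(1) rT(1)] by blast+
      thus False using e s r by simp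
    next
      case False
      have "lt S s t" "lt S r s" using s.dir[OF sT(1) t] s.dir[OF rT(1) sT(1)] sT rT False by simp_all
      hence "ap (ap f s) (D f s t) = zero" "ap (ap f s) (D f r s) = one"
        using D_bits[OF f sT(1) t] D_bits[OF f rT(1) sT(1)] by blast+
      thus False using e s r D_commute by simp
    qed
  qed
  hence "mm f t \<in> mm f s"
    using mm_mono[OF f t s(1)] ord_subset_iff mm_k[OF f t] mm_k[OF f sT(1)] by blast
  thus ?thesis using that s by blast
qed

text \<open>Values cofinal in \<open>k\<close> would leave no bound for the length of the blocks in
  \<open>pos\<close>; pieces with this behaviour are treated separately in
  \<open>val\<close>.\<close>

definition unb :: "'a \<Rightarrow> 'a \<Rightarrow> bool" where
  "unb f t \<longleftrightarrow> (\<forall>x. x \<in> k \<longrightarrow> (\<exists>s. s \<in> T \<and> ap pc s = ap pc t \<and> x \<subseteq> mm f s))"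

text \<open>The least \<open>\<xi>\<close> with \<open>x \<subseteq> c(\<xi>)\<close>; used to fold an unbounded piece into the cofinality \<open>\<rho>\<close>.\<close>

definition fold :: "'a \<Rightarrow> 'a" where
  "fold x = sep \<rho> (\<lambda>y. \<forall>z. z \<in> succ y \<longrightarrow> \<not> x \<subseteq> ap c z)"

definition val :: "'a \<Rightarrow> 'a \<Rightarrow> 'a" where
  "val f t = (if unb f t then fold (mm f t) else mm f t)"

lemma dfnp_unb [simp]: "dfnt f \<Longrightarrow> dfnt g \<Longrightarrow> dfnp (\<lambda>v. unb (f v) (g v))"
  by (rule dfnp_app2[of unb]) (unfold unb_def, intro dfn dfnt_mm)

lemma dfnt_fold [simp]: "dfnt f \<Longrightarrow> dfnt (\<lambda>v. fold (f v))"
  by (rule dfnt_app1[of fold]) (unfold fold_def, intro dfn)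

lemma dfnt_val [simp]: "dfnt f \<Longrightarrow> dfnt g \<Longrightarrow> dfnt (\<lambda>v. val (f v) (g v))"
  unfolding val_def by (intro dfn dfnp_unb dfnt_fold dfnt_mm)

lemma unb_cong: "ap pc s = ap pc t \<Longrightarrow> unb f s \<longleftrightarrow> unb f t"
  unfolding unb_def by simp

text \<open>The piece has type below \<open>k\<close>, so its values form a cofinal map into
  \<open>k\<close> from a smaller ordinal. The locale assumption then supplies the fixed pair
  \<open>\<rho>\<close>, \<open>c\<close>, the same for every embedding and every piece.\<close>

lemma unb_singular:
  assumes f: "emb f Y" and t: "t \<in> T" and u: "unb f t"
  shows "\<rho> \<in> k" "\<And>x. x \<in> \<rho> \<Longrightarrow> ap c x \<in> k" "\<forall>x. x \<in> k \<longrightarrow> (\<exists>y. y \<in> \<rho> \<and> x \<subseteq> ap c y)"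
proof -
  note wt = s.wo_piece[OF t]
  note inv = bij_betw_invf[OF rk_bij[OF wt]]
  define c' where "c' = lam (otp (piece T pc t) W) (\<lambda>x. mm f (invf (piece T pc t) (rk (piece T pc t) W) x))"
  have c': "ap c' x = mm f (invf (piece T pc t) (rk (piece T pc t) W) x)" if "x \<in> otp (piece T pc t) W" for x
    unfolding c'_def using that by (intro ap_lam) simp_all
  have "\<rho> \<in> k \<and> (\<forall>x. x \<in> \<rho> \<longrightarrow> ap c x \<in> k) \<and> (\<forall>x. x \<in> k \<longrightarrow> (\<exists>y. y \<in> \<rho> \<and> x \<subseteq> ap c y))"
  proof (rule singular[OF small[OF t], of c'])
    fix x assume x: "x \<in> otp (piece T pc t) W"
    have "invf (piece T pc t) (rk (piece T pc t) W) x \<in> piece T pc t"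
      using inv(1) x unfolding bij_el_iff by blast
    thus "ap c' x \<in> k" using c'[OF x] mm_k(1)[OF f] by simp
  next
    fix x assume "x \<in> k"
    then obtain s where s: "s \<in> T" "ap pc s = ap pc t" "x \<subseteq> mm f s" using u unfolding unb_def by blast
    have sp: "s \<in> piece T pc t" using s by simp
    have "ap c' (rk (piece T pc t) W s) = mm f s" using c'[OF rk_mem[OF wt sp]] inv(3)[OF sp] by simp
    thus "\<exists>y. y \<in> otp (piece T pc t) W \<and> x \<subseteq> ap c' y" using rk_mem[OF wt sp] s(3) by metis
  qed
  thus "\<rho> \<in> k" "\<And>x. x \<in> \<rho> \<Longrightarrow> ap c x \<in> k" "\<forall>x. x \<in> k \<longrightarrow> (\<exists>y. y \<in> \<rho> \<and> x \<subseteq> ap c y)" by blast+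
qed

lemma fold:
  assumes r: "\<rho> \<in> k" "\<forall>x. x \<in> k \<longrightarrow> (\<exists>y. y \<in> \<rho> \<and> x \<subseteq> ap c y)" and x: "x \<in> k"
  shows "fold x \<in> \<rho>" "x \<subseteq> ap c (fold x)" "\<And>z. z \<in> fold x \<Longrightarrow> \<not> x \<subseteq> ap c z"
proof -
  have orr: "ordinal \<rho>" using ord_mem[OF ok r(1)] .
  obtain y where y: "y \<in> \<rho>" "x \<subseteq> ap c y" using r(2) x by blast
  have Dm: "dfnp (\<lambda>v. v 0 \<in> \<rho> \<and> x \<subseteq> ap c (v 0))" by simp
  obtain m where "ordinal m" and m: "m \<in> \<rho> \<and> x \<subseteq> ap c m" "\<And>z. z \<in> m \<Longrightarrow> \<not> (z \<in> \<rho> \<and> x \<subseteq> ap c z)"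
    by (rule ord_least[OF ord_mem[OF orr y(1)], of "\<lambda>m. m \<in> \<rho> \<and> x \<subseteq> ap c m", OF conjI[OF y] Dm], rule that)
  have om: "ordinal m" using ord_mem[OF orr] m by blast
  have m2: "\<not> x \<subseteq> ap c z" if "z \<in> m" for z using m(2)[OF that] ord_trans[OF orr that] m(1) by blast
  have "y \<in> fold x \<longleftrightarrow> y \<in> m" for y
  proof -
    have "y \<in> fold x \<longleftrightarrow> y \<in> \<rho> \<and> (\<forall>z. z \<in> succ y \<longrightarrow> \<not> x \<subseteq> ap c z)" unfolding fold_def by (rule mem_sep) simp
    also have "\<dots> \<longleftrightarrow> y \<in> m"
    proof
      assume h: "y \<in> \<rho> \<and> (\<forall>z. z \<in> succ y \<longrightarrow> \<not> x \<subseteq> ap c z)"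
      hence "\<not> m \<in> succ y" using m(1) by blast
      thus "y \<in> m" using ord_linear[OF ord_mem[OF orr conjunct1[OF h]] om] by auto
    next
      assume ym: "y \<in> m"
      thus "y \<in> \<rho> \<and> (\<forall>z. z \<in> succ y \<longrightarrow> \<not> x \<subseteq> ap c z)"
        using m2 ord_trans[OF om _ ym] ord_trans[OF orr ym] m(1) unfolding mem_succ by blast
    qed
    finally show ?thesis .
  qed
  hence "fold x = m" by (rule mext)
  thus "fold x \<in> \<rho>" "x \<subseteq> ap c (fold x)" "\<And>z. z \<in> fold x \<Longrightarrow> \<not> x \<subseteq> ap c z" using m m2 by simp_all
qed

lemma val_mono:
  assumes f: "emb f Y" and t: "t \<in> T" and s: "after t s"
  shows "val f t \<subseteq> val f s"
proof -
  have sT: "s \<in> T" "ap pc s = ap pc t" using s after_def by auto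
  note u = unb_cong[OF sT(2), of f]
  show ?thesis
  proof (cases "unb f t")
    case True
    note sg = unb_singular[OF f t True]
    note F = fold[OF sg(1,3)]
    note Ft = F[OF mm_k(1)[OF f t]] and Fs = F[OF mm_k(1)[OF f sT(1)]]
    have orr: "ordinal \<rho>" using ord_mem[OF ok sg(1)] .
    have "mm f t \<subseteq> ap c (fold (mm f s))" using subset_trans[OF mm_mono[OF f t s] Fs(2)] .
    hence "\<not> fold (mm f s) \<in> fold (mm f t)" using Ft(3) by blast
    hence "fold (mm f t) \<subseteq> fold (mm f s)" using ord_not_mem ord_mem[OF orr] Ft(1) Fs(1) by blast
    thus ?thesis unfolding val_def using True u by simp
  next
    case False
    thus ?thesis unfolding val_def using u mm_mono[OF f t s] by simp
  qed
qed

text \<open>Folding can identify distinct values but never becomes constant: some later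
  \<open>mm f s1\<close> reaches \<open>c\<close> at the current folded value, and a strictly larger
  value after it needs a larger index.\<close>

lemma val_incr:
  assumes f: "emb f Y" and t: "t \<in> T" and ex: "\<exists>s. after t s"
  obtains s where "after t s" "val f t \<in> val f s"
proof (cases "unb f t")
  case True
  note sg = unb_singular[OF f t True]
  note F = fold[OF sg(1,3)]
  note Ft = F[OF mm_k(1)[OF f t]]
  have orr: "ordinal \<rho>" using ord_mem[OF ok sg(1)] .
  obtain s0 where s0: "s0 \<in> T" "ap pc s0 = ap pc t" "ap c (fold (mm f t)) \<subseteq> mm f s0"
    using True sg(2)[OF Ft(1)] unfolding unb_def by blast
  obtain s1 where s1: "after t s1" "ap c (fold (mm f t)) \<subseteq> mm f s1"
  proof (cases "after t s0")
    case False
    obtain s where "after t s" using ex by blast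
    moreover have "mm f s0 \<subseteq> mm f s"
    proof (cases "s0 = t")
      case True thus ?thesis using mm_mono[OF f t \<open>after t s\<close>] by simp
    next
      case ne: False
      hence "after s0 t" using after_total[OF t s0(1,2)] False by blast
      thus ?thesis using mm_mono[OF f s0(1) after_trans[OF s0(1) _ \<open>after t s\<close>]] by blast
    qed
    ultimately show ?thesis using that s0(3) subset_trans by blast
  qed (use that s0 in blast)
  have s1T: "s1 \<in> T" using s1 after_def by blast
  obtain s where s: "after s1 s" "mm f s1 \<in> mm f s" using mm_incr[OF f s1T after_next[OF t s1(1)]] .
  have ts: "after t s" using after_trans[OF t s1(1) s(1)] .
  have sT: "s \<in> T" "ap pc s = ap pc t" using ts after_def by auto
  note Fs = F[OF mm_k(1)[OF f sT(1)]]
  have "val f t \<noteq> val f s"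
  proof
    assume "val f t = val f s"
    hence "fold (mm f t) = fold (mm f s)" unfolding val_def using True unb_cong[OF sT(2), of f] by simp
    hence "mm f s \<subseteq> mm f s1" using Fs(2) s1(2) subset_trans by metis
    thus False using s(2) mem_irrefl subsetD by blast
  qed
  moreover have "ordinal (val f t)" "ordinal (val f s)"
    unfolding val_def using True unb_cong[OF sT(2), of f] Ft(1) Fs(1) ord_mem[OF orr] by simp_all
  ultimately have "val f t \<in> val f s" using val_mono[OF f t ts] ord_subset_iff by blast
  thus ?thesis using that ts by blast
next
  case False
  obtain s where s: "after t s" "mm f t \<in> mm f s" using mm_incr[OF f t ex] .
  hence "ap pc s = ap pc t" using after_def by blast
  thus ?thesis using that[OF s(1)] s(2) False unb_cong[of s t f] unfolding val_def by simp
qed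

lemma val_bound:
  assumes f: "emb f Y" and t: "t \<in> T"
  shows "\<exists>b. b \<in> k \<and> (\<forall>s. s \<in> T \<and> ap pc s = ap pc t \<longrightarrow> val f s \<in> b)"
proof (cases "unb f t")
  case True
  note sg = unb_singular[OF f t True]
  have "val f s \<in> \<rho>" if "s \<in> T" "ap pc s = ap pc t" for s
    unfolding val_def using True unb_cong[OF that(2), of f] fold(1)[OF sg(1,3) mm_k(1)[OF f that(1)]] by simp
  thus ?thesis using sg(1) by blast
next
  case False
  then obtain b where b: "b \<in> k" "\<And>s. s \<in> T \<Longrightarrow> ap pc s = ap pc t \<Longrightarrow> \<not> b \<subseteq> mm f s" unfolding unb_def by blast
  have "val f s \<in> b" if "s \<in> T" "ap pc s = ap pc t" for s
    unfolding val_def using False unb_cong[OF that(2), of f] b(2)[OF that] ord_not_mem[OF mm_k(2)[OF f that(1)] ord_mem[OF ok b(1)]]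
    by auto
  thus ?thesis using b(1) by blast
qed

lemma val_ord: "emb f Y \<Longrightarrow> t \<in> T \<Longrightarrow> ordinal (val f t)"
  using val_bound[of f Y t] ord_mem[OF ok] ord_mem by blast

text \<open>For an embedding \<open>f\<close> this is the least ordinal above all values, that is,
  the common block length for \<open>pos\<close>.\<close>

definition sg :: "'a \<Rightarrow> 'a" where
  "sg f = sep k (\<lambda>z. \<exists>t. t \<in> T \<and> z \<subseteq> val f t)"

lemma dfnt_sg [simp]: "dfnt f \<Longrightarrow> dfnt (\<lambda>v. sg (f v))"
  by (rule dfnt_app1[of sg]) (unfold sg_def, intro dfn dfnt_val)

lemma mem_sg: "z \<in> sg f \<longleftrightarrow> z \<in> k \<and> (\<exists>t. t \<in> T \<and> z \<subseteq> val f t)"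
  unfolding sg_def by simp

lemma val_k: "emb f Y \<Longrightarrow> t \<in> T \<Longrightarrow> val f t \<in> k"
  using val_bound[of f Y t] ord_trans[OF ok] by blast

lemma val_sg: "emb f Y \<Longrightarrow> t \<in> T \<Longrightarrow> val f t \<in> sg f"
  unfolding mem_sg using val_k subset_refl by blast

text \<open>There are finitely many pieces, so the supremum over them is a maximum, and each piece
  alone is bounded by \<open>val_bound\<close>.\<close>

lemma sg_k:
  assumes f: "emb f Y" and t: "t \<in> T" shows "sg f \<in> k"
proof -
  define b where "b Z = sep k (\<lambda>z. \<exists>t. t \<in> Z \<and> z \<subseteq> val f t)" for Z
  have bD: "dfn1 b" unfolding b_def by (intro dfn dfnt_val)
  have b: "z \<in> b Z \<longleftrightarrow> z \<in> k \<and> (\<exists>t. t \<in> Z \<and> z \<subseteq> val f t)" for z Z unfolding b_def by simp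
  have bo: "ordinal (b Z)" if "Z \<in> s.pset" for Z
  proof (rule ord_memI)
    fix x y assume "y \<in> b Z" "x \<in> y"
    then obtain t where h: "y \<in> k" "x \<in> k" "t \<in> Z" "y \<subseteq> val f t" using b ord_trans[OF ok] by blast
    have "x \<subseteq> y" using ord_mem_subset[OF ord_mem[OF ok h(1)] \<open>x \<in> y\<close>] .
    thus "x \<in> b Z" using b h subset_trans by blast
  qed (use b ord_mem[OF ok] in blast)
  have bk: "b Z \<in> k" if Z: "Z \<in> s.pset" for Z
  proof -
    obtain t where t: "t \<in> T" "Z = piece T pc t" using Z s.mem_pset by blast
    obtain x where x: "x \<in> k" "\<And>s. s \<in> T \<Longrightarrow> ap pc s = ap pc t \<Longrightarrow> val f s \<in> x" using val_bound[OF f t(1)] by blast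
    have ox: "ordinal x" using ord_mem[OF ok x(1)] .
    have "z \<in> x" if z: "z \<in> b Z" for z
    proof -
      obtain s where s: "z \<in> k" "s \<in> T" "ap pc s = ap pc t" "z \<subseteq> val f s" using z t b by auto
      show ?thesis using ord_le_lt[OF ord_mem[OF ok s(1)] val_ord[OF f s(2)] ox s(4) x(2)[OF s(2,3)]] .
    qed
    hence "b Z \<subseteq> x" by (simp add: subset_def)
    thus ?thesis using ord_le_lt[OF bo[OF Z] ox ok _ x(1)] by blast
  qed
  have pt: "piece T pc t \<in> s.pset" using s.mem_pset t by blast
  obtain Z where Z: "Z \<in> s.pset" "\<And>Y. Y \<in> s.pset \<Longrightarrow> b Y \<subseteq> b Z"
    using fin_max[OF s.fin_pset bD bo pt] by blast
  have "sg f = b Z"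
  proof (rule mext)
    fix z show "z \<in> sg f \<longleftrightarrow> z \<in> b Z"
    proof
      assume "z \<in> sg f"
      then obtain t where t: "z \<in> k" "t \<in> T" "z \<subseteq> val f t" using mem_sg by blast
      have "t \<in> piece T pc t" using t by simp
      hence "z \<in> b (piece T pc t)" using b t by blast
      thus "z \<in> b Z" using Z(2) s.mem_pset t(2) subsetD by blast
    next
      assume "z \<in> b Z"
      moreover obtain t where "Z = piece T pc t" using Z(1) s.mem_pset by blast
      ultimately show "z \<in> sg f" unfolding mem_sg b by auto
    qed
  qed
  thus ?thesis using bk[OF Z(1)] by simp
qed

text \<open>Each piece receives its own block of length \<open>sg f\<close>, so the images of the
  pieces are stacked in the order of \<open>W\<close>.\<close>

definition pos :: "'a \<Rightarrow> 'a \<Rightarrow> 'a" where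
  "pos f t = lexpos M (sg f) (ap wp t) (val f t)"

lemma dfnt_pos [simp]: "dfnt f \<Longrightarrow> dfnt g \<Longrightarrow> dfnt (\<lambda>v. pos (f v) (g v))"
  unfolding pos_def by (intro dfn dfnt_sg dfnt_val)

definition nin :: "'a \<Rightarrow> bool" where
  "nin f \<longleftrightarrow> (\<exists>s t. s \<in> T \<and> after s t \<and> val f s = val f t)"

text \<open>Tests for a repetition at the first point of a piece. If repetitions persist in every
  tail of some piece, one full subset passes this test and another fails it, although both still
  contain a repetition; this rules out homogeneity.\<close>

definition ffs :: "'a \<Rightarrow> bool" where
  "ffs f \<longleftrightarrow> (\<exists>s t. s \<in> T \<and> after s t \<and> val f s = val f t \<and> \<not> (\<exists>r. r \<in> T \<and> after r s))"

lemma pos_k: "emb f Y \<Longrightarrow> t \<in> T \<Longrightarrow> pos f t \<in> k"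
  unfolding pos_def using lexpos(1)[OF init om w.N_omega sg_k w.pc_mem val_sg] by blast

lemma pos_less:
  assumes f: "emb f Y" and n: "\<not> nin f" and st: "s \<in> T" "t \<in> T" and W: "lt W s t"
  shows "pos f s \<in> pos f t"
proof -
  note L = lexpos(2)[OF init om w.N_omega sg_k[OF f st(1)] w.pc_mem[OF st(1)] val_sg[OF f st(1)] w.pc_mem[OF st(2)] val_sg[OF f st(2)]]
  have "ap wp s \<in> ap wp t \<or> ap wp s = ap wp t" using w.pc_le[OF st W] .
  moreover have "val f s \<in> val f t" if "ap wp s = ap wp t"
  proof -
    have a: "after s t" unfolding after_def using that pc_wp[OF st] st W by simp
    hence "val f s \<noteq> val f t" using n st unfolding nin_def by blast
    thus ?thesis using val_mono[OF f st(1) a] ord_subset_iff val_ord[OF f] st by blast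
  qed
  ultimately show ?thesis unfolding pos_def L by blast
qed

end

section \<open>Restriction of an embedding to a full subset\<close>

context reduction
begin

text \<open>Composing with \<open>glue U\<close> keeps \<open>T\<close> as the index set, so that
  the image of \<open>U\<close> is again given by an embedding of \<open>T\<close>.\<close>

definition cut :: "'a \<Rightarrow> 'a \<Rightarrow> 'a" where
  "cut f U = lam T (\<lambda>t. ap f (glue U t))"

lemma cut_ap: "t \<in> T \<Longrightarrow> ap (cut f U) t = ap f (glue U t)"
  unfolding cut_def by (rule ap_lam) simp_all

lemma cut_emb:
  assumes f: "emb f Y" and U: "full U"
  shows "emb (cut f U) (img (ap f) U)" and "img (ap f) U \<subseteq> Y"
proof -
  note g = glue[OF U]
  have UT: "U \<subseteq> T" using U full_def by blast
  have mi: "y \<in> img (ap f) U \<longleftrightarrow> (\<exists>u. u \<in> U \<and> y = ap f u)" for y by (rule mem_img) simp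
  show sub: "img (ap f) U \<subseteq> Y" unfolding subset_def mi using emb_mem[OF f] UT subsetD by blast
  have "bij_betw (ap (cut f U)) (el T) (el (img (ap f) U))"
    unfolding bij_el_iff mi
  proof (intro conjI allI impI)
    fix t assume t: "t \<in> T" thus "\<exists>u. u \<in> U \<and> ap (cut f U) t = ap f u" using cut_ap g(1) by blast
  next
    fix y assume "\<exists>u. u \<in> U \<and> y = ap f u"
    then obtain u where u: "u \<in> U" "y = ap f u" by blast
    then obtain t where t: "t \<in> T" "glue U t = u" "\<And>t'. t' \<in> T \<Longrightarrow> glue U t' = u \<Longrightarrow> t' = t"
      using g(6) unfolding bij_el_iff by metis
    have "t' = t" if "t' \<in> T" "ap (cut f U) t' = y" for t'
      using t(3)[OF that(1)] emb_inj[OF f g(3)[OF that(1)]] u UT subsetD that cut_ap by metis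
    thus "\<exists>!t. t \<in> T \<and> ap (cut f U) t = y" using t u cut_ap by blast
  qed
  moreover have "fun_on (cut f U) T" unfolding cut_def by simp
  moreover have "lt S s t \<longleftrightarrow> lt (lex k) (ap (cut f U) s) (ap (cut f U) t)" if "s \<in> T" "t \<in> T" for s t
    using g(5)[OF that] emb_iff[OF f g(3)[OF that(1)] g(3)[OF that(2)]] cut_ap that by simp
  ultimately show "emb (cut f U) (img (ap f) U)"
    unfolding emb_def isoby_def using sub f subset_trans unfolding emb_def by blast
qed

lemma after_glue:
  assumes U: "full U" and "s \<in> T" "t \<in> T"
  shows "after (glue U s) (glue U t) \<longleftrightarrow> after s t"
  unfolding after_def using glue(2,3,4)[OF U] assms(2,3) by metis

lemma glue_surj: "full U \<Longrightarrow> u \<in> U \<Longrightarrow> \<exists>t. t \<in> T \<and> glue U t = u"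
  using glue_bij[of U] unfolding bij_el_iff by blast

text \<open>Every later point \<open>s\<close> is followed or equalled by a later point of
  \<open>U\<close>, namely \<open>glue U s\<close>, and splitting positions only decrease further
  along the piece. So the minimum over \<open>U\<close> is the minimum over the whole piece.\<close>

lemma mm_cut:
  assumes f: "emb f Y" and U: "full U" and t: "t \<in> T"
  shows "mm (cut f U) t = mm f (glue U t)"
proof (rule mext)
  fix z
  note g = glue[OF U]
  have gt: "glue U t \<in> T" using g(3)[OF t] .
  have m: "z \<in> mm f t \<longleftrightarrow> z \<in> k \<and> (\<exists>s. after t s) \<and> (\<forall>s. after t s \<longrightarrow> z \<in> D f t s)" for f t
    unfolding mm_def by simp
  have Dc: "D (cut f U) t s = D f (glue U t) (glue U s)" if "after t s" for s
    using cut_ap t that unfolding after_def by simp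
  have up: "after t s \<and> D f (glue U t) (glue U s) \<subseteq> D f (glue U t) s" if s: "after (glue U t) s" for s
  proof -
    have sT: "s \<in> T" using s after_def by blast
    have "glue U s = s \<or> after s (glue U s)" using g(7)[OF sT] g(2,3)[OF sT] unfolding after_def by blast
    hence "after (glue U t) (glue U s) \<and> D f (glue U t) (glue U s) \<subseteq> D f (glue U t) s"
      using s after_trans[OF gt s] D_after(1)[OF f gt s] subset_refl by metis
    thus ?thesis using after_glue[OF U t sT] by blast
  qed
  have down: "after (glue U t) (glue U s)" if "after t s" for s
    using after_glue[OF U t] that unfolding after_def by blast
  show "z \<in> mm (cut f U) t \<longleftrightarrow> z \<in> mm f (glue U t)"
  proof
    assume "z \<in> mm (cut f U) t"
    hence h: "z \<in> k" "\<exists>s. after t s" "\<And>s. after t s \<Longrightarrow> z \<in> D (cut f U) t s" unfolding m by blast+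
    have "z \<in> D f (glue U t) s" if s: "after (glue U t) s" for s
    proof -
      have "z \<in> D f (glue U t) (glue U s)" using h(3)[of s] Dc[of s] up[OF s] by simp
      thus ?thesis using up[OF s] subsetD by blast
    qed
    thus "z \<in> mm f (glue U t)" unfolding m using h(1,2) down by blast
  next
    assume "z \<in> mm f (glue U t)"
    hence h: "z \<in> k" "\<exists>s. after (glue U t) s" "\<And>s. after (glue U t) s \<Longrightarrow> z \<in> D f (glue U t) s" unfolding m by blast+
    have "z \<in> D (cut f U) t s" if "after t s" for s unfolding Dc[OF that] by (rule h(3)[OF down[OF that]])
    thus "z \<in> mm (cut f U) t" unfolding m using h(1,2) up by blast
  qed
qed

lemma unb_cut:
  assumes f: "emb f Y" and U: "full U" and t: "t \<in> T"
  shows "unb (cut f U) t \<longleftrightarrow> unb f (glue U t)"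
proof -
  note g = glue[OF U]
  have 1: "mm f s \<subseteq> mm f (glue U s)" if s: "s \<in> T" for s
  proof -
    have "glue U s = s \<or> after s (glue U s)" using g(7)[OF s] g(2,3)[OF s] unfolding after_def by blast
    thus ?thesis using mm_mono[OF f s] subset_refl by metis
  qed
  have "(\<exists>s. s \<in> T \<and> ap pc s = ap pc t \<and> x \<subseteq> mm (cut f U) s) \<longleftrightarrow>
    (\<exists>s. s \<in> T \<and> ap pc s = ap pc (glue U t) \<and> x \<subseteq> mm f s)" for x
  proof
    assume "\<exists>s. s \<in> T \<and> ap pc s = ap pc t \<and> x \<subseteq> mm (cut f U) s"
    then obtain s where s: "s \<in> T" "ap pc s = ap pc t" "x \<subseteq> mm (cut f U) s" by blast
    hence "x \<subseteq> mm f (glue U s)" using mm_cut[OF f U s(1)] by simp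
    moreover have "ap pc (glue U s) = ap pc (glue U t)" using g(2) s t by simp
    ultimately show "\<exists>s. s \<in> T \<and> ap pc s = ap pc (glue U t) \<and> x \<subseteq> mm f s" using g(3)[OF s(1)] by blast
  next
    assume "\<exists>s. s \<in> T \<and> ap pc s = ap pc (glue U t) \<and> x \<subseteq> mm f s"
    then obtain s where s: "s \<in> T" "ap pc s = ap pc t" "x \<subseteq> mm f s" using g(2)[OF t] by metis
    have "x \<subseteq> mm (cut f U) s" using subset_trans[OF s(3) 1[OF s(1)]] mm_cut[OF f U s(1)] by simp
    thus "\<exists>s. s \<in> T \<and> ap pc s = ap pc t \<and> x \<subseteq> mm (cut f U) s" using s by blast
  qed
  thus ?thesis unfolding unb_def by simp
qed

lemma val_cut:
  "emb f Y \<Longrightarrow> full U \<Longrightarrow> t \<in> T \<Longrightarrow> val (cut f U) t = val f (glue U t)"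
  unfolding val_def by (simp add: mm_cut unb_cut)

lemma val_glue: "emb f Y \<Longrightarrow> full U \<Longrightarrow> t \<in> T \<Longrightarrow> val f t \<subseteq> val f (glue U t)"
  using glue(2,3,7)[of U t] val_mono[of f Y t "glue U t"] subset_refl unfolding after_def by metis

text \<open>\<open>glue U\<close> moves every point to one with at least the same value. The block
  length must survive restriction, since otherwise \<open>pos\<close> of the restriction would not
  be the restriction of \<open>pos\<close>.\<close>

lemma sg_cut:
  assumes f: "emb f Y" and U: "full U" shows "sg (cut f U) = sg f"
proof -
  have "(\<exists>t. t \<in> T \<and> z \<subseteq> val (cut f U) t) \<longleftrightarrow> (\<exists>t. t \<in> T \<and> z \<subseteq> val f t)" for z
  proof
    assume "\<exists>t. t \<in> T \<and> z \<subseteq> val (cut f U) t"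
    then obtain t where t: "t \<in> T" "z \<subseteq> val f (glue U t)" using val_cut[OF f U] by metis
    thus "\<exists>t. t \<in> T \<and> z \<subseteq> val f t" using glue_T[OF U t(1)] by blast
  next
    assume "\<exists>t. t \<in> T \<and> z \<subseteq> val f t"
    then obtain t where t: "t \<in> T" "z \<subseteq> val f t" by blast
    have "z \<subseteq> val (cut f U) t" using subset_trans[OF t(2) val_glue[OF f U t(1)]] val_cut[OF f U t(1)] by simp
    thus "\<exists>t. t \<in> T \<and> z \<subseteq> val (cut f U) t" using t by blast
  qed
  thus ?thesis by (intro mext) (simp add: mem_sg)
qed

lemma pos_cut: "emb f Y \<Longrightarrow> full U \<Longrightarrow> t \<in> T \<Longrightarrow> pos (cut f U) t = pos f (glue U t)"
  unfolding pos_def using pc_wp[of "glue U t" t] by (simp add: sg_cut val_cut glue_pc glue_T)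

lemma nin_cut:
  assumes f: "emb f Y" and U: "full U"
  shows "nin (cut f U) \<longleftrightarrow> (\<exists>s t. s \<in> U \<and> t \<in> U \<and> after s t \<and> val f s = val f t)" (is "_ \<longleftrightarrow> ?R")
proof
  assume "nin (cut f U)"
  then obtain s t where st: "s \<in> T" "after s t" "val (cut f U) s = val (cut f U) t" unfolding nin_def by blast
  have tT: "t \<in> T" using st after_def by blast
  have "val f (glue U s) = val f (glue U t)" using st(3) val_cut[OF f U st(1)] val_cut[OF f U tT] by simp
  thus ?R using st(2) glue_mem[OF U st(1)] glue_mem[OF U tT] after_glue[OF U st(1) tT] by blast
next
  assume ?R
  then obtain s t where st: "s \<in> U" "t \<in> U" "after s t" "val f s = val f t" by blast
  obtain s' t' where st': "s' \<in> T" "glue U s' = s" "t' \<in> T" "glue U t' = t" using glue_surj[OF U] st by metis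
  have "val (cut f U) s' = val (cut f U) t'" using st(4) st' val_cut[OF f U st'(1)] val_cut[OF f U st'(3)] by simp
  moreover have "after s' t'" using st(3) st' after_glue[OF U st'(1,3)] by simp
  ultimately show "nin (cut f U)" unfolding nin_def using st' by blast
qed

lemma ffs_cut:
  assumes f: "emb f Y" and U: "full U"
  shows "ffs (cut f U) \<longleftrightarrow> (\<exists>s t. s \<in> U \<and> t \<in> U \<and> after s t \<and> val f s = val f t \<and> \<not> (\<exists>r. r \<in> U \<and> after r s))"
    (is "_ \<longleftrightarrow> ?R")
proof
  assume "ffs (cut f U)"
  then obtain s t where st: "s \<in> T" "after s t" "val (cut f U) s = val (cut f U) t" "\<not> (\<exists>r. r \<in> T \<and> after r s)"
    unfolding ffs_def by blast
  have tT: "t \<in> T" using st after_def by blast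
  have "\<not> (\<exists>r. r \<in> U \<and> after r (glue U s))"
  proof
    assume "\<exists>r. r \<in> U \<and> after r (glue U s)"
    then obtain r r' where "r' \<in> T" "glue U r' = r" "after r (glue U s)" using glue_surj[OF U] by blast
    thus False using st(4) after_glue[OF U _ st(1)] by blast
  qed
  moreover have "val f (glue U s) = val f (glue U t)" using st(3) val_cut[OF f U st(1)] val_cut[OF f U tT] by simp
  ultimately show ?R using st(2) glue_mem[OF U st(1)] glue_mem[OF U tT] after_glue[OF U st(1) tT] by blast
next
  assume ?R
  then obtain s t where st: "s \<in> U" "t \<in> U" "after s t" "val f s = val f t" "\<not> (\<exists>r. r \<in> U \<and> after r s)" by blast
  obtain s' t' where st': "s' \<in> T" "glue U s' = s" "t' \<in> T" "glue U t' = t" using glue_surj[OF U] st by metis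
  have "\<not> (\<exists>r. r \<in> T \<and> after r s')" using st(5) st'(2) glue_mem[OF U] after_glue[OF U _ st'(1)] by blast
  moreover have "val (cut f U) s' = val (cut f U) t'" using st(4) st' val_cut[OF f U st'(1)] val_cut[OF f U st'(3)] by simp
  moreover have "after s' t'" using st(3) st' after_glue[OF U st'(1,3)] by simp
  ultimately show "ffs (cut f U)" unfolding ffs_def using st' by blast
qed

text \<open>
  Consecutive pieces of which the left one is reversed and the right one is not: the only place
  where an automorphism of \<open>T\<close> can move points between pieces.
\<close>

definition adj :: "'a \<Rightarrow> 'a \<Rightarrow> bool" where
  "adj s t \<longleftrightarrow> s \<in> T \<and> t \<in> T \<and> ap d (ap pc s) \<noteq> zero \<and> ap d (ap pc t) = zero \<and> ap pc s \<in> ap pc t \<and>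
     \<not> (\<exists>r. r \<in> T \<and> ap pc s \<in> ap pc r \<and> ap pc r \<in> ap pc t)"

text \<open>A rigidity condition: it blocks the only possible movement of points between pieces, see
  \<open>no_move_up\<close>.\<close>

definition good :: "'a \<Rightarrow> bool" where
  "good f \<longleftrightarrow> (\<forall>s t s' t'. adj s t \<and> adj s' t' \<and> ap pc s' = ap pc s \<and> ap pc t' = ap pc t \<longrightarrow> D f s' t' = D f s t)"

lemma goodD:
  "good f \<Longrightarrow> adj s t \<Longrightarrow> adj s' t' \<Longrightarrow> ap pc s' = ap pc s \<Longrightarrow> ap pc t' = ap pc t \<Longrightarrow> D f s' t' = D f s t"
  unfolding good_def by blast

lemma dfnp_adj [simp]: "dfnt f \<Longrightarrow> dfnt g \<Longrightarrow> dfnp (\<lambda>v. adj (f v) (g v))"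
  by (rule dfnp_app2[of adj]) (unfold adj_def, intro dfn)

lemma dfnp_good [simp]: "dfnt f \<Longrightarrow> dfnp (\<lambda>v. good (f v))"
  by (rule dfnp_app1[of good]) (unfold good_def, intro dfn dfnp_adj)

lemma dfnp_emb [simp]: "dfnt f \<Longrightarrow> dfnt Y \<Longrightarrow> dfnp (\<lambda>v. emb (f v) (Y v))"
  by (rule dfnp_app2[of emb]) (unfold emb_def, intro dfn)

lemma dfnp_nin [simp]: "dfnt f \<Longrightarrow> dfnp (\<lambda>v. nin (f v))"
  by (rule dfnp_app1[of nin]) (unfold nin_def, intro dfn dfnp_after dfnt_val)

lemma dfnp_ffs [simp]: "dfnt f \<Longrightarrow> dfnp (\<lambda>v. ffs (f v))"
  by (rule dfnp_app1[of ffs]) (unfold ffs_def, intro dfn dfnp_after dfnt_val)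

lemma adj_cong:
  assumes "adj s t" "s' \<in> T" "ap pc s' = ap pc s" "t' \<in> T" "ap pc t' = ap pc t"
  shows "adj s' t'"
  using assms unfolding adj_def by simp

lemma good_cut:
  assumes U: "full U" and "good f" shows "good (cut f U)"
  unfolding good_def
proof (intro allI impI)
  fix s t s' t' assume h: "adj s t \<and> adj s' t' \<and> ap pc s' = ap pc s \<and> ap pc t' = ap pc t"
  hence T: "s \<in> T" "t \<in> T" "s' \<in> T" "t' \<in> T" unfolding adj_def by blast+
  note g = glue(2,3)[OF U]
  have a: "adj (glue U s) (glue U t)" "adj (glue U s') (glue U t')" using adj_cong h g T by blast+
  have "D f (glue U s') (glue U t') = D f (glue U s) (glue U t)"
    by (rule goodD[OF assms(2) a]) (use g T h in simp_all)
  thus "D (cut f U) s' t' = D (cut f U) s t" using cut_ap T by simp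
qed

lemma adj_less: "adj s t \<Longrightarrow> lt S s t"
  unfolding adj_def using s.pc_less by blast

text \<open>A tail of each piece is kept in place by \<open>automorphism_stable\<close>. This forces
  a point \<open>t\<close> moving up to lie in a reversed piece, and its image \<open>r\<close> in
  an unreversed one directly after it. Constancy of the first difference across the junction then
  yields one position where the sequence of \<open>t\<close> under \<open>f\<close> has bit 0 and
  that of \<open>r\<close> under \<open>f'\<close> has bit 1, although the two sequences are
  equal.\<close>

lemma no_move_up:
  assumes f: "emb f Y" "good f" and f': "emb f' Y" "good f'"
    and a: "dfn1 a" "\<And>t. t \<in> T \<Longrightarrow> a t \<in> T" "\<And>s t. s \<in> T \<Longrightarrow> t \<in> T \<Longrightarrow> lt S s t \<Longrightarrow> lt S (a s) (a t)"
    and b: "dfn1 b" "\<And>t. t \<in> T \<Longrightarrow> b t \<in> T" "\<And>s t. s \<in> T \<Longrightarrow> t \<in> T \<Longrightarrow> lt S s t \<Longrightarrow> lt S (b s) (b t)"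
    and ba: "\<And>t. t \<in> T \<Longrightarrow> b (a t) = t" and ab: "\<And>t. t \<in> T \<Longrightarrow> a (b t) = t"
    and fa: "\<And>t. t \<in> T \<Longrightarrow> ap f t = ap f' (a t)" and t: "t \<in> T"
  shows "\<not> ap pc t \<in> ap pc (a t)"
proof
  assume lt: "ap pc t \<in> ap pc (a t)"
  define r where "r = a t"
  have r: "r \<in> T" "b r = t" "ap pc t \<in> ap pc r" using a(2)[OF t] ba[OF t] lt unfolding r_def by auto
  obtain t0 where t0: "t0 \<in> T" "ap pc t0 = ap pc t" "\<And>s. s \<in> tail T W pc t0 \<Longrightarrow> ap pc (a s) = ap pc t"
    using s.automorphism_stable[OF a t] by blast
  obtain r0 where r0: "r0 \<in> T" "ap pc r0 = ap pc r" "\<And>s. s \<in> tail T W pc r0 \<Longrightarrow> ap pc (b s) = ap pc r"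
    using s.automorphism_stable[OF b r(1)] by blast
  \<comment> \<open>In an unreversed piece the points beyond \<open>t\<close> would have to move up
    with it, but a tail of them stays.\<close>
  have dt: "ap d (ap pc t) \<noteq> zero"
  proof
    assume z: "ap d (ap pc t) = zero"
    obtain u where u: "u \<in> tail T W pc t0" "u \<in> tail T W pc t"
      using s.tail_or[OF t t0(1)] t0 t by (metis mem_tail)
    have uT: "u \<in> T" "ap pc u = ap pc t" using u by auto
    have "u = t \<or> lt S t u" using u(2) s.dir[OF t uT(1)] uT z by auto
    hence "a u = a t \<or> lt S (a t) (a u)" using a(3)[OF t uT(1)] by blast
    hence "ap pc (a t) = ap pc (a u) \<or> ap pc (a t) \<in> ap pc (a u)" using s.pc_le[OF a(2)[OF t] a(2)[OF uT(1)]] by metis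
    thus False using t0(3)[OF u(1)] lt mem_asym mem_irrefl by metis
  qed
  have dr: "ap d (ap pc r) = zero"
  proof (rule ccontr)
    assume z: "ap d (ap pc r) \<noteq> zero"
    obtain u where u: "u \<in> tail T W pc r0" "u \<in> tail T W pc r"
      using s.tail_or[OF r(1) r0(1)] r0 r by (metis mem_tail)
    have uT: "u \<in> T" "ap pc u = ap pc r" using u by auto
    have "u = r \<or> lt S u r" using u(2) s.dir[OF uT(1) r(1)] uT z by auto
    hence "b u = b r \<or> lt S (b u) (b r)" using b(3)[OF uT(1) r(1)] by blast
    hence "ap pc (b u) = ap pc (b r) \<or> ap pc (b u) \<in> ap pc (b r)" using s.pc_le[OF b(2)[OF uT(1)] b(2)[OF r(1)]] by metis
    thus False using r0(3)[OF u(1)] r(2,3) mem_asym mem_irrefl by metis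
  qed
  have nb: "\<not> (\<exists>q. q \<in> T \<and> ap pc t \<in> ap pc q \<and> ap pc q \<in> ap pc r)"
  proof
    assume "\<exists>q. q \<in> T \<and> ap pc t \<in> ap pc q \<and> ap pc q \<in> ap pc r"
    then obtain q where q: "q \<in> T" "ap pc t \<in> ap pc q" "ap pc q \<in> ap pc r" by blast
    obtain q0 where q0: "q0 \<in> T" "ap pc q0 = ap pc q" "\<And>s. s \<in> tail T W pc q0 \<Longrightarrow> ap pc (a s) = ap pc q"
      using s.automorphism_stable[OF a q(1)] by blast
    have e: "ap pc (a q0) = ap pc q" using q0(3)[of q0] q0(1) by simp
    have "lt S t q0" using s.pc_less[OF t q0(1)] q0 q by simp
    hence "lt S (a t) (a q0)" using a(3)[OF t q0(1)] by blast
    hence "ap pc r \<in> ap pc q \<or> ap pc r = ap pc q" using s.pc_le[OF a(2)[OF t] a(2)[OF q0(1)]] e r_def by metis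
    thus False using q(3) mem_asym mem_irrefl by metis
  qed
  have adj: "adj t r" unfolding adj_def using t r dt dr nb by blast
  \<comment> \<open>\<open>a\<close> sends \<open>t0\<close> to \<open>a t0\<close> and
    \<open>v\<close> to \<open>r0\<close>, and each of these points lies in the same piece as its
    image. This pair links the constant first difference of \<open>f\<close> to that of
    \<open>f'\<close>.\<close>
  define v where "v = b r0"
  have v: "v \<in> T" "ap pc v = ap pc r" "a v = r0" unfolding v_def using b(2)[OF r0(1)] r0(3)[of r0] ab[OF r0(1)] r0(1) by auto
  have at0: "a t0 \<in> T" "ap pc (a t0) = ap pc t" using a(2)[OF t0(1)] t0(3)[of t0] t0(1) by auto
  have A: "adj t0 v" "adj t v" "adj (a t0) r0" "adj (a t0) r" using adj_cong[OF adj] t t0(1,2) v r(1) r0(1,2) at0 by blast+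
  have 1: "D f t v = D f t0 v" by (rule goodD[OF f(2) A(1,2) t0(2)[symmetric] refl])
  have 2: "D f' (a t0) r = D f' (a t0) r0" by (rule goodD[OF f'(2) A(3,4) refl r0(2)[symmetric]])
  have 3: "D f t0 v = D f' (a t0) r0" using fa[OF t0(1)] fa[OF v(1)] v(3) by simp
  have "ap (ap f t) (D f t v) = zero" using D_bits(1)[OF f(1) t v(1) adj_less[OF A(2)]] .
  moreover have "ap (ap f' r) (D f' (a t0) r) = one" using D_bits(2)[OF f'(1) at0(1) r(1) adj_less[OF A(4)]] .
  ultimately show False using 1 2 3 fa[OF t] r_def by simp
qed

text \<open>Two such embeddings with the same range differ by an automorphism \<open>a\<close> of
  \<open>T\<close>. Neither \<open>a\<close> nor its inverse moves a point to a later piece, so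
  pieces are preserved, and a piece is rigid because \<open>W\<close> well-orders it.\<close>

lemma good_unique:
  assumes f: "emb f Y" "good f" and f': "emb f' Y" "good f'"
  shows "f = f'"
proof -
  define a where "a t = invf T (ap f') (ap f t)" for t
  define b where "b t = invf T (ap f) (ap f' t)" for t
  have bij: "bij_betw (ap f) (el T) (el Y)" "bij_betw (ap f') (el T) (el Y)" using f f' unfolding emb_def isoby_def by blast+
  note I = bij_betw_invf[OF bij(1)] and I' = bij_betw_invf[OF bij(2)]
  have aD: "dfn1 a" and bD: "dfn1 b" unfolding a_def b_def by (intro dfn)+
  have aT: "a t \<in> T" "ap f' (a t) = ap f t" if "t \<in> T" for t
    unfolding a_def using I'(1,2) emb_mem[OF f(1) that] unfolding bij_el_iff by blast+
  have bT: "b t \<in> T" "ap f (b t) = ap f' t" if "t \<in> T" for t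
    unfolding b_def using I(1,2) emb_mem[OF f'(1) that] unfolding bij_el_iff by blast+
  have ba: "b (a t) = t" if "t \<in> T" for t using emb_inj[OF f(1)] aT bT that by metis
  have ab: "a (b t) = t" if "t \<in> T" for t using emb_inj[OF f'(1)] aT bT that by metis
  have ai: "lt S s t \<longleftrightarrow> lt S (a s) (a t)" if "s \<in> T" "t \<in> T" for s t
    using emb_iff[OF f(1) that] emb_iff[OF f'(1) aT(1)[OF that(1)] aT(1)[OF that(2)]] aT(2) that by simp
  have bi: "lt S s t \<longleftrightarrow> lt S (b s) (b t)" if "s \<in> T" "t \<in> T" for s t
    using emb_iff[OF f'(1) that] emb_iff[OF f(1) bT(1)[OF that(1)] bT(1)[OF that(2)]] bT(2) that by simp
  have up: "\<not> ap pc t \<in> ap pc (a t)" if "t \<in> T" for t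
    by (rule no_move_up[OF f f' aD aT(1) _ bD bT(1) _ ba ab _ that]) (use ai bi aT(2) in auto)
  have down: "\<not> ap pc t \<in> ap pc (b t)" if "t \<in> T" for t
    by (rule no_move_up[OF f' f bD bT(1) _ aD aT(1) _ ab ba _ that]) (use ai bi bT(2) in auto)
  have pca: "ap pc (a t) = ap pc t" if t: "t \<in> T" for t
    using up[OF t] down[OF aT(1)[OF t]] ba[OF t] s.pc_cases[OF t aT(1)[OF t]] by metis
  have aid: "a t = t" if t: "t \<in> T" for t
  proof -
    let ?P = "piece T pc t"
    have W: "lt W x y \<longleftrightarrow> lt W (a x) (a y)" if "x \<in> ?P" "y \<in> ?P" for x y
    proof -
      have xy: "x \<in> T" "y \<in> T" "ap pc x = ap pc y" "ap pc y = ap pc t" using that by auto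
      have axy: "a x \<in> T" "a y \<in> T" "ap pc (a x) = ap pc (a y)" "ap pc (a y) = ap pc t" using aT(1) pca xy by simp_all
      show ?thesis
        using s.dir[OF xy(1,2,3)] s.dir[OF xy(2,1) xy(3)[symmetric]] s.dir[OF axy(1,2,3)] s.dir[OF axy(2,1) axy(3)[symmetric]]
          ai[OF xy(1,2)] ai[OF xy(2,1)] xy axy by (cases "ap d (ap pc t) = zero") simp_all
    qed
    have b': "bij_betw a (el ?P) (el ?P)" unfolding bij_el_iff
    proof (intro conjI allI impI)
      fix x assume "x \<in> ?P" thus "a x \<in> ?P" using aT(1) pca by simp
    next
      fix y assume y: "y \<in> ?P"
      have "b y \<in> ?P" using y bT(1) pca[of "b y"] ab[of y] by simp
      moreover have "a (b y) = y" using ab y by simp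
      moreover have "x = b y" if "x \<in> ?P" "a x = y" for x using that ba by auto
      ultimately show "\<exists>!x. x \<in> ?P \<and> a x = y" by blast
    qed
    have tp: "t \<in> ?P" using t by simp
    have "rk ?P W (a t) = rk ?P W t" by (rule rk_iso[OF s.wo_piece[OF t] aD b' W tp])
    moreover have "a t \<in> ?P" using aT(1)[OF t] pca[OF t] by simp
    ultimately show ?thesis using rk_inj[OF s.wo_piece[OF t]] tp by blast
  qed
  show ?thesis by (rule fun_on_ext[OF emb_fun[OF f(1)] emb_fun[OF f'(1)]]) (use aT(2) aid in metis)
qed

definition least_split :: "'a \<Rightarrow> 'a \<Rightarrow> 'a \<Rightarrow> bool" where
  "least_split f s t \<longleftrightarrow> adj s t \<and> (\<forall>s' t'. adj s' t' \<and> ap pc s' = ap pc s \<and> ap pc t' = ap pc t \<longrightarrow> D f s t \<subseteq> D f s' t')"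

lemma dfnp_least_split [simp]: "dfnt g \<Longrightarrow> dfnt h \<Longrightarrow> dfnp (\<lambda>v. least_split f (g v) (h v))"
  by (rule dfnp_app2[of "least_split f"]) (unfold least_split_def, intro dfn dfnp_adj)

lemma least_split_ex:
  assumes f: "emb f Y" and a: "adj s t"
  obtains s0 t0 where "least_split f s0 t0" "ap pc s0 = ap pc s" "ap pc t0 = ap pc t"
proof -
  have o: "ordinal (D f s' t')" if "adj s' t'" for s' t'
    by (rule D_ord(2)[OF f]) (use that mem_irrefl in \<open>unfold adj_def, blast+\<close>)
  let ?Q = "\<lambda>q. \<exists>s' t'. adj s' t' \<and> ap pc s' = ap pc s \<and> ap pc t' = ap pc t \<and> q = D f s' t'"
  have Dm: "dfnp (\<lambda>v. ?Q (v 0))" by simp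
  have ex: "?Q (D f s t)" using a by blast
  obtain q where "ordinal q" and q: "?Q q" "\<And>c. c \<in> q \<Longrightarrow> \<not> ?Q c"
    by (rule ord_least[OF o[OF a], of ?Q, OF ex Dm], rule that)
  obtain s0 t0 where st: "adj s0 t0" "ap pc s0 = ap pc s" "ap pc t0 = ap pc t" "q = D f s0 t0" using q(1) by blast
  have "D f s0 t0 \<subseteq> D f s' t'" if "adj s' t'" "ap pc s' = ap pc s0" "ap pc t' = ap pc t0" for s' t'
  proof -
    have "\<not> D f s' t' \<in> q" using q(2)[of "D f s' t'"] that st by metis
    thus ?thesis using ord_not_mem[OF o[OF that(1)] o[OF st(1)]] st(4) by simp
  qed
  hence "least_split f s0 t0" unfolding least_split_def using st(1) by blast
  thus ?thesis using that st by blast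
qed

text \<open>Moving away from the junction lowers the first difference, so the points that take part
  in a least one include a tail of each of the two pieces. \<open>U\<close> keeps these
  points.\<close>

lemma thin:
  assumes f: "emb f Y"
  obtains U where "full U" "good (cut f U)"
proof -
  define U where "U = sep T (\<lambda>t. (\<forall>s. adj t s \<longrightarrow> (\<exists>s'. ap pc s' = ap pc s \<and> least_split f t s')) \<and>
    (\<forall>s. adj s t \<longrightarrow> (\<exists>s'. ap pc s' = ap pc s \<and> least_split f s' t)))"
  have U: "t \<in> U \<longleftrightarrow> t \<in> T \<and> (\<forall>s. adj t s \<longrightarrow> (\<exists>s'. ap pc s' = ap pc s \<and> least_split f t s')) \<and>
    (\<forall>s. adj s t \<longrightarrow> (\<exists>s'. ap pc s' = ap pc s \<and> least_split f s' t))" for t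
    unfolding U_def by simp
  have uniq: "ap pc s = ap pc s'" if "adj t s" "adj t s'" for t s s'
    using that s.pc_cases[of s s'] unfolding adj_def by blast
  have uniq': "ap pc s = ap pc s'" if "adj s t" "adj s' t" for t s s'
    using that s.pc_cases[of s s'] unfolding adj_def by blast
  have excl: False if "adj t s" "adj s' t" for t s s' using that unfolding adj_def by blast
  have full: "full U"
  proof (rule full_tails)
    show "U \<subseteq> T" by (simp add: subset_def U)
    fix t assume t: "t \<in> T"
    consider (l) s where "adj t s" | (r) s where "adj s t" | (n) "\<And>s. \<not> adj t s" "\<And>s. \<not> adj s t" by blast
    thus "\<exists>s. s \<in> T \<and> ap pc s = ap pc t \<and> tail T W pc s \<subseteq> U"
    proof cases
      case l
      obtain t0 s0 where ts: "least_split f t0 s0" "ap pc t0 = ap pc t" "ap pc s0 = ap pc s" using least_split_ex[OF f l] .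
      have a0: "adj t0 s0" using ts least_split_def by blast
      have T: "t0 \<in> T" "s0 \<in> T" using a0 adj_def by blast+
      have "u \<in> U" if u: "u \<in> tail T W pc t0" for u
      proof -
        have uT: "u \<in> T" "ap pc u = ap pc t0" using u by auto
        have au: "adj u s0" using adj_cong[OF a0 uT T(2)] by blast
        have "D f u s0 \<subseteq> D f t0 s0"
        proof (cases "u = t0")
          case False
          hence "lt W t0 u" using u by auto
          moreover have "ap d (ap pc t0) \<noteq> zero" using a0 adj_def by blast
          ultimately have "lt S u t0" using s.dir[OF uT(1) T(1) uT(2)] by simp
          thus ?thesis using D_outer(2)[OF f uT(1) T _ adj_less[OF a0]] by blast
        qed simp
        hence "least_split f u s0" using ts(1) au uT(2) subset_trans unfolding least_split_def by metis
        thus ?thesis unfolding U using uT(1) au uniq excl by metis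
      qed
      thus ?thesis using T(1) ts(2) by (auto simp: subset_def)
    next
      case r
      obtain s0 t0 where ts: "least_split f s0 t0" "ap pc s0 = ap pc s" "ap pc t0 = ap pc t" using least_split_ex[OF f r] .
      have a0: "adj s0 t0" using ts least_split_def by blast
      have T: "t0 \<in> T" "s0 \<in> T" using a0 adj_def by blast+
      have "u \<in> U" if u: "u \<in> tail T W pc t0" for u
      proof -
        have uT: "u \<in> T" "ap pc u = ap pc t0" using u by auto
        have au: "adj s0 u" using adj_cong[OF a0 T(2) refl uT] by blast
        have "D f s0 u \<subseteq> D f s0 t0"
        proof (cases "u = t0")
          case False
          hence "lt W t0 u" using u by auto
          moreover have "ap d (ap pc u) = zero" using au adj_def by blast
          ultimately have "lt S t0 u" using s.dir[OF T(1) uT(1)] uT(2) by simp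
          thus ?thesis using D_outer(1)[OF f T(2,1) uT(1) adj_less[OF a0]] by blast
        qed simp
        hence "least_split f s0 u" using ts(1) au uT(2) subset_trans unfolding least_split_def by metis
        thus ?thesis unfolding U using uT(1) au uniq' excl by metis
      qed
      thus ?thesis using T(1) ts(2,3) by (auto simp: subset_def)
    next
      case n
      have "u \<in> U" if u: "u \<in> tail T W pc t" for u
      proof -
        have uT: "u \<in> T" "ap pc u = ap pc t" using u by auto
        thus ?thesis unfolding U using n t unfolding adj_def by metis
      qed
      thus ?thesis using t by (auto simp: subset_def)
    qed
  qed
  have min: "D f s t = D f s' t'" if "least_split f s t" "least_split f s' t'" "ap pc s' = ap pc s" "ap pc t' = ap pc t" for s t s' t'
    using that subset_antisym unfolding least_split_def by metis
  \<comment> \<open>Each of \<open>s\<close> and \<open>t\<close> realises the least position with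
    some partner. At that position the sequence of \<open>s\<close> has bit 0 and that of
    \<open>t\<close> has bit 1, so the two differ there, and minimality gives equality.\<close>
  have key: "least_split f s t" if st: "s \<in> U" "t \<in> U" "adj s t" for s t
  proof -
    have T: "s \<in> T" "t \<in> T" using st U by blast+
    obtain t1 where t1: "ap pc t1 = ap pc t" "least_split f s t1" using st U by blast
    obtain s1 where s1: "ap pc s1 = ap pc s" "least_split f s1 t" using st U by blast
    have a: "adj s t1" "adj s1 t" using t1 s1 least_split_def by blast+
    have T1: "t1 \<in> T" "s1 \<in> T" using a adj_def by blast+
    have e: "D f s t1 = D f s1 t" by (rule min[OF t1(2) s1(2)]) (use t1 s1 in simp_all)
    have "ap (ap f s) (D f s t1) = zero" "ap (ap f t) (D f s1 t) = one"
      using D_bits(1)[OF f T(1) T1(1) adj_less[OF a(1)]] D_bits(2)[OF f T1(2) T(2) adj_less[OF a(2)]] by blast+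
    hence ne: "ap (ap f s) (D f s t1) \<noteq> ap (ap f t) (D f s t1)" using e by simp
    have sub: "D f s t1 \<subseteq> D f s t" using t1 st(3) unfolding least_split_def by metis
    have stne: "s \<noteq> t" "s \<noteq> t1" using st(3) a(1) unfolding adj_def by auto
    have "\<not> D f s t1 \<in> D f s t" using dl(3)[OF ok emb_maps[OF f T(1)] emb_maps[OF f T(2)]] ne emb_inj[OF f T] stne by blast
    hence "D f s t = D f s t1" using sub ord_subset_iff[OF D_ord(2)[OF f T(1) T1(1) stne(2)] D_ord(2)[OF f T stne(1)]] by metis
    thus ?thesis using t1 st(3) unfolding least_split_def by metis
  qed
  have "good (cut f U)" unfolding good_def
  proof (intro allI impI)
    fix s t s' t' assume h: "adj s t \<and> adj s' t' \<and> ap pc s' = ap pc s \<and> ap pc t' = ap pc t"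
    hence T: "s \<in> T" "t \<in> T" "s' \<in> T" "t' \<in> T" unfolding adj_def by blast+
    note g = glue(2,3)[OF full] and gm = glue(1)[OF full]
    have a: "adj (glue U s) (glue U t)" "adj (glue U s') (glue U t')" using adj_cong h g T by blast+
    have "D f (glue U s') (glue U t') = D f (glue U s) (glue U t)"
      by (rule min[OF key[OF gm[OF T(3)] gm[OF T(4)] a(2)] key[OF gm[OF T(1)] gm[OF T(2)] a(1)]])
        (use g T h in simp_all)
    thus "D (cut f U) s' t' = D (cut f U) s t" using cut_ap T by simp
  qed
  thus ?thesis using that full by blast
qed

lemma tail_after: "t \<in> T \<Longrightarrow> s \<in> tail T W pc t \<longleftrightarrow> s = t \<or> after t s"
  unfolding after_def mem_tail by auto

lemma first_ex:
  assumes t: "t \<in> T"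
  obtains r where "r \<in> T" "ap pc r = ap pc t" "\<And>s. \<not> (s \<in> T \<and> after s r)"
proof -
  obtain m where m: "m \<in> piece T pc t" "True" "\<And>y. y \<in> piece T pc t \<Longrightarrow> True \<Longrightarrow> y = m \<or> lt W m y"
    by (rule wo_least[OF s.wo_piece[OF t], of t "\<lambda>x. True"]) (use t in auto)
  have mT: "m \<in> T" "ap pc m = ap pc t" using m by auto
  have "\<not> (s \<in> T \<and> after s m)" for s
  proof
    assume h: "s \<in> T \<and> after s m"
    hence "s \<in> piece T pc t" "lt W s m" "s \<noteq> m" using mT after_ne unfolding after_def by auto
    thus False using m(3)[of s] s.W_asym[OF mT(1), of s] h unfolding after_def by auto
  qed
  thus ?thesis using that mT by blast
qed

lemma full_tail_piece:
  assumes s: "s \<in> T" shows "full (sep T (\<lambda>t. ap pc t \<noteq> ap pc s \<or> t = s \<or> after s t))"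
proof (rule full_tails)
  let ?U = "sep T (\<lambda>t. ap pc t \<noteq> ap pc s \<or> t = s \<or> after s t)"
  have U: "t \<in> ?U \<longleftrightarrow> t \<in> T \<and> (ap pc t \<noteq> ap pc s \<or> t = s \<or> after s t)" for t by simp
  show "?U \<subseteq> T" unfolding subset_def U by blast
  fix t assume t: "t \<in> T"
  show "\<exists>r. r \<in> T \<and> ap pc r = ap pc t \<and> tail T W pc r \<subseteq> ?U"
  proof (cases "ap pc t = ap pc s")
    case True
    have "tail T W pc s \<subseteq> ?U" unfolding subset_def U tail_after[OF s] using s after_def by blast
    thus ?thesis using s True[symmetric] by blast
  next
    case False
    have "tail T W pc t \<subseteq> ?U" unfolding subset_def U using False by (metis mem_tail)
    thus ?thesis using t by blast
  qed
qed

theorem arrow_lex_imp_arrow_ordinal: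
  assumes arr: "arrow (binary_seqs k) (lex k) T S T S"
  shows "arrow k (memrel k) T W T W"
  unfolding arrow_iff
proof (intro allI impI)
  fix G assume G: "maps G (subsets_of_type k (memrel k) T W) two"
  define Zs where "Zs f = img (pos f) T" for f
  have ZD: "dfnt (\<lambda>v. Zs (g v))" if "dfnt g" for g
    by (rule dfnt_app1[of Zs, OF _ that]) (unfold Zs_def, intro dfn dfnt_pos)
  have Zs: "z \<in> Zs f \<longleftrightarrow> (\<exists>t. t \<in> T \<and> z = pos f t)" for z f unfolding Zs_def by (rule mem_img) simp
  define one_col where "one_col f \<longleftrightarrow> (nin f \<and> ffs f) \<or> (\<not> nin f \<and> ap G (Zs f) = one)" for f
  \<comment> \<open>By \<open>good_unique\<close> at most one good embedding has range
    \<open>Y\<close>, so the existential quantifier reads off its colour. The default zero for sets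
    without one does no harm once a homogeneous set has been thinned.\<close>
  define F where "F = lam (subsets_of_type (binary_seqs k) (lex k) T S)
    (\<lambda>Y. if \<exists>f. emb f Y \<and> good f \<and> one_col f then one else zero)"
  have FD: "dfnt (\<lambda>v. if \<exists>f. emb f (v 0) \<and> good f \<and> one_col f then one else zero)"
    unfolding one_col_def by (intro dfn dfnp_emb dfnp_good dfnp_nin dfnp_ffs ZD)
  have F_ap: "ap F Y = (if one_col f then one else zero)" if f: "emb f Y" "good f" for f Y
  proof -
    have i: "isomorphic Y (lex k) T S" using isomorphic_sym f(1) unfolding emb_def isomorphic_iff by (metis isomorphic_iff isomorphic_sym)
    have "Y \<in> subsets_of_type (binary_seqs k) (lex k) T S" using f(1) i unfolding emb_def by simp
    hence "ap F Y = (if \<exists>f. emb f Y \<and> good f \<and> one_col f then one else zero)" unfolding F_def by (rule ap_lam[OF FD])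
    moreover have "(\<exists>f. emb f Y \<and> good f \<and> one_col f) \<longleftrightarrow> one_col f" using good_unique[OF f] f by blast
    ultimately show ?thesis by simp
  qed
  have "maps F (subsets_of_type (binary_seqs k) (lex k) T S) two"
    unfolding maps_iff
  proof (intro conjI allI impI)
    show "fun_on F (subsets_of_type (binary_seqs k) (lex k) T S)" unfolding F_def by (rule fun_on_lam[OF FD])
    fix Y assume "Y \<in> subsets_of_type (binary_seqs k) (lex k) T S"
    hence "ap F Y = (if \<exists>f. emb f Y \<and> good f \<and> one_col f then one else zero)" unfolding F_def by (rule ap_lam[OF FD])
    thus "ap F Y \<in> two" by simp
  qed
  then obtain H where H: "H \<subseteq> binary_seqs k" "isomorphic H (lex k) T S"
    and hom: "\<And>X Y. X \<subseteq> H \<Longrightarrow> isomorphic X (lex k) T S \<Longrightarrow> Y \<subseteq> H \<Longrightarrow> isomorphic Y (lex k) T S \<Longrightarrow> ap F X = ap F Y"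
    using arr unfolding arrow_iff by (metis (no_types, lifting))
  obtain h where h: "emb h H" using isomorphic_sym[OF H(2)] H(1) unfolding isomorphic_iff emb_def by blast
  obtain U0 where U0: "full U0" "good (cut h U0)" using thin[OF h] .
  define f where "f = cut h U0"
  define Y0 where "Y0 = img (ap h) U0"
  have f: "emb f Y0" "good f" and Y0H: "Y0 \<subseteq> H" unfolding f_def Y0_def using cut_emb[OF h U0(1)] U0(2) by blast+
  have const: "one_col (cut f U) \<longleftrightarrow> one_col (cut f V)" if U: "full U" and V: "full V" for U V
  proof -
    note cU = cut_emb[OF f(1) U] and cV = cut_emb[OF f(1) V]
    have "isomorphic (img (ap f) U) (lex k) T S" "isomorphic (img (ap f) V) (lex k) T S"
      using cU(1) cV(1) isomorphic_sym unfolding emb_def isomorphic_iff by (metis isomorphic_iff isomorphic_sym)+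
    hence "ap F (img (ap f) U) = ap F (img (ap f) V)"
      by (intro hom) (use cU(2) cV(2) Y0H subset_trans in blast)+
    thus ?thesis using F_ap[OF cU(1) good_cut[OF U f(2)]] F_ap[OF cV(1) good_cut[OF V f(2)]] by (auto split: if_splits)
  qed
  \<comment> \<open>If repetitions persisted in every tail of some piece, two full subsets of
    different colour would arise: \<open>U\<close> starts that piece with a repeated value, while
    \<open>V\<close> starts no piece in this way and still contains a repetition.\<close>
  have reg: "\<exists>t. t \<in> T \<and> ap pc t = ap pc t0 \<and> (\<forall>s s'. s \<in> tail T W pc t \<and> after s s' \<longrightarrow> val f s \<noteq> val f s')" if t0: "t0 \<in> T" for t0
  proof (rule ccontr)
    assume n: "\<not> ?thesis"
    have bad: "\<exists>s s'. s \<in> tail T W pc t \<and> after s s' \<and> val f s = val f s'" if "t \<in> T" "ap pc t = ap pc t0" for t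
      using n that by blast
    obtain s s' where s: "s \<in> tail T W pc t0" "after s s'" "val f s = val f s'" using bad[OF t0] by blast
    have sT: "s \<in> T" "s' \<in> T" using s(1,2) unfolding after_def by auto
    define U where "U = sep T (\<lambda>t. ap pc t \<noteq> ap pc s \<or> t = s \<or> after s t)"
    have fU: "full U" unfolding U_def by (rule full_tail_piece[OF sT(1)])
    have Um: "t \<in> U \<longleftrightarrow> t \<in> T \<and> (ap pc t \<noteq> ap pc s \<or> t = s \<or> after s t)" for t unfolding U_def by simp
    have sU: "s \<in> U" "s' \<in> U" using sT s Um by blast+
    have "\<not> (\<exists>r. r \<in> U \<and> after r s)"
    proof
      assume "\<exists>r. r \<in> U \<and> after r s"
      then obtain r where r: "r \<in> U" "after r s" by blast
      hence rT: "r \<in> T" "ap pc s = ap pc r" using Um after_def by blast+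
      have "r \<noteq> s" using after_ne rT r by blast
      hence "after s r" using r Um rT by auto
      thus False using after_trans[OF sT(1) _ r(2)] after_ne[OF sT(1)] by blast
    qed
    hence "ffs (cut f U)" "nin (cut f U)"
      unfolding ffs_cut[OF f(1) fU] nin_cut[OF f(1) fU] using sU s(2,3) by blast+
    hence 1: "one_col (cut f U)" unfolding one_col_def by blast
    let ?fst = "\<lambda>t. \<not> (\<exists>r. r \<in> T \<and> after r t)"
    \<comment> \<open>Each piece keeps its first point and, behind it, only points with a strictly
      larger value. By \<open>val_incr\<close> and \<open>val_mono\<close> a tail of the piece
      survives.\<close>
    define V where "V = sep T (\<lambda>t. ?fst t \<or> (\<exists>r. r \<in> T \<and> after r t \<and> ?fst r \<and> val f r \<in> val f t))"
    have Vm: "t \<in> V \<longleftrightarrow> t \<in> T \<and> (?fst t \<or> (\<exists>r. r \<in> T \<and> after r t \<and> ?fst r \<and> val f r \<in> val f t))" for t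
      unfolding V_def by simp
    have tl: "\<exists>q. q \<in> T \<and> ap pc q = ap pc t \<and> tail T W pc q \<subseteq> V" if t: "t \<in> T" for t
    proof -
      obtain r where r: "r \<in> T" "ap pc r = ap pc t" "\<And>s. \<not> (s \<in> T \<and> after s r)" by (rule first_ex[OF t], rule that)
      show ?thesis
      proof (cases "\<exists>q. after r q")
        case True
        obtain q where q: "after r q" "val f r \<in> val f q" using val_incr[OF f(1) r(1) True] .
        have qT: "q \<in> T" "ap pc q = ap pc r" using q after_def by blast+
        have "u \<in> V" if "u = q \<or> after q u" for u
        proof -
          have u: "u \<in> T" "after r u" using that qT q(1) after_trans[OF r(1) q(1)] after_def by blast+
          have "val f q \<subseteq> val f u"
          proof (cases "u = q")
            case False
            thus ?thesis using that val_mono[OF f(1) qT(1)] by blast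
          qed simp
          hence "val f r \<in> val f u" using q(2) subsetD by blast
          thus ?thesis using Vm[of u] r u by blast
        qed
        hence "tail T W pc q \<subseteq> V" unfolding subset_def tail_after[OF qT(1)] by blast
        moreover have "ap pc q = ap pc t" using qT(2) r(2) by simp
        ultimately show ?thesis using qT(1) by blast
      next
        case False
        hence "tail T W pc r \<subseteq> V" unfolding subset_def tail_after[OF r(1)] using r Vm by blast
        thus ?thesis using r by blast
      qed
    qed
    have fV: "full V" by (rule full_tails[OF _ tl]) (simp_all add: subset_def Vm)
    obtain q where q: "q \<in> T" "ap pc q = ap pc t0" "tail T W pc q \<subseteq> V" using tl[OF t0] by blast
    obtain x y where xy: "x \<in> tail T W pc q" "after x y" "val f x = val f y" using bad[OF q(1,2)] by blast
    have "y \<in> tail T W pc q" using xy(1,2) after_trans[OF q(1)] unfolding tail_after[OF q(1)] by blast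
    hence "x \<in> V" "y \<in> V" using xy(1) q(3) subsetD by blast+
    hence "nin (cut f V)" unfolding nin_cut[OF f(1) fV] using xy by blast
    moreover have "\<not> ffs (cut f V)"
    proof
      assume "ffs (cut f V)"
      then obtain x y where xy: "x \<in> V" "y \<in> V" "after x y" "val f x = val f y" "\<not> (\<exists>r. r \<in> V \<and> after r x)"
        unfolding ffs_cut[OF f(1) fV] by blast
      have xT: "x \<in> T" "y \<in> T" using xy Vm by blast+
      have fx: "?fst x"
      proof (rule ccontr)
        assume "\<not> ?fst x"
        then obtain r where r: "r \<in> T" "after r x" "?fst r" using xy(1) Vm by blast
        hence "r \<in> V" using Vm by blast
        thus False using xy(5) r by blast
      qed
      obtain r where r: "r \<in> T" "after r y" "?fst r" "val f r \<in> val f y" using xy(2,3) Vm xT by blast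
      have "r = x"
      proof (rule ccontr)
        assume "r \<noteq> x"
        moreover have "ap pc r = ap pc x" using r(2) xy(3) unfolding after_def by simp
        ultimately have "after x r \<or> after r x" using after_total[OF xT(1) r(1)] by blast
        thus False using fx r(1,3) xT(1) by blast
      qed
      thus False using r(4) xy(4) by simp
    qed
    ultimately have "\<not> one_col (cut f V)" unfolding one_col_def by blast
    thus False using 1 const[OF fU fV] by blast
  qed
  define U where "U = sep T (\<lambda>t. \<forall>s s'. s \<in> tail T W pc t \<and> after s s' \<longrightarrow> val f s \<noteq> val f s')"
  have Um: "t \<in> U \<longleftrightarrow> t \<in> T \<and> (\<forall>s s'. s \<in> tail T W pc t \<and> after s s' \<longrightarrow> val f s \<noteq> val f s')" for t
    unfolding U_def by (rule mem_sep) (intro dfn dfnp_after dfnt_val)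
  have fU: "full U"
  proof (rule full_tails)
    show "U \<subseteq> T" unfolding subset_def Um by blast
    fix t assume "t \<in> T"
    then obtain q where q: "q \<in> T" "ap pc q = ap pc t" "\<And>s s'. s \<in> tail T W pc q \<Longrightarrow> after s s' \<Longrightarrow> val f s \<noteq> val f s'"
      using reg by blast
    have "u \<in> U" if u: "u \<in> tail T W pc q" for u
    proof -
      have uT: "u \<in> T" using u by simp
      show ?thesis unfolding Um using uT q(3) s.tail_trans[OF q(1) u] by blast
    qed
    hence "tail T W pc q \<subseteq> U" unfolding subset_def by blast
    thus "\<exists>s. s \<in> T \<and> ap pc s = ap pc t \<and> tail T W pc s \<subseteq> U" using q by blast
  qed
  define f1 where "f1 = cut f U"
  define Y1 where "Y1 = img (ap f) U"
  have f1: "emb f1 Y1" unfolding f1_def Y1_def by (rule cut_emb(1)[OF f(1) fU])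
  have nn: "\<not> nin f1" unfolding f1_def nin_cut[OF f(1) fU]
  proof
    assume "\<exists>s t. s \<in> U \<and> t \<in> U \<and> after s t \<and> val f s = val f t"
    then obtain s t where st: "s \<in> U" "after s t" "val f s = val f t" by blast
    have "s \<in> tail T W pc s" using st(1) Um by simp
    thus False using st Um by blast
  qed
  have pinc: "lt (memrel k) (pos f1 s) (pos f1 t)" if "s \<in> T" "t \<in> T" "lt W s t" for s t
    using pos_less[OF f1 nn that] pos_k[OF f1] that by simp
  have lk: "lin k (memrel k)" using wo_lin[OF wo_memrel[OF ok]] .
  have lT: "lin T W" using wo_lin[OF wo_W] .
  have pD: "dfnt (\<lambda>v. pos f1 (v 0))" by simp
  have piff: "lt W s t \<longleftrightarrow> lt (memrel k) (pos f1 s) (pos f1 t)" if "s \<in> T" "t \<in> T" for s t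
    by (rule inc_iff(1)[of T W k "memrel k" "pos f1", OF lT lk pos_k[OF f1] pinc that])
  have pinj: "s = t" if "s \<in> T" "t \<in> T" "pos f1 s = pos f1 t" for s t
    by (rule inc_iff(2)[of T W k "memrel k" "pos f1", OF lT lk pos_k[OF f1] pinc that])
  define K where "K = Zs f1"
  have Kk: "K \<subseteq> k" unfolding K_def subset_def Zs using pos_k[OF f1] by blast
  have Kiso: "isomorphic K (memrel k) T W"
    unfolding K_def Zs_def by (rule isomorphic_sym[OF inc_iso[OF lT lk pD pos_k[OF f1] pinc]])
  \<comment> \<open>A copy \<open>Z\<close> of \<open>W\<close> inside \<open>K\<close> has a full
    set \<open>V\<close> of indices. The restriction of \<open>f1\<close> to \<open>V\<close> has
    \<open>Z\<close> as its set of positions, so its colour decides whether \<open>G\<close> gives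
    \<open>Z\<close> the value one.\<close>
  have key: "(\<exists>V. full V \<and> (one_col (cut f V) \<longleftrightarrow> ap G Z = one))" if Z: "Z \<subseteq> K" "isomorphic Z (memrel k) T W" for Z
  proof -
    define V where "V = sep T (\<lambda>t. pos f1 t \<in> Z)"
    have Vm: "t \<in> V \<longleftrightarrow> t \<in> T \<and> pos f1 t \<in> Z" for t unfolding V_def by simp
    have VT: "V \<subseteq> T" by (simp add: subset_def Vm)
    have b: "bij_betw (pos f1) (el V) (el Z)" unfolding bij_el_iff Vm
    proof (intro conjI allI impI)
      fix z assume z: "z \<in> Z"
      then obtain t where t: "t \<in> T" "z = pos f1 t" using Z(1) unfolding K_def subset_def Zs by blast
      show "\<exists>!t. (t \<in> T \<and> pos f1 t \<in> Z) \<and> pos f1 t = z" using t z pinj by blast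
    qed blast
    have "isomorphic V W Z (memrel k)" by (rule isomorphicI[OF pD b]) (use piff Vm in blast)
    hence "isomorphic V W T W" using Z(2) isomorphic_trans by blast
    hence fV: "full V" using iso_W_full[OF VT] by blast
    define g where "g = cut f1 V"
    have gg: "good g" unfolding g_def f1_def by (intro good_cut fV fU f(2))
    have ge: "emb g (img (ap f1) V)" unfolding g_def by (rule cut_emb(1)[OF f1 fV])
    have ng: "\<not> nin g" unfolding g_def nin_cut[OF f1 fV] using nn VT subsetD unfolding nin_def by blast
    have "Zs g = Z"
    proof (rule mext)
      fix z
      have "z \<in> Zs g \<longleftrightarrow> (\<exists>t. t \<in> T \<and> z = pos f1 (glue V t))"
        unfolding Zs g_def using pos_cut[OF f1 fV] by metis
      also have "\<dots> \<longleftrightarrow> (\<exists>u. u \<in> V \<and> z = pos f1 u)" using glue_mem[OF fV] glue_surj[OF fV] by metis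
      also have "\<dots> \<longleftrightarrow> z \<in> Z" using b unfolding bij_el_iff by metis
      finally show "z \<in> Zs g \<longleftrightarrow> z \<in> Z" .
    qed
    hence col: "one_col g \<longleftrightarrow> ap G Z = one" unfolding one_col_def using ng by simp
    have fUV: "full (img (glue U) V)"
    proof -
      have D: "dfnt (\<lambda>v. glue U (v 0))" by simp
      have "isomorphic V S (img (glue U) V) S"
        by (rule inc_iso[OF lin_subset[OF s.lin_R VT] s.lin_R D]) (use glue(3,5)[OF fU] VT subsetD in blast)+
      hence "isomorphic (img (glue U) V) S T S" using full_iso_S[OF fV] isomorphic_sym isomorphic_trans by blast
      moreover have "img (glue U) V \<subseteq> T" unfolding subset_def mem_img[OF D] using glue_T[OF fU] VT subsetD by blast
      ultimately show ?thesis using iso_S_full by blast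
    qed
    let ?X = "img (glue U) V"
    have D: "dfnt (\<lambda>v. glue U (v 0))" by simp
    have e: "emb (cut f ?X) (img (ap f) ?X)" by (rule cut_emb(1)[OF f(1) fUV])
    have "img (ap f) ?X = img (ap f1) V"
    proof (rule mext)
      fix y
      have "y \<in> img (ap f) ?X \<longleftrightarrow> (\<exists>u. u \<in> V \<and> y = ap f (glue U u))" by (auto simp: mem_img[OF D])
      also have "\<dots> \<longleftrightarrow> (\<exists>u. u \<in> V \<and> y = ap f1 u)" unfolding f1_def using cut_ap VT subsetD by metis
      finally show "y \<in> img (ap f) ?X \<longleftrightarrow> y \<in> img (ap f1) V" by auto
    qed
    \<comment> \<open>\<open>const\<close> speaks of restrictions of \<open>f\<close>, whereas
      \<open>g\<close> restricts the restriction \<open>f1\<close>. Both are good with the same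
      range, hence equal.\<close>
    hence "cut f ?X = g" using good_unique[OF e good_cut[OF fUV f(2)] _ gg] ge by simp
    thus ?thesis using fUV col by blast
  qed
  have G2: "ap G Z = zero \<or> ap G Z = one" if "Z \<subseteq> K" "isomorphic Z (memrel k) T W" for Z
    using G that Kk subset_trans unfolding maps_iff mem_subsets_of_type mem_two by blast
  show "\<exists>H. H \<subseteq> k \<and> isomorphic H (memrel k) T W \<and> (\<forall>X Y. X \<subseteq> H \<and> isomorphic X (memrel k) T W \<and>
      Y \<subseteq> H \<and> isomorphic Y (memrel k) T W \<longrightarrow> ap G X = ap G Y)"
  proof (intro exI[of _ K] conjI Kk Kiso allI impI)
    fix X Y assume h: "X \<subseteq> K \<and> isomorphic X (memrel k) T W \<and> Y \<subseteq> K \<and> isomorphic Y (memrel k) T W"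
    obtain V where V: "full V" "one_col (cut f V) \<longleftrightarrow> ap G X = one" using key h by blast
    obtain V' where V': "full V'" "one_col (cut f V') \<longleftrightarrow> ap G Y = one" using key h by blast
    have "ap G X = one \<longleftrightarrow> ap G Y = one" using V(2) V'(2) const[OF V(1) V'(1)] by blast
    thus "ap G X = ap G Y" using G2[of X] G2[of Y] h by auto
  qed
qed

end

subsection \<open>Ordinal sums and powers of \<open>\<omega>\<close>\<close>

context zf_model
begin

text \<open>The sums \<open>sum_set\<close> and \<open>sum_rel\<close> with the definable application \<open>ap\<close> in place of \<open>app\<close>.\<close>

definition dsum :: "'a \<Rightarrow> 'a \<Rightarrow> 'a" where
  "dsum I b = setof (\<lambda>p. \<exists>i x. i \<in> I \<and> x \<in> ap b i \<and> p = opair i x)"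

definition dsr :: "'a \<Rightarrow> 'a \<Rightarrow> 'a \<Rightarrow> 'a" where
  "dsr I b d = setof (\<lambda>p. \<exists>i x j y.
     i \<in> I \<and> x \<in> ap b i \<and> j \<in> I \<and> y \<in> ap b j \<and> p = opair (opair i x) (opair j y) \<and>
     (i \<in> j \<or> i = j \<and> (ap d i = zero \<and> x \<in> y \<or> ap d i = one \<and> y \<in> x)))"

lemma mem_dsum [simp]: "p \<in> dsum I b \<longleftrightarrow> (\<exists>i x. i \<in> I \<and> x \<in> ap b i \<and> p = opair i x)"
  unfolding dsum_def
proof (rule mem_setof)
  have "dfn1 (ap b)" by simp
  thus "\<exists>u. \<forall>z. z \<in> u \<longleftrightarrow> (\<exists>i x. i \<in> I \<and> x \<in> ap b i \<and> z = opair i x)"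
    by (intro exI[of _ "sep (times I (unite (img (ap b) I))) (\<lambda>p. \<exists>i x. i \<in> I \<and> x \<in> ap b i \<and> p = opair i x)"]) auto
qed

lemma mem_dsr: "opair (opair i x) (opair j y) \<in> dsr I b d \<longleftrightarrow>
    i \<in> I \<and> x \<in> ap b i \<and> j \<in> I \<and> y \<in> ap b j \<and>
    (i \<in> j \<or> i = j \<and> (ap d i = zero \<and> x \<in> y \<or> ap d i = one \<and> y \<in> x))"
proof -
  let ?P = "\<lambda>p. \<exists>i x j y.
     i \<in> I \<and> x \<in> ap b i \<and> j \<in> I \<and> y \<in> ap b j \<and> p = opair (opair i x) (opair j y) \<and>
     (i \<in> j \<or> i = j \<and> (ap d i = zero \<and> x \<in> y \<or> ap d i = one \<and> y \<in> x))"
  have "\<exists>u. \<forall>z. z \<in> u \<longleftrightarrow> ?P z"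
    by (rule exI[of _ "sep (times (dsum I b) (dsum I b)) ?P"]) auto
  thus ?thesis unfolding dsr_def by (subst mem_setof) auto
qed

lemma dfnt_dsum [dfn, simp]: "dfnt I \<Longrightarrow> dfnt b \<Longrightarrow> dfnt (\<lambda>v. dsum (I v) (b v))"
  by (rule dfnt_app2[of dsum]) (unfold dsum_def, intro dfn)

lemma dfnt_dsr [dfn, simp]: "dfnt I \<Longrightarrow> dfnt b \<Longrightarrow> dfnt d \<Longrightarrow> dfnt (\<lambda>v. dsr (I v) (b v) (d v))"
  by (rule dfnt_app3[of dsr]) (unfold dsr_def, intro dfn)

lemma sum_set_eq: "fun_on b I \<Longrightarrow> sum_set I b = dsum I b"
  unfolding sum_set_def dsum_def by (rule arg_cong[where f = setof], rule ext) (metis fun_on_ap(2))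

lemma sum_rel_eq: "fun_on b I \<Longrightarrow> fun_on d I \<Longrightarrow> sum_rel I b d = dsr I b d"
  unfolding sum_rel_def dsr_def
  by (rule arg_cong[where f = setof], rule ext, intro ex_cong1 conj_cong refl) (simp_all add: fun_on_ap(2))

lemma const_eq: "const I c = lam I (\<lambda>i. c)"
  unfolding const_def lam_def ..

lemma fun_on_const [simp]: "fun_on (const I c) I"
  unfolding const_eq by simp

lemma ap_const [simp]: "i \<in> I \<Longrightarrow> ap (const I c) i = c"
  unfolding const_eq by simp

lemma dfnt_const_fun [dfn, simp]: "dfnt I \<Longrightarrow> dfnt c \<Longrightarrow> dfnt (\<lambda>v. const (I v) (c v))"
  by (rule dfnt_app2[of const]) (unfold const_eq, intro dfn)

definition osr :: "'a \<Rightarrow> 'a \<Rightarrow> 'a" where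
  "osr I b = dsr I b (const I zero)"

lemma mem_osr: "lt (osr I b) (opair i x) (opair j y) \<longleftrightarrow>
    i \<in> I \<and> x \<in> ap b i \<and> j \<in> I \<and> y \<in> ap b j \<and> (i \<in> j \<or> i = j \<and> x \<in> y)"
  unfolding osr_def mem_dsr by auto

lemma dfnt_osr [dfn, simp]: "dfnt I \<Longrightarrow> dfnt b \<Longrightarrow> dfnt (\<lambda>v. osr (I v) (b v))"
  by (rule dfnt_app2[of osr]) (unfold osr_def, intro dfn)

lemma wo_agree:
  assumes "wo A R" "\<And>x y. x \<in> A \<Longrightarrow> y \<in> A \<Longrightarrow> lt R x y \<longleftrightarrow> lt R' x y"
  shows "wo A R'"
proof (rule wo_iso[OF _ assms(1)])
  show "isomorphic A R' A R" by (rule isomorphicI[of "\<lambda>x. x"]) (simp_all add: assms(2) bij_betw_def)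
qed

lemma wo_dsum:
  assumes I: "ordinal I" and b: "\<And>i. i \<in> I \<Longrightarrow> ordinal (ap b i)"
  shows "wo (dsum I b) (osr I b)"
proof -
  \<comment> \<open>A bound for all summands, so that the sum becomes a suborder of one
    lexicographic product.\<close>
  let ?c = "unite (img (ap b) I)"
  have D: "dfn1 (ap b)" by simp
  have "ordinal ?c" by (rule ord_unite) (use b in \<open>auto simp: mem_img[OF D]\<close>)
  hence w: "wo (times I ?c) (lxr I ?c)" by (rule wo_lxr[OF I])
  have sub: "dsum I b \<subseteq> times I ?c" unfolding subset_def by (auto simp: mem_img[OF D])
  have "wo (dsum I b) (lxr I ?c)" by (rule wo_subset[OF w sub])
  thus ?thesis
  proof (rule wo_agree)
    fix x y assume x: "x \<in> dsum I b" and y: "y \<in> dsum I b"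
    obtain i u where i: "x = opair i u" "i \<in> I" "u \<in> ap b i" using x by auto
    obtain j w where j: "y = opair j w" "j \<in> I" "w \<in> ap b j" using y by auto
    have "u \<in> ?c" "w \<in> ?c" using i j by (auto simp: mem_img[OF D])
    thus "opair x y \<in> lxr I ?c \<longleftrightarrow> lt (osr I b) x y"
      unfolding i(1) j(1) mem_lxr mem_osr using i j by blast
  qed
qed

lemma osum_eq:
  assumes "ordinal I" "fun_on b I" "\<And>i. i \<in> I \<Longrightarrow> ordinal (ap b i)"
  shows "osum I b = otp (dsum I b) (osr I b)"
  unfolding osum_def sum_set_eq[OF assms(2)] sum_rel_eq[OF assms(2) fun_on_const] osr_def[symmetric]
  by (rule otp(3)[OF wo_dsum[OF assms(1,3)]])

definition mul :: "'a \<Rightarrow> 'a \<Rightarrow> 'a" where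
  "mul a c = otp (times c a) (lxr c a)"

lemma dfnt_mul [dfn, simp]: "dfnt a \<Longrightarrow> dfnt c \<Longrightarrow> dfnt (\<lambda>v. mul (a v) (c v))"
  by (rule dfnt_app2[of mul]) (unfold mul_def, intro dfn)

lemma omult_eq:
  assumes a: "ordinal a" and c: "ordinal c"
  shows "omult a c = mul a c"
proof -
  have b: "ordinal (ap (const c a) i)" if "i \<in> c" for i using a that by simp
  have s: "dsum c (const c a) = times c a" 
  proof (rule mext)
    fix z
    have "z \<in> dsum c (const c a) \<longleftrightarrow> (\<exists>i x. i \<in> c \<and> x \<in> a \<and> z = opair i x)"
      unfolding mem_dsum using ap_const[of _ c a] by metis
    thus "z \<in> dsum c (const c a) \<longleftrightarrow> z \<in> times c a" by simp
  qed
  have r: "isomorphic (times c a) (osr c (const c a)) (times c a) (lxr c a)"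
    by (rule isomorphicI[of "\<lambda>x. x"]) (auto simp: bij_betw_def mem_osr mem_lxr)
  have "osum c (const c a) = otp (times c a) (osr c (const c a))"
    using osum_eq[of c "const c a", OF c fun_on_const b] unfolding s by blast
  also have "\<dots> = mul a c" unfolding mul_def
    using otp_iso_iff[OF wo_dsum[of c "const c a", OF c b] wo_lxr[OF c a]] r unfolding s by blast
  finally show ?thesis unfolding omult_def .
qed

lemma ord_mul: "ordinal a \<Longrightarrow> ordinal c \<Longrightarrow> ordinal (mul a c)"
  unfolding mul_def by (rule otp(1)[OF wo_lxr])

lemma mul_mono:
  assumes "ordinal a" "ordinal b" "ordinal c" "a \<subseteq> b"
  shows "mul a c \<subseteq> mul b c"
  unfolding mul_def
  by (rule otp_le[OF wo_lxr[OF assms(3,1)] wo_lxr[OF assms(3,2)], of "\<lambda>x. x"])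
    (use assms(4) subsetD in \<open>auto simp: mem_lxr\<close>)

lemma mul_less:
  assumes a: "ordinal a" "zero \<in> a" and c: "ordinal c" "c' \<in> c"
  shows "mul a c' \<in> mul a c"
  unfolding mul_def
  by (rule otp_lt[OF wo_lxr[OF ord_mem[OF c] a(1)] wo_lxr[OF c(1) a(1)], of "\<lambda>x. x" "opair c' zero"])
    (use a c ord_trans[OF c(1)] in \<open>auto simp: mem_lxr\<close>)

lemma mul_ge:
  assumes a: "ordinal a" and c: "ordinal c" "c \<noteq> zero"
  shows "a \<subseteq> mul a c"
proof -
  have "zero \<in> c" by (rule ord_zero_mem[OF c])
  hence "otp a (memrel a) \<subseteq> mul a c" unfolding mul_def
    by (intro otp_le[OF wo_memrel[OF a] wo_lxr[OF c(1) a], of "opair zero"]) (auto simp: mem_lxr)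
  thus ?thesis unfolding otp_ordinal[OF a] .
qed

lemma mem_mul_omega:
  assumes "ordinal a" "zero \<in> a"
  shows "a \<in> mul a omega"
  using ord_le_lt[OF assms(1) _ _ mul_ge[OF assms(1), of one] mul_less[OF assms ord_omega, of one]]
    ord_mul[OF assms(1)] by (simp add: one_def)

text \<open>The increasing enumeration of the numbers above \<open>i\<close>, obtained from ranks;
  it serves in place of addition of natural numbers.\<close>

lemma omega_shift:
  assumes i: "i \<in> omega"
  obtains f where "fun_on f omega" "\<And>n. n \<in> omega \<Longrightarrow> ap f n \<in> omega \<and> i \<in> ap f n"
    "\<And>m n. n \<in> omega \<Longrightarrow> m \<in> n \<Longrightarrow> ap f m \<in> ap f n"
proof -
  define B where "B = sep omega (\<lambda>n. i \<in> n)"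
  have B: "n \<in> B \<longleftrightarrow> n \<in> omega \<and> i \<in> n" for n unfolding B_def by simp
  have sub: "B \<subseteq> omega" by (simp add: subset_def B)
  have w: "wo B (memrel omega)" by (rule wo_subset[OF wo_memrel[OF ord_omega] sub])
  have "\<not> fin B"
  proof
    assume "fin B"
    hence "fin (un B (succ i))" using fin_un fin_omega_mem[OF succ_omega[OF i]] by blast
    moreover have "omega \<subseteq> un B (succ i)" unfolding subset_def
      using ord_linear[OF ord_omega_mem[OF i] ord_omega_mem] by (auto simp: B)
    ultimately show False using fin_subset not_fin_omega by blast
  qed
  moreover have "equipotent B (otp B (memrel omega))" by (rule equipotentI[OF _ rk_bij[OF w]]) simp
  ultimately have "\<not> otp B (memrel omega) \<in> omega" unfolding fin_def by blast
  hence e: "otp B (memrel omega) = omega"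
    using otp_subset_ordinal[OF ord_omega sub] ord_subset_iff[OF otp(1)[OF w] ord_omega] by blast
  define F where "F = invf B (rk B (memrel omega))"
  have D: "dfn1 F" unfolding F_def by simp
  note b = bij_betw_invf[OF rk_bij[OF w], unfolded e, folded F_def]
  have m: "F n \<in> B" if "n \<in> omega" for n using b(1) that unfolding bij_el_iff by blast
  have inc: "F x \<in> F n" if "n \<in> omega" "x \<in> n" for x n
  proof -
    have x: "x \<in> omega" using omega_mem_mem that by blast
    have "lt (memrel omega) (F x) (F n)"
      using rk_iff[OF w m[OF x] m[OF that(1)]] that b(2)[OF x] b(2)[OF that(1)] by simp
    thus ?thesis by simp
  qed
  show ?thesis
  proof (rule that[of "lam omega F"])
    show "fun_on (lam omega F) omega" by (rule fun_on_lam[OF D])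
    show "ap (lam omega F) n \<in> omega \<and> i \<in> ap (lam omega F) n" if "n \<in> omega" for n
      using m[OF that] by (simp add: ap_lam[OF D that] B)
    show "ap (lam omega F) m \<in> ap (lam omega F) n" if "n \<in> omega" "m \<in> n" for m n
      using inc[OF that] omega_mem_mem[OF that] that(1) by (simp add: ap_lam[OF D])
  qed
qed

text \<open>If \<open>x\<close> lies in copy \<open>i\<close> of \<open>a\<close>, an increasing
  renumbering of the copies by numbers above \<open>i\<close> embeds the whole product behind
  \<open>x\<close>.\<close>

lemma mul_omega_tail:
  assumes a: "ordinal a" and x: "x \<in> mul a omega"
  shows "mul a omega \<subseteq> otp (sep (mul a omega) (\<lambda>y. y = x \<or> x \<in> y)) (memrel (mul a omega))"
proof -
  let ?Q = "times omega a" and ?L = "lxr omega a" and ?m = "mul a omega"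
  have w: "wo ?Q ?L" by (rule wo_lxr[OF ord_omega a])
  have om: "ordinal ?m" by (rule ord_mul[OF a ord_omega])
  obtain i u where iu: "i \<in> omega" "u \<in> a" "rk ?Q ?L (opair i u) = x"
    using rk_surj[OF w, of x] x unfolding mul_def mem_times by blast
  obtain f where f: "fun_on f omega" "\<And>n. n \<in> omega \<Longrightarrow> ap f n \<in> omega \<and> i \<in> ap f n"
    "\<And>m n. n \<in> omega \<Longrightarrow> m \<in> n \<Longrightarrow> ap f m \<in> ap f n"
    by (rule omega_shift[OF iu(1)], rule that)
  let ?F = "\<lambda>p. rk ?Q ?L (opair (ap f (fstp p)) (sndp p))"
  have "otp ?Q ?L \<subseteq> otp (sep ?m (\<lambda>y. y = x \<or> x \<in> y)) (memrel ?m)"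
  proof (rule otp_le[of _ _ _ _ ?F])
    show "wo ?Q ?L" by (rule w)
    show "wo (sep ?m (\<lambda>y. y = x \<or> x \<in> y)) (memrel ?m)"
      by (rule wo_subset[OF wo_memrel[OF om]]) (simp add: subset_def)
    show "dfnt (\<lambda>v. ?F (v 0))" by simp
    have m: "?F p \<in> ?m" if "p \<in> ?Q" for p
      using that f(2) rk_mem[OF w] unfolding mul_def by auto
    show "?F p \<in> sep ?m (\<lambda>y. y = x \<or> x \<in> y)" if p: "p \<in> ?Q" for p
    proof -
      obtain j v where j: "p = opair j v" "j \<in> omega" "v \<in> a" using p by auto
      have "lt ?L (opair i u) (opair (ap f j) v)" using mem_lxr iu j f(2) by blast
      hence "x \<in> ?F p" using rk_iff[OF w, of "opair i u" "opair (ap f j) v"] iu j f(2) by auto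
      thus ?thesis using m[OF p] by simp
    qed
    show "opair (?F p) (?F q) \<in> memrel ?m" if p: "p \<in> ?Q" and q: "q \<in> ?Q" and pq: "lt ?L p q" for p q
    proof -
      obtain j v where j: "p = opair j v" "j \<in> omega" "v \<in> a" using p by auto
      obtain k w' where k: "q = opair k w'" "k \<in> omega" "w' \<in> a" using q by auto
      have "lt ?L (opair (ap f j) v) (opair (ap f k) w')"
        using pq f(2,3) j(2,3) k(2,3) unfolding j(1) k(1) mem_lxr by metis
      hence "?F p \<in> ?F q" using rk_iff[OF w, of "opair (ap f j) v" "opair (ap f k) w'"] j k f(2) by auto
      thus ?thesis using m p q by simp
    qed
  qed
  thus ?thesis unfolding mul_def .
qed

declare subset_trans [trans]

text \<open>
  The recursion \<open>\<omega>\<^bsup>e\<^esup> = 1 \<union> (\<Union>y<e. \<omega>\<^bsup>y\<^esup> \<omega>)\<close> treats zero, successors and limits uniformly.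
\<close>

definition opw :: "'a \<Rightarrow> 'a" where
  "opw = recur (\<lambda>f. un one (setof (\<lambda>z. \<exists>y u. opair y u \<in> f \<and> z \<in> mul u omega)))"

lemma dfnt_opw [dfn, simp]: "dfnt f \<Longrightarrow> dfnt (\<lambda>v. opw (f v))"
  by (rule dfnt_app1[of opw]) (unfold opw_def, intro dfn)

lemma mem_opw:
  assumes e: "ordinal e"
  shows "z \<in> opw e \<longleftrightarrow> z = zero \<or> (\<exists>y. y \<in> e \<and> z \<in> mul (opw y) omega)"
proof -
  let ?f = "lam e opw"
  have D: "dfn1 opw" and D': "dfnt (\<lambda>v. mul (opw (v 0)) omega)" by simp_all
  have "opw e = un one (setof (\<lambda>z. \<exists>y u. opair y u \<in> ?f \<and> z \<in> mul u omega))"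
    unfolding opw_def by (rule recur[OF _ e]) (intro dfn)
  moreover have "(\<exists>y u. opair y u \<in> ?f \<and> z \<in> mul u omega) \<longleftrightarrow> (\<exists>y. y \<in> e \<and> z \<in> mul (opw y) omega)" for z
    unfolding mem_lam[OF D] opair_eq by blast
  ultimately have "opw e = un one (setof (\<lambda>z. \<exists>y. y \<in> e \<and> z \<in> mul (opw y) omega))" by simp
  moreover have "\<exists>u. \<forall>z. z \<in> u \<longleftrightarrow> (\<exists>y. y \<in> e \<and> z \<in> mul (opw y) omega)"
    by (rule exI[of _ "unite (img (\<lambda>y. mul (opw y) omega) e)"]) (unfold mem_unite mem_img[OF D'], blast)
  ultimately show ?thesis using mem_setof[of "\<lambda>z. \<exists>y. y \<in> e \<and> z \<in> mul (opw y) omega"] by simp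
qed

lemma opw_zero_mem [simp]: "ordinal e \<Longrightarrow> zero \<in> opw e"
  using mem_opw by blast

lemma ord_opw: "ordinal e \<Longrightarrow> ordinal (opw e)"
proof (induction rule: ord_induct)
  case (step e)
  have m: "ordinal (mul (opw y) omega)" if "y \<in> e" for y using step ord_mul that by simp
  show ?case
  proof (rule ord_memI)
    show "x \<in> opw e" if "y \<in> opw e" "x \<in> y" for x y
      using that m ord_trans[OF m] unfolding mem_opw[OF step(1)] by (metis not_mem_zero)
    show "ordinal x" if "x \<in> opw e" for x
      using that ord_mem[OF m] ord_zero unfolding mem_opw[OF step(1)] by metis
  qed
qed simp

lemma mul_opw_subset: "ordinal e \<Longrightarrow> y \<in> e \<Longrightarrow> mul (opw y) omega \<subseteq> opw e"
  unfolding subset_def using mem_opw by blast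

lemma opw_less: "ordinal e \<Longrightarrow> y \<in> e \<Longrightarrow> opw y \<in> opw e"
  using subsetD[OF mul_opw_subset mem_mul_omega[OF ord_opw opw_zero_mem]] ord_mem by blast

lemma opw_mono: "ordinal e \<Longrightarrow> ordinal y \<Longrightarrow> y \<subseteq> e \<Longrightarrow> opw y \<subseteq> opw e"
  using ord_subset_iff[of y e] opw_less[of e y] ord_mem_subset[OF ord_opw] by auto

lemma opw_ge: "ordinal e \<Longrightarrow> e \<subseteq> opw e"
  by (rule incr_ge[of "succ e" e opw]) (auto intro: opw_less ord_opw ord_mem)

lemma opw_term_less:
  assumes "ordinal e" "y \<in> e" "c \<in> omega"
  shows "mul (opw y) c \<in> opw e"
proof -
  have y: "ordinal y" using assms ord_mem by blast
  show ?thesis using subsetD[OF mul_opw_subset[OF assms(1,2)] mul_less[OF ord_opw[OF y] opw_zero_mem[OF y] ord_omega assms(3)]] .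
qed

text \<open>If \<open>e\<close> were below \<open>y\<close>, every finite multiple of
  \<open>opw e\<close> would be below \<open>opw y\<close>. Weak decrease of the terms therefore
  gives weak decrease of the exponents, the form needed for sorting pieces.\<close>

lemma opw_term_le:
  assumes e: "ordinal e" and y: "ordinal y" and c: "c \<in> omega" "c' \<in> omega" "c' \<noteq> zero"
    and le: "mul (opw y) c' \<subseteq> mul (opw e) c"
  shows "y \<subseteq> e"
proof (rule ccontr)
  assume "\<not> y \<subseteq> e"
  hence "e \<in> y" using ord_not_mem[OF e y] by blast
  hence "mul (opw e) c \<in> opw y" using opw_term_less[OF y] c by blast
  thus False using subsetD[OF le subsetD[OF mul_ge[OF ord_opw[OF y] ord_omega_mem[OF c(2)] c(3)]]] mem_irrefl by blast
qed

text \<open>Additive indecomposability of powers of omega. For nonzero \<open>x\<close> the set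
  \<open>opw e\<close> is exhausted by the products \<open>mul (opw z) omega\<close> with
  \<open>z \<in> e\<close>; from some \<open>z\<close> on they contain \<open>x\<close> and have
  tails of full type by \<open>mul_omega_tail\<close>.\<close>

lemma opw_tail:
  assumes e: "ordinal e" and x: "x \<in> opw e"
  shows "otp (sep (opw e) (\<lambda>y. y = x \<or> x \<in> y)) (memrel (opw e)) = opw e" (is "otp (?tl (opw e)) _ = _")
proof (cases "x = zero")
  case True
  have "?tl (opw e) = opw e"
    by (rule mext) (use ord_zero_mem[OF ord_mem[OF ord_opw[OF e]]] in \<open>auto simp: True\<close>)
  thus ?thesis using otp_ordinal[OF ord_opw[OF e]] by simp
next
  case False
  note oe = ord_opw[OF e]
  obtain y where y: "y \<in> e" "x \<in> mul (opw y) omega" using x False mem_opw[OF e] by blast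
  have w: "wo (?tl (opw e)) (memrel (opw e))" by (rule wo_subset[OF wo_memrel[OF oe]]) (simp add: subset_def)
  have o: "ordinal (mul (opw z) omega)" "ordinal (opw z)" if "z \<in> e" for z
    using ord_mul ord_opw ord_mem[OF e that] by simp_all
  have ge: "mul (opw z) omega \<subseteq> otp (?tl (opw e)) (memrel (opw e))" if z: "z \<in> e" "y \<subseteq> z" for z
  proof -
    have "opw y \<subseteq> opw z" using opw_mono ord_mem[OF e] y z by blast
    hence "x \<in> mul (opw z) omega" using subsetD[OF mul_mono[OF o(2)[OF y(1)] o(2)[OF z(1)] ord_omega] y(2)] by blast
    hence "mul (opw z) omega \<subseteq> otp (?tl (mul (opw z) omega)) (memrel (mul (opw z) omega))"
      using mul_omega_tail o z by blast
    also have "otp (?tl (mul (opw z) omega)) (memrel (mul (opw z) omega)) \<subseteq> otp (?tl (opw e)) (memrel (opw e))"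
    proof (rule otp_le[OF _ w, of _ _ "\<lambda>x. x"])
      show "wo (?tl (mul (opw z) omega)) (memrel (mul (opw z) omega))"
        by (rule wo_subset[OF wo_memrel[OF o(1)[OF z(1)]]]) (simp add: subset_def)
    qed (use subsetD[OF mul_opw_subset[OF e z(1)]] in auto)
    finally show ?thesis .
  qed
  have "opw e \<subseteq> otp (?tl (opw e)) (memrel (opw e))" unfolding subset_def
  proof (intro allI impI)
    fix u assume "u \<in> opw e"
    then consider "u = zero" | z where "z \<in> e" "u \<in> mul (opw z) omega" using mem_opw[OF e] by blast
    thus "u \<in> otp (?tl (opw e)) (memrel (opw e))"
    proof cases
      case 1
      have "zero \<in> mul (opw y) omega" using y o[OF y(1)] ord_zero_mem by fastforce
      thus ?thesis using 1 ge[OF y(1)] subsetD subset_refl by blast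
    next
      case 2
      thus ?thesis
      proof (cases "y \<subseteq> z")
        case True thus ?thesis using ge 2 subsetD by blast
      next
        case False
        hence "z \<subseteq> y" using ord_not_mem ord_mem_subset ord_mem[OF e] y 2 by metis
        hence "opw z \<subseteq> opw y" using opw_mono ord_mem[OF e] y 2 by blast
        hence "u \<in> mul (opw y) omega" using subsetD[OF mul_mono[OF o(2)[OF 2(1)] o(2)[OF y(1)] ord_omega] 2(2)] by blast
        thus ?thesis using ge[OF y(1)] subsetD subset_refl by blast
      qed
    qed
  qed
  moreover have "otp (?tl (opw e)) (memrel (opw e)) \<subseteq> opw e"
    by (rule otp_subset_ordinal[OF oe]) (simp add: subset_def)
  ultimately show ?thesis using subset_antisym by blast
qed

lemma opw_zero: "opw zero = one"
  by (rule mext) (simp add: mem_opw)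

lemma opw_succ:
  assumes e: "ordinal e" shows "opw (succ e) = mul (opw e) omega"
proof (rule subset_antisym)
  show "mul (opw e) omega \<subseteq> opw (succ e)" using mul_opw_subset e by simp
  have m: "mul (opw y) omega \<subseteq> mul (opw e) omega" if "y \<in> succ e" for y
  proof (rule mul_mono)
    have "ordinal y" "y \<subseteq> e" using that e ord_mem ord_mem_subset by auto
    thus "opw y \<subseteq> opw e" "ordinal (opw y)" using opw_mono e ord_opw by simp_all
  qed (simp_all add: ord_opw e)
  have "zero \<in> mul (opw e) omega"
    using ord_trans[OF ord_mul _ mem_mul_omega] ord_opw e opw_zero_mem ord_omega by blast
  thus "opw (succ e) \<subseteq> mul (opw e) omega"
    unfolding subset_def mem_opw[OF ord_succ[OF e]] using m subsetD by blast
qed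

lemma opw_limit:
  assumes e: "ordinal e" "e \<noteq> zero" "\<not> (\<exists>y. e = succ y)"
  shows "z \<in> opw e \<longleftrightarrow> (\<exists>y. y \<in> e \<and> z \<in> opw y)"
proof
  assume "\<exists>y. y \<in> e \<and> z \<in> opw y"
  thus "z \<in> opw e" using opw_less e ord_trans[OF ord_opw] by blast
next
  assume "z \<in> opw e"
  then consider "z = zero" | y where "y \<in> e" "z \<in> mul (opw y) omega" using mem_opw e by blast
  thus "\<exists>y. y \<in> e \<and> z \<in> opw y"
  proof cases
    case 1 thus ?thesis using ord_zero_mem e opw_zero_mem ord_zero by blast
  next
    case 2
    have o: "ordinal y" using ord_mem e 2 by blast
    hence "succ y \<in> e" using succ_subset_iff[OF o e(1)] ord_subset_iff[of "succ y" e] 2 e by auto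
    thus ?thesis using 2 opw_succ[OF o] by metis
  qed
qed

text \<open>The clauses for zero, successors and limits determine a function on
  \<open>succ e\<close> by induction, and \<open>opw\<close> satisfies them.\<close>

lemma omega_power_eq:
  assumes e: "ordinal e" shows "omega_power e = opw e"
proof -
  define Q where "Q f \<longleftrightarrow> fun_on f (succ e) \<and> app f zero = one \<and>
     (\<forall>x. x \<in> e \<longrightarrow> app f (succ x) = omult (app f x) omega) \<and>
     (\<forall>x. x \<in> succ e \<and> x \<noteq> zero \<and> \<not> (\<exists>y. x = succ y) \<longrightarrow>
        app f x = setof (\<lambda>z. \<exists>y. y \<in> x \<and> z \<in> app f y))" for f
  have D: "dfn1 opw" by simp
  let ?f = "lam (succ e) opw"
  have se: "ordinal (succ e)" using e by simp
  have sx: "succ x \<in> succ e" "x \<in> succ e" "ordinal x" if "x \<in> e" for x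
    using that succ_mem_succ e ord_mem by auto
  have z: "zero \<in> succ e" using ord_zero_mem[OF se] by simp
  have fo: "fun_on ?f (succ e)" by (rule fun_on_lam[OF D])
  have fa: "app ?f x = opw x" if "x \<in> succ e" for x
    using fun_on_ap(2)[OF fo that] ap_lam[OF D that] by simp
  have lim: "opw x = setof (\<lambda>z. \<exists>y. y \<in> x \<and> z \<in> F y)"
    if x: "ordinal x" "x \<noteq> zero" "\<not> (\<exists>y. x = succ y)" and F: "\<And>y. y \<in> x \<Longrightarrow> F y = opw y" for x F
  proof (rule mext)
    fix u
    have *: "(\<exists>y. y \<in> x \<and> u \<in> F y) \<longleftrightarrow> u \<in> opw x" for u
      unfolding opw_limit[OF x] using F by metis
    show "u \<in> opw x \<longleftrightarrow> u \<in> setof (\<lambda>z. \<exists>y. y \<in> x \<and> z \<in> F y)"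
      by (subst mem_setof) (use * in blast)+
  qed
  have "Q ?f" unfolding Q_def
  proof (intro conjI allI impI fo)
    show "app ?f zero = one" using fa z opw_zero by simp
    show "app ?f (succ x) = omult (app ?f x) omega" if "x \<in> e" for x
      using fa sx[OF that] omult_eq[OF ord_opw ord_omega] opw_succ by simp
    fix x assume x: "x \<in> succ e \<and> x \<noteq> zero \<and> \<not> (\<exists>y. x = succ y)"
    show "app ?f x = setof (\<lambda>z. \<exists>y. y \<in> x \<and> z \<in> app ?f y)"
      unfolding fa[OF conjunct1[OF x]]
      by (rule lim) (use x ord_mem[OF se] fa ord_trans[OF se] in blast)+
  qed
  moreover have "app f e = opw e" if f: "Q f" for f
  proof -
    have ff: "app f x = ap f x" if "x \<in> succ e" for x using f fun_on_ap(2) that unfolding Q_def by blast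
    have "x \<in> succ e \<longrightarrow> ap f x = opw x" if "ordinal x" for x using that
    proof (induction rule: ord_induct)
      case (step x)
      show ?case
      proof
        assume x: "x \<in> succ e"
        consider "x = zero" | y where "x = succ y" | "x \<noteq> zero" "\<not> (\<exists>y. x = succ y)" by blast
        thus "ap f x = opw x"
        proof cases
          case 1 thus ?thesis using f ff[OF z] opw_zero unfolding Q_def by simp
        next
          case (2 y)
          have ye: "y \<in> e" using x 2 ord_trans[OF e, of y x] mem_succ[of y y] mem_succ[of x e] mem_succ[of y e] by blast
          have "ap f y = opw y" using step(2)[of y] 2 sx(2)[OF ye] mem_succ[of y y] by blast
          moreover have "app f (succ y) = omult (app f y) omega" using f ye unfolding Q_def by blast
          ultimately show ?thesis
            using ff sx[OF ye] omult_eq[OF ord_opw ord_omega] opw_succ 2 by simp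
        next
          case 3
          have "ap f x = setof (\<lambda>z. \<exists>y. y \<in> x \<and> z \<in> app f y)" using f 3 x ff[OF x] unfolding Q_def by simp
          also have "\<dots> = opw x"
          proof (rule lim[symmetric, OF step(1) 3])
            fix y assume "y \<in> x"
            thus "app f y = opw y" using step(2) ff ord_trans[OF se _ x] by metis
          qed
          finally show ?thesis .
        qed
      qed
    qed simp
    thus ?thesis using ff e by simp
  qed
  ultimately have "(THE p. \<exists>f. Q f \<and> p = app f e) = opw e" by (intro the_equality) metis+
  moreover have "omega_power e = (THE p. \<exists>f. Q f \<and> p = app f e)"
    unfolding omega_power_def Q_def by (rule arg_cong[where f = The], rule ext, rule ex_cong1) blast
  ultimately show ?thesis by simp
qed

subsection \<open>Cantor normal forms\<close>

definition terms :: "'a \<Rightarrow> 'a \<Rightarrow> 'a \<Rightarrow> 'a" where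
  "terms m e c = lam m (\<lambda>j. mul (opw (ap e j)) (ap c j))"

lemma dfnt_terms [dfn, simp]: "dfnt m \<Longrightarrow> dfnt e \<Longrightarrow> dfnt c \<Longrightarrow> dfnt (\<lambda>v. terms (m v) (e v) (c v))"
  by (rule dfnt_app3[of terms]) (unfold terms_def, intro dfn)

lemma fun_on_terms [simp]: "fun_on (terms m e c) m"
  unfolding terms_def by simp

lemma ap_terms [simp]: "j \<in> m \<Longrightarrow> ap (terms m e c) j = mul (opw (ap e j)) (ap c j)"
  unfolding terms_def by simp

text \<open>Exponents and coefficients are explicit here, while \<open>is_cnf\<close> hides them
  behind the sequence of terms; \<open>is_cnfI\<close> and \<open>is_cnfD\<close> translate.\<close>

definition cnf_data :: "'a \<Rightarrow> 'a \<Rightarrow> 'a \<Rightarrow> bool" where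
  "cnf_data m e c \<longleftrightarrow> m \<in> omega \<and> fun_on e m \<and> fun_on c m \<and>
     (\<forall>j. j \<in> m \<longrightarrow> ordinal (ap e j) \<and> ap c j \<in> omega \<and> ap c j \<noteq> zero) \<and>
     (\<forall>i j. i \<in> j \<and> j \<in> m \<longrightarrow> ap e j \<in> ap e i)"

definition cnf_val :: "'a \<Rightarrow> 'a \<Rightarrow> 'a \<Rightarrow> 'a" where
  "cnf_val m e c = otp (dsum m (terms m e c)) (osr m (terms m e c))"

lemma dfnp_cnf_data [dfn, simp]: "dfnt m \<Longrightarrow> dfnt e \<Longrightarrow> dfnt c \<Longrightarrow> dfnp (\<lambda>v. cnf_data (m v) (e v) (c v))"
  by (rule dfnp_app3[of cnf_data]) (unfold cnf_data_def, intro dfn)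

lemma dfnt_cnf_val [dfn, simp]: "dfnt m \<Longrightarrow> dfnt e \<Longrightarrow> dfnt c \<Longrightarrow> dfnt (\<lambda>v. cnf_val (m v) (e v) (c v))"
  by (rule dfnt_app3[of cnf_val]) (unfold cnf_val_def, intro dfn)

lemma cnf_dataD:
  assumes "cnf_data m e c"
  shows "m \<in> omega" "fun_on e m" "fun_on c m" "\<And>j. j \<in> m \<Longrightarrow> ordinal (ap e j)"
    "\<And>j. j \<in> m \<Longrightarrow> ap c j \<in> omega" "\<And>j. j \<in> m \<Longrightarrow> ap c j \<noteq> zero"
    "\<And>i j. i \<in> j \<Longrightarrow> j \<in> m \<Longrightarrow> ap e j \<in> ap e i"
    "\<And>j. j \<in> m \<Longrightarrow> ordinal (ap (terms m e c) j)"
    "wo (dsum m (terms m e c)) (osr m (terms m e c))"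
proof -
  show 1: "m \<in> omega" "fun_on e m" "fun_on c m" "\<And>j. j \<in> m \<Longrightarrow> ordinal (ap e j)"
    "\<And>j. j \<in> m \<Longrightarrow> ap c j \<in> omega" "\<And>j. j \<in> m \<Longrightarrow> ap c j \<noteq> zero"
    "\<And>i j. i \<in> j \<Longrightarrow> j \<in> m \<Longrightarrow> ap e j \<in> ap e i"
    using assms unfolding cnf_data_def by blast+
  show 2: "\<And>j. j \<in> m \<Longrightarrow> ordinal (ap (terms m e c) j)"
    by (simp add: ord_mul ord_opw 1 ord_omega_mem)
  show "wo (dsum m (terms m e c)) (osr m (terms m e c))"
    by (rule wo_dsum[OF ord_omega_mem[OF 1(1)] 2])
qed

lemma is_cnfI:
  assumes d: "cnf_data m e c" and x: "x = cnf_val m e c"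
  shows "is_cnf x m (terms m e c)"
  unfolding is_cnf_def maps_iff
proof (intro conjI, goal_cases)
  note D = cnf_dataD[OF d]
  case 3
  show ?case
  proof (rule exI[of _ e], rule exI[of _ c], intro conjI)
    show "\<forall>j. j \<in> m \<longrightarrow> ordinal (app e j) \<and> app c j \<noteq> zero \<and>
           app (terms m e c) j = omult (omega_power (app e j)) (app c j)"
    proof (intro allI impI)
      fix j assume j: "j \<in> m"
      hence "app e j = ap e j" "app c j = ap c j" "app (terms m e c) j = mul (opw (ap e j)) (ap c j)"
        using fun_on_ap(2)[OF D(2)] fun_on_ap(2)[OF D(3)] fun_on_ap(2)[OF fun_on_terms] by simp_all
      thus "ordinal (app e j) \<and> app c j \<noteq> zero \<and>
           app (terms m e c) j = omult (omega_power (app e j)) (app c j)"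
        using D(4,5,6)[OF j] by (simp add: omega_power_eq omult_eq ord_opw ord_omega_mem)
    qed
    show "\<forall>i j. i \<in> j \<and> j \<in> m \<longrightarrow> app e j \<in> app e i"
    proof (intro allI impI)
      fix i j assume ij: "i \<in> j \<and> j \<in> m"
      hence "i \<in> m" using ord_trans[OF ord_omega_mem[OF D(1)]] by blast
      thus "app e j \<in> app e i" using D(7)[of i j] ij fun_on_ap(2)[OF D(2)] by simp
    qed
  qed (use D in blast)+
next
  note D = cnf_dataD[OF d]
  case 4
  show ?case unfolding x cnf_val_def by (rule osum_eq[OF ord_omega_mem[OF D(1)] fun_on_terms D(8), symmetric])
qed (use cnf_dataD[OF d] in simp_all)

lemma is_cnfD:
  assumes "is_cnf x m t"
  shows "\<exists>e c. cnf_data m e c \<and> x = cnf_val m e c \<and> t = terms m e c"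
proof -
  obtain e c where m: "m \<in> omega" and t: "fun_on t m" and e: "fun_on e m" and c: "maps c m omega"
    and h: "\<forall>j. j \<in> m \<longrightarrow> ordinal (app e j) \<and> app c j \<noteq> zero \<and>
           app t j = omult (omega_power (app e j)) (app c j)"
    and dc: "\<forall>i j. i \<in> j \<and> j \<in> m \<longrightarrow> app e j \<in> app e i" and x: "x = osum m t"
    using assms unfolding is_cnf_def by blast
  have c': "fun_on c m" "ap c j \<in> omega" if "j \<in> m" for j using c that unfolding maps_iff by blast+
  have cf: "fun_on c m" using c unfolding maps_iff by blast
  have a: "app e j = ap e j" "app c j = ap c j" "app t j = ap t j" if "j \<in> m" for j
    using fun_on_ap(2) e cf t that by blast+
  have d: "cnf_data m e c" unfolding cnf_data_def
  proof (intro conjI allI impI m e cf)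
    fix j assume j: "j \<in> m"
    show "ordinal (ap e j)" "ap c j \<in> omega" "ap c j \<noteq> zero" using h a[OF j] c' j by metis+
  next
    show "ap e j \<in> ap e i" if "i \<in> j \<and> j \<in> m" for i j
      using dc a that ord_trans[OF ord_omega_mem[OF m]] by metis
  qed
  note D = cnf_dataD[OF d]
  have "t = terms m e c"
  proof (rule fun_on_ext[OF t fun_on_terms])
    fix j assume j: "j \<in> m"
    have "ap t j = omult (omega_power (ap e j)) (ap c j)" using h a[OF j] j by metis
    thus "ap t j = ap (terms m e c) j"
      using D(4,5)[OF j] j by (simp add: omega_power_eq omult_eq ord_opw ord_omega_mem)
  qed
  thus ?thesis using d x osum_eq[OF ord_omega_mem[OF D(1)] fun_on_terms D(8)]
    unfolding cnf_val_def by blast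
qed

lemma cnf_term_le:
  assumes d: "cnf_data m e c" and j: "j \<in> m"
  shows "opw (ap e j) \<subseteq> cnf_val m e c"
proof -
  note D = cnf_dataD[OF d]
  let ?a = "mul (opw (ap e j)) (ap c j)"
  have o: "ordinal ?a" using D(8)[OF j] j by simp
  have "opw (ap e j) \<subseteq> ?a" by (rule mul_ge) (simp_all add: ord_opw D j ord_omega_mem)
  also have "?a = otp ?a (memrel ?a)" using otp_ordinal[OF o] by simp
  also have "\<dots> \<subseteq> cnf_val m e c" unfolding cnf_val_def
    by (rule otp_le[OF wo_memrel[OF o] D(9), of "opair j"]) (use j in \<open>auto simp: mem_osr\<close>)
  finally show ?thesis .
qed

lemma unite_succ: "ordinal a \<Longrightarrow> unite (succ a) = a"
  by (rule mext) (auto intro: ord_trans)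

text \<open>Division with remainder by the largest power \<open>opw e\<close> not exceeding
  \<open>x\<close>: a nonzero \<open>x\<close> consists of \<open>c\<close> copies of it followed by
  \<open>r\<close>, where \<open>r\<close> is below that power and hence covered by the induction
  hypothesis.\<close>

lemma cnf_ex: "ordinal x \<Longrightarrow> \<exists>m e c. cnf_data m e c \<and> x = cnf_val m e c"
proof (induction rule: ord_induct)
  case (step x)
  show ?case
  proof (cases "x = zero")
    case True
    have d: "cnf_data zero zero zero" unfolding cnf_data_def fun_on_def by simp
    have "cnf_val zero zero zero = zero" unfolding cnf_val_def
    proof (rule otp_eq(1)[OF ord_zero isomorphicI[of "\<lambda>x. x"]])
      show "bij_betw (\<lambda>x. x) (el (dsum zero (terms zero zero zero))) (el zero)" unfolding bij_el_iff by simp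
    qed simp_all
    thus ?thesis using d True by metis
  next
    case False
    note x = step(1)
    have ex: "x \<in> opw (succ x)" using subsetD[OF opw_ge[of "succ x"]] x by simp
    \<comment> \<open>From the least such \<open>q\<close> the recursion for \<open>opw\<close>
      yields \<open>e \<in> q\<close> with \<open>x\<close> below omega copies of
      \<open>opw e\<close>; minimality gives \<open>opw e \<subseteq> x\<close>.\<close>
    obtain q where "ordinal q" and q: "x \<in> opw q" "\<And>c. c \<in> q \<Longrightarrow> \<not> x \<in> opw c"
      by (rule ord_least[of "succ x" "\<lambda>q. x \<in> opw q"], rule ord_succ[OF x], rule ex, simp, rule that)
    obtain e where e: "e \<in> q" "x \<in> mul (opw e) omega" using mem_opw[OF \<open>ordinal q\<close>] q(1) False by blast
    have oe: "ordinal e" using ord_mem \<open>ordinal q\<close> e by blast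
    define a where "a = opw e"
    have oa: "ordinal a" unfolding a_def by (rule ord_opw[OF oe])
    have ax: "a \<subseteq> x" using q(2)[OF e(1)] ord_not_mem[OF x oa] unfolding a_def by blast
    let ?Q = "times omega a" and ?L = "lxr omega a"
    have w: "wo ?Q ?L" by (rule wo_lxr[OF ord_omega oa])
    obtain c r where c: "c \<in> omega" and r: "r \<in> a" and cr: "rk ?Q ?L (opair c r) = x"
      using rk_surj[OF w, of x] e(2) unfolding mul_def a_def mem_times by blast
    define A where "A = pred ?Q ?L (opair c r)"
    have A: "p \<in> A \<longleftrightarrow> (\<exists>i y. p = opair i y \<and> y \<in> a \<and> (i \<in> c \<or> i = c \<and> y \<in> r))" for p
    proof -
      have *: "lt ?L (opair i y) (opair c r) \<longleftrightarrow> y \<in> a \<and> (i \<in> c \<or> i = c \<and> y \<in> r)" for i y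
        unfolding mem_lxr using r c omega_mem_mem[OF c, of i] by blast
      have "p \<in> A \<longleftrightarrow> (\<exists>i y. i \<in> omega \<and> y \<in> a \<and> p = opair i y \<and> lt ?L (opair i y) (opair c r))"
        unfolding A_def mem_pred mem_times by blast
      thus ?thesis unfolding * using c omega_mem_mem[OF c] by blast
    qed
    have xA: "otp A ?L = x" using cr unfolding rk_def A_def .
    have wA: "wo A ?L" by (rule wo_subset[OF w]) (simp add: A_def subset_def)
    have AL: "lt ?L (opair i y) (opair j z) \<longleftrightarrow> i \<in> j \<or> i = j \<and> y \<in> z"
      if "opair i y \<in> A" "opair j z \<in> A" for i j y z
      using that mem_lxr unfolding A_def mem_pred mem_times by blast
    have orr: "ordinal r" using ord_mem oa r by blast
    have rx: "r \<in> x" using subsetD[OF ax r] .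
    \<comment> \<open>With no full copy, \<open>x\<close> would be at most \<open>r\<close>, but
      \<open>r \<in> a\<close> and \<open>a \<subseteq> x\<close>.\<close>
    have c0: "c \<noteq> zero"
    proof
      assume "c = zero"
      hence A0: "p \<in> A \<Longrightarrow> \<exists>y. p = opair zero y \<and> y \<in> r" for p unfolding A by auto
      have "otp A ?L \<subseteq> otp r (memrel r)"
      proof (rule otp_le[OF wA wo_memrel[OF orr], of sndp])
        show "sndp p \<in> r" if "p \<in> A" for p using A0[OF that] by auto
        show "lt (memrel r) (sndp p) (sndp p')" if "p \<in> A" "p' \<in> A" "lt ?L p p'" for p p'
          using A0[OF that(1)] A0[OF that(2)] that AL by fastforce
      qed simp
      thus False using rx subsetD unfolding xA otp_ordinal[OF orr] by fastforce
    qed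
    obtain m e0 c0' where d0: "cnf_data m e0 c0'" and rv: "r = cnf_val m e0 c0'" using step(2)[OF rx] by blast
    note D0 = cnf_dataD[OF d0]
    have om: "ordinal m" by (rule ord_omega_mem[OF D0(1)])
    have small: "ap e0 j \<in> e" if j: "j \<in> m" for j
    proof (rule ccontr)
      assume "\<not> ap e0 j \<in> e"
      hence "e \<subseteq> ap e0 j" using ord_not_mem D0(4)[OF j] oe by blast
      hence "a \<subseteq> r" using subset_trans[OF opw_mono cnf_term_le[OF d0 j]] D0(4)[OF j] oe unfolding a_def rv by blast
      thus False using r subsetD by fastforce
    qed
    \<comment> \<open>The new leading term is put in front. \<open>unite\<close> is the predecessor
      of a successor, so the old terms move up by one index.\<close>
    define e' where "e' = lam (succ m) (\<lambda>j. if j = zero then e else ap e0 (unite j))"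
    define c' where "c' = lam (succ m) (\<lambda>j. if j = zero then c else ap c0' (unite j))"
    have E: "ap e' zero = e" "ap c' zero = c" unfolding e'_def c'_def
      using ord_zero_mem[OF ord_succ[OF om]] by simp_all
    have Es: "ap e' (succ j) = ap e0 j" "ap c' (succ j) = ap c0' j" if "j \<in> m" for j
      unfolding e'_def c'_def using that succ_mem_succ[OF ord_mem[OF om that] om] unite_succ[OF ord_mem[OF om that]] by simp_all
    have jc: "j = zero \<or> (\<exists>i. i \<in> m \<and> j = succ i)" if "j \<in> succ m" for j
    proof -
      have "j \<in> omega" using that omega_mem_mem succ_omega D0(1) by blast
      thus ?thesis using omega_cases[of j] that succ_mem_succ[OF _ om] ord_omega_mem by blast
    qed
    have d': "cnf_data (succ m) e' c'" unfolding cnf_data_def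
    proof (intro conjI allI impI)
      show "succ m \<in> omega" using D0(1) by simp
      show "fun_on e' (succ m)" "fun_on c' (succ m)" unfolding e'_def c'_def by simp_all
      show "ordinal (ap e' j)" "ap c' j \<in> omega" "ap c' j \<noteq> zero" if "j \<in> succ m" for j
        using jc[OF that] oe c c0 D0(4,5,6) by (auto simp: E Es)
      show "ap e' j \<in> ap e' i" if ij: "i \<in> j \<and> j \<in> succ m" for i j
      proof -
        obtain j' where j': "j' \<in> m" "j = succ j'" using jc[of j] ij by auto
        have "i \<in> succ m" using ij ord_trans[OF ord_succ[OF om]] by blast
        then consider "i = zero" | i' where "i' \<in> m" "i = succ i'" using jc by blast
        thus ?thesis
        proof cases
          case 1 thus ?thesis using j' small by (simp add: E Es)
        next
          case 2
          hence "i' \<in> j'" using ij j' succ_mem_succ ord_mem[OF om] by metis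
          thus ?thesis using j' 2 D0(7) by (simp add: Es)
        qed
      qed
    qed
    note D' = cnf_dataD[OF d']
    let ?t = "terms (succ m) e' c'" and ?tm = "terms m e0 c0'"
    let ?B = "dsum (succ m) ?t" and ?R = "osr (succ m) ?t" and ?Bm = "dsum m ?tm" and ?Rm = "osr m ?tm"
    have z: "zero \<in> succ m" using ord_zero_mem[OF ord_succ[OF om]] by simp
    have t0: "ap ?t zero = mul a c" using z by (simp add: E a_def)
    have ts: "ap ?t (succ j) = ap ?tm j" "succ j \<in> succ m" if "j \<in> m" for j
      using that succ_mem_succ[OF ord_mem[OF om that] om] Es[OF that] by simp_all
    let ?Q' = "times c a" and ?L' = "lxr c a"
    have w': "wo ?Q' ?L'" by (rule wo_lxr[OF ord_omega_mem[OF c] oa])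
    define h where "h y = invf ?Bm (rk ?Bm ?Rm) y" for y
    have hD: "dfnt (\<lambda>v. h (f v))" if "dfnt f" for f unfolding h_def using that by simp
    have hb: "bij_betw (rk ?Bm ?Rm) (el ?Bm) (el r)" using rk_bij[OF D0(9)] unfolding rv cnf_val_def .
    have h: "h y \<in> ?Bm" "rk ?Bm ?Rm (h y) = y" if "y \<in> r" for y
      using bij_betw_invf(1,2)[OF hb] that unfolding h_def bij_el_iff by blast+
    \<comment> \<open>Points in the first \<open>c\<close> copies go to the leading term by their
      rank. In the remainder, \<open>h\<close> turns a point of \<open>r\<close> into its place in
      the normal form of \<open>r\<close>, whose term index is then raised by one.\<close>
    define G where "G p = (if fstp p = c then opair (succ (fstp (h (sndp p)))) (sndp (h (sndp p)))
      else opair zero (rk ?Q' ?L' p))" for p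
    have GD: "dfn1 G" unfolding G_def by (intro dfn hD)
    have Ac: "p \<in> ?Q' \<and> G p = opair zero (rk ?Q' ?L' p) \<and> fstp p \<noteq> c \<or>
        (\<exists>y j z. p = opair c y \<and> y \<in> r \<and> j \<in> m \<and> z \<in> ap ?tm j \<and> h y = opair j z \<and> G p = opair (succ j) z)"
      if p: "p \<in> A" for p
    proof -
      obtain i y where iy: "p = opair i y" "y \<in> a" "i \<in> c \<or> i = c \<and> y \<in> r" using p unfolding A by blast
      show ?thesis
      proof (cases "i = c")
        case True
        hence "y \<in> r" using iy by auto
        moreover obtain j z where "j \<in> m" "z \<in> ap ?tm j" "h y = opair j z" using h(1)[OF \<open>y \<in> r\<close>] unfolding mem_dsum by blast
        ultimately show ?thesis using iy(1) True unfolding G_def by simp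
      next
        case False
        thus ?thesis using iy unfolding G_def by auto
      qed
    qed
    have GB: "G p \<in> ?B" if p: "p \<in> A" for p
    proof -
      have "rk ?Q' ?L' p \<in> mul a c" if "p \<in> ?Q'" using rk_mem[OF w' that] unfolding mul_def .
      thus ?thesis using Ac[OF p] z t0 ts unfolding mem_dsum by metis
    qed
    have inc: "lt ?R (G p) (G p')" if p: "p \<in> A" and p': "p' \<in> A" and l: "lt ?L p p'" for p p'
    proof -
      obtain i y i' y' where ii: "p = opair i y" "p' = opair i' y'" using p p' unfolding A by blast
      have l': "i \<in> i' \<or> i = i' \<and> y \<in> y'" using AL l p p' unfolding ii by blast
      have key: "lt ?R (G p) (G p') \<longleftrightarrow> fstp (G p) \<in> fstp (G p') \<or> fstp (G p) = fstp (G p') \<and> sndp (G p) \<in> sndp (G p')"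
        using GB[OF p] GB[OF p'] mem_osr by auto
      consider (a) "p \<in> ?Q'" "p' \<in> ?Q'" "G p = opair zero (rk ?Q' ?L' p)" "G p' = opair zero (rk ?Q' ?L' p')"
        | (b) j z where "G p = opair zero (rk ?Q' ?L' p)" "j \<in> m" "G p' = opair (succ j) z"
        | (c) "i = c" "p' \<in> ?Q'"
        | (d) j z k u where "i = c" "i' = c" "y \<in> r" "y' \<in> r" "j \<in> m" "k \<in> m" "h y = opair j z" "h y' = opair k u" "G p = opair (succ j) z" "G p' = opair (succ k) u"
        using Ac[OF p] Ac[OF p'] unfolding ii opair_eq by blast
      thus ?thesis
      proof cases
        case a
        have "lt ?L' p p'" using l' a(1,2) mem_lxr unfolding ii by auto
        hence "rk ?Q' ?L' p \<in> rk ?Q' ?L' p'" using rk_iff[OF w' a(1,2)] by blast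
        thus ?thesis by (subst key) (simp add: a(3,4))
      next
        case b
        have "zero \<in> succ j" using ord_zero_mem[OF ord_succ[OF ord_mem[OF om b(2)]] succ_not_zero(1)] .
        thus ?thesis by (subst key) (simp add: b(1,3))
      next
        case c
        hence "i' \<in> c" unfolding ii by auto
        thus ?thesis using l' c(1) mem_asym mem_irrefl by blast
      next
        case d
        have "y \<in> y'" using l' d(1,2) by auto
        hence "lt ?Rm (h y) (h y')" using rk_iff[OF D0(9) h(1) h(1)] h(2) d(3,4) by simp
        hence "j \<in> k \<or> j = k \<and> z \<in> u" unfolding d(7,8) mem_osr by blast
        thus ?thesis by (subst key) (use succ_mem_succ ord_mem[OF om] d(5,6) in \<open>auto simp: d(9,10)\<close>)
      qed
    qed
    have "img G A = ?B"
    proof (rule mext)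
      fix p
      have "\<exists>u. u \<in> A \<and> p = G u" if p: "p \<in> ?B"
      proof -
        obtain j z where jz: "p = opair j z" "j \<in> succ m" "z \<in> ap ?t j" using p unfolding mem_dsum by blast
        from jc[OF jz(2)] show ?thesis
        proof
          assume j: "j = zero"
          then obtain u where u: "u \<in> ?Q'" "rk ?Q' ?L' u = z" using rk_surj[OF w', of z] jz(3) t0 unfolding mul_def by auto
          hence "u \<in> A" "fstp u \<noteq> c" unfolding A by auto
          thus ?thesis using u jz(1) j unfolding G_def by auto
        next
          assume "\<exists>i. i \<in> m \<and> j = succ i"
          then obtain i where i: "i \<in> m" "j = succ i" by blast
          have b: "opair i z \<in> ?Bm" using i jz(3) ts by simp
          let ?y = "rk ?Bm ?Rm (opair i z)"
          have y: "?y \<in> r" using rk_mem[OF D0(9) b] unfolding rv cnf_val_def .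
          have "h ?y = opair i z" using bij_betw_invf(3)[OF hb b] unfolding h_def .
          moreover have "opair c ?y \<in> A" unfolding A using y ord_trans[OF oa y r] by blast
          ultimately show ?thesis using jz(1) i(2) unfolding G_def by (intro exI[of _ "opair c ?y"]) simp
        qed
      qed
      thus "p \<in> img G A \<longleftrightarrow> p \<in> ?B" unfolding mem_img[OF GD] using GB by blast
    qed
    hence "isomorphic A ?L ?B ?R"
      using inc_iso[OF wo_lin[OF wA] wo_lin[OF D'(9)] GD GB inc] by simp
    hence "x = cnf_val (succ m) e' c'" unfolding cnf_val_def xA[symmetric]
      using otp_iso_iff[OF wA D'(9)] by blast
    thus ?thesis using d' by blast
  qed
qed simp

end

subsection \<open>The well-order of type \<open>\<beta>(\<tau>)\<close>\<close>

context zf_model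
begin

text \<open>Finite choice is provable in ZF by induction on \<open>n\<close>. It allows normal forms
  to be chosen for all summands at once.\<close>

lemma fin_choice:
  assumes n: "n \<in> omega" and D: "dfnp (\<lambda>v. P (v 0) (v 1))" and ex: "\<And>i. i \<in> n \<Longrightarrow> \<exists>x. P i x"
  shows "\<exists>f. fun_on f n \<and> (\<forall>i. i \<in> n \<longrightarrow> P i (ap f i))"
proof -
  have P: "dfnp (\<lambda>v. P (f v) (g v))" if "dfnt f" "dfnt g" for f g by (rule dfnp_app2[OF D that])
  have "(\<forall>i. i \<in> n \<longrightarrow> (\<exists>x. P i x)) \<longrightarrow> (\<exists>f. fun_on f n \<and> (\<forall>i. i \<in> n \<longrightarrow> P i (ap f i)))" using n
  proof (induction rule: omega_induct)
    case defn
    show ?case by (intro dfn P)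
  next
    case zero
    have "fun_on zero zero" unfolding fun_on_def by simp
    thus ?case by auto
  next
    case (succ n)
    show ?case
    proof
      assume h: "\<forall>i. i \<in> succ n \<longrightarrow> (\<exists>x. P i x)"
      then obtain f where f: "\<And>i. i \<in> n \<Longrightarrow> P i (ap f i)" using succ by auto
      obtain x where x: "P n x" using h by auto
      let ?F = "\<lambda>i. if i = n then x else ap f i"
      have F: "dfnt (\<lambda>v. ?F (v 0))" by simp
      have "P i (ap (lam (succ n) ?F) i)" if "i \<in> succ n" for i
        unfolding ap_lam[OF F that] using that x f by auto
      thus "\<exists>f. fun_on f (succ n) \<and> (\<forall>i. i \<in> succ n \<longrightarrow> P i (ap f i))"
        using fun_on_lam[OF F] by blast
    qed
  qed
  thus ?thesis using ex by blast
qed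

lemma fin_dsum:
  assumes "fin I" "\<And>i. i \<in> I \<Longrightarrow> fin (ap b i)"
  shows "fin (dsum I b)"
proof -
  let ?F = "\<lambda>i. img (opair i) (ap b i)"
  have D: "dfnt (\<lambda>v. ?F (v 0))" and D': "dfnt (\<lambda>v. opair i (v 0))" for i by simp_all
  have "fin (unite (img ?F I))"
  proof (rule fin_unite)
    show "fin (img ?F I)" by (rule fin_img[OF assms(1) D])
    show "fin x" if "x \<in> img ?F I" for x
      using that fin_img[OF assms(2) D'] unfolding mem_img[OF D] by blast
  qed
  moreover have "dsum I b \<subseteq> unite (img ?F I)"
    unfolding subset_def mem_unite mem_img[OF D] mem_dsum by (metis mem_img[OF D'])
  ultimately show ?thesis using fin_subset by blast
qed

text \<open>Convexity makes the comparison of two different classes independent of the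
  representatives, so the finite set of keys is linearly, hence well, ordered; ranks number the
  classes.\<close>

lemma convex_index:
  assumes l: "lin T R" and D: "dfn1 key" and f: "fin (img key T)"
    and cv: "\<And>s r t. s \<in> T \<Longrightarrow> r \<in> T \<Longrightarrow> t \<in> T \<Longrightarrow> lt R s r \<Longrightarrow> lt R r t \<Longrightarrow> key s = key t \<Longrightarrow>
      key r = key t"
  shows "\<exists>N pc. N \<in> omega \<and> (\<forall>t. t \<in> T \<longrightarrow> ap pc t \<in> N) \<and>
    (\<forall>s t. s \<in> T \<and> t \<in> T \<longrightarrow> (ap pc s = ap pc t \<longleftrightarrow> key s = key t) \<and>
      (ap pc s \<in> ap pc t \<longleftrightarrow> key s \<noteq> key t \<and> lt R s t))"
proof -
  have Dk: "dfnt (\<lambda>v. key (g v))" if "dfnt g" for g by (rule dfnt_app1[of key, OF D that])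
  define K where "K = img key T"
  have K: "u \<in> K \<longleftrightarrow> (\<exists>t. t \<in> T \<and> u = key t)" for u unfolding K_def by (rule mem_img[OF D])
  let ?q = "\<lambda>p. \<exists>s t. s \<in> T \<and> t \<in> T \<and> key s \<noteq> key t \<and> lt R s t \<and> p = opair (key s) (key t)"
  define Q where "Q = sep (times K K) ?q"
  have qD: "dfnp (\<lambda>v. ?q (v 0))" by (intro dfn Dk)
  have Q: "lt Q (key s) (key t) \<longleftrightarrow> key s \<noteq> key t \<and> lt R s t" if st: "s \<in> T" "t \<in> T" for s t
  proof
    assume "lt Q (key s) (key t)"
    then obtain s' t' where s': "s' \<in> T" "t' \<in> T" "key s = key s'" "key t = key t'" "key s' \<noteq> key t'" "lt R s' t'"
      unfolding Q_def mem_sep[OF qD] opair_eq by blast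
    have "lt R s t"
    proof (rule ccontr)
      assume "\<not> lt R s t"
      hence ts: "lt R t s" using lin_total[OF l st] s' by metis
      have "s' \<noteq> t" using s' by metis
      then consider "lt R s' t" | "lt R t s'" using lin_total[OF l s'(1) st(2)] by blast
      thus False
      proof cases
        case 1 show False using cv[OF s'(1) st(2,1) 1 ts] s' by metis
      next
        case 2 show False using cv[OF st(2) s'(1,2) 2 s'(6)] s' by metis
      qed
    qed
    thus "key s \<noteq> key t \<and> lt R s t" using s' by metis
  next
    assume "key s \<noteq> key t \<and> lt R s t"
    thus "lt Q (key s) (key t)" unfolding Q_def mem_sep[OF qD] mem_times K using st by blast
  qed
  have "lin K Q" unfolding lin_def
  proof (intro conjI allI impI)
    show "\<not> lt Q x x" if "x \<in> K" for x using that Q unfolding K by blast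
    show "lt Q x y \<or> lt Q y x" if "x \<in> K \<and> y \<in> K \<and> x \<noteq> y" for x y
    proof -
      obtain s t where "s \<in> T" "t \<in> T" "x = key s" "y = key t" using \<open>x \<in> K \<and> y \<in> K \<and> x \<noteq> y\<close> K by blast
      thus ?thesis using Q[of s t] Q[of t s] lin_total[OF l, of s t] that by metis
    qed
    show "lt Q x z" if h: "x \<in> K \<and> y \<in> K \<and> z \<in> K \<and> lt Q x y \<and> lt Q y z" for x y z
    proof -
      obtain s t r where st: "s \<in> T" "t \<in> T" "r \<in> T" "x = key s" "y = key t" "z = key r" using h K by blast
      have q: "key s \<noteq> key t" "lt R s t" "key t \<noteq> key r" "lt R t r" using h Q st by blast+
      have "lt R s r" using lin_trans[OF l st(1,2,3) q(2,4)] .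
      moreover have "key s \<noteq> key r" using cv[OF st(1,2,3) q(2,4)] q(3) by blast
      ultimately show ?thesis using Q st by blast
    qed
  qed
  hence w: "wo K Q" using fin_lin_wo f unfolding K_def by blast
  let ?pc = "lam T (\<lambda>t. rk K Q (key t))"
  have pD: "dfnt (\<lambda>v. rk K Q (key (v 0)))" by (intro dfn D)
  note p = ap_lam[OF pD]
  have kK: "key t \<in> K" if "t \<in> T" for t using K that by blast
  show ?thesis
  proof (rule exI[of _ "otp K Q"], rule exI[of _ ?pc], intro conjI allI impI)
    show "otp K Q \<in> omega" using fin_otp[OF _ w] f unfolding K_def by blast
    show "ap ?pc t \<in> otp K Q" if "t \<in> T" for t unfolding p[OF that] by (rule rk_mem[OF w kK[OF that]])
    fix s t assume st: "s \<in> T \<and> t \<in> T"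
    show "ap ?pc s = ap ?pc t \<longleftrightarrow> key s = key t"
      unfolding p[OF conjunct1[OF st]] p[OF conjunct2[OF st]] using rk_inj[OF w kK kK] st by metis
    show "ap ?pc s \<in> ap ?pc t \<longleftrightarrow> key s \<noteq> key t \<and> lt R s t"
      unfolding p[OF conjunct1[OF st]] p[OF conjunct2[OF st]] using rk_iff[OF w kK kK] Q st by metis
  qed
qed

end

text \<open>
  The point \<open>t\<close> is the \<open>Y t\<close>-th element of the \<open>K t\<close>-th copy of \<open>\<omega>\<^bsup>Ex t\<^esup>\<close> in the \<open>J t\<close>-th term of the
  normal form of the summand \<open>I t\<close>; that term is the \<open>l t\<close>-th one in decreasing order.
\<close>

locale beta_data = zf_model mem
  for mem :: "'a \<Rightarrow> 'a \<Rightarrow> bool"  (infix "\<in>" 50) +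
  fixes T S W n dd :: 'a and I J K Y l Ex :: "'a \<Rightarrow> 'a"
  assumes dfnt_parts: "dfn1 I" "dfn1 J" "dfn1 K" "dfn1 Y"
    and lin_S: "lin T S" and wo_W: "wo T W"
    and n: "n \<in> omega" and I_mem: "t \<in> T \<Longrightarrow> I t \<in> n"
    and dd: "i \<in> n \<Longrightarrow> ap dd i = zero \<or> ap dd i = one"
    and alt: "succ i \<in> n \<Longrightarrow> ap dd (succ i) \<noteq> ap dd i"
    and ords: "t \<in> T \<Longrightarrow> ordinal (J t)" "t \<in> T \<Longrightarrow> ordinal (K t)" "t \<in> T \<Longrightarrow> ordinal (Ex t)"
    and fin_keys: "fin (img (\<lambda>t. opair (opair (I t) (J t)) (K t)) T)"
    and S_iff: "s \<in> T \<Longrightarrow> t \<in> T \<Longrightarrow> lt S s t \<longleftrightarrow> I s \<in> I t \<or> I s = I t \<and>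
      (ap dd (I t) = zero \<and> (J s \<in> J t \<or> J s = J t \<and> (K s \<in> K t \<or> K s = K t \<and> Y s \<in> Y t)) \<or>
       ap dd (I t) = one \<and> (J t \<in> J s \<or> J t = J s \<and> (K t \<in> K s \<or> K t = K s \<and> Y t \<in> Y s)))"
    and W_iff: "s \<in> T \<Longrightarrow> t \<in> T \<Longrightarrow>
      lt W s t \<longleftrightarrow> l s \<in> l t \<or> l s = l t \<and> (K s \<in> K t \<or> K s = K t \<and> Y s \<in> Y t)"
    and l_iff: "s \<in> T \<Longrightarrow> t \<in> T \<Longrightarrow> l s = l t \<longleftrightarrow> I s = I t \<and> J s = J t"
    and Y_mem: "t \<in> T \<Longrightarrow> Y t \<in> opw (Ex t)"
    and Y_surj: "t \<in> T \<Longrightarrow> y \<in> opw (Ex t) \<Longrightarrow> \<exists>s. s \<in> T \<and> I s = I t \<and> J s = J t \<and> K s = K t \<and> Y s = y"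
    and Ex_J: "s \<in> T \<Longrightarrow> t \<in> T \<Longrightarrow> I s = I t \<Longrightarrow> J s \<in> J t \<or> J s = J t \<Longrightarrow> Ex t \<subseteq> Ex s"
    and Ex_l: "s \<in> T \<Longrightarrow> t \<in> T \<Longrightarrow> l s \<in> l t \<Longrightarrow> Ex t \<subseteq> Ex s"
    and lead: "i \<in> n \<Longrightarrow> \<exists>t. t \<in> T \<and> I t = i \<and> J t = zero \<and> K t = zero \<and> Ex t \<noteq> zero"
begin

definition key :: "'a \<Rightarrow> 'a" where
  "key t = opair (opair (I t) (J t)) (K t)"

lemma key_eq: "key s = key t \<longleftrightarrow> I s = I t \<and> J s = J t \<and> K s = K t"
  unfolding key_def by auto

lemma dfnt_key: "dfn1 key"
  unfolding key_def by (intro dfn dfnt_parts)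

lemma fin_key: "fin (img key T)"
  using fin_keys unfolding key_def .

lemma convex_S:
  assumes "s \<in> T" "r \<in> T" "t \<in> T" "lt S s r" "lt S r t" "key s = key t"
  shows "key r = key t"
proof -
  have e: "I s = I t" "J s = J t" "K s = K t" using assms(6) key_eq by blast+
  note sr = assms(4)[unfolded S_iff[OF assms(1,2)] e] and rt = assms(5)[unfolded S_iff[OF assms(2,3)]]
  have i: "I r = I t" using sr rt mem_asym by metis
  have "J r = J t" using sr rt mem_asym mem_irrefl one_zero unfolding i by metis
  moreover have "K r = K t" using sr rt mem_asym mem_irrefl one_zero unfolding i \<open>J r = J t\<close> by metis
  ultimately show ?thesis using i key_eq by blast
qed

lemma convex_W:
  assumes "s \<in> T" "r \<in> T" "t \<in> T" "lt W s r" "lt W r t" "key s = key t"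
  shows "key r = key t"
proof -
  have e: "l s = l t" "K s = K t" using assms(1,3,6) key_eq l_iff by blast+
  note sr = assms(4)[unfolded W_iff[OF assms(1,2)] e] and rt = assms(5)[unfolded W_iff[OF assms(2,3)]]
  have i: "l r = l t" using sr rt mem_asym by metis
  have "K r = K t" using sr rt mem_asym mem_irrefl unfolding i by metis
  thus ?thesis using i l_iff[OF assms(2,3)] key_eq by blast
qed

lemma key_ord:
  assumes "t \<in> T" "s \<in> T" "key s = key t"
  shows "lt W s t \<longleftrightarrow> Y s \<in> Y t" and "lt S s t \<longleftrightarrow> (if ap dd (I t) = zero then lt W s t else lt W t s)"
    and "Y s = Y t \<Longrightarrow> s = t" and "Ex s = Ex t"
proof -
  have e: "I s = I t" "J s = J t" "K s = K t" using assms(3) key_eq by blast+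
  have el: "l s = l t" using l_iff assms e by blast
  show 1: "lt W s t \<longleftrightarrow> Y s \<in> Y t" unfolding W_iff[OF assms(2,1)] using el e by simp
  have 2: "lt W t s \<longleftrightarrow> Y t \<in> Y s" unfolding W_iff[OF assms(1,2)] using el e by simp
  show "lt S s t \<longleftrightarrow> (if ap dd (I t) = zero then lt W s t else lt W t s)"
    unfolding S_iff[OF assms(2,1)] 1 2 e using dd[OF I_mem[OF assms(1)]] by auto
  show "s = t" if "Y s = Y t" using lin_total[OF wo_lin[OF wo_W] assms(2,1)] 1 2 that by auto
  show "Ex s = Ex t" using Ex_J[OF assms(1,2)] Ex_J[OF assms(2,1)] e subset_antisym by metis
qed

text \<open>Inside a class, \<open>Y\<close> is an isomorphism onto \<open>opw (Ex t)\<close>, and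
  tails correspond to final segments, so \<open>opw_tail\<close> yields indecomposability.\<close>

lemma class_type:
  assumes t: "t \<in> T" and pc: "\<And>s. s \<in> T \<Longrightarrow> ap pc s = ap pc t \<longleftrightarrow> key s = key t"
  shows "otp (piece T pc t) W = opw (Ex t)" and "otp (tail T W pc t) W = opw (Ex t)"
proof -
  note oe = ord_opw[OF ords(3)[OF t]]
  have m: "s \<in> piece T pc t \<longleftrightarrow> s \<in> T \<and> key s = key t" for s using pc by auto
  have iso: "isomorphic A W (img Y A) (memrel (opw (Ex t)))" if A: "A \<subseteq> piece T pc t" for A
  proof (rule inc_iso[OF _ wo_lin[OF wo_memrel[OF oe]] dfnt_parts(4)])
    show "lin A W" by (rule lin_subset[OF wo_lin[OF wo_W]]) (use A m subset_def in blast)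
    have x: "x \<in> T" "key x = key t" if "x \<in> A" for x using A m subset_def that by blast+
    show y: "Y x \<in> opw (Ex t)" if "x \<in> A" for x using Y_mem[OF x(1)] key_ord(4)[OF t x(1,2)] that by simp
    show "opair (Y x) (Y y) \<in> memrel (opw (Ex t))" if h: "x \<in> A" "y \<in> A" "lt W x y" for x y
      using key_ord(1)[OF x(1)[OF h(2)] x(1)[OF h(1)]] x(2)[OF h(1)] x(2)[OF h(2)] h y by simp
  qed
  have surj: "\<exists>s. s \<in> piece T pc t \<and> y = Y s" if "y \<in> opw (Ex t)" for y
    using Y_surj[OF t that] m key_eq by metis
  have Ym: "Y s \<in> opw (Ex t)" if "s \<in> piece T pc t" for s
    using that Y_mem[of s] key_ord(4)[OF t, of s] unfolding m by simp
  have "img Y (piece T pc t) = opw (Ex t)"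
    by (rule mext) (unfold mem_img[OF dfnt_parts(4)], use surj Ym in blast)
  thus "otp (piece T pc t) W = opw (Ex t)" using otp_eq(1)[OF oe] iso[OF subset_refl] by simp
  have tm: "s \<in> tail T W pc t \<longleftrightarrow> s \<in> piece T pc t \<and> (Y s = Y t \<or> Y t \<in> Y s)" for s
    using key_ord(1)[of s t] key_ord(3)[OF t, of s] t unfolding mem_tail m by (metis pc)
  have tp: "tail T W pc t \<subseteq> piece T pc t" unfolding subset_def tm by blast
  have "img Y (tail T W pc t) = sep (opw (Ex t)) (\<lambda>y. y = Y t \<or> Y t \<in> y)"
  proof (rule mext)
    fix y
    have "y \<in> img Y (tail T W pc t) \<longleftrightarrow> y \<in> opw (Ex t) \<and> (y = Y t \<or> Y t \<in> y)"
      unfolding mem_img[OF dfnt_parts(4)] tm using surj Ym by metis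
    thus "y \<in> img Y (tail T W pc t) \<longleftrightarrow> y \<in> sep (opw (Ex t)) (\<lambda>y. y = Y t \<or> Y t \<in> y)" by simp
  qed
  hence "isomorphic (tail T W pc t) W (sep (opw (Ex t)) (\<lambda>y. y = Y t \<or> Y t \<in> y)) (memrel (opw (Ex t)))"
    using iso[OF tp] by simp
  moreover have "wo (tail T W pc t) W" by (rule wo_subset[OF wo_W]) (simp add: subset_def)
  moreover have "wo (sep (opw (Ex t)) (\<lambda>y. y = Y t \<or> Y t \<in> y)) (memrel (opw (Ex t)))"
    by (rule wo_subset[OF wo_memrel[OF oe]]) (simp add: subset_def)
  ultimately show "otp (tail T W pc t) W = opw (Ex t)"
    using otp_iso_iff opw_tail[OF ords(3)[OF t] Y_mem[OF t]] by metis
qed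

lemma I_ord: "t \<in> T \<Longrightarrow> ordinal (I t)"
  using I_mem n ord_mem ord_omega_mem by blast

text \<open>The summand just before that of \<open>t\<close> is reversed by alternation, so its
  leading term, which is infinite, stands at its right end. The last copy of the power there is an
  infinite reversed piece that does not lie before \<open>s\<close>.\<close>

lemma lead_before:
  assumes s: "s \<in> T" and t: "t \<in> T" and st: "I s \<in> I t" and d: "ap dd (I t) = zero"
  obtains r where "r \<in> T" "Ex r \<noteq> zero" "I r \<in> I t" "ap dd (I r) = one" "key s = key r \<or> lt S s r"
proof -
  have it: "I t \<in> omega" using omega_mem_mem n I_mem[OF t] by blast
  obtain i where i: "i \<in> omega" "I t = succ i" using omega_cases[OF it] st by auto
  have "i \<in> n" using ord_trans[OF ord_omega_mem[OF n] _ I_mem[OF t]] i(2) by simp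
  then obtain r where r: "r \<in> T" "I r = i" "J r = zero" "K r = zero" "Ex r \<noteq> zero" using lead by blast
  have "ap dd i = one" using alt[of i] dd[OF \<open>i \<in> n\<close>] I_mem[OF t] d unfolding i(2) by auto
  moreover have "key s = key r \<or> lt S s r"
  proof (cases "I s = i")
    case True
    show ?thesis unfolding S_iff[OF s r(1)] key_eq
      using True r ord_zero_mem ords(1,2)[OF s] \<open>ap dd i = one\<close> by metis
  next
    case False
    hence "I s \<in> I r" using st r(2) unfolding i(2) by simp
    thus ?thesis using S_iff[OF s r(1)] by blast
  qed
  moreover have "I r \<in> I t" using i(2) r(2) by simp
  ultimately show ?thesis using that[of r] r by blast
qed

text \<open>Mirror image of \<open>lead_before\<close>: the summand just after that of a reversed
  \<open>t\<close> is not reversed and begins with its infinite leading term.\<close>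

lemma lead_after:
  assumes s: "s \<in> T" and t: "t \<in> T" and st: "I t \<in> I s" and d: "ap dd (I t) = one"
  obtains r where "r \<in> T" "Ex r \<noteq> zero" "I t \<in> I r" "ap dd (I r) = zero" "key s = key r \<or> lt S r s"
proof -
  let ?i = "succ (I t)"
  have oi: "ordinal ?i" using I_ord[OF t] by simp
  have le: "?i \<in> I s \<or> ?i = I s"
    using ord_subset_iff[OF oi I_ord[OF s]] succ_subset_iff[OF I_ord[OF t] I_ord[OF s]] st by blast
  have "?i \<in> n" using le ord_trans[OF ord_omega_mem[OF n] _ I_mem[OF s]] I_mem[OF s] by auto
  then obtain r where r: "r \<in> T" "I r = ?i" "J r = zero" "K r = zero" "Ex r \<noteq> zero" using lead by blast
  have z: "ap dd ?i = zero" using alt[OF \<open>?i \<in> n\<close>] dd[OF \<open>?i \<in> n\<close>] d by metis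
  moreover have "key s = key r \<or> lt S r s"
  proof (cases "I s = ?i")
    case True
    show ?thesis unfolding S_iff[OF r(1) s] key_eq
      using True r ord_zero_mem ords(1,2)[OF s] z by metis
  next
    case False
    thus ?thesis using S_iff[OF r(1) s] le r(2) by metis
  qed
  moreover have "I t \<in> I r" using r(2) by simp
  ultimately show ?thesis using that[of r] r by metis
qed

theorem structure_ex: "\<exists>pc N d wp M e. beta_structure mem T S W pc N d wp M e"
proof -
  obtain N pc where N: "N \<in> omega" and pcN: "\<And>t. t \<in> T \<Longrightarrow> ap pc t \<in> N"
    and pc: "\<And>s t. s \<in> T \<Longrightarrow> t \<in> T \<Longrightarrow> ap pc s = ap pc t \<longleftrightarrow> key s = key t"
    and pcl: "\<And>s t. s \<in> T \<Longrightarrow> t \<in> T \<Longrightarrow> ap pc s \<in> ap pc t \<longleftrightarrow> key s \<noteq> key t \<and> lt S s t"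
  proof -
    have "\<exists>N pc. N \<in> omega \<and> (\<forall>t. t \<in> T \<longrightarrow> ap pc t \<in> N) \<and>
      (\<forall>s t. s \<in> T \<and> t \<in> T \<longrightarrow> (ap pc s = ap pc t \<longleftrightarrow> key s = key t) \<and>
        (ap pc s \<in> ap pc t \<longleftrightarrow> key s \<noteq> key t \<and> lt S s t))"
      by (rule convex_index[OF lin_S dfnt_key fin_key]) (rule convex_S)
    thus thesis using that by blast
  qed
  obtain M wp where M: "M \<in> omega" and wpM: "\<And>t. t \<in> T \<Longrightarrow> ap wp t \<in> M"
    and wp: "\<And>s t. s \<in> T \<Longrightarrow> t \<in> T \<Longrightarrow> ap wp s = ap wp t \<longleftrightarrow> key s = key t"
    and wpl: "\<And>s t. s \<in> T \<Longrightarrow> t \<in> T \<Longrightarrow> ap wp s \<in> ap wp t \<longleftrightarrow> key s \<noteq> key t \<and> lt W s t"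
  proof -
    have "\<exists>N pc. N \<in> omega \<and> (\<forall>t. t \<in> T \<longrightarrow> ap pc t \<in> N) \<and>
      (\<forall>s t. s \<in> T \<and> t \<in> T \<longrightarrow> (ap pc s = ap pc t \<longleftrightarrow> key s = key t) \<and>
        (ap pc s \<in> ap pc t \<longleftrightarrow> key s \<noteq> key t \<and> lt W s t))"
      by (rule convex_index[OF wo_lin[OF wo_W] dfnt_key fin_key]) (rule convex_W)
    thus thesis using that by blast
  qed
  define d where "d = lam N (\<lambda>q. if \<exists>t. t \<in> T \<and> ap pc t = q \<and> ap dd (I t) = zero then zero else one)"
  have DI: "dfnt (\<lambda>v. I (f v))" if "dfnt f" for f by (rule dfnt_app1[of I, OF dfnt_parts(1) that])
  have dD: "dfnt (\<lambda>v. if \<exists>t. t \<in> T \<and> ap pc t = v 0 \<and> ap dd (I t) = zero then zero else one)"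
    by (intro dfn DI)
  have d: "ap d (ap pc t) = ap dd (I t)" if t: "t \<in> T" for t
  proof -
    have "(\<exists>s. s \<in> T \<and> ap pc s = ap pc t \<and> ap dd (I s) = zero) \<longleftrightarrow> ap dd (I t) = zero"
      using t pc key_eq by metis
    thus ?thesis unfolding d_def ap_lam[OF dD pcN[OF t]] using dd[OF I_mem[OF t]] by auto
  qed
  define e where "e = const M zero"
  have e: "ap e (ap wp t) = zero" if "t \<in> T" for t unfolding e_def using wpM[OF that] by simp
  have wop: "wo (piece T q t) W" for q t by (rule wo_subset[OF wo_W]) (simp add: subset_def)
  interpret s: wpieces mem T S W pc N d
  proof
    show "lt S s t" if "s \<in> T" "t \<in> T" "ap pc s \<in> ap pc t" for s t using pcl that by blast
    show "lt S s t \<longleftrightarrow> (if ap d (ap pc t) = zero then lt W s t else lt W t s)"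
      if "s \<in> T" "t \<in> T" "ap pc s = ap pc t" for s t
      unfolding d[OF that(2)] using key_ord(2)[OF that(2,1)] pc[OF that(1,2)] that(3) by blast
  qed (use lin_S N pcN wop in blast)+
  interpret w: wpieces mem T W W wp M e
  proof
    show "lt W s t" if "s \<in> T" "t \<in> T" "ap wp s \<in> ap wp t" for s t using wpl that by blast
    show "lt W s t \<longleftrightarrow> (if ap e (ap wp t) = zero then lt W s t else lt W t s)"
      if "s \<in> T" "t \<in> T" "ap wp s = ap wp t" for s t
      unfolding e[OF that(2)] by simp
  qed (use wo_lin[OF wo_W] M wpM wop in blast)+
  have ty: "otp (piece T pc t) W = opw (Ex t)" and tl: "otp (tail T W pc t) W = opw (Ex t)" if "t \<in> T" for t
    by (rule class_type[OF that pc[OF _ that]], assumption)+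
  have bg: "s.big r" if r: "r \<in> T" "Ex r \<noteq> zero" for r
  proof -
    have "one \<in> opw (Ex r)" using opw_less[OF ords(3)[OF r(1)] ord_zero_mem[OF ords(3)[OF r(1)] r(2)]] opw_zero by simp
    then obtain s where s: "s \<in> T" "I s = I r" "J s = J r" "K s = K r" "Y s = one" using Y_surj[OF r(1)] by blast
    obtain s' where s': "s' \<in> T" "I s' = I r" "J s' = J r" "K s' = K r" "Y s' = zero"
      using Y_surj[OF r(1) opw_zero_mem[OF ords(3)[OF r(1)]]] by blast
    have "s \<noteq> s'" using s s' by auto
    moreover have "ap pc s = ap pc r" "ap pc s' = ap pc r" using pc[of _ r] r s s' key_eq by simp_all
    ultimately show ?thesis unfolding s.big_def using s(1) s'(1) by metis
  qed
  have mono: "opw (Ex t) \<subseteq> opw (Ex s)" if "s \<in> T" "t \<in> T" "Ex t \<subseteq> Ex s" for s t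
    using opw_mono ords(3) that by blast
  have "beta_structure mem T S W pc N d wp M e"
  proof
    show "otp (tail T W pc t) W = otp (piece T pc t) W" if "t \<in> T" for t using ty[OF that] tl[OF that] by simp
    show "otp (tail T W wp t) W = otp (piece T wp t) W" if "t \<in> T" for t
      using class_type[OF that wp[OF _ that]] by simp
    show "otp (piece T pc t) W \<subseteq> otp (piece T pc s) W"
      if h: "s \<in> T" "t \<in> T" "ap pc s \<in> ap pc t" "ap d (ap pc t) = zero" "s.big t"
        and b: "\<And>r. r \<in> T \<Longrightarrow> s.big r \<Longrightarrow> ap pc s \<in> ap pc r \<or> ap pc s = ap pc r \<Longrightarrow> ap pc r \<in> ap pc t \<Longrightarrow>
        ap d (ap pc r) = zero" for s t
    proof -
      have dt: "ap dd (I t) = zero" using h(4) d[OF h(2)] by simp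
      have st: "key s \<noteq> key t" "lt S s t" using pcl h by blast+
      \<comment> \<open>The hypothesis on intermediate pieces excludes an infinite reversed one, so
        \<open>s\<close> and \<open>t\<close> belong to the same summand, where the exponents
        decrease.\<close>
      have "\<not> I s \<in> I t"
      proof
        assume "I s \<in> I t"
        then obtain r where r: "r \<in> T" "Ex r \<noteq> zero" "I r \<in> I t" "ap dd (I r) = one" "key s = key r \<or> lt S s r"
          by (rule lead_before[OF h(1,2) _ dt])
        have "ap pc r \<in> ap pc t" using pcl[OF r(1) h(2)] S_iff[OF r(1) h(2)] r(3) key_eq mem_irrefl by metis
        moreover have "ap pc s \<in> ap pc r \<or> ap pc s = ap pc r" using pcl[OF h(1) r(1)] pc[OF h(1) r(1)] r(5) by blast
        ultimately have "ap d (ap pc r) = zero" using b[OF r(1) bg[OF r(1,2)]] by blast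
        thus False using r(4) d[OF r(1)] by simp
      qed
      hence "I s = I t" "J s \<in> J t \<or> J s = J t" using st(2) S_iff[OF h(1,2)] dt one_zero by metis+
      thus ?thesis using mono[OF h(1,2)] Ex_J[OF h(1,2)] ty[OF h(1)] ty[OF h(2)] by simp
    qed
    show "otp (piece T pc t) W \<subseteq> otp (piece T pc s) W"
      if h: "s \<in> T" "t \<in> T" "ap pc t \<in> ap pc s" "ap d (ap pc t) \<noteq> zero" "s.big t"
        and b: "\<And>r. r \<in> T \<Longrightarrow> s.big r \<Longrightarrow> ap pc r \<in> ap pc s \<or> ap pc s = ap pc r \<Longrightarrow> ap pc t \<in> ap pc r \<Longrightarrow>
        ap d (ap pc r) \<noteq> zero" for s t
    proof -
      have dt: "ap dd (I t) = one" using h(4) d[OF h(2)] dd[OF I_mem[OF h(2)]] by simp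
      have st: "key t \<noteq> key s" "lt S t s" using pcl h by blast+
      have "\<not> I t \<in> I s"
      proof
        assume "I t \<in> I s"
        then obtain r where r: "r \<in> T" "Ex r \<noteq> zero" "I t \<in> I r" "ap dd (I r) = zero" "key s = key r \<or> lt S r s"
          by (rule lead_after[OF h(1,2) _ dt])
        have "ap pc t \<in> ap pc r" using pcl[OF h(2) r(1)] S_iff[OF h(2) r(1)] r(3) key_eq mem_irrefl by metis
        moreover have "ap pc r \<in> ap pc s \<or> ap pc s = ap pc r" using pcl[OF r(1) h(1)] pc[OF h(1) r(1)] r(5) by metis
        ultimately have "ap d (ap pc r) \<noteq> zero" using b[OF r(1) bg[OF r(1,2)]] by blast
        thus False using r(4) d[OF r(1)] by simp
      qed
      hence "I s = I t" "J s \<in> J t \<or> J s = J t" using st(2) S_iff[OF h(2,1)] dt one_zero by metis+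
      thus ?thesis using mono[OF h(1,2)] Ex_J[OF h(1,2)] ty[OF h(1)] ty[OF h(2)] by simp
    qed
    show "otp (piece T wp t) W \<subseteq> otp (piece T wp s) W" if h: "s \<in> T" "t \<in> T" "ap wp s \<in> ap wp t" for s t
    proof -
      have "lt W s t" using wpl h by blast
      hence "l s \<in> l t \<or> l s = l t" using W_iff[OF h(1,2)] by blast
      hence "Ex t \<subseteq> Ex s" using Ex_l[OF h(1,2)] Ex_J[OF h(1,2)] l_iff[OF h(1,2)] by blast
      thus ?thesis using mono[OF h(1,2)] class_type(1)[OF h(1) wp[OF _ h(1)]] class_type(1)[OF h(2) wp[OF _ h(2)]] by simp
    qed
    show "ap pc s = ap pc t \<longleftrightarrow> ap wp s = ap wp t" if "s \<in> T" "t \<in> T" for s t using pc wp that by simp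
  qed (use e wo_W in blast)+
  thus ?thesis by blast
qed

end

section \<open>From the definition of beta to a well-order on \<open>T\<close>\<close>

context zf_model
begin

lemma fin_bij:
  assumes "fin A" "bij_betw F (el A) (el B)" "dfn1 F"
  shows "fin B"
  using fin_cong[OF equipotentI[OF assms(3,2)]] assms(1) by blast

text \<open>With leading exponent zero, strict decrease leaves room for a single term, and that term
  is finite.\<close>

lemma cnf_infinite:
  assumes d: "cnf_data m e c" and inf: "\<not> fin (cnf_val m e c)"
  shows "zero \<in> m" "ap e zero \<noteq> zero"
proof -
  note D = cnf_dataD[OF d]
  have "\<not> fin (dsum m (terms m e c))"
    using inf fin_bij[OF _ rk_bij[OF D(9)]] unfolding cnf_val_def by auto
  then obtain j where j: "j \<in> m" "\<not> fin (ap (terms m e c) j)"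
    using fin_dsum fin_omega_mem[OF D(1)] by blast
  show z: "zero \<in> m" using ord_zero_mem[OF ord_omega_mem[OF D(1)]] j(1) not_mem_zero by metis
  show "ap e zero \<noteq> zero"
  proof
    assume e: "ap e zero = zero"
    have "j = zero" using D(7)[of zero j] ord_zero_mem[OF ord_mem[OF ord_omega_mem[OF D(1)] j(1)]] j(1) e by auto
    hence "ap (terms m e c) j = mul one (ap c zero)" using z e opw_zero by simp
    moreover have "fin (mul one (ap c zero))"
    proof -
      have o: "ordinal (ap c zero)" "ordinal one" using D(5)[OF z] ord_omega_mem by (simp_all add: one_def)
      have "fin (times (ap c zero) one)" by (intro fin_times fin_omega_mem D(5)[OF z]) (simp add: one_def)
      thus ?thesis unfolding mul_def using fin_omega_mem fin_otp wo_lxr[OF o] by blast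
    qed
    ultimately show False using j(2) by simp
  qed
qed

text \<open>The data in \<open>is_beta\<close> address each point in stages: summand, term of its
  normal form, copy of the power, place in the copy. Each stage is inverted by ranks, and the
  resulting coordinates satisfy \<open>beta_data\<close>.\<close>

lemma is_beta_structure:
  assumes lin: "lin T S" and beta: "is_beta T S x"
  shows "\<exists>W pc N d wp M e. beta_structure mem T S W pc N d wp M e \<and> x = otp T W"
proof -
  obtain n b m tt N g sq where alt: "alternating_sum T S n b" and mf: "fun_on m n" and tf: "fun_on tt n"
    and cnf: "\<forall>i. i \<in> n \<longrightarrow> is_cnf (app b i) (app m i) (app tt i)"
    and N: "N \<in> omega" and g: "bijection g N (sum_set n m)" and sf: "fun_on sq N"
    and sq: "\<forall>l i j. l \<in> N \<and> app g l = opair i j \<longrightarrow> app sq l = app (app tt i) j"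
    and dec: "\<forall>l l'. l \<in> l' \<and> l' \<in> N \<longrightarrow> app sq l' \<in> app sq l \<or> app sq l' = app sq l"
    and x: "x = osum N sq"
    using beta unfolding is_beta_def by blast
  obtain dd where n: "n \<in> omega" and bf: "fun_on b n"
    and bo: "\<forall>i. i \<in> n \<longrightarrow> ordinal (app b i) \<and> infinite_set (app b i)" and df: "maps dd n two"
    and da: "\<forall>i. succ i \<in> n \<longrightarrow> app dd (succ i) \<noteq> app dd i"
    and iso: "isomorphic T S (sum_set n b) (sum_rel n b dd)"
    using alt unfolding alternating_sum_def by blast
  have ddf: "fun_on dd n" using df unfolding maps_iff by blast
  have on: "ordinal n" and oN: "ordinal N" using ord_omega_mem n N by blast+
  have an: "app b i = ap b i" "app m i = ap m i" "app tt i = ap tt i" "app dd i = ap dd i" if "i \<in> n" for i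
    using fun_on_ap(2) bf mf tf ddf that by blast+
  have inf: "\<not> fin (ap b i)" if "i \<in> n" for i
    using bo an(1)[OF that] that infinite_set_iff by metis
  have cnf': "is_cnf (ap b i) (ap m i) (ap tt i)" if "i \<in> n" for i using cnf an[OF that] that by metis
  let ?P = "\<lambda>i p. cnf_data (ap m i) (fstp p) (sndp p) \<and> ap b i = cnf_val (ap m i) (fstp p) (sndp p) \<and>
    ap tt i = terms (ap m i) (fstp p) (sndp p)"
  have "\<exists>f. fun_on f n \<and> (\<forall>i. i \<in> n \<longrightarrow> ?P i (ap f i))"
  proof (rule fin_choice[OF n])
    show "dfnp (\<lambda>v. ?P (v 0) (v 1))" by (intro dfn)
    fix i assume "i \<in> n"
    then obtain e c where "cnf_data (ap m i) e c \<and> ap b i = cnf_val (ap m i) e c \<and> ap tt i = terms (ap m i) e c"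
      using is_cnfD[OF cnf'] by blast
    hence "?P i (opair e c)" by simp
    thus "\<exists>p. ?P i p" by blast
  qed
  then obtain f where f: "\<And>i. i \<in> n \<Longrightarrow> ?P i (ap f i)" by blast
  define E where "E i = fstp (ap f i)" for i
  define C where "C i = sndp (ap f i)" for i
  have cd: "cnf_data (ap m i) (E i) (C i)" and bv: "ap b i = cnf_val (ap m i) (E i) (C i)"
    and tv: "ap tt i = terms (ap m i) (E i) (C i)" if "i \<in> n" for i
    using f[OF that] unfolding E_def C_def by blast+
  note CD = cnf_dataD[OF cd]
  obtain \<phi> where \<phi>: "isoby \<phi> T S (dsum n b) (dsr n b dd)"
    using iso unfolding sum_set_eq[OF bf] sum_rel_eq[OF bf ddf] isomorphic_iff by blast
  have \<phi>b: "bij_betw (ap \<phi>) (el T) (el (dsum n b))"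
    and \<phi>S: "\<And>u v. u \<in> T \<Longrightarrow> v \<in> T \<Longrightarrow> lt S u v \<longleftrightarrow> opair (ap \<phi> u) (ap \<phi> v) \<in> dsr n b dd"
    using \<phi> unfolding isoby_def by blast+
  have gb: "bij_betw (ap g) (el N) (el (dsum n m))" and gf: "fun_on g N"
    using g unfolding bijection_iff sum_set_eq[OF mf] by blast+

  define I where "I t = fstp (ap \<phi> t)" for t
  define X where "X t = sndp (ap \<phi> t)" for t
  define B where "B i = dsum (ap m i) (ap tt i)" for i
  define R where "R i = osr (ap m i) (ap tt i)" for i
  define H where "H t = invf (B (I t)) (rk (B (I t)) (R (I t))) (X t)" for t
  define J where "J t = fstp (H t)" for t
  define Z where "Z t = sndp (H t)" for t
  define Ex where "Ex t = ap (E (I t)) (J t)" for t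
  define c where "c t = ap (C (I t)) (J t)" for t
  define Q where "Q t = times (c t) (opw (Ex t))" for t
  define L where "L t = lxr (c t) (opw (Ex t))" for t
  define H2 where "H2 t = invf (Q t) (rk (Q t) (L t)) (Z t)" for t
  define K where "K t = fstp (H2 t)" for t
  define Y where "Y t = sndp (H2 t)" for t
  define l where "l t = invf N (ap g) (opair (I t) (J t))" for t
  note defs1 = I_def X_def B_def R_def H_def J_def Z_def and defs2 = Ex_def c_def E_def C_def Q_def L_def H2_def
  have dI: "dfn1 I" unfolding I_def by (intro dfn)
  have dX: "dfn1 X" unfolding X_def by (intro dfn)
  have dH: "dfnt (\<lambda>v. H (h v))" if "dfnt h" for h
    by (rule dfnt_app1[of H, OF _ that]) (unfold H_def B_def R_def I_def X_def, intro dfn)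
  have dJ: "dfnt (\<lambda>v. J (h v))" if "dfnt h" for h unfolding J_def by (intro dfn dH that)
  have dZ: "dfnt (\<lambda>v. Z (h v))" if "dfnt h" for h unfolding Z_def by (intro dfn dH that)
  have dI': "dfnt (\<lambda>v. I (h v))" if "dfnt h" for h unfolding I_def by (intro dfn that)
  have dc: "dfnt (\<lambda>v. c (h v))" if "dfnt h" for h unfolding c_def C_def by (intro dfn dI' dJ that)
  have dE: "dfnt (\<lambda>v. Ex (h v))" if "dfnt h" for h unfolding Ex_def E_def by (intro dfn dI' dJ that)
  have dH2: "dfn1 H2"
    unfolding H2_def Q_def L_def by (intro dfn dZ dc dE)
  have dK: "dfn1 K" unfolding K_def by (intro dfn dH2)
  have dY: "dfn1 Y" unfolding Y_def by (intro dfn dH2)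
  have dl: "dfnt (\<lambda>v. l (h v))" if "dfnt h" for h unfolding l_def by (intro dfn dI' dJ that)

  have \<phi>t: "ap \<phi> t = opair (I t) (X t)" and In: "I t \<in> n" and Xb: "X t \<in> ap b (I t)" if t: "t \<in> T" for t
  proof -
    have "ap \<phi> t \<in> dsum n b" using \<phi>b t unfolding bij_el_iff by blast
    then obtain i y where iy: "ap \<phi> t = opair i y" "i \<in> n" "y \<in> ap b i" by auto
    hence "I t = i" "X t = y" unfolding I_def X_def by simp_all
    thus "ap \<phi> t = opair (I t) (X t)" "I t \<in> n" "X t \<in> ap b (I t)" using iy by simp_all
  qed
  have wB: "wo (B i) (R i)" if "i \<in> n" for i unfolding B_def R_def tv[OF that] by (rule CD(9)[OF that])
  have bB: "bij_betw (rk (B i) (R i)) (el (B i)) (el (ap b i))" if "i \<in> n" for i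
    using rk_bij[OF wB[OF that]] unfolding B_def R_def tv[OF that] bv[OF that] cnf_val_def .
  have Ht: "H t \<in> B (I t)" and rH: "rk (B (I t)) (R (I t)) (H t) = X t" if t: "t \<in> T" for t
    using bij_betw_invf(1,2)[OF bB[OF In[OF t]]] Xb[OF t] unfolding H_def bij_el_iff by blast+
  have HJ: "H t = opair (J t) (Z t)" and Jm: "J t \<in> ap m (I t)" and Zt: "Z t \<in> ap (ap tt (I t)) (J t)" if t: "t \<in> T" for t
  proof -
    obtain i y where iy: "H t = opair i y" "i \<in> ap m (I t)" "y \<in> ap (ap tt (I t)) i"
      using Ht[OF t] unfolding B_def by auto
    hence "J t = i" "Z t = y" unfolding J_def Z_def by simp_all
    thus "H t = opair (J t) (Z t)" "J t \<in> ap m (I t)" "Z t \<in> ap (ap tt (I t)) (J t)" using iy by simp_all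
  qed
  have trm: "ap (ap tt (I t)) (J t) = mul (opw (Ex t)) (c t)" if t: "t \<in> T" for t
    unfolding tv[OF In[OF t]] ap_terms[OF Jm[OF t]] Ex_def c_def ..
  have oE: "ordinal (Ex t)" and cw: "c t \<in> omega" and c0: "c t \<noteq> zero" if t: "t \<in> T" for t
    using CD(4,5,6)[OF In[OF t] Jm[OF t]] unfolding Ex_def c_def by blast+
  have wQ: "wo (Q t) (L t)" if t: "t \<in> T" for t
    unfolding Q_def L_def by (rule wo_lxr[OF ord_omega_mem[OF cw[OF t]] ord_opw[OF oE[OF t]]])
  have bQ: "bij_betw (rk (Q t) (L t)) (el (Q t)) (el (ap (ap tt (I t)) (J t)))" if t: "t \<in> T" for t
    using rk_bij[OF wQ[OF t]] unfolding trm[OF t] mul_def Q_def L_def .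
  have H2t: "H2 t \<in> Q t" and rH2: "rk (Q t) (L t) (H2 t) = Z t" if t: "t \<in> T" for t
    using bij_betw_invf(1,2)[OF bQ[OF t]] Zt[OF t] unfolding H2_def bij_el_iff by blast+
  have HK: "H2 t = opair (K t) (Y t)" and Kc: "K t \<in> c t" and Yt: "Y t \<in> opw (Ex t)" if t: "t \<in> T" for t
  proof -
    obtain i y where iy: "H2 t = opair i y" "i \<in> c t" "y \<in> opw (Ex t)"
      using H2t[OF t] unfolding Q_def by auto
    hence "K t = i" "Y t = y" unfolding K_def Y_def by simp_all
    thus "H2 t = opair (K t) (Y t)" "K t \<in> c t" "Y t \<in> opw (Ex t)" using iy by simp_all
  qed
  have X_iff: "X u \<in> X v \<longleftrightarrow> J u \<in> J v \<or> J u = J v \<and> Z u \<in> Z v" if u: "u \<in> T" and v: "v \<in> T" and i: "I u = I v" for u v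
  proof -
    have "X u \<in> X v \<longleftrightarrow> opair (H u) (H v) \<in> R (I v)"
      using rk_iff[OF wB[OF In[OF v]], of "H u" "H v"] Ht[OF u] Ht[OF v] rH[OF u] rH[OF v] i by simp
    also have "\<dots> \<longleftrightarrow> J u \<in> J v \<or> J u = J v \<and> Z u \<in> Z v"
      unfolding HJ[OF u] HJ[OF v] R_def mem_osr using Jm[OF u] Jm[OF v] Zt[OF u] Zt[OF v] i by simp
    finally show ?thesis .
  qed
  have Z_iff: "Z u \<in> Z v \<longleftrightarrow> K u \<in> K v \<or> K u = K v \<and> Y u \<in> Y v" if u: "u \<in> T" and v: "v \<in> T" and i: "I u = I v" "J u = J v" for u v
  proof -
    have e: "Ex u = Ex v" "c u = c v" "Q u = Q v" "L u = L v" unfolding Q_def L_def Ex_def c_def i by simp_all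
    have "Z u \<in> Z v \<longleftrightarrow> opair (H2 u) (H2 v) \<in> L v"
      using rk_iff[OF wQ[OF v], of "H2 u" "H2 v"] H2t[OF u] H2t[OF v] rH2[OF u] rH2[OF v] e by simp
    also have "\<dots> \<longleftrightarrow> K u \<in> K v \<or> K u = K v \<and> Y u \<in> Y v"
      unfolding HK[OF u] HK[OF v] L_def mem_lxr using Kc[OF u] Kc[OF v] Yt[OF u] Yt[OF v] e by simp
    finally show ?thesis .
  qed
  \<comment> \<open>All admissible coordinates occur; \<open>mk1\<close> and \<open>mk2\<close> lead
    from coordinates back to points.\<close>
  have mk1: "\<exists>t. t \<in> T \<and> I t = i \<and> J t = j \<and> Z t = z" if i: "i \<in> n" and j: "j \<in> ap m i" and z: "z \<in> ap (ap tt i) j" for i j z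
  proof -
    have b: "opair j z \<in> B i" unfolding B_def using j z by simp
    let ?x = "rk (B i) (R i) (opair j z)"
    have "?x \<in> ap b i" using bB[OF i] b unfolding bij_el_iff by blast
    hence "opair i ?x \<in> dsum n b" using i by simp
    then obtain t where t: "t \<in> T" "ap \<phi> t = opair i ?x" using \<phi>b unfolding bij_el_iff by blast
    hence ix: "I t = i" "X t = ?x" unfolding I_def X_def by simp_all
    have "H t = opair j z" unfolding H_def ix by (rule bij_betw_invf(3)[OF bB[OF i] b])
    thus ?thesis using t ix unfolding J_def Z_def by auto
  qed
  have mk2: "\<exists>t. t \<in> T \<and> I t = i \<and> J t = j \<and> K t = k \<and> Y t = y"
    if i: "i \<in> n" and j: "j \<in> ap m i" and k: "k \<in> ap (C i) j" and y: "y \<in> opw (ap (E i) j)" for i j k y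
  proof -
    let ?Q = "times (ap (C i) j) (opw (ap (E i) j))" and ?L = "lxr (ap (C i) j) (opw (ap (E i) j))"
    have w: "wo ?Q ?L" by (intro wo_lxr ord_omega_mem ord_opw CD(4,5)[OF i j])
    have q: "opair k y \<in> ?Q" using k y by simp
    have "rk ?Q ?L (opair k y) \<in> ap (ap tt i) j"
      using rk_mem[OF w q] unfolding tv[OF i] ap_terms[OF j] mul_def .
    then obtain t where t: "t \<in> T" "I t = i" "J t = j" "Z t = rk ?Q ?L (opair k y)" using mk1[OF i j] by blast
    have "Q t = ?Q" "L t = ?L" unfolding Q_def L_def c_def Ex_def t(2,3) by simp_all
    hence "H2 t = opair k y" using bij_betw_invf(3)[OF bQ[OF t(1)], of "opair k y"] q t(4) unfolding H2_def by simp
    thus ?thesis using t unfolding K_def Y_def by auto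
  qed

  have IJ: "opair (I t) (J t) \<in> dsum n m" if "t \<in> T" for t using In[OF that] Jm[OF that] by simp
  have lN: "l t \<in> N" and gl: "ap g (l t) = opair (I t) (J t)" if t: "t \<in> T" for t
    using bij_betw_invf(1,2)[OF gb] IJ[OF t] unfolding l_def bij_el_iff by blast+
  have sqv: "ap sq l = ap (ap tt i) j" if h: "l \<in> N" "ap g l = opair i j" for l i j
  proof -
    have "opair i j \<in> dsum n m" using gb h unfolding bij_el_iff by metis
    hence i: "i \<in> n" "j \<in> ap m i" by simp_all
    have "app g l = opair i j" using h fun_on_ap(2)[OF gf h(1)] by simp
    hence "app sq l = app (app tt i) j" using sq h(1) by blast
    moreover have "app (ap tt i) j = ap (ap tt i) j" using fun_on_ap(2)[of "ap tt i" "ap m i"] i tv[OF i(1)] by simp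
    ultimately show ?thesis using fun_on_ap(2)[OF sf h(1)] an(3)[OF i(1)] by simp
  qed
  have l_iff: "l u = l v \<longleftrightarrow> I u = I v \<and> J u = J v" if "u \<in> T" "v \<in> T" for u v
  proof
    assume "l u = l v"
    hence "opair (I u) (J u) = opair (I v) (J v)" using gl[OF that(1)] gl[OF that(2)] by simp
    thus "I u = I v \<and> J u = J v" by simp
  qed (simp add: l_def)
  have sqo: "ordinal (ap sq l)" if l: "l \<in> N" for l
  proof -
    have "ap g l \<in> dsum n m" using gb l unfolding bij_el_iff by blast
    then obtain i j where ij: "ap g l = opair i j" "i \<in> n" "j \<in> ap m i" by auto
    thus ?thesis unfolding sqv[OF l ij(1)] tv[OF ij(2)] by (intro CD(8))
  qed
  have wN: "wo (dsum N sq) (osr N sq)" by (rule wo_dsum[OF oN sqo])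
  \<comment> \<open>\<open>W\<close> is pulled back along \<open>\<theta>\<close> from the sum of
    the terms in decreasing order, so its type is the given \<open>x\<close>.\<close>
  define \<theta> where "\<theta> t = opair (l t) (Z t)" for t
  have d\<theta>: "dfnt (\<lambda>v. \<theta> (h v))" if "dfnt h" for h unfolding \<theta>_def by (intro dfn dl dZ that)
  define W where "W = sep (times T T) (\<lambda>p. lt (osr N sq) (\<theta> (fstp p)) (\<theta> (sndp p)))"
  have WD: "dfnp (\<lambda>v. lt (osr N sq) (\<theta> (fstp (v 0))) (\<theta> (sndp (v 0))))" by (intro dfn d\<theta>)
  have W\<theta>: "lt W u v \<longleftrightarrow> lt (osr N sq) (\<theta> u) (\<theta> v)" if "u \<in> T" "v \<in> T" for u v
    unfolding W_def mem_sep[OF WD] using that by simp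
  have Zs: "Z t \<in> ap sq (l t)" if t: "t \<in> T" for t using sqv[OF lN[OF t] gl[OF t]] Zt[OF t] by simp
  have \<theta>b: "bij_betw \<theta> (el T) (el (dsum N sq))" unfolding bij_el_iff
  proof (intro conjI allI impI)
    show "\<theta> t \<in> dsum N sq" if "t \<in> T" for t unfolding \<theta>_def using lN[OF that] Zs[OF that] by simp
    fix p assume "p \<in> dsum N sq"
    then obtain k z where p: "p = opair k z" "k \<in> N" "z \<in> ap sq k" by auto
    have "ap g k \<in> dsum n m" using gb p unfolding bij_el_iff by blast
    then obtain i j where ij: "ap g k = opair i j" "i \<in> n" "j \<in> ap m i" by auto
    then obtain t where t: "t \<in> T" "I t = i" "J t = j" "Z t = z" using mk1[OF ij(2,3)] p(3) sqv[OF p(2) ij(1)] by auto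
    have "l t = k" unfolding l_def t(2,3) ij(1)[symmetric] by (rule bij_betw_invf(3)[OF gb p(2)])
    show "\<exists>!t. t \<in> T \<and> \<theta> t = p"
    proof
      show "t \<in> T \<and> \<theta> t = p" unfolding \<theta>_def using t p \<open>l t = k\<close> by simp
      fix u assume u: "u \<in> T \<and> \<theta> u = p"
      hence e: "l u = l t" "Z u = Z t" using t p \<open>l t = k\<close> unfolding \<theta>_def by simp_all
      have ij: "I u = I t" "J u = J t" using l_iff[of u t] u t e by blast+
      have "H u = H t" using HJ[of u] HJ[OF t(1)] u ij e(2) by simp
      hence "X u = X t" using rH[of u] rH[OF t(1)] u ij by simp
      hence "ap \<phi> u = ap \<phi> t" using \<phi>t[of u] \<phi>t[OF t(1)] u ij by simp
      thus "u = t" using \<phi>b u t(1) unfolding bij_betw_def inj_on_def by simp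
    qed
  qed
  have isoW: "isomorphic T W (dsum N sq) (osr N sq)"
    by (rule isomorphicI[OF d\<theta> \<theta>b W\<theta>]) (simp_all add: dfn)
  have woW: "wo T W" by (rule wo_iso[OF isoW wN])
  have xW: "x = otp T W"
  proof -
    have "osum N sq = otp (dsum N sq) (osr N sq)" by (rule osum_eq[OF oN sf sqo])
    thus ?thesis using x otp_iso_iff[OF woW wN] isoW by simp
  qed
  have W_iff: "lt W u v \<longleftrightarrow> l u \<in> l v \<or> l u = l v \<and> (K u \<in> K v \<or> K u = K v \<and> Y u \<in> Y v)"
    if u: "u \<in> T" and v: "v \<in> T" for u v
  proof -
    have "lt W u v \<longleftrightarrow> l u \<in> l v \<or> l u = l v \<and> Z u \<in> Z v"
      unfolding W\<theta>[OF u v] \<theta>_def mem_osr using lN[OF u] lN[OF v] Zs[OF u] Zs[OF v] by blast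
    thus ?thesis using Z_iff[OF u v] l_iff[OF u v] by blast
  qed
  interpret beta_data mem T S W n dd I J K Y l Ex
  proof
    show "ap dd i = zero \<or> ap dd i = one" if "i \<in> n" for i using df that unfolding maps_iff by simp
    show "ap dd (succ i) \<noteq> ap dd i" if h: "succ i \<in> n" for i
    proof -
      have "i \<in> n" using ord_trans[OF on _ h] by simp
      thus ?thesis using da h an(4) by metis
    qed
    show "ordinal (J t)" "ordinal (K t)" if "t \<in> T" for t
      using ord_mem ord_omega_mem CD(1)[OF In[OF that]] Jm[OF that] cw[OF that] Kc[OF that] by blast+
    show "fin (img (\<lambda>t. opair (opair (I t) (J t)) (K t)) T)"
    proof -
      let ?h = "\<lambda>p. ap (C (fstp p)) (sndp p)"
      \<comment> \<open>Triples of summand, term and copy, where the copies are limited by the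
        finite coefficient of the term.\<close>
      let ?D = "dsum (dsum n m) (lam (dsum n m) ?h)"
      have hD: "dfnt (\<lambda>v. ?h (v 0))" unfolding C_def by (intro dfn)
      have kD: "dfnt (\<lambda>v. opair (opair (I (v 0)) (J (v 0))) (K (v 0)))" by (intro dfn dI dJ dK)
      have "fin (dsum n m)" by (rule fin_dsum[OF fin_omega_mem[OF n]]) (use CD(1) fin_omega_mem in blast)
      hence "fin ?D"
      proof (rule fin_dsum)
        fix p assume p: "p \<in> dsum n m"
        then obtain i j where "p = opair i j" "i \<in> n" "j \<in> ap m i" by auto
        thus "fin (ap (lam (dsum n m) ?h) p)"
          unfolding ap_lam[OF hD p] using CD(5) fin_omega_mem by simp
      qed
      moreover have "img (\<lambda>t. opair (opair (I t) (J t)) (K t)) T \<subseteq> ?D"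
        unfolding subset_def mem_img[OF kD]
      proof (intro allI impI)
        fix p assume "\<exists>t. t \<in> T \<and> p = opair (opair (I t) (J t)) (K t)"
        then obtain t where t: "t \<in> T" "p = opair (opair (I t) (J t)) (K t)" by blast
        have "K t \<in> ap (lam (dsum n m) ?h) (opair (I t) (J t))"
          unfolding ap_lam[OF hD IJ[OF t(1)]] using Kc[OF t(1)] unfolding c_def by simp
        thus "p \<in> ?D" unfolding mem_dsum[of _ "dsum n m"] t(2) using IJ[OF t(1)] by blast
      qed
      ultimately show ?thesis using fin_subset by blast
    qed
    show "lt S s t \<longleftrightarrow> I s \<in> I t \<or> I s = I t \<and>
      (ap dd (I t) = zero \<and> (J s \<in> J t \<or> J s = J t \<and> (K s \<in> K t \<or> K s = K t \<and> Y s \<in> Y t)) \<or>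
       ap dd (I t) = one \<and> (J t \<in> J s \<or> J t = J s \<and> (K t \<in> K s \<or> K t = K s \<and> Y t \<in> Y s)))"
      if s: "s \<in> T" and t: "t \<in> T" for s t
    proof -
      have "lt S s t \<longleftrightarrow> I s \<in> I t \<or> I s = I t \<and> (ap dd (I t) = zero \<and> X s \<in> X t \<or> ap dd (I t) = one \<and> X t \<in> X s)"
        unfolding \<phi>S[OF s t] \<phi>t[OF s] \<phi>t[OF t] mem_dsr using In[OF s] In[OF t] Xb[OF s] Xb[OF t] by auto
      thus ?thesis using X_iff[OF s t] X_iff[OF t s] Z_iff[OF s t] Z_iff[OF t s] by (cases "I s = I t") (auto)
    qed
    show "\<exists>s. s \<in> T \<and> I s = I t \<and> J s = J t \<and> K s = K t \<and> Y s = y" if t: "t \<in> T" and y: "y \<in> opw (Ex t)" for t y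
      by (rule mk2[OF In[OF t] Jm[OF t]]) (use Kc[OF t] y in \<open>simp_all add: c_def Ex_def\<close>)
    show "Ex t \<subseteq> Ex s" if s: "s \<in> T" and t: "t \<in> T" and i: "I s = I t" and j: "J s \<in> J t \<or> J s = J t" for s t
      using j
    proof
      assume "J s \<in> J t"
      hence "Ex t \<in> Ex s" using CD(7)[OF In[OF t] _ Jm[OF t]] unfolding Ex_def i by blast
      thus ?thesis using ord_mem_subset oE[OF s] by blast
    qed (simp add: Ex_def i)
    show "Ex t \<subseteq> Ex s" if s: "s \<in> T" and t: "t \<in> T" and l: "l s \<in> l t" for s t
    proof -
      have "app sq (l t) \<in> app sq (l s) \<or> app sq (l t) = app sq (l s)" using dec l lN[OF t] by blast
      hence "ap sq (l t) \<in> ap sq (l s) \<or> ap sq (l t) = ap sq (l s)"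
        using fun_on_ap(2)[OF sf lN[OF t]] fun_on_ap(2)[OF sf lN[OF s]] by simp
      hence "ap sq (l t) \<subseteq> ap sq (l s)" using ord_subset_iff sqo lN s t by blast
      hence "mul (opw (Ex t)) (c t) \<subseteq> mul (opw (Ex s)) (c s)"
        using sqv[OF lN[OF t] gl[OF t]] sqv[OF lN[OF s] gl[OF s]] trm[OF s] trm[OF t] by simp
      thus ?thesis by (rule opw_term_le[OF oE[OF s] oE[OF t] cw[OF s] cw[OF t] c0[OF t]])
    qed
    show "\<exists>t. t \<in> T \<and> I t = i \<and> J t = zero \<and> K t = zero \<and> Ex t \<noteq> zero" if i: "i \<in> n" for i
    proof -
      have z: "zero \<in> ap m i" "ap (E i) zero \<noteq> zero" using cnf_infinite[OF cd[OF i]] inf[OF i] bv[OF i] by simp_all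
      have "zero \<in> ap (C i) zero" using ord_zero_mem[OF ord_omega_mem] CD(5,6)[OF i z(1)] by blast
      then obtain t where t: "t \<in> T" "I t = i" "J t = zero" "K t = zero"
        using mk2[OF i z(1) _ opw_zero_mem[OF CD(4)[OF i z(1)]]] by blast
      have "Ex t \<noteq> zero" using z(2) t(2,3) by (simp add: Ex_def)
      thus ?thesis using t by blast
    qed
  qed (fact dI dJ[OF dfnt_var] dK dY lin woW n In oE W_iff l_iff Yt)+
  show ?thesis using structure_ex xW by blast
qed

end

subsection \<open>Existence of alternating sums\<close>

context zf_model
begin

definition conv :: "'a \<Rightarrow> 'a \<Rightarrow> 'a" where
  "conv A R = sep (times A A) (\<lambda>p. lt R (sndp p) (fstp p))"

lemma mem_conv: "opair x y \<in> conv A R \<longleftrightarrow> x \<in> A \<and> y \<in> A \<and> lt R y x"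
  unfolding conv_def by simp

text \<open>Turns the direction of a block into a relation, so that \<open>wo\<close> covers
  reversed blocks as well.\<close>

definition dirr :: "'a \<Rightarrow> 'a \<Rightarrow> 'a \<Rightarrow> 'a" where
  "dirr A R c = (if c = zero then R else conv A R)"

lemma dfnt_dirr [dfn, simp]: "dfnt A \<Longrightarrow> dfnt R \<Longrightarrow> dfnt c \<Longrightarrow> dfnt (\<lambda>v. dirr (A v) (R v) (c v))"
  by (rule dfnt_app3[of dirr]) (unfold dirr_def conv_def, intro dfn)

lemma lin_dirr:
  assumes l: "lin A R" shows "lin A (dirr A R c)"
proof (cases "c = zero")
  case False
  have "lin A (conv A R)" unfolding lin_def mem_conv
    using lin_irrefl[OF l] lin_trans[OF l] lin_total[OF l] by blast
  thus ?thesis using False unfolding dirr_def by simp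
qed (use l in \<open>simp add: dirr_def\<close>)

definition cls :: "'a \<Rightarrow> 'a \<Rightarrow> 'a \<Rightarrow> 'a" where
  "cls T pc i = sep T (\<lambda>t. ap pc t = i)"

lemma mem_cls [simp]: "t \<in> cls T pc i \<longleftrightarrow> t \<in> T \<and> ap pc t = i"
  unfolding cls_def by simp

lemma dfnt_cls [dfn, simp]: "dfnt A \<Longrightarrow> dfnt pc \<Longrightarrow> dfnt c \<Longrightarrow> dfnt (\<lambda>v. cls (A v) (pc v) (c v))"
  by (rule dfnt_app3[of cls]) (unfold cls_def, intro dfn)

text \<open>Finite sums of ordinals and reverse ordinals seen from inside \<open>T\<close>. Empty,
  finite or equally directed neighbouring blocks are allowed; the alternating form is reached by
  minimising their number.\<close>

definition blocks :: "'a \<Rightarrow> 'a \<Rightarrow> 'a \<Rightarrow> 'a \<Rightarrow> 'a \<Rightarrow> bool" where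
  "blocks T S N pc d \<longleftrightarrow> (\<forall>t. t \<in> T \<longrightarrow> ap pc t \<in> N) \<and>
     (\<forall>s t. s \<in> T \<and> t \<in> T \<and> ap pc s \<in> ap pc t \<longrightarrow> lt S s t) \<and>
     (\<forall>i. i \<in> N \<longrightarrow> (ap d i = zero \<or> ap d i = one) \<and> wo (cls T pc i) (dirr T S (ap d i)))"

lemma dfnp_blocks [dfn, simp]:
  "dfnt T \<Longrightarrow> dfnt S \<Longrightarrow> dfnt N \<Longrightarrow> dfnt pc \<Longrightarrow> dfnt d \<Longrightarrow> dfnp (\<lambda>v. blocks (T v) (S v) (N v) (pc v) (d v))"
  by (rule dfnp_app5[of blocks]) (unfold blocks_def, intro dfn)

lemma blocksD:
  assumes "blocks T S N pc d"
  shows blocks_mem: "\<And>t. t \<in> T \<Longrightarrow> ap pc t \<in> N"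
    and blocks_less: "\<And>s t. s \<in> T \<Longrightarrow> t \<in> T \<Longrightarrow> ap pc s \<in> ap pc t \<Longrightarrow> lt S s t"
    and blocks_two: "\<And>i. i \<in> N \<Longrightarrow> ap d i = zero \<or> ap d i = one"
    and blocks_wo: "\<And>i. i \<in> N \<Longrightarrow> wo (cls T pc i) (dirr T S (ap d i))"
  using assms unfolding blocks_def by blast+

lemma wo_un:
  assumes A: "wo A R" and B: "wo B R" and l: "lin (un A B) R"
    and AB: "\<And>a b. a \<in> A \<Longrightarrow> b \<in> B \<Longrightarrow> lt R a b"
  shows "wo (un A B) R"
  unfolding wo_def
proof (intro conjI allI impI l)
  fix X assume X: "X \<subseteq> un A B \<and> (\<exists>x. x \<in> X)"
  show "\<exists>x. x \<in> X \<and> (\<forall>y. y \<in> X \<longrightarrow> y = x \<or> lt R x y)"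
  proof (cases "\<exists>x. x \<in> X \<and> x \<in> A")
    case True
    then obtain x where x: "x \<in> X" "x \<in> A" by blast
    obtain m where "m \<in> A" and m: "m \<in> X" "\<And>y. y \<in> A \<Longrightarrow> y \<in> X \<Longrightarrow> y = m \<or> lt R m y"
      by (rule wo_least[OF A x(2), of "\<lambda>x. x \<in> X", OF x(1)], simp, rule that)
    thus ?thesis using X AB unfolding subset_def by (metis mem_un)
  next
    case False
    hence XB: "y \<in> B" if "y \<in> X" for y using X that unfolding subset_def by auto
    obtain x where x: "x \<in> X" using X by blast
    obtain m where "m \<in> B" and m: "m \<in> X" "\<And>y. y \<in> B \<Longrightarrow> y \<in> X \<Longrightarrow> y = m \<or> lt R m y"
      by (rule wo_least[OF B XB[OF x], of "\<lambda>x. x \<in> X", OF x], simp, rule that)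
    thus ?thesis using XB by blast
  qed
qed

lemma otp_agree:
  assumes "wo A R" "\<And>x y. x \<in> A \<Longrightarrow> y \<in> A \<Longrightarrow> lt R x y \<longleftrightarrow> lt R' x y"
  shows "otp A R = otp A R'"
proof -
  have "isomorphic A R A R'" by (rule isomorphicI[of "\<lambda>x. x"]) (simp_all add: assms(2) bij_betw_def)
  thus ?thesis using otp_iso_iff[OF assms(1) wo_agree[OF assms]] by blast
qed

lemma finite_sum_blocks:
  assumes k: "ordinal k" and fs: "finite_sum_below k T S"
  shows "\<exists>n pc d. n \<in> omega \<and> blocks T S n pc d \<and> (\<forall>i. i \<in> n \<longrightarrow> otp (cls T pc i) (dirr T S (ap d i)) \<in> k)"
proof -
  obtain n b d where n: "n \<in> omega" and b: "maps b n k" and d: "maps d n two"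
    and iso: "isomorphic T S (sum_set n b) (sum_rel n b d)" using fs unfolding finite_sum_below_def by blast
  have bf: "fun_on b n" "\<And>i. i \<in> n \<Longrightarrow> ap b i \<in> k" and df: "fun_on d n" "\<And>i. i \<in> n \<Longrightarrow> ap d i = zero \<or> ap d i = one"
    using b d unfolding maps_iff by auto
  obtain f where f: "isoby f T S (dsum n b) (dsr n b d)"
    using iso unfolding sum_set_eq[OF bf(1)] sum_rel_eq[OF bf(1) df(1)] isomorphic_iff by blast
  have fb: "bij_betw (ap f) (el T) (el (dsum n b))"
    and fS: "\<And>u v. u \<in> T \<Longrightarrow> v \<in> T \<Longrightarrow> lt S u v \<longleftrightarrow> opair (ap f u) (ap f v) \<in> dsr n b d"
    using f unfolding isoby_def by blast+
  define pc where "pc = lam T (\<lambda>t. fstp (ap f t))"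
  define X where "X t = sndp (ap f t)" for t
  have DX: "dfn1 X" unfolding X_def by (intro dfn)
  have ft: "ap f t = opair (ap pc t) (X t)" "ap pc t \<in> n" "X t \<in> ap b (ap pc t)" if t: "t \<in> T" for t
  proof -
    have "ap f t \<in> dsum n b" using fb t unfolding bij_el_iff by blast
    then obtain i y where iy: "ap f t = opair i y" "i \<in> n" "y \<in> ap b i" by auto
    hence "ap pc t = i" "X t = y" unfolding pc_def X_def using t by simp_all
    thus "ap f t = opair (ap pc t) (X t)" "ap pc t \<in> n" "X t \<in> ap b (ap pc t)" using iy by simp_all
  qed
  have S: "lt S s t \<longleftrightarrow> ap pc s \<in> ap pc t \<or> ap pc s = ap pc t \<and>
      (ap d (ap pc t) = zero \<and> X s \<in> X t \<or> ap d (ap pc t) = one \<and> X t \<in> X s)" if s: "s \<in> T" and t: "t \<in> T" for s t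
    unfolding fS[OF s t] ft(1)[OF s] ft(1)[OF t] mem_dsr using ft[OF s] ft[OF t] by auto
  have ci: "isomorphic (cls T pc i) (dirr T S (ap d i)) (ap b i) (memrel (ap b i))" if i: "i \<in> n" for i
  proof (rule isomorphicI[OF DX])
    show "bij_betw X (el (cls T pc i)) (el (ap b i))" unfolding bij_el_iff mem_cls
    proof (intro conjI allI impI)
      show "X t \<in> ap b i" if "t \<in> T \<and> ap pc t = i" for t using ft(3)[of t] that by blast
      fix y assume "y \<in> ap b i"
      hence "opair i y \<in> dsum n b" using i by simp
      hence ex: "\<exists>!t. t \<in> T \<and> ap f t = opair i y" using fb unfolding bij_el_iff by blast
      have "(t \<in> T \<and> ap f t = opair i y) \<longleftrightarrow> ((t \<in> T \<and> ap pc t = i) \<and> X t = y)" for t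
        using ft(1)[of t] by auto
      thus "\<exists>!t. (t \<in> T \<and> ap pc t = i) \<and> X t = y" using ex by simp
    qed
    show "opair s t \<in> dirr T S (ap d i) \<longleftrightarrow> opair (X s) (X t) \<in> memrel (ap b i)"
      if s: "s \<in> cls T pc i" and t: "t \<in> cls T pc i" for s t
      using S[of s t] S[of t s] s t ft(3)[of s] ft(3)[of t] df(2)[OF i] unfolding dirr_def by (auto simp: mem_conv)
  qed
  have ob: "ordinal (ap b i)" if "i \<in> n" for i using ord_mem[OF k bf(2)[OF that]] .
  have "blocks T S n pc d" unfolding blocks_def
    using ft(2) S df(2) wo_iso[OF ci wo_memrel[OF ob]] by blast
  moreover have "otp (cls T pc i) (dirr T S (ap d i)) \<in> k" if "i \<in> n" for i
    using otp_eq(1)[OF ob[OF that] ci[OF that]] bf(2)[OF that] by simp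
  ultimately show ?thesis using n by blast
qed

text \<open>The union of the two neighbours is well-ordered in the common direction, since one of
  them precedes the other as a whole; which one comes first depends on \<open>c\<close>.\<close>

lemma blocks_merge:
  assumes l: "lin T S" and M: "M \<in> omega" and bl: "blocks T S (succ M) pc d" and i: "i \<in> M"
    and c: "c = zero \<or> c = one" and w1: "wo (cls T pc i) (dirr T S c)" and w2: "wo (cls T pc (succ i)) (dirr T S c)"
  shows "\<exists>pc d. blocks T S M pc d"
proof -
  have oM: "ordinal M" and oi: "ordinal i" using ord_omega_mem M ord_mem i by blast+
  note bl1 = blocks_mem[OF bl] and bl2 = blocks_less[OF bl] and bl3 = blocks_two[OF bl] and w = blocks_wo[OF bl]
  \<comment> \<open>Closes the gap left by the join: indices up to \<open>i\<close> stay, larger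
    ones drop by one, with \<open>unite\<close> as the predecessor.\<close>
  define dn where "dn p = (if p \<in> succ i then p else unite p)" for p
  have dn: "p \<in> succ i \<and> dn p = p \<or> (\<exists>q. q \<in> M \<and> p = succ q \<and> \<not> q \<in> i \<and> dn p = q)" if p: "p \<in> succ M" for p
  proof (cases "p \<in> succ i")
    case True thus ?thesis unfolding dn_def by simp
  next
    case False
    have po: "p \<in> omega" using omega_mem_mem succ_omega M p by blast
    have "p \<noteq> zero" using False ord_zero_mem[OF ord_succ[OF oi]] succ_not_zero(1) by metis
    then obtain q where q: "q \<in> omega" "p = succ q" using omega_cases[OF po] by blast
    have "q \<in> M" using p succ_mem_succ[OF ord_omega_mem[OF q(1)] oM] unfolding q(2) by blast
    moreover have "\<not> q \<in> i" using False succ_mem_succ[OF ord_omega_mem[OF q(1)] oi] unfolding q(2) by blast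
    moreover have "dn p = q" unfolding dn_def using False unite_succ[OF ord_omega_mem[OF q(1)]] q(2) by simp
    ultimately show ?thesis using q(2) by blast
  qed
  have le: "q = i \<or> i \<in> q" if "q \<in> M" "\<not> q \<in> i" for q using ord_linear[OF oi ord_mem[OF oM that(1)]] that by auto
  have dM: "dn p \<in> M" if p: "p \<in> succ M" for p
    using dn[OF p] i ord_trans[OF oM _ i, of p] by auto
  have mono: "p \<in> p'" if p: "p \<in> succ M" "p' \<in> succ M" "dn p \<in> dn p'" for p p'
  proof -
    from dn[OF p(1)] show ?thesis
    proof
      assume a: "p \<in> succ i \<and> dn p = p"
      from dn[OF p(2)] show ?thesis
      proof
        assume "p' \<in> succ i \<and> dn p' = p'"
        thus ?thesis using p(3) a by simp
      next
        assume "\<exists>q. q \<in> M \<and> p' = succ q \<and> \<not> q \<in> i \<and> dn p' = q"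
        then obtain q where q: "p' = succ q" "dn p' = q" by blast
        thus ?thesis using p(3) a mem_succ[of p q] by metis
      qed
    next
      assume "\<exists>q. q \<in> M \<and> p = succ q \<and> \<not> q \<in> i \<and> dn p = q"
      then obtain q where q: "q \<in> M" "p = succ q" "\<not> q \<in> i" "dn p = q" by blast
      from dn[OF p(2)] show ?thesis
      proof
        assume "p' \<in> succ i \<and> dn p' = p'"
        hence "q \<in> i" using p(3) q(4) ord_trans[OF oi, of q p'] by auto
        thus ?thesis using q(3) by blast
      next
        assume "\<exists>q. q \<in> M \<and> p' = succ q \<and> \<not> q \<in> i \<and> dn p' = q"
        then obtain q' where q': "q' \<in> M" "p' = succ q'" "dn p' = q'" by blast
        thus ?thesis using p(3) q succ_mem_succ ord_mem[OF oM] by simp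
      qed
    qed
  qed
  define pc' where "pc' = lam T (\<lambda>t. dn (ap pc t))"
  have pD: "dfnt (\<lambda>v. dn (ap pc (v 0)))" unfolding dn_def by (intro dfn)
  have pc': "ap pc' t = dn (ap pc t)" if "t \<in> T" for t unfolding pc'_def by (rule ap_lam[OF pD that])
  define d' where "d' = lam M (\<lambda>j. if j = i then c else if j \<in> i then ap d j else ap d (succ j))"
  have d': "ap d' j = (if j = i then c else if j \<in> i then ap d j else ap d (succ j))" if "j \<in> M" for j
    unfolding d'_def using that by (subst ap_lam) (intro dfn, auto)
  have cl: "t \<in> cls T pc' j \<longleftrightarrow> t \<in> T \<and> dn (ap pc t) = j" for t j using pc' by auto
  have sj: "succ j \<in> succ M" "j \<in> succ M" if "j \<in> M" for j
    using that succ_mem_succ[OF ord_mem[OF oM that] oM] by auto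
  have down1: "dn p = j \<longleftrightarrow> p = j" if "j \<in> i" "p \<in> succ M" for p j
    using dn[OF that(2)] that(1) unfolding dn_def by auto
  have down2: "dn p = i \<longleftrightarrow> p = i \<or> p = succ i" if "p \<in> succ M" for p
  proof -
    have "dn i = i" unfolding dn_def by simp
    moreover have "dn (succ i) = i" unfolding dn_def using unite_succ[OF oi] by simp
    ultimately show ?thesis using dn[OF that] by auto
  qed
  have down3: "dn p = j \<longleftrightarrow> p = succ j" if "i \<in> j" "j \<in> M" "p \<in> succ M" for p j
  proof
    assume "dn p = j"
    thus "p = succ j" using dn[OF that(3)] that(1) mem_asym[of i j] by auto
  next
    assume p: "p = succ j"
    have "\<not> p \<in> succ i" unfolding p using succ_mem_succ[OF ord_mem[OF oM that(2)] oi] mem_asym that(1) by blast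
    thus "dn p = j" unfolding dn_def using unite_succ[OF ord_mem[OF oM that(2)]] p by simp
  qed
  have "blocks T S M pc' d'" unfolding blocks_def
  proof (intro conjI allI impI)
    show "ap pc' t \<in> M" if "t \<in> T" for t using pc'[OF that] dM[OF bl1[OF that]] by simp
    show "lt S s t" if "s \<in> T \<and> t \<in> T \<and> ap pc' s \<in> ap pc' t" for s t
      using bl2[of s t] mono[OF bl1 bl1, of s t] that pc' by metis
    show "ap d' j = zero \<or> ap d' j = one" if "j \<in> M" for j
      unfolding d'[OF that] using c bl3 sj[OF that] by auto
    fix j assume j: "j \<in> M"
    consider "j \<in> i" | "j = i" | "i \<in> j" using ord_linear[OF ord_mem[OF oM j] oi] by blast
    thus "wo (cls T pc' j) (dirr T S (ap d' j))"
    proof cases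
      case 1
      have "cls T pc' j = cls T pc j" 
      proof (rule mext)
        show "t \<in> cls T pc' j \<longleftrightarrow> t \<in> cls T pc j" for t unfolding cl mem_cls[of t T pc] using down1[OF 1 bl1[of t]] by blast
      qed
      thus ?thesis using w[OF sj(2)[OF j]] d'[OF j] 1 by auto
    next
      case 2
      have cu: "t \<in> cls T pc' j \<longleftrightarrow> t \<in> T \<and> (ap pc t = i \<or> ap pc t = succ i)" for t
        unfolding cl 2 using down2[OF bl1[of t]] by blast
      have u1: "cls T pc' j = un (cls T pc i) (cls T pc (succ i))"
      proof (rule mext)
        show "t \<in> cls T pc' j \<longleftrightarrow> t \<in> un (cls T pc i) (cls T pc (succ i))" for t
          unfolding cu mem_un mem_cls[of t T pc] by blast
      qed
      have u2: "cls T pc' j = un (cls T pc (succ i)) (cls T pc i)"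
        unfolding u1 by (rule mext) (unfold mem_un, blast)
      have ln: "lin (cls T pc' j) (dirr T S c)" by (rule lin_subset[OF lin_dirr[OF l]]) (simp add: subset_def)
      have ab: "lt S a b" if "a \<in> cls T pc i" "b \<in> cls T pc (succ i)" for a b
        using bl2[of a b] that by simp
      have "wo (cls T pc' j) (dirr T S c)"
      proof (cases "c = zero")
        case True
        show ?thesis unfolding u1
          by (rule wo_un[OF w1 w2 ln[unfolded u1]]) (use ab True in \<open>simp add: dirr_def\<close>)
      next
        case False
        show ?thesis unfolding u2
        proof (rule wo_un[OF w2 w1 ln[unfolded u2]])
          fix a b assume "a \<in> cls T pc (succ i)" "b \<in> cls T pc i"
          thus "opair a b \<in> dirr T S c" using ab[of b a] False unfolding dirr_def by (simp add: mem_conv)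
        qed
      qed
      thus ?thesis using d'[OF j] 2 by simp
    next
      case 3
      have "cls T pc' j = cls T pc (succ j)" 
      proof (rule mext)
        show "t \<in> cls T pc' j \<longleftrightarrow> t \<in> cls T pc (succ j)" for t unfolding cl mem_cls[of t T pc] using down3[OF 3 j bl1[of t]] by blast
      qed
      moreover have "j \<noteq> i" "\<not> j \<in> i" using 3 mem_asym by auto
      ultimately show ?thesis using w[OF sj(1)[OF j]] d'[OF j] by auto
    qed
  qed
  thus ?thesis by blast
qed

text \<open>Take the least possible number of blocks. Neighbours of equal direction could be merged,
  so directions alternate. A finite block is well-ordered both ways and could be merged with any
  neighbour; having none, it would be all of the infinite set \<open>T\<close>.\<close>

lemma alternating_sum_ex:
  assumes l: "lin T S" and inf: "\<not> fin T" and ex: "N0 \<in> omega" "blocks T S N0 pc0 d0"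
  shows "\<exists>n b. alternating_sum T S n b"
proof -
  have P0: "N0 \<in> omega \<and> (\<exists>pc d. blocks T S N0 pc d)" using ex by blast
  obtain N where "ordinal N" and N: "N \<in> omega \<and> (\<exists>pc d. blocks T S N pc d)"
    and min: "\<And>c. c \<in> N \<Longrightarrow> \<not> (c \<in> omega \<and> (\<exists>pc d. blocks T S c pc d))"
    by (rule ord_least[OF ord_omega_mem[OF ex(1)], of "\<lambda>N. N \<in> omega \<and> (\<exists>pc d. blocks T S N pc d)", OF P0],
        intro dfn, rule that)
  obtain pc d where bl: "blocks T S N pc d" using N by blast
  note bl1 = blocks_mem[OF bl] and bl2 = blocks_less[OF bl] and bl3 = blocks_two[OF bl] and w = blocks_wo[OF bl]
  have "\<exists>t. t \<in> T" using inf fin_zero mext[of T zero] not_mem_zero by metis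
  hence "N \<noteq> zero" using bl1 by auto
  then obtain M where M: "M \<in> omega" "N = succ M" using omega_cases N by blast
  have oM: "ordinal M" by (rule ord_omega_mem[OF M(1)])
  have nm: False if "i \<in> M" "c = zero \<or> c = one" "wo (cls T pc i) (dirr T S c)" "wo (cls T pc (succ i)) (dirr T S c)" for i c
    using blocks_merge[OF l M(1) _ that] bl min[of M] M by auto
  have sN: "i \<in> M" "i \<in> N" if "succ i \<in> N" for i
  proof -
    show "i \<in> N" using ord_trans[OF \<open>ordinal N\<close> _ that] by simp
    thus "i \<in> M" using that succ_mem_succ[OF ord_mem[OF \<open>ordinal N\<close>] oM] unfolding M(2) by blast
  qed
  have fw: "wo (cls T pc i) (dirr T S c)" if "fin (cls T pc i)" for i c
    by (rule fin_lin_wo[OF that lin_subset[OF lin_dirr[OF l]]]) (simp add: subset_def)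
  have nf: "\<not> fin (cls T pc i)" if i: "i \<in> N" for i
  proof
    assume f: "fin (cls T pc i)"
    show False
    proof (cases "i \<in> M")
      case True
      hence "succ i \<in> N" using succ_mem_succ[OF ord_mem[OF oM True] oM] M(2) by simp
      thus False using nm[OF True bl3 fw[OF f] w] by blast
    next
      case False
      hence iM: "i = M" using i M(2) by simp
      show False
      proof (cases "M = zero")
        case True
        have "cls T pc i = T" by (rule mext) (use bl1 M(2) iM True in auto)
        thus False using f inf by simp
      next
        case False
        then obtain j where j: "j \<in> omega" "M = succ j" using omega_cases M(1) by blast
        have jM: "j \<in> M" "j \<in> N" using j M(2) by simp_all
        show False using nm[OF jM(1) bl3[OF jM(2)] w[OF jM(2)]] fw[OF f] iM j(2) by simp
      qed
    qed
  qed
  define b where "b = lam N (\<lambda>i. otp (cls T pc i) (dirr T S (ap d i)))"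
  define d' where "d' = lam N (ap d)"
  have D: "dfnt (\<lambda>v. otp (cls T pc (v 0)) (dirr T S (ap d (v 0))))" "dfn1 (ap d)" by (intro dfn)+
  have b: "fun_on b N" "\<And>i. i \<in> N \<Longrightarrow> ap b i = otp (cls T pc i) (dirr T S (ap d i))"
    unfolding b_def using fun_on_lam[OF D(1)] ap_lam[OF D(1)] by blast+
  have d': "fun_on d' N" "\<And>i. i \<in> N \<Longrightarrow> ap d' i = ap d i"
    unfolding d'_def using fun_on_lam[OF D(2)] ap_lam[OF D(2)] by blast+
  let ?r = "\<lambda>t. rk (cls T pc (ap pc t)) (dirr T S (ap d (ap pc t))) t"
  let ?F = "\<lambda>t. opair (ap pc t) (?r t)"
  have FD: "dfnt (\<lambda>v. ?F (v 0))" by (intro dfn)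
  have rm: "?r t \<in> ap b (ap pc t)" if t: "t \<in> T" for t
    unfolding b(2)[OF bl1[OF t]] by (rule rk_mem[OF w[OF bl1[OF t]]]) (use t in simp)
  have rI: "?r s \<in> ?r t \<longleftrightarrow> opair s t \<in> dirr T S (ap d (ap pc t))" "?r s = ?r t \<longleftrightarrow> s = t"
    if s: "s \<in> T" and t: "t \<in> T" and e: "ap pc s = ap pc t" for s t
    using rk_iff[OF w[OF bl1[OF t]], of s t] rk_inj[OF w[OF bl1[OF t]], of s t] s t e by auto
  have "isomorphic T S (dsum N b) (dsr N b d')"
  proof (rule isomorphicI[OF FD])
    show "bij_betw ?F (el T) (el (dsum N b))" unfolding bij_el_iff
    proof (intro conjI allI impI)
      show "?F t \<in> dsum N b" if "t \<in> T" for t using bl1[OF that] rm[OF that] by simp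
      fix p assume "p \<in> dsum N b"
      then obtain i y where p: "p = opair i y" "i \<in> N" "y \<in> ap b i" by auto
      obtain t where t: "t \<in> T" "ap pc t = i" "?r t = y"
        using rk_surj[OF w[OF p(2)], of y] p(3) unfolding b(2)[OF p(2)] by auto
      show "\<exists>!t. t \<in> T \<and> ?F t = p"
      proof
        show "t \<in> T \<and> ?F t = p" using t p(1) by simp
        show "u = t" if "u \<in> T \<and> ?F u = p" for u
        proof -
          have "?F u = opair i y" using conjunct2[OF that] p(1) by (rule trans)
          hence e': "ap pc u = i \<and> ?r u = y" unfolding opair_eq .
          have e: "ap pc u = ap pc t" "?r u = ?r t"
            by (rule trans[OF conjunct1[OF e'] t(2)[symmetric]], rule trans[OF conjunct2[OF e'] t(3)[symmetric]])
          show ?thesis using rI(2)[OF conjunct1[OF that] t(1) e(1)] e(2) by blast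
        qed
      qed
    qed
    show "lt S s t \<longleftrightarrow> opair (?F s) (?F t) \<in> dsr N b d'" if s: "s \<in> T" and t: "t \<in> T" for s t
    proof -
      have R: "opair (?F s) (?F t) \<in> dsr N b d' \<longleftrightarrow> ap pc s \<in> ap pc t \<or> ap pc s = ap pc t \<and>
        (ap d (ap pc t) = zero \<and> ?r s \<in> ?r t \<or> ap d (ap pc t) = one \<and> ?r t \<in> ?r s)"
        unfolding mem_dsr using bl1[OF s] bl1[OF t] rm[OF s] rm[OF t] d'(2)[OF bl1[OF s]] by auto
      have o: "ordinal (ap pc s)" "ordinal (ap pc t)" using ord_mem[OF \<open>ordinal N\<close>] bl1 s t by blast+
      consider "ap pc s \<in> ap pc t" | "ap pc s = ap pc t" | "ap pc t \<in> ap pc s" using ord_linear[OF o] by blast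
      thus ?thesis
      proof cases
        case 1 thus ?thesis using R bl2[OF s t] by blast
      next
        case 2
        thus ?thesis unfolding R using rI(1)[OF s t 2] rI(1)[OF t s 2[symmetric]] bl3[OF bl1[OF t]] s t
          unfolding dirr_def by (auto simp: mem_conv)
      next
        case 3
        have "\<not> lt S s t" using bl2[OF t s 3] lin_asym[OF l t s] by blast
        moreover have "\<not> ap pc s \<in> ap pc t" "ap pc s \<noteq> ap pc t" using 3 mem_asym by auto
        ultimately show ?thesis using R by blast
      qed
    qed
  qed
  hence iso: "isomorphic T S (sum_set N b) (sum_rel N b d')" unfolding sum_set_eq[OF b(1)] sum_rel_eq[OF b(1) d'(1)] .
  have "alternating_sum T S N b" unfolding alternating_sum_def
  proof (intro conjI allI impI exI[of _ d'] iso)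
    show "N \<in> omega" "fun_on b N" using N b by blast+
    show "maps d' N two" unfolding maps_iff using d' bl3 by simp
    show "app d' (succ i) \<noteq> app d' i" if h: "succ i \<in> N" for i
    proof
      assume "app d' (succ i) = app d' i"
      hence "ap d (succ i) = ap d i" using fun_on_ap(2)[OF d'(1)] h sN[OF h] d'(2) by simp
      thus False using nm[OF sN(1)[OF h] bl3[OF sN(2)[OF h]] w[OF sN(2)[OF h]]] w[OF h] by simp
    qed
    fix i assume i: "i \<in> N"
    have a: "app b i = otp (cls T pc i) (dirr T S (ap d i))" using fun_on_ap(2)[OF b(1) i] b(2)[OF i] by simp
    show "ordinal (app b i)" unfolding a by (rule otp(1)[OF w[OF i]])
    have "equipotent (cls T pc i) (app b i)" unfolding a by (rule equipotentI[OF _ rk_bij[OF w[OF i]]]) (intro dfn)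
    thus "infinite_set (app b i)" unfolding infinite_set_iff using fin_cong nf[OF i] by blast
  qed
  thus ?thesis by blast
qed

end

subsection \<open>The theorem\<close>

context zf_model
begin

text \<open>The normal forms of the summands are collected by \<open>fin_choice\<close>, and the
  finite set of their terms is sorted.\<close>

lemma is_beta_ex:
  assumes alt: "alternating_sum T S n b"
  shows "\<exists>x. is_beta T S x"
proof -
  have n: "n \<in> omega" and bf: "fun_on b n" and bo: "\<And>i. i \<in> n \<Longrightarrow> ordinal (app b i)"
    using alt unfolding alternating_sum_def by blast+
  have on: "ordinal n" by (rule ord_omega_mem[OF n])
  let ?P = "\<lambda>i p. cnf_data (fstp p) (fstp (sndp p)) (sndp (sndp p)) \<and> ap b i = cnf_val (fstp p) (fstp (sndp p)) (sndp (sndp p))"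
  have "\<exists>f. fun_on f n \<and> (\<forall>i. i \<in> n \<longrightarrow> ?P i (ap f i))"
  proof (rule fin_choice[OF n])
    show "dfnp (\<lambda>v. ?P (v 0) (v 1))" by (intro dfn)
    fix i assume "i \<in> n"
    hence "ordinal (ap b i)" using bo fun_on_ap(2)[OF bf] by metis
    then obtain m e c where "cnf_data m e c \<and> ap b i = cnf_val m e c" using cnf_ex by blast
    hence "?P i (opair m (opair e c))" by simp
    thus "\<exists>p. ?P i p" by blast
  qed
  then obtain f where f: "\<And>i. i \<in> n \<Longrightarrow> ?P i (ap f i)" by blast
  define m where "m = lam n (\<lambda>i. fstp (ap f i))"
  let ?t = "\<lambda>i. terms (fstp (ap f i)) (fstp (sndp (ap f i))) (sndp (sndp (ap f i)))"
  define tt where "tt = lam n ?t"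
  have D: "dfnt (\<lambda>v. fstp (ap f (v 0)))" "dfnt (\<lambda>v. ?t (v 0))" by (intro dfn)+
  have mf: "fun_on m n" and m: "\<And>i. i \<in> n \<Longrightarrow> ap m i = fstp (ap f i)"
    unfolding m_def using fun_on_lam[OF D(1)] ap_lam[OF D(1)] by blast+
  have tf: "fun_on tt n" and tt: "\<And>i. i \<in> n \<Longrightarrow> ap tt i = ?t i"
    unfolding tt_def using fun_on_lam[OF D(2)] ap_lam[OF D(2)] by blast+
  note CD = cnf_dataD[OF conjunct1[OF f]]
  have mo: "ap m i \<in> omega" if "i \<in> n" for i using CD(1)[OF that] m[OF that] by simp
  have to: "fun_on (ap tt i) (ap m i)" "ordinal (ap (ap tt i) j)" if "i \<in> n" "j \<in> ap m i" for i j
    using CD(8)[OF that(1), of j] that(2) unfolding tt[OF that(1)] m[OF that(1)] by simp_all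
  define P where "P = dsum n m"
  define h where "h p = ap (ap tt (fstp p)) (sndp p)" for p
  have hD: "dfnt (\<lambda>v. h (g v))" if "dfnt g" for g unfolding h_def by (intro dfn that)
  have hP: "ordinal (h p)" if "p \<in> P" for p using that to(2) unfolding P_def h_def by auto
  have wP: "wo P (osr n m)" unfolding P_def by (rule wo_dsum[OF on ord_omega_mem[OF mo]])
  \<comment> \<open>Larger terms come first; equal terms are ordered by their indices, which makes
    the order linear.\<close>
  define Q where "Q = sep (times P P) (\<lambda>p. h (sndp p) \<in> h (fstp p) \<or> h (sndp p) = h (fstp p) \<and> p \<in> osr n m)"
  have QD: "dfnp (\<lambda>v. h (sndp (v 0)) \<in> h (fstp (v 0)) \<or> h (sndp (v 0)) = h (fstp (v 0)) \<and> v 0 \<in> osr n m)"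
    by (intro dfn hD)
  have Q: "lt Q u v \<longleftrightarrow> h v \<in> h u \<or> h v = h u \<and> lt (osr n m) u v" if "u \<in> P" "v \<in> P" for u v
    unfolding Q_def mem_sep[OF QD] using that by simp
  have finP: "fin P" unfolding P_def by (rule fin_dsum[OF fin_omega_mem[OF n] fin_omega_mem[OF mo]])
  have "lin P Q" unfolding lin_def
  proof (intro conjI allI impI)
    show "\<not> lt Q u u" if "u \<in> P" for u using Q[OF that that] lin_irrefl[OF wo_lin[OF wP] that] by simp
    show "lt Q u w" if a: "u \<in> P \<and> v \<in> P \<and> w \<in> P \<and> lt Q u v \<and> lt Q v w" for u v w
    proof -
      have p: "u \<in> P" "v \<in> P" "w \<in> P" using a by blast+
      have "h v \<in> h u \<or> h v = h u \<and> lt (osr n m) u v" "h w \<in> h v \<or> h w = h v \<and> lt (osr n m) v w"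
        using a Q p by blast+
      thus ?thesis unfolding Q[OF p(1,3)]
        using ord_trans[OF hP[OF p(1)]] lin_trans[OF wo_lin[OF wP] p] by metis
    qed
    show "lt Q u v \<or> lt Q v u" if a: "u \<in> P \<and> v \<in> P \<and> u \<noteq> v" for u v
    proof -
      have p: "u \<in> P" "v \<in> P" "u \<noteq> v" using a by blast+
      show ?thesis unfolding Q[OF p(1,2)] Q[OF p(2,1)]
        using ord_linear[OF hP[OF p(1)] hP[OF p(2)]] lin_total[OF wo_lin[OF wP] p] by metis
    qed
  qed
  hence w: "wo P Q" by (rule fin_lin_wo[OF finP])
  define N where "N = otp P Q"
  have N: "N \<in> omega" unfolding N_def by (rule fin_otp[OF finP w])
  define G where "G = invf P (rk P Q)"
  have GD: "dfn1 G" unfolding G_def by (intro dfn)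
  note Gb = bij_betw_invf[OF rk_bij[OF w], folded N_def G_def]
  define g where "g = lam N G"
  have g: "fun_on g N" "\<And>l. l \<in> N \<Longrightarrow> ap g l = G l" unfolding g_def using fun_on_lam[OF GD] ap_lam[OF GD] by blast+
  have gP: "ap g l \<in> P" if "l \<in> N" for l using Gb(1) that g(2)[OF that] unfolding bij_el_iff by simp
  have gb: "bij_betw (ap g) (el N) (el P)" using Gb(1) bij_betw_cong[of "el N" "ap g" G "el P"] g(2) by simp
  define sq where "sq = lam N (\<lambda>l. h (ap g l))"
  have sD: "dfnt (\<lambda>v. h (ap g (v 0)))" by (intro dfn hD)
  have s: "fun_on sq N" "\<And>l. l \<in> N \<Longrightarrow> ap sq l = h (ap g l)" unfolding sq_def using fun_on_lam[OF sD] ap_lam[OF sD] by blast+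
  have "is_beta T S (osum N sq)" unfolding is_beta_def
  proof (rule exI[of _ n], rule exI[of _ b], rule exI[of _ m], rule exI[of _ tt], rule exI[of _ N], rule exI[of _ g],
      rule exI[of _ sq], intro conjI allI impI alt mf tf N s(1) refl)
    show "is_cnf (app b i) (app m i) (app tt i)" if i: "i \<in> n" for i
      using is_cnfI[of "fstp (ap f i)" "fstp (sndp (ap f i))" "sndp (sndp (ap f i))" "ap b i"] f[OF i]
      unfolding fun_on_ap(2)[OF bf i] fun_on_ap(2)[OF mf i] fun_on_ap(2)[OF tf i] m[OF i] tt[OF i] by blast
    show "bijection g N (sum_set n m)" unfolding bijection_iff sum_set_eq[OF mf] using g gb unfolding P_def by blast
    show "app sq l = app (app tt i) j" if a: "l \<in> N \<and> app g l = opair i j" for l i j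
    proof -
      have l: "l \<in> N" "ap g l = opair i j" using a fun_on_ap(2)[OF g(1)] by auto
      hence ij: "i \<in> n" "j \<in> ap m i" using gP[OF l(1)] unfolding P_def by simp_all
      show ?thesis using fun_on_ap(2)[OF s(1) l(1)] s(2)[OF l(1)] l(2) fun_on_ap(2)[OF tf ij(1)] fun_on_ap(2)[OF to(1)[OF ij] ij(2)]
        unfolding h_def by simp
    qed
    show "app sq l' \<in> app sq l \<or> app sq l' = app sq l" if a: "l \<in> l' \<and> l' \<in> N" for l l'
    proof -
      have l: "l \<in> N" "l' \<in> N" using a ord_trans[OF ord_omega_mem[OF N]] by blast+
      have "lt Q (ap g l) (ap g l')"
        using rk_iff[OF w gP[OF l(1)] gP[OF l(2)]] Gb(2) l a unfolding g(2)[OF l(1)] g(2)[OF l(2)] by simp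
      thus ?thesis using Q[OF gP[OF l(1)] gP[OF l(2)]] fun_on_ap(2)[OF s(1)] s(2) l by auto
    qed
  qed
  thus ?thesis by blast
qed

lemma beta_eqI:
  assumes "lin T S" "is_beta T S x"
  shows "beta T S = x"
  unfolding beta_def
proof (rule the_equality[of "is_beta T S" x, OF assms(2)])
  fix y assume y: "is_beta T S y"
  show "y = x"
    using is_beta_structure[OF assms] is_beta_structure[OF assms(1) y] beta_structure_unique by metis
qed

text \<open>Turns the given finite sum into a possible target of a
  \<open>piece_embedding\<close>.\<close>

lemma blocks_wpieces:
  assumes l: "lin T S" and n: "n \<in> omega" and bl: "blocks T S n pc d"
  shows "\<exists>W. wpieces mem T S W pc n d \<and>
    (\<forall>t. t \<in> T \<longrightarrow> otp (piece T pc t) W = otp (cls T pc (ap pc t)) (dirr T S (ap d (ap pc t))))"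
proof -
  define W where "W = sep (times T T) (\<lambda>p. p \<in> dirr T S (ap d (ap pc (sndp p))))"
  have W: "lt W s t \<longleftrightarrow> opair s t \<in> dirr T S (ap d (ap pc t))" if "s \<in> T" "t \<in> T" for s t
    unfolding W_def using that by simp
  note bl1 = blocks_mem[OF bl] and bl2 = blocks_less[OF bl] and bl3 = blocks_two[OF bl] and w = blocks_wo[OF bl]
  have p: "piece T pc t = cls T pc (ap pc t)" for t by (rule mext) simp
  have ag: "opair x y \<in> dirr T S (ap d i) \<longleftrightarrow> lt W x y" if "x \<in> cls T pc i" "y \<in> cls T pc i" for x y i
    using W[of x y] that by simp
  have "wpieces mem T S W pc n d"
  proof
    show "wo (piece T pc t) W" if "t \<in> T" for t unfolding p by (rule wo_agree[OF w[OF bl1[OF that]] ag])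
    show "lt S s t \<longleftrightarrow> (if ap d (ap pc t) = zero then lt W s t else lt W t s)"
      if "s \<in> T" "t \<in> T" "ap pc s = ap pc t" for s t
      unfolding W[OF that(1,2)] W[OF that(2,1)] that(3) dirr_def using that by (simp add: mem_conv)
  qed (fact l n bl1 bl2)+
  moreover have "otp (piece T pc t) W = otp (cls T pc (ap pc t)) (dirr T S (ap d (ap pc t)))" if "t \<in> T" for t
    unfolding p by (rule otp_agree[OF w[OF bl1[OF that]] ag, symmetric])
  ultimately show ?thesis by blast
qed

theorem arrow_lex_iff_arrow_beta:
  assumes k: "initial_ordinal k" and lo: "linear_order T S" and inf: "infinite_set T" and fs: "finite_sum_below k T S"
  shows "arrow (binary_seqs k) (lex k) T S T S \<longleftrightarrow>
    arrow k (memrel k) (beta T S) (memrel (beta T S)) (beta T S) (memrel (beta T S))"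
proof -
  have ok: "ordinal k" using k unfolding initial_ordinal_def by blast
  have l: "lin T S" using lo unfolding linear_order_def lin_def by blast
  have nf: "\<not> fin T" using inf infinite_set_iff by blast
  obtain n pc0 d0 where n: "n \<in> omega" and bl: "blocks T S n pc0 d0"
    and bk: "\<And>i. i \<in> n \<Longrightarrow> otp (cls T pc0 i) (dirr T S (ap d0 i)) \<in> k"
    using finite_sum_blocks[OF ok fs] by blast
  obtain x where x: "is_beta T S x" using is_beta_ex alternating_sum_ex[OF l nf n bl] by blast
  obtain W pc N d wp M e where B: "beta_structure mem T S W pc N d wp M e" and xW: "x = otp T W"
    using is_beta_structure[OF l x] by blast
  interpret beta_structure mem T S W pc N d wp M e by (rule B)
  \<comment> \<open>One of the finitely many blocks is infinite because \<open>T\<close> is, and its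
    type is a member of \<open>k\<close>.\<close>
  have om: "omega \<subseteq> k"
  proof -
    have "\<exists>i. i \<in> n \<and> \<not> fin (cls T pc0 i)"
    proof (rule ccontr)
      assume a: "\<not> (\<exists>i. i \<in> n \<and> \<not> fin (cls T pc0 i))"
      have D: "dfnt (\<lambda>v. cls T pc0 (v 0))" by (intro dfn)
      have "fin (unite (img (cls T pc0) n))"
      proof (rule fin_unite[OF fin_img[OF fin_omega_mem[OF n] D]])
        show "fin y" if "y \<in> img (cls T pc0) n" for y using that a unfolding mem_img[OF D] by blast
      qed
      moreover have "T \<subseteq> unite (img (cls T pc0) n)"
        unfolding subset_def mem_unite mem_img[OF D] using bl unfolding blocks_def by (metis mem_cls)
      ultimately show False using fin_subset nf by blast
    qed
    then obtain i where i: "i \<in> n" "\<not> fin (cls T pc0 i)" by blast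
    have w: "wo (cls T pc0 i) (dirr T S (ap d0 i))" using bl i unfolding blocks_def by blast
    let ?a = "otp (cls T pc0 i) (dirr T S (ap d0 i))"
    have "equipotent (cls T pc0 i) ?a" by (rule equipotentI[OF _ rk_bij[OF w]]) (intro dfn)
    hence "\<not> ?a \<in> omega" using i(2) unfolding fin_def by blast
    hence "omega \<subseteq> ?a" using ord_not_mem[OF otp(1)[OF w] ord_omega] by blast
    thus ?thesis using subset_trans ord_mem_subset[OF ok bk[OF i(1)]] by blast
  qed
  \<comment> \<open>The bounds below \<open>k\<close> are given for another decomposition. The
    identity of \<open>T\<close>, read as an embedding between the two, puts a tail of each piece
    into a single given block.\<close>
  have small: "otp (piece T pc t) W \<in> k" if t: "t \<in> T" for t
  proof -
    obtain W' where w': "wpieces mem T S W' pc0 n d0" and ty: "\<And>t. t \<in> T \<Longrightarrow>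
        otp (piece T pc0 t) W' = otp (cls T pc0 (ap pc0 t)) (dirr T S (ap d0 (ap pc0 t)))"
      using blocks_wpieces[OF l n bl] by blast
    interpret t: wpieces mem T S W' pc0 n d0 by (rule w')
    interpret e: piece_embedding mem T S W pc N d T S W' pc0 n d0 "\<lambda>x. x"
      by unfold_locales (simp_all add: dfn)
    obtain t0 where t0: "e.stable t0" "ap pc t0 = ap pc t" by (rule e.stable_ex[OF t])
    have t0T: "t0 \<in> T" using t0(1) unfolding e.stable_def by blast
    have "piece T pc t0 = piece T pc t" by (rule s.piece_cong[OF t0(2)])
    hence le: "otp (piece T pc t) W \<subseteq> otp (piece T pc0 t0) W'" using e.stable_ty[OF t0(1)] by simp
    have "ap pc0 t0 \<in> n" using bl t0T unfolding blocks_def by blast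
    hence "otp (piece T pc0 t0) W' \<in> k" using bk ty[OF t0T] by simp
    thus ?thesis by (rule ord_le_lt[OF s.ty_ord[OF t] t.ty_ord[OF t0T] ok le])
  qed
  define wit where "wit r c \<longleftrightarrow> r \<in> k \<and> (\<forall>x. x \<in> r \<longrightarrow> ap c x \<in> k) \<and> (\<forall>x. x \<in> k \<longrightarrow> (\<exists>y. y \<in> r \<and> x \<subseteq> ap c y))" for r c
  \<comment> \<open>Excluded middle fixes one cofinal map if there is any; this single witness
    serves all embeddings, so no choice is made.\<close>
  obtain \<rho> c where sing: "\<And>r c'. wit r c' \<Longrightarrow> wit \<rho> c" by (cases "\<exists>r c. wit r c") blast+
  interpret reduction mem T S W pc N d wp M e k \<rho> c
  proof
    show "\<rho> \<in> k \<and> (\<forall>x. x \<in> \<rho> \<longrightarrow> ap c x \<in> k) \<and> (\<forall>x. x \<in> k \<longrightarrow> (\<exists>y. y \<in> \<rho> \<and> x \<subseteq> ap c y))"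
      if "r \<in> k" "\<And>x. x \<in> r \<Longrightarrow> ap c' x \<in> k" "\<And>x. x \<in> k \<Longrightarrow> \<exists>y. y \<in> r \<and> x \<subseteq> ap c' y" for r c'
      by (rule sing[of r c', unfolded wit_def]) (use that in blast)
  qed (fact k om small)+
  have "isomorphic T W x (memrel x)" unfolding xW by (rule otp(2)[OF wo_W])
  hence "arrow k (memrel k) T W T W \<longleftrightarrow> arrow k (memrel k) x (memrel x) x (memrel x)" by (rule arrow_cong)
  thus ?thesis unfolding beta_eqI[OF l x]
    using arrow_lex_imp_arrow_ordinal arrow_ordinal_imp_arrow_lex[OF ok nf om] by blast
qed

end

theorem theorem4:
  fixes mem :: "'a \<Rightarrow> 'a \<Rightarrow> bool" and \<kappa> T S :: 'a
  assumes "zf_model mem"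
    and "membership.initial_ordinal mem \<kappa>"
    and "membership.linear_order mem T S"
    and "membership.infinite_set mem T"
    and "membership.finite_sum_below mem \<kappa> T S"
  shows "membership.arrow mem (membership.binary_seqs mem \<kappa>) (membership.lex mem \<kappa>) T S T S \<longleftrightarrow>
    (let \<beta> = membership.beta mem T S; less_\<beta> = membership.memrel mem \<beta>
     in membership.arrow mem \<kappa> (membership.memrel mem \<kappa>) \<beta> less_\<beta> \<beta> less_\<beta>)"
  unfolding Let_def by (rule zf_model.arrow_lex_iff_arrow_beta[OF assms])

end
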